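(* Fix $n\ge1$ and let $\mathfrak C>0$ be a constant such that $\mathbb E\sup_{t\in[0,T]}\|\Pi^\varepsilon_tX^\varepsilon\|^n<\mathfrak C$ for all sufficiently small $\varepsilon>0$. There exists $\varepsilon_*>0$ such that for all $0<\varepsilon<\varepsilon_*$ $$\mathbb E\sup_{s\in[0,T]}\|\mathcal Y^\varepsilon_s\|^n\le\varepsilon^{2n}2^{n-1}\Big(\frac{K_G\widetilde K}{\kappa}\Big)^n\mathfrak C+2^{n-1}\,\mathbb E\sup_{s\in[0,T]}(\Upsilon^\varepsilon_s)^n,\qquad \widetilde K:=K\|(1-\hat\pi)\mathbf 1_{\{0\}}\|,$$ and the right-hand side tends to $0$ as $\varepsilon\to0$.
   Context: Equation. Let $r>0$ and $T>0$ be fixed and let $\mathcal C=C([-r,0];\mathbb R)$ with the sup norm $\|\cdot\|$. For $\varepsilon>0$ and a continuous function $f$ on $[-\varepsilon^2r,T]$ let $\Pi^\varepsilon_tf\in\mathcal C$ be $(\Pi^\varepsilon_tf)(\theta)=f(t+\varepsilon^2\theta)$, $\theta\in[-r,0]$. Let $L_0,L_1:\mathcal C\to\mathbb R$ be bounded linear, and assume that the characteristic equation $\lambda-L_0(e^{\lambda\,\cdot})=0$ has exactly two roots (counted with multiplicity) on the imaginary axis, $\pm i\omega_c$ with $\omega_c>0$, and that all other roots have negative real parts. Let $G:\mathcal C\to\mathbb R$ satisfy $|G(\eta_1)-G(\eta_2)|\le K_G\|\eta_1-\eta_2\|$ and $G(0)=0$. Let $W$ be a one-dimensional Wiener process and $\xi\in\mathcal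 C$ deterministic. $X^\varepsilon$ is the solution of $dX^\varepsilon(t)=\varepsilon^{-2}L_0(\Pi^\varepsilon_tX^\varepsilon)dt+G(\Pi^\varepsilon_tX^\varepsilon)dt+L_1(\Pi^\varepsilon_tX^\varepsilon)dW(t)$ for $t\in[0,T]$, $X^\varepsilon(t)=\xi(\varepsilon^{-2}t)$ for $t\in[-\varepsilon^2r,0]$. Splitting. Let $\hat{\mathcal C}$ be the space of bounded measurable functions $[-r,0]\to\mathbb R$ with sup norm; $L_0$ is extended to $\hat{\mathcal C}$ via its Riesz representation as integration against a finite signed measure. For $\phi\in\hat{\mathcal C}$, $\hat T(t)\phi\in\hat{\mathcal C}$ is $\theta\mapsto x(t+\theta)$, where $x=\phi$ on $[-r,0]$ and $x(t)=\phi(0)+\int_0^tL_0(x(s+\cdot))ds$ for $t\ge0$. Let $P=\mathrm{span}\{\cos(\omega_c\cdot),\sin(\omega_c\cdot)\}$. Then $\hat{\mathcal C}=P\oplus\hat Q$, where $\hat Q$ is the $\hat T$-invariant set of $\phi$ with $\hat T(t)\phi\to0$ as $t\to\infty$; $\hat\pi$ is the projection onto $P$ along $\hat Q$ and $\pi$ its restriction to $\mathcal C$. $K,\kappa>0$ are constants with $\|\hat T(t)\phi\|\le Ke^{-\kappa t}\|\phi\|$ for all $\phi\in\hat Q$, $t\ge0$. $\mathbf 1_{\{0\}}$ is the indicator function of $\{0\}$ on $[-r,0]$. Processes. $y^\varepsilon_t=(1-\pi)\Pi^\varepsilon_tX^\varepsilon$, $\mathfrak Y^\varepsilon_t=\hat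 T(t/\varepsilon^2)y^\varepsilon_0$, $\mathcal Y^\varepsilon_t=y^\varepsilon_t-\mathfrak Y^\varepsilon_t$, and $$\Upsilon^\varepsilon_s=\sup_{\theta\in[-r,0]}\Big|\int_0^s\Big(\hat T\big(\tfrac{s-u}{\varepsilon^2}\big)(1-\hat\pi)\mathbf 1_{\{0\}}\Big)(\theta)\,dZ_u\Big|,\qquad Z_t=\int_0^tL_1(\Pi^\varepsilon_sX^\varepsilon)dW_s.$$ *)

theory Defs
  imports "HOL-Probability.Probability" "HOL-Complex_Analysis.Complex_Analysis"
begin

section \<open>Function spaces on $[-r,0]$\<close>

text \<open>A function on $[-r,0]$ is represented by its extension by zero to the real line, so that
  HOL equality of representatives is equality of functions on $[-r,0]$.\<close>

definition on_seg :: "real \<Rightarrow> (real \<Rightarrow> real) \<Rightarrow> real \<Rightarrow> real" where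
  "on_seg r f = (\<lambda>\<theta>. if \<theta> \<in> {-r..0} then f \<theta> else 0)"

definition C_space :: "real \<Rightarrow> (real \<Rightarrow> real) set" where
  "C_space r = {\<phi>. continuous_on {-r..0} \<phi> \<and> (\<forall>\<theta>. \<theta> \<notin> {-r..0} \<longrightarrow> \<phi> \<theta> = 0)}"

definition Chat_space :: "real \<Rightarrow> (real \<Rightarrow> real) set" where
  "Chat_space r = {\<phi>. \<phi> \<in> borel_measurable borel \<and> bounded (range \<phi>) \<and>
     (\<forall>\<theta>. \<theta> \<notin> {-r..0} \<longrightarrow> \<phi> \<theta> = 0)}"

definition supnorm :: "real \<Rightarrow> (real \<Rightarrow> real) \<Rightarrow> real" where
  "supnorm r \<phi> = (SUP \<theta>\<in>{-r..0}. \<bar>\<phi> \<theta>\<bar>)"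

text \<open>The segment $(\Pi^\varepsilon_t f)(\theta) = f(t+\varepsilon^2\theta)$; the unscaled
  segment $f(t+\cdot)$ is the case $\varepsilon = 1$.\<close>

definition seg :: "real \<Rightarrow> real \<Rightarrow> (real \<Rightarrow> real) \<Rightarrow> real \<Rightarrow> real \<Rightarrow> real" where
  "seg r \<epsilon> f t = on_seg r (\<lambda>\<theta>. f (t + \<epsilon>\<^sup>2 * \<theta>))"

definition bounded_linear_C :: "real \<Rightarrow> ((real \<Rightarrow> real) \<Rightarrow> real) \<Rightarrow> bool" where
  "bounded_linear_C r L \<longleftrightarrow>
     (\<forall>\<phi>\<in>C_space r. \<forall>\<psi>\<in>C_space r. L (\<lambda>\<theta>. \<phi> \<theta> + \<psi> \<theta>) = L \<phi> + L \<psi>) \<and>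
     (\<forall>\<phi>\<in>C_space r. \<forall>c. L (\<lambda>\<theta>. c * \<phi> \<theta>) = c * L \<phi>) \<and>
     (\<exists>B. \<forall>\<phi>\<in>C_space r. \<bar>L \<phi>\<bar> \<le> B * supnorm r \<phi>)"

text \<open>The finite signed measure is written as a difference of two finite measures on $[-r,0]$.\<close>

definition riesz_extension ::
    "real \<Rightarrow> ((real \<Rightarrow> real) \<Rightarrow> real) \<Rightarrow> ((real \<Rightarrow> real) \<Rightarrow> real) \<Rightarrow> bool" where
  "riesz_extension r L Lhat \<longleftrightarrow>
     (\<exists>\<mu> \<nu>. finite_measure \<mu> \<and> finite_measure \<nu> \<and>
        sets \<mu> = sets (restrict_space borel {-r..0}) \<and>
        sets \<nu> = sets (restrict_space borel {-r..0}) \<and>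
        (\<forall>\<phi>\<in>C_space r. L \<phi> = (LINT \<theta>|\<mu>. \<phi> \<theta>) - (LINT \<theta>|\<nu>. \<phi> \<theta>)) \<and>
        (\<forall>\<phi>\<in>Chat_space r. Lhat \<phi> = (LINT \<theta>|\<mu>. \<phi> \<theta>) - (LINT \<theta>|\<nu>. \<phi> \<theta>)))"


section \<open>The unperturbed delay equation\<close>

text \<open>$\lambda - L(e^{\lambda\cdot})$, where $L$ acts on complex functions through real and
  imaginary parts.\<close>

definition char_fun :: "real \<Rightarrow> ((real \<Rightarrow> real) \<Rightarrow> real) \<Rightarrow> complex \<Rightarrow> complex" where
  "char_fun r L z = z - Complex (L (on_seg r (\<lambda>\<theta>. Re (exp (z * of_real \<theta>)))))
                                (L (on_seg r (\<lambda>\<theta>. Im (exp (z * of_real \<theta>)))))"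

definition critical_spectrum :: "real \<Rightarrow> ((real \<Rightarrow> real) \<Rightarrow> real) \<Rightarrow> real \<Rightarrow> bool" where
  "critical_spectrum r L \<omega>c \<longleftrightarrow>
     {z. char_fun r L z = 0 \<and> Re z = 0} = {\<i> * of_real \<omega>c, - \<i> * of_real \<omega>c} \<and>
     zorder (char_fun r L) (\<i> * of_real \<omega>c) = 1 \<and>
     zorder (char_fun r L) (- \<i> * of_real \<omega>c) = 1 \<and>
     (\<forall>z. char_fun r L z = 0 \<and> Re z \<noteq> 0 \<longrightarrow> Re z < 0)"

text \<open>The values of a solution left of $-r$ are fixed to be zero, so that a solution is unique
  as a function on the whole real line.\<close>

definition dde_solution ::
    "real \<Rightarrow> ((real \<Rightarrow> real) \<Rightarrow> real) \<Rightarrow> (real \<Rightarrow> real) \<Rightarrow> (real \<Rightarrow> real) \<Rightarrow> bool" where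
  "dde_solution r L \<phi> x \<longleftrightarrow>
     (\<forall>t. t < - r \<longrightarrow> x t = 0) \<and>
     (\<forall>\<theta>\<in>{-r..0}. x \<theta> = \<phi> \<theta>) \<and>
     (\<forall>t\<ge>0. set_integrable lborel {0..t} (\<lambda>s. L (seg r 1 x s)) \<and>
             x t = \<phi> 0 + (LBINT s:{0..t}. L (seg r 1 x s)))"

definition dde_semigroup ::
    "real \<Rightarrow> ((real \<Rightarrow> real) \<Rightarrow> real) \<Rightarrow> real \<Rightarrow> (real \<Rightarrow> real) \<Rightarrow> real \<Rightarrow> real" where
  "dde_semigroup r L t \<phi> = seg r 1 (THE x. dde_solution r L \<phi> x) t"

definition P_space :: "real \<Rightarrow> real \<Rightarrow> (real \<Rightarrow> real) set" where
  "P_space r \<omega>c =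
     {on_seg r (\<lambda>\<theta>. a * cos (\<omega>c * \<theta>) + b * sin (\<omega>c * \<theta>)) | a b. True}"

definition Qhat_space :: "real \<Rightarrow> ((real \<Rightarrow> real) \<Rightarrow> real) \<Rightarrow> (real \<Rightarrow> real) set" where
  "Qhat_space r L =
     {\<phi> \<in> Chat_space r. ((\<lambda>t. supnorm r (dde_semigroup r L t \<phi>)) \<longlongrightarrow> 0) at_top}"

definition proj_compl ::
    "((real \<Rightarrow> real) \<Rightarrow> real \<Rightarrow> real) \<Rightarrow> (real \<Rightarrow> real) \<Rightarrow> real \<Rightarrow> real" where
  "proj_compl p \<phi> = (\<lambda>\<theta>. \<phi> \<theta> - p \<phi> \<theta>)"

text \<open>\<open>p\<close> is the projection onto $P$ along $\hat Q$ belonging to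
  $\hat{\mathcal C} = P \oplus \hat Q$.\<close>

definition spectral_projection ::
    "real \<Rightarrow> ((real \<Rightarrow> real) \<Rightarrow> real) \<Rightarrow> real \<Rightarrow> ((real \<Rightarrow> real) \<Rightarrow> real \<Rightarrow> real) \<Rightarrow> bool" where
  "spectral_projection r L \<omega>c p \<longleftrightarrow>
     (\<forall>\<phi>\<in>Chat_space r. p \<phi> \<in> P_space r \<omega>c \<and> proj_compl p \<phi> \<in> Qhat_space r L)"


section \<open>Wiener process and It\^o integral\<close>

definition wiener_process ::
    "'a measure \<Rightarrow> (real \<Rightarrow> 'a measure) \<Rightarrow> (real \<Rightarrow> 'a \<Rightarrow> real) \<Rightarrow> bool" where
  "wiener_process M F W \<longleftrightarrow>
     (AE \<omega> in M. W 0 \<omega> = 0) \<and>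
     (AE \<omega> in M. continuous_on {0..} (\<lambda>t. W t \<omega>)) \<and>
     (\<forall>t\<ge>0. W t \<in> borel_measurable (F t)) \<and>
     (\<forall>s\<ge>0. \<forall>t>s.
        distributed M lborel (\<lambda>\<omega>. W t \<omega> - W s \<omega>) (normal_density 0 (sqrt (t - s))) \<and>
        prob_space.indep_set M (sets (F s))
          (sets (vimage_algebra (space M) (\<lambda>\<omega>. W t \<omega> - W s \<omega>) borel)))"

text \<open>A simple process is $\sum_{i<m} \eta_i 1_{(\tau_i,\tau_{i+1}]}$ with deterministic times
  and bounded $\mathcal F_{\tau_i}$-measurable coefficients.\<close>

definition simple_proc_data ::
    "'a measure \<Rightarrow> (real \<Rightarrow> 'a measure) \<Rightarrow> nat \<Rightarrow> (nat \<Rightarrow> real) \<Rightarrow> (nat \<Rightarrow> 'a \<Rightarrow> real) \<Rightarrow> bool" where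
  "simple_proc_data M F m \<tau> \<eta> \<longleftrightarrow>
     0 \<le> \<tau> 0 \<and> (\<forall>i<m. \<tau> i \<le> \<tau> (Suc i)) \<and>
     (\<forall>i<m. \<eta> i \<in> borel_measurable (F (\<tau> i))) \<and>
     (\<exists>B. \<forall>i<m. \<forall>\<omega>\<in>space M. \<bar>\<eta> i \<omega>\<bar> \<le> B)"

definition simple_proc ::
    "nat \<Rightarrow> (nat \<Rightarrow> real) \<Rightarrow> (nat \<Rightarrow> 'a \<Rightarrow> real) \<Rightarrow> real \<Rightarrow> 'a \<Rightarrow> real" where
  "simple_proc m \<tau> \<eta> s \<omega> = (\<Sum>i<m. \<eta> i \<omega> * indicator {\<tau> i<..\<tau> (Suc i)} s)"

definition simple_integral_wrt ::
    "(real \<Rightarrow> 'a \<Rightarrow> real) \<Rightarrow> nat \<Rightarrow> (nat \<Rightarrow> real) \<Rightarrow> (nat \<Rightarrow> 'a \<Rightarrow> real) \<Rightarrow> real \<Rightarrow> 'a \<Rightarrow> real" where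
  "simple_integral_wrt W m \<tau> \<eta> t \<omega> =
     (\<Sum>i<m. \<eta> i \<omega> * (W (min t (\<tau> (Suc i))) \<omega> - W (min t (\<tau> i)) \<omega>))"

text \<open>\<open>ito_integral M F W H t I\<close>: the random variable \<open>I\<close> is (a version of) the It\^o integral
  $\int_0^t H_s\,dW_s$ of a progressively measurable \<open>H\<close> that is almost surely square
  integrable on $[0,t]$. It is the limit in probability of the integrals of simple processes
  $H^k$ with $\int_0^t |H^k_s-H_s|^2\,ds \to 0$ in probability, and is determined up to
  almost sure equality.\<close>

definition ito_integral ::
    "'a measure \<Rightarrow> (real \<Rightarrow> 'a measure) \<Rightarrow> (real \<Rightarrow> 'a \<Rightarrow> real) \<Rightarrow>
     (real \<Rightarrow> 'a \<Rightarrow> real) \<Rightarrow> real \<Rightarrow> ('a \<Rightarrow> real) \<Rightarrow> bool" where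
  "ito_integral M F W H t I \<longleftrightarrow>
     (\<forall>u\<in>{0..t}. (\<lambda>(s, \<omega>). H s \<omega>)
        \<in> borel_measurable (restrict_space borel {0..u} \<Otimes>\<^sub>M F u)) \<and>
     I \<in> borel_measurable M \<and>
     (\<exists>m \<tau> \<eta>.
        (\<forall>k. simple_proc_data M F (m k) (\<tau> k) (\<eta> k)) \<and>
        (\<forall>\<delta>>0. (\<lambda>k. measure M {\<omega>\<in>space M.
           (\<integral>\<^sup>+s\<in>{0..t}. ennreal ((simple_proc (m k) (\<tau> k) (\<eta> k) s \<omega> - H s \<omega>)\<^sup>2) \<partial>lborel)
             > ennreal \<delta>}) \<longlonglongrightarrow> 0) \<and>
        (\<forall>\<delta>>0. (\<lambda>k. measure M {\<omega>\<in>space M.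
           \<bar>simple_integral_wrt W (m k) (\<tau> k) (\<eta> k) t \<omega> - I \<omega>\<bar> > \<delta>}) \<longlonglongrightarrow> 0))"

text \<open>The integral $\int_0^t g(u)\,dZ_u$ of a deterministic \<open>g\<close> against the It\^o process
  $Z_t = \int_0^t h_s\,dW_s$, i.e. $dZ_u = h_u\,dW_u$.\<close>

definition ito_process_integral ::
    "'a measure \<Rightarrow> (real \<Rightarrow> 'a measure) \<Rightarrow> (real \<Rightarrow> 'a \<Rightarrow> real) \<Rightarrow>
     (real \<Rightarrow> 'a \<Rightarrow> real) \<Rightarrow> (real \<Rightarrow> real) \<Rightarrow> real \<Rightarrow> ('a \<Rightarrow> real) \<Rightarrow> bool" where
  "ito_process_integral M F W h g t I \<longleftrightarrow> ito_integral M F W (\<lambda>u \<omega>. g u * h u \<omega>) t I"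


section \<open>The stochastic delay equation and its stable part\<close>

definition sdde_solution ::
    "'a measure \<Rightarrow> (real \<Rightarrow> 'a measure) \<Rightarrow> (real \<Rightarrow> 'a \<Rightarrow> real) \<Rightarrow> real \<Rightarrow> real \<Rightarrow>
     ((real \<Rightarrow> real) \<Rightarrow> real) \<Rightarrow> ((real \<Rightarrow> real) \<Rightarrow> real) \<Rightarrow> ((real \<Rightarrow> real) \<Rightarrow> real) \<Rightarrow>
     (real \<Rightarrow> real) \<Rightarrow> real \<Rightarrow> (real \<Rightarrow> 'a \<Rightarrow> real) \<Rightarrow> bool" where
  "sdde_solution M F W r T L0 G L1 \<xi> \<epsilon> X \<longleftrightarrow>
     (\<forall>\<omega>\<in>space M. continuous_on {-(\<epsilon>\<^sup>2 * r)..T} (\<lambda>t. X t \<omega>)) \<and>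
     (\<forall>t\<in>{-(\<epsilon>\<^sup>2 * r)..0}. \<forall>\<omega>\<in>space M. X t \<omega> = \<xi> (t / \<epsilon>\<^sup>2)) \<and>
     (\<forall>t\<in>{0..T}. X t \<in> borel_measurable (F t)) \<and>
     (\<forall>t\<in>{0..T}. ito_integral M F W (\<lambda>s \<omega>. L1 (seg r \<epsilon> (\<lambda>v. X v \<omega>) s)) t
        (\<lambda>\<omega>. X t \<omega> - X 0 \<omega>
             - (LBINT s:{0..t}. L0 (seg r \<epsilon> (\<lambda>v. X v \<omega>) s) / \<epsilon>\<^sup>2)
             - (LBINT s:{0..t}. G (seg r \<epsilon> (\<lambda>v. X v \<omega>) s))))"

text \<open>For a path \<open>x\<close> of $X^\varepsilon$: the paths of $y^\varepsilon$,
  $\mathfrak Y^\varepsilon$ and $\mathcal Y^\varepsilon$.\<close>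

definition y_path ::
    "real \<Rightarrow> ((real \<Rightarrow> real) \<Rightarrow> real \<Rightarrow> real) \<Rightarrow> real \<Rightarrow> (real \<Rightarrow> real) \<Rightarrow> real \<Rightarrow> real \<Rightarrow> real" where
  "y_path r p \<epsilon> x t = proj_compl p (seg r \<epsilon> x t)"

definition free_y_path ::
    "real \<Rightarrow> ((real \<Rightarrow> real) \<Rightarrow> real) \<Rightarrow> ((real \<Rightarrow> real) \<Rightarrow> real \<Rightarrow> real) \<Rightarrow>
     real \<Rightarrow> (real \<Rightarrow> real) \<Rightarrow> real \<Rightarrow> real \<Rightarrow> real" where
  "free_y_path r L p \<epsilon> x t = dde_semigroup r L (t / \<epsilon>\<^sup>2) (y_path r p \<epsilon> x 0)"

definition forced_y_path ::
    "real \<Rightarrow> ((real \<Rightarrow> real) \<Rightarrow> real) \<Rightarrow> ((real \<Rightarrow> real) \<Rightarrow> real \<Rightarrow> real) \<Rightarrow>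
     real \<Rightarrow> (real \<Rightarrow> real) \<Rightarrow> real \<Rightarrow> real \<Rightarrow> real" where
  "forced_y_path r L p \<epsilon> x t = (\<lambda>\<theta>. y_path r p \<epsilon> x t \<theta> - free_y_path r L p \<epsilon> x t \<theta>)"

text \<open>\<open>V s \<theta>\<close> is the It\^o integral whose absolute value enters
  $\Upsilon^\varepsilon_s$, for $h = L_1(\Pi^\varepsilon X^\varepsilon)$. Each integral is
  determined only almost surely, whereas $\Upsilon^\varepsilon_s$ and its supremum over $s$ range
  over uncountably many of them; hence the version is required to be jointly continuous
  in $(s,\theta)$.\<close>

definition stoch_conv_version ::
    "'a measure \<Rightarrow> (real \<Rightarrow> 'a measure) \<Rightarrow> (real \<Rightarrow> 'a \<Rightarrow> real) \<Rightarrow> real \<Rightarrow> real \<Rightarrow>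
     ((real \<Rightarrow> real) \<Rightarrow> real) \<Rightarrow> ((real \<Rightarrow> real) \<Rightarrow> real \<Rightarrow> real) \<Rightarrow> real \<Rightarrow>
     (real \<Rightarrow> 'a \<Rightarrow> real) \<Rightarrow> (real \<Rightarrow> real \<Rightarrow> 'a \<Rightarrow> real) \<Rightarrow> bool" where
  "stoch_conv_version M F W r T L p \<epsilon> h V \<longleftrightarrow>
     (\<forall>s\<in>{0..T}. \<forall>\<theta>\<in>{-r..0}. ito_process_integral M F W h
        (\<lambda>u. dde_semigroup r L ((s - u) / \<epsilon>\<^sup>2) (proj_compl p (indicator {0})) \<theta>)
        s (V s \<theta>)) \<and>
     (\<forall>\<omega>\<in>space M. continuous_on ({0..T} \<times> {-r..0}) (\<lambda>(s, \<theta>). V s \<theta> \<omega>))"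

definition Upsilon ::
    "real \<Rightarrow> (real \<Rightarrow> real \<Rightarrow> 'a \<Rightarrow> real) \<Rightarrow> real \<Rightarrow> 'a \<Rightarrow> real" where
  "Upsilon r V s \<omega> = (SUP \<theta>\<in>{-r..0}. \<bar>V s \<theta> \<omega>\<bar>)"

text \<open>$\mathbb E \sup_{t\in[0,T]} (Y_t)^n \in [0,\infty]$ for a nonnegative process \<open>Y\<close>.\<close>

definition sup_moment ::
    "'a measure \<Rightarrow> real \<Rightarrow> nat \<Rightarrow> (real \<Rightarrow> 'a \<Rightarrow> real) \<Rightarrow> ennreal" where
  "sup_moment M T n Y = (\<integral>\<^sup>+\<omega>. (SUP t\<in>{0..T}. ennreal (Y t \<omega> ^ n)) \<partial>M)"

end

(* Rescaling time by eps^2 and applying variation of constants to X = X(0) + int L0/eps^2 + int G + Z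
   writes the forced part of y as the G-convolution plus the stochastic convolution V of the kernel
   psi = (1 - pihat) 1_{0}.  Both convolutions are read off limits of the same Riemann sums: pathwise the
   sums against IG + Z converge to the forced part, and in probability the sums against Z converge to V.
   The sums against IG are bounded by eps^2 K_G K |psi| / kappa times sup |X| because the kernel decays
   like exp(-kappa (s-u)/eps^2) and IG is Lipschitz; (a+b)^n <= 2^(n-1) (a^n + b^n) gives the inequality.

   For the limit, summation by parts bounds V by const * eps^(1/2) times the 1/4-Hoelder seminorm of Z, the
   kernel being of bounded variation with exponentially small tails.  Only the n-th moment of sup |X| is
   available, so the n-th moment of that seminorm is estimated without Burkholder-Davis-Gundy:
   discretise h, let Q be the eighth root of its running maximum, and write h = Q^7 g with |g| <= Q.  The
   sums of g have moments of order 8 n controlled by E Q^(8n) = E sup |h|^n, dyadic chaining yields their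
   Hoelder seminorm, and Abel summation against the increasing weight Q^7 followed by Young's inequality
   returns to h. *)
theory Submission
  imports Defs
begin

section \<open>Function spaces\<close>

text \<open>The kernel depends on the final time, so \<open>V s \<theta>\<close> is no martingale in
  \<open>s\<close> and maximal inequalities do not apply to it. Moving the differences onto the
  kernel turns the supremum over \<open>s\<close> and \<open>\<theta>\<close> into one property of
  the path of \<open>Z\<close>, with a constant uniform in the rescaled horizon
  \<open>s / \<epsilon>\<^sup>2\<close>, which is unbounded as \<open>\<epsilon>\<close> shrinks.
  The exponent 1/4 is far enough below 1/2 for moments of order \<open>8 * n\<close> to be summable
  over dyadic levels already when \<open>n = 1\<close>. Since 1_{0} gives the kernel one jump, left
  continuity takes the place of continuity and one grid cell is exceptional. Linearity and
  boundedness of the projection are derived: the semigroup is periodic on P and decays on the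
  complement. An Ito integral is fixed only up to a null set at each time, so each comparison is
  made at one pair \<open>(s, \<theta>)\<close>, then on a countable dense set, then everywhere by
  joint continuity.\<close>

lemma seg_1: "seg r 1 x t = on_seg r (\<lambda>\<theta>. x (t + \<theta>))"
  by (simp add: seg_def)

lemma bounded_image_realE:
  fixes f :: "'b \<Rightarrow> real"
  assumes "bounded (f ` S)"
  obtains c where "\<And>x. x \<in> S \<Longrightarrow> \<bar>f x\<bar> \<le> c"
  using assms unfolding bounded_iff by (auto simp: Ball_def)

lemma supnorm_ge:
  assumes "bounded (\<phi> ` {-r..0})" "\<theta> \<in> {-r..0}"
  shows "\<bar>\<phi> \<theta>\<bar> \<le> supnorm r \<phi>"
proof -
  obtain c where "\<And>t. t \<in> {-r..0} \<Longrightarrow> \<bar>\<phi> t\<bar> \<le> c"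
    using assms(1) by (rule bounded_image_realE) blast
  then have "bdd_above ((\<lambda>\<theta>. \<bar>\<phi> \<theta>\<bar>) ` {-r..0})"
    by (intro bdd_aboveI2)
  then show ?thesis
    unfolding supnorm_def using assms(2) by (intro cSUP_upper)
qed

lemma supnorm_le:
  assumes "r \<ge> 0" "\<And>\<theta>. \<theta> \<in> {-r..0} \<Longrightarrow> \<bar>\<phi> \<theta>\<bar> \<le> c"
  shows "supnorm r \<phi> \<le> c"
  unfolding supnorm_def using assms by (intro cSUP_least) auto

lemma supnorm_nonneg:
  assumes "bounded (\<phi> ` {-r..0})" "r \<ge> 0"
  shows "0 \<le> supnorm r \<phi>"
  using supnorm_ge[OF assms(1), of 0] assms(2) by (auto intro: order_trans[OF abs_ge_zero])

lemma Chat_bounded: "\<phi> \<in> Chat_space r \<Longrightarrow> bounded (\<phi> ` A)"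
  unfolding Chat_space_def by (auto intro: bounded_subset)

lemma Chat_supnorm: "\<phi> \<in> Chat_space r \<Longrightarrow> r \<ge> 0 \<Longrightarrow> \<bar>\<phi> \<theta>\<bar> \<le> supnorm r \<phi>"
proof (cases "\<theta> \<in> {-r..0}")
  case False
  assume *: "\<phi> \<in> Chat_space r" "r \<ge> 0"
  then have "\<phi> \<theta> = 0" using False by (auto simp: Chat_space_def)
  with supnorm_nonneg[OF Chat_bounded[OF *(1)] *(2)] show ?thesis by simp
qed (intro supnorm_ge Chat_bounded)

lemma Chat_add: "\<phi> \<in> Chat_space r \<Longrightarrow> \<psi> \<in> Chat_space r \<Longrightarrow> (\<lambda>\<theta>. \<phi> \<theta> + \<psi> \<theta>) \<in> Chat_space r"
  unfolding Chat_space_def by (auto intro: bounded_plus_comp)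

lemma Chat_diff: "\<phi> \<in> Chat_space r \<Longrightarrow> \<psi> \<in> Chat_space r \<Longrightarrow> (\<lambda>\<theta>. \<phi> \<theta> - \<psi> \<theta>) \<in> Chat_space r"
  unfolding Chat_space_def by (auto intro: bounded_minus_comp)

lemma Chat_scale: "\<phi> \<in> Chat_space r \<Longrightarrow> (\<lambda>\<theta>. c * \<phi> \<theta>) \<in> Chat_space r"
  unfolding Chat_space_def
  by (auto dest: bounded_scaling[where c=c] simp: image_image)

lemma Chat_zero: "(\<lambda>_. 0) \<in> Chat_space r"
  unfolding Chat_space_def by auto

lemma C_subset_Chat: "C_space r \<subseteq> Chat_space r"
proof
  fix \<phi> assume "\<phi> \<in> C_space r"
  then have c: "continuous_on {-r..0} \<phi>" and z: "\<And>\<theta>. \<theta> \<notin> {-r..0} \<Longrightarrow> \<phi> \<theta> = 0"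
    by (auto simp: C_space_def)
  have "\<phi> = (\<lambda>\<theta>. indicator {-r..0} \<theta> *\<^sub>R \<phi> \<theta>)"
    using z by (auto simp: indicator_def fun_eq_iff)
  moreover have "(\<lambda>\<theta>. indicator {-r..0} \<theta> *\<^sub>R \<phi> \<theta>) \<in> borel_measurable borel"
    using borel_measurable_continuous_on_indicator[OF _ c] by simp
  ultimately have "\<phi> \<in> borel_measurable borel" by simp
  moreover have "bounded (range \<phi>)"
  proof -
    have "bounded (\<phi> ` {-r..0})"
      using c by (intro compact_imp_bounded compact_continuous_image) auto
    then have "bounded (insert 0 (\<phi> ` {-r..0}))" by simp
    then show ?thesis by (rule bounded_subset) (use z in blast)
  qed
  ultimately show "\<phi> \<in> Chat_space r" using z by (simp add: Chat_space_def)
qed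

text \<open>Continuity would be too strong: the solution started from \<open>indicator {0}\<close>
  jumps at time 0. Measurable, locally bounded paths still have all segments in
  \<open>Chat_space\<close>, and they are stable under the shifts and superpositions used
  below.\<close>

definition adm :: "(real \<Rightarrow> real) \<Rightarrow> bool" where
  "adm x \<longleftrightarrow> x \<in> borel_measurable borel \<and> (\<forall>a b. bounded (x ` {a..b}))"

lemma adm_seg: "adm x \<Longrightarrow> seg r 1 x s \<in> Chat_space r"
proof -
  assume x: "adm x"
  then have [measurable]: "x \<in> borel_measurable borel" by (simp add: adm_def)
  have "on_seg r (\<lambda>\<theta>. x (s + \<theta>)) \<in> borel_measurable borel"
    unfolding on_seg_def by measurable
  moreover have "bounded (range (on_seg r (\<lambda>\<theta>. x (s + \<theta>))))"
  proof -
    have "bounded (insert 0 (x ` {s-r..s}))" using x by (simp add: adm_def)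
    then show ?thesis by (rule bounded_subset) (auto simp: on_seg_def)
  qed
  ultimately show ?thesis by (simp add: Chat_space_def seg_1 on_seg_def)
qed

lemma adm_add: "adm x \<Longrightarrow> adm y \<Longrightarrow> adm (\<lambda>t. x t + y t)"
  unfolding adm_def by (auto intro: bounded_plus_comp)

lemma adm_diff: "adm x \<Longrightarrow> adm y \<Longrightarrow> adm (\<lambda>t. x t - y t)"
  unfolding adm_def by (auto intro: bounded_minus_comp)

lemma adm_scale: "adm x \<Longrightarrow> adm (\<lambda>t. c * x t)"
proof -
  assume x: "adm x"
  have "bounded ((\<lambda>t. c * x t) ` {a..b})" for a b
    using x bounded_scaling[of "x ` {a..b}" c] by (simp add: adm_def image_image)
  then show ?thesis using x by (auto simp: adm_def)
qed

lemma adm_sum: "(\<And>i. i \<in> I \<Longrightarrow> adm (x i)) \<Longrightarrow> adm (\<lambda>t. \<Sum>i\<in>I. x i t)"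
proof (induction I rule: infinite_finite_induct)
  case (insert i I)
  then show ?case by (simp add: adm_add)
qed (auto simp: adm_def image_constant_conv)

lemma adm_shift: "adm x \<Longrightarrow> adm (\<lambda>t. x (t + c))"
proof -
  assume x: "adm x"
  have "bounded ((\<lambda>t. x (t + c)) ` {a..b})" for a b
  proof -
    have "bounded (x ` {a + c..b + c})" using x by (simp add: adm_def)
    then show ?thesis by (rule bounded_subset) auto
  qed
  moreover have "(\<lambda>t. x (t + c)) \<in> borel_measurable borel"
    using x by (auto simp: adm_def)
  ultimately show ?thesis by (simp add: adm_def)
qed

lemma adm_cut: "adm x \<Longrightarrow> adm (\<lambda>t. if t < c then 0 else x t)"
proof -
  assume x: "adm x"
  then have [measurable]: "x \<in> borel_measurable borel" by (simp add: adm_def)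
  have "bounded ((\<lambda>t. if t < c then 0 else x t) ` {a..b})" for a b
  proof -
    have "bounded (insert 0 (x ` {a..b}))" using x by (simp add: adm_def)
    then show ?thesis by (rule bounded_subset) auto
  qed
  then show ?thesis by (simp add: adm_def)
qed

lemma Chat_adm: "\<phi> \<in> Chat_space r \<Longrightarrow> adm \<phi>"
  unfolding adm_def by (auto simp: Chat_bounded) (simp add: Chat_space_def)

text \<open>The shape in which solutions arise: an arbitrary history, a possible jump at
  \<open>c\<close>, and a continuous path from \<open>c\<close> on.\<close>

lemma adm_glue:
  assumes x: "adm x" and y: "continuous_on {c..} y"
  shows "adm (\<lambda>t. if t < c then x t else y t)"
proof -
  have [measurable]: "x \<in> borel_measurable borel" using x by (simp add: adm_def)
  have "(\<lambda>t. indicator {c..} t *\<^sub>R y t) \<in> borel_measurable borel"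
    using borel_measurable_continuous_on_indicator[OF _ y] by simp
  then have "(\<lambda>t. (if t < c then x t else 0) + indicator {c..} t *\<^sub>R y t) \<in> borel_measurable borel"
    by measurable
  also have "(\<lambda>t. (if t < c then x t else 0) + indicator {c..} t *\<^sub>R y t)
      = (\<lambda>t. if t < c then x t else y t)"
    by (auto simp: fun_eq_iff)
  finally have "(\<lambda>t. if t < c then x t else y t) \<in> borel_measurable borel" .
  moreover have "bounded ((\<lambda>t. if t < c then x t else y t) ` {a..b})" for a b
  proof -
    have "continuous_on {max a c..b} y" using y by (rule continuous_on_subset) auto
    then have "bounded (y ` {max a c..b})"
      by (intro compact_imp_bounded compact_continuous_image) auto
    moreover have "bounded (x ` {a..b})" using x by (simp add: adm_def)
    ultimately have "bounded (x ` {a..b} \<union> y ` {max a c..b})" by simp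
    then show ?thesis by (rule bounded_subset) auto
  qed
  ultimately show ?thesis by (simp add: adm_def)
qed

section \<open>Integrals with exponential weights\<close>

lemma set_integrable_bounded_interval:
  fixes g :: "real \<Rightarrow> real"
  assumes "g \<in> borel_measurable borel" "\<And>s. s \<in> {a..b} \<Longrightarrow> \<bar>g s\<bar> \<le> c"
  shows "set_integrable lborel {a..b} g"
  unfolding set_integrable_def
  using assms by (intro integrableI_bounded_set_indicator[where B=c]) (auto simp: emeasure_lborel_Icc_eq)

lemma set_integral_exp:
  fixes l :: real assumes "l > 0" "t \<ge> 0"
  shows "(LBINT s:{0..t}. exp (l * s)) = (exp (l * t) - 1) / l"
proof -
  have "(LBINT s. exp (l * s) * indicator {0..t} s) = exp (l * t) / l - exp (l * 0) / l"
    by (rule integral_FTC_Icc_real) (use assms in \<open>auto intro!: derivative_eq_intros continuous_intros\<close>)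
  then show ?thesis
    by (simp add: set_lebesgue_integral_def mult.commute diff_divide_distrib)
qed

text \<open>Integrating the weight \<open>exp (l * s)\<close> gains a factor \<open>1 / l\<close>.
  With \<open>l = 2 * B\<close> this turns the bound \<open>B\<close> of the delay functional into
  the factor 1/2 that drives both the Gronwall estimate and the contraction.\<close>

lemma set_integral_exp_bound:
  fixes g :: "real \<Rightarrow> real"
  assumes "g \<in> borel_measurable borel" "l > 0" "t \<ge> 0" "c \<ge> 0"
    "\<And>s. s \<in> {0..t} \<Longrightarrow> \<bar>g s\<bar> \<le> c * exp (l * s)"
  shows "set_integrable lborel {0..t} g" "\<bar>LBINT s:{0..t}. g s\<bar> \<le> c * (exp (l * t) - 1) / l"
    "(LBINT s:{0..t}. \<bar>g s\<bar>) \<le> c * (exp (l * t) - 1) / l"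
proof -
  have [measurable]: "g \<in> borel_measurable borel" by fact
  have b: "\<bar>g s\<bar> \<le> c * exp (l * t)" if "s \<in> {0..t}" for s
    using assms(5)[OF that] that assms by (elim order_trans) (auto intro!: mult_left_mono)
  show i: "set_integrable lborel {0..t} g"
    by (rule set_integrable_bounded_interval[where c="c * exp (l * t)"]) (use b in auto)
  have ia: "set_integrable lborel {0..t} (\<lambda>s. \<bar>g s\<bar>)"
    using i by (rule set_integrable_abs)
  have ie: "set_integrable lborel {0..t} (\<lambda>s. c * exp (l * s))"
    by (rule borel_integrable_compact[OF compact_Icc, unfolded scaleR_conv_of_real[symmetric], folded set_integrable_def])
       (auto intro!: continuous_intros)
  have "(LBINT s:{0..t}. \<bar>g s\<bar>) \<le> (LBINT s:{0..t}. c * exp (l * s))"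
    by (rule set_integral_mono[OF ia ie]) (use assms in auto)
  also have "\<dots> = c * (exp (l * t) - 1) / l"
    by (subst set_integral_mult_right) (use set_integral_exp[of l t] assms in auto)
  finally show 3: "(LBINT s:{0..t}. \<bar>g s\<bar>) \<le> c * (exp (l * t) - 1) / l" .
  have "\<bar>LBINT s:{0..t}. g s\<bar> \<le> (LBINT s:{0..t}. \<bar>g s\<bar>)"
    using set_integral_norm_bound[OF i] by simp
  with 3 show "\<bar>LBINT s:{0..t}. g s\<bar> \<le> c * (exp (l * t) - 1) / l" by simp
qed

section \<open>The delay equation\<close>

text \<open>The signed measure enters only through these properties. \<open>Lh_meas\<close> is the
  one that linearity and the norm bound do not supply; it comes from measurability of integrals with
  a parameter. \<open>B\<close> is strictly positive because \<open>2 * B\<close> serves as an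
  exponential rate and is divided by.\<close>

locale delay =
  fixes r :: real and Lh :: "(real \<Rightarrow> real) \<Rightarrow> real" and B :: real
  assumes r_pos: "r > 0" and B_pos: "B > 0"
    and Lh_add: "\<And>\<phi> \<psi>. \<phi> \<in> Chat_space r \<Longrightarrow> \<psi> \<in> Chat_space r \<Longrightarrow> Lh (\<lambda>\<theta>. \<phi> \<theta> + \<psi> \<theta>) = Lh \<phi> + Lh \<psi>"
    and Lh_scale: "\<And>\<phi> c. \<phi> \<in> Chat_space r \<Longrightarrow> Lh (\<lambda>\<theta>. c * \<phi> \<theta>) = c * Lh \<phi>"
    and Lh_supnorm: "\<And>\<phi>. \<phi> \<in> Chat_space r \<Longrightarrow> \<bar>Lh \<phi>\<bar> \<le> B * supnorm r \<phi>"
    and Lh_meas: "\<And>x. adm x \<Longrightarrow> (\<lambda>s. Lh (seg r 1 x s)) \<in> borel_measurable borel"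
begin

lemma Lh_diff: "\<phi> \<in> Chat_space r \<Longrightarrow> \<psi> \<in> Chat_space r \<Longrightarrow> Lh (\<lambda>\<theta>. \<phi> \<theta> - \<psi> \<theta>) = Lh \<phi> - Lh \<psi>"
  using Lh_add[of \<phi> "\<lambda>\<theta>. (-1) * \<psi> \<theta>"] Lh_scale[of \<psi> "-1"] Chat_scale[of \<psi> r "-1"] by simp

lemma Lh_bound:
  assumes "adm x" "\<And>u. u \<in> {s-r..s} \<Longrightarrow> \<bar>x u\<bar> \<le> c"
  shows "\<bar>Lh (seg r 1 x s)\<bar> \<le> B * c"
proof -
  have "supnorm r (seg r 1 x s) \<le> c"
    using assms(2) r_pos by (intro supnorm_le) (auto simp: seg_1 on_seg_def)
  then show ?thesis
    using Lh_supnorm[OF adm_seg[OF assms(1)], of s] B_pos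
    by (meson mult_left_mono order_trans less_imp_le)
qed

lemma seg_add: "seg r e (\<lambda>t. x t + y t) s = (\<lambda>\<theta>. seg r e x s \<theta> + seg r e y s \<theta>)"
  by (auto simp: seg_def on_seg_def)

lemma seg_diff: "seg r e (\<lambda>t. x t - y t) s = (\<lambda>\<theta>. seg r e x s \<theta> - seg r e y s \<theta>)"
  by (auto simp: seg_def on_seg_def)

lemma seg_scale: "seg r e (\<lambda>t. c * x t) s = (\<lambda>\<theta>. c * seg r e x s \<theta>)"
  by (auto simp: seg_def on_seg_def)

lemma seg_cong: "(\<And>u. u \<in> {s-r..s} \<Longrightarrow> x u = y u) \<Longrightarrow> seg r 1 x s = seg r 1 y s"
  by (auto simp: seg_1 on_seg_def)

lemma seg_shift: "seg r 1 (\<lambda>t. x (t + c)) s = seg r 1 x (s + c)"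
  by (auto simp: seg_1 on_seg_def algebra_simps)

lemma Lh_integrable:
  assumes "adm x" shows "set_integrable lborel {a..b} (\<lambda>s. Lh (seg r 1 x s))"
proof -
  have "bounded (x ` {a - r..b})" using assms by (simp add: adm_def)
  then obtain c where c: "\<And>u. u \<in> {a-r..b} \<Longrightarrow> \<bar>x u\<bar> \<le> c"
    by (rule bounded_image_realE) blast
  show ?thesis
    by (rule set_integrable_bounded_interval[OF Lh_meas[OF assms], where c="B * c"])
       (use assms c in \<open>auto intro!: Lh_bound\<close>)
qed

text \<open>Take the supremum \<open>D\<close> of the path relative to the weight
  \<open>exp (2 * B * t)\<close>. In this weighted norm the integral term is at most half of
  \<open>D\<close>, so it can be absorbed, which is where the factor 2 in front of
  \<open>\<eta>\<close> comes from.\<close>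

lemma gronwall:
  assumes d: "adm d" and A: "A \<ge> 0" and h: "\<And>\<theta>. \<theta> \<in> {-r..0} \<Longrightarrow> \<bar>d \<theta>\<bar> \<le> \<eta>"
    and e: "\<And>t. t \<in> {0..A} \<Longrightarrow> \<bar>d t\<bar> \<le> \<eta> + (LBINT s:{0..t}. \<bar>Lh (seg r 1 d s)\<bar>)"
    and t: "t \<in> {-r..A}"
  shows "\<bar>d t\<bar> \<le> 2 * \<eta> * exp (2 * B * max 0 t)"
proof -
  \<comment> \<open>The clamp keeps the weight equal to 1 on the initial segment. Monotonicity lets
    the weight at time \<open>s\<close> dominate the whole segment behind \<open>s\<close>.\<close>
  define w where "w t = exp (2 * B * max 0 t)" for t
  have w1: "w t \<ge> 1" and wp: "w t > 0" for t using B_pos by (auto simp: w_def)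
  have wmono: "w s \<le> w t" if "s \<le> t" for s t using that B_pos by (auto simp: w_def)
  define D where "D = (SUP t\<in>{-r..A}. \<bar>d t\<bar> / w t)"
  obtain c where c: "\<And>u. u \<in> {-r..A} \<Longrightarrow> \<bar>d u\<bar> \<le> c"
    using d unfolding adm_def bounded_iff by (metis image_eqI real_norm_def)
  have c0: "c \<ge> 0" using c[of 0] r_pos A by auto
  have "\<bar>d u\<bar> / w u \<le> c" if "u \<in> {-r..A}" for u
    using c[OF that] w1[of u] c0 by (simp add: divide_le_eq) (meson mult_left_mono mult_cancel_left1 order_trans dual_order.trans mult_le_cancel_left1 less_le_not_le)
  then have bdd: "bdd_above ((\<lambda>t. \<bar>d t\<bar> / w t) ` {-r..A})" by (intro bdd_aboveI2)
  have Dge: "\<bar>d u\<bar> \<le> D * w u" if "u \<in> {-r..A}" for u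
    using cSUP_upper[OF that bdd] wp[of u] by (simp add: D_def divide_le_eq)
  have D0: "D \<ge> 0" using Dge[of 0] r_pos A by (auto simp: w_def intro: order_trans[OF abs_ge_zero])
  have \<eta>0: "\<eta> \<ge> 0" using h[of 0] r_pos by auto
  have "\<bar>d u\<bar> / w u \<le> \<eta> + D / 2" if u: "u \<in> {-r..A}" for u
  proof (cases "u \<le> 0")
    case True
    then show ?thesis using h[of u] u D0 by (auto simp: w_def)
  next
    case False
    have "\<bar>Lh (seg r 1 d s)\<bar> \<le> B * D * exp (2 * B * s)" if s: "s \<in> {0..u}" for s
    proof -
      have "\<bar>Lh (seg r 1 d s)\<bar> \<le> B * (D * w s)"
      proof (rule Lh_bound[OF d])
        fix v assume v: "v \<in> {s-r..s}"
        have "\<bar>d v\<bar> \<le> D * w v" using v s u by (intro Dge) auto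
        also have "\<dots> \<le> D * w s" using v D0 wmono by (intro mult_left_mono) auto
        finally show "\<bar>d v\<bar> \<le> D * w s" .
      qed
      then show ?thesis using s by (simp add: w_def mult.assoc)
    qed
    then have "(LBINT s:{0..u}. \<bar>Lh (seg r 1 d s)\<bar>) \<le> B * D * (exp (2 * B * u) - 1) / (2 * B)"
      using B_pos D0 False by (intro set_integral_exp_bound[OF Lh_meas[OF d]]) auto
    also have "\<dots> \<le> D * w u / 2" using B_pos D0 False by (simp add: w_def field_simps)
    finally have "\<bar>d u\<bar> \<le> \<eta> + D * w u / 2" using e[of u] u False by auto
    also have "\<dots> \<le> \<eta> * w u + D * w u / 2" using w1[of u] \<eta>0 by (simp add: mult_le_cancel_left1)
    finally show ?thesis using wp[of u] by (simp add: divide_le_eq algebra_simps)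
  qed
  \<comment> \<open>Absorption is legitimate because \<open>bdd\<close> made \<open>D\<close> a
    genuine finite supremum.\<close>
  then have "D \<le> \<eta> + D / 2" unfolding D_def using r_pos A by (intro cSUP_least) auto
  then have "D \<le> 2 * \<eta>" by simp
  then have "D * w t \<le> 2 * \<eta> * w t" using wp[of t] by simp
  with Dge[OF t] have "\<bar>d t\<bar> \<le> 2 * \<eta> * w t" by (rule order_trans)
  then show ?thesis unfolding w_def .
qed

text \<open>The definition of a solution asks only for integrability along the path. Regularity has
  to be recovered from the equation itself: an indefinite integral is continuous on the half line,
  and before time 0 the path is the initial function.\<close>

lemma dde_solution_adm:
  assumes \<phi>: "\<phi> \<in> Chat_space r" and x: "dde_solution r Lh \<phi> x"
  shows "continuous_on {0..} x" "adm x"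
proof -
  let ?g = "\<lambda>s. Lh (seg r 1 x s)"
  have i: "set_integrable lborel {0..t} ?g" if "t \<ge> 0" for t
    using x that by (auto simp: dde_solution_def)
  have e: "x t = \<phi> 0 + (LBINT s:{0..t}. ?g s)" if "t \<ge> 0" for t
    using x that by (auto simp: dde_solution_def)
  have c: "continuous_on {0..b} x" if "b \<ge> 0" for b
  proof -
    have ig: "?g integrable_on {0..b}"
      using i[OF that] by (rule set_borel_integral_eq_integral)
    have "continuous_on {0..b} (\<lambda>t. \<phi> 0 + integral {0..t} ?g)"
      by (intro continuous_intros indefinite_integral_continuous_1 ig)
    moreover have "\<phi> 0 + integral {0..t} ?g = x t" if "t \<in> {0..b}" for t
      using e[of t] i[of t] that by (simp add: set_borel_integral_eq_integral)
    ultimately show ?thesis by (rule continuous_on_eq)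
  qed
  show c': "continuous_on {0..} x"
    unfolding continuous_on_eq_continuous_within
  proof
    fix t :: real assume t: "t \<in> {0..}"
    have "continuous (at t within {0..t + 1}) x"
      using c[of "t + 1"] t by (auto simp: continuous_on_eq_continuous_within)
    moreover have "at t within {0..} = at t within {0..t + 1}"
      by (rule at_within_nhd[where S="{..<t + 1}"]) (use t in auto)
    ultimately show "continuous (at t within {0..}) x" by simp
  qed
  have "x t = \<phi> t" if "t < 0" for t
  proof (cases "t < -r")
    case True then show ?thesis
      using x \<phi> by (auto simp: dde_solution_def Chat_space_def)
  next
    case False then show ?thesis using x that by (auto simp: dde_solution_def)
  qed
  then have "x = (\<lambda>t. if t < 0 then \<phi> t else x t)" by auto
  then show "adm x" using adm_glue[OF Chat_adm[OF \<phi>] c'] by simp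
qed

lemma adm_integral:
  assumes "adm x"
  shows "continuous_on {0..} (\<lambda>t. LBINT s:{0..t}. Lh (seg r 1 x s))"
  unfolding continuous_on_eq_continuous_within
proof
  let ?g = "\<lambda>s. Lh (seg r 1 x s)"
  fix t :: real assume t: "t \<in> {0..}"
  have "continuous_on {0..t+1} (\<lambda>u. integral {0..u} ?g)"
    by (intro indefinite_integral_continuous_1 set_borel_integral_eq_integral Lh_integrable assms)
  moreover have "integral {0..u} ?g = (LBINT s:{0..u}. ?g s)" for u
    using Lh_integrable[OF assms] by (simp add: set_borel_integral_eq_integral)
  ultimately have "continuous (at t within {0..t + 1}) (\<lambda>u. LBINT s:{0..u}. ?g s)"
    using t by (auto simp: continuous_on_eq_continuous_within)
  moreover have "at t within {0..} = at t within {0..t + 1}"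
    by (rule at_within_nhd[where S="{..<t + 1}"]) (use t in auto)
  ultimately show "continuous (at t within {0..}) (\<lambda>u. LBINT s:{0..u}. ?g s)" by simp
qed

lemma adm_dde_solutionI:
  assumes "adm x" "\<And>t. t < -r \<Longrightarrow> x t = 0" "\<And>\<theta>. \<theta> \<in> {-r..0} \<Longrightarrow> x \<theta> = \<phi> \<theta>"
    "\<And>t. t \<ge> 0 \<Longrightarrow> x t = \<phi> 0 + (LBINT s:{0..t}. Lh (seg r 1 x s))"
  shows "dde_solution r Lh \<phi> x"
  unfolding dde_solution_def using assms Lh_integrable by auto

text \<open>The difference of two solutions solves the equation with zero history, so the Gronwall
  bound applies with \<open>\<eta> = 0\<close>. Left of \<open>-r\<close> both solutions vanish by
  convention.\<close>

lemma dde_unique: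
  assumes \<phi>: "\<phi> \<in> Chat_space r" and x: "dde_solution r Lh \<phi> x" and y: "dde_solution r Lh \<phi> y"
  shows "x = y"
proof
  fix t
  have ax: "adm x" "adm y" using dde_solution_adm[OF \<phi>] x y by auto
  have ad: "adm (\<lambda>t. x t - y t)" by (rule adm_diff[OF ax])
  have eq: "(LBINT s:{0..t}. Lh (seg r 1 (\<lambda>t. x t - y t) s)) = x t - y t" if "t \<ge> 0" for t
  proof -
    have "(LBINT s:{0..t}. Lh (seg r 1 (\<lambda>t. x t - y t) s))
        = (LBINT s:{0..t}. Lh (seg r 1 x s) - Lh (seg r 1 y s))"
      by (simp add: seg_diff Lh_diff adm_seg ax)
    also have "\<dots> = (LBINT s:{0..t}. Lh (seg r 1 x s)) - (LBINT s:{0..t}. Lh (seg r 1 y s))"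
      by (intro set_integral_diff Lh_integrable ax)
    finally show ?thesis using x y that by (auto simp: dde_solution_def)
  qed
  have "\<bar>x t - y t\<bar> \<le> 0" if "t \<ge> 0" for t
  proof -
    have "\<bar>x t - y t\<bar> \<le> 2 * 0 * exp (2 * B * max 0 t)"
    proof (rule gronwall[OF ad \<open>t \<ge> 0\<close>])
      fix u assume u: "u \<in> {0..t}"
      have "\<bar>LBINT s:{0..u}. Lh (seg r 1 (\<lambda>t. x t - y t) s)\<bar>
          \<le> (LBINT s:{0..u}. \<bar>Lh (seg r 1 (\<lambda>t. x t - y t) s)\<bar>)"
        using set_integral_norm_bound[OF Lh_integrable[OF ad]] by simp
      then show "\<bar>x u - y u\<bar> \<le> 0 + (LBINT s:{0..u}. \<bar>Lh (seg r 1 (\<lambda>t. x t - y t) s)\<bar>)"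
        using eq[of u] u by simp
    qed (use that r_pos x y in \<open>auto simp: dde_solution_def\<close>)
    then show ?thesis by simp
  qed
  then have 1: "x t = y t" if "t \<ge> 0" using that by force
  have 2: "x t = y t" if "t < -r" using x y that unfolding dde_solution_def by metis
  have 3: "x t = y t" if "t \<in> {-r..0}" using x y that unfolding dde_solution_def by metis
  consider "t \<ge> 0" | "t < -r" | "t \<in> {-r..0}" by fastforce
  then show "x t = y t" using 1 2 3 by cases
qed

text \<open>One global Picard step instead of a continuation argument: in the unknown
  \<open>z t = exp (- l * t) * x t\<close> with \<open>l = 2 * B\<close> the integral operator is a
  contraction with factor 1/2 on bounded continuous functions.\<close>

lemma dde_exists:
  assumes \<phi>: "\<phi> \<in> Chat_space r"
  shows "\<exists>x. dde_solution r Lh \<phi> x"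
proof -
  define l where "l = 2 * B"
  have l: "l > 0" using B_pos by (simp add: l_def)
  \<comment> \<open>This undoes the weight. The values of \<open>z\<close> at negative times are
    ignored, since there the path is the prescribed history.\<close>
  define X where "X z t = (if t < 0 then \<phi> t else exp (l * t) * apply_bcontfun z t)" for z t
  have admX: "adm (X z)" for z
    unfolding X_def
    by (intro adm_glue Chat_adm[OF \<phi>] continuous_on_mult continuous_on_exp continuous_on_const
        continuous_on_id continuous_on_subset[OF continuous_on_apply_bcontfun]) auto
  define I where "I z t = (LBINT s:{0..t}. Lh (seg r 1 (X z) s))" for z t
  define N where "N = supnorm r \<phi>"
  have N: "\<bar>\<phi> t\<bar> \<le> N" for t using Chat_supnorm[OF \<phi>] r_pos by (simp add: N_def)
  have N0: "N \<ge> 0" using N[of 0] by simp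
  have Xb: "\<bar>Lh (seg r 1 (X z) s)\<bar> \<le> B * (N + norm z) * exp (l * s)" if "s \<ge> 0" for z s
  proof -
    have "\<bar>Lh (seg r 1 (X z) s)\<bar> \<le> B * ((N + norm z) * exp (l * s))"
    proof (rule Lh_bound[OF admX])
      fix u assume u: "u \<in> {s-r..s}"
      show "\<bar>X z u\<bar> \<le> (N + norm z) * exp (l * s)"
      proof (cases "u < 0")
        case True
        have "\<bar>\<phi> u\<bar> \<le> (N + norm z) * 1" using N[of u] by (simp add: add_increasing2)
        also have "\<dots> \<le> (N + norm z) * exp (l * s)"
          using that l N0 by (intro mult_left_mono) auto
        finally show ?thesis using True by (simp add: X_def)
      next
        case False
        have "\<bar>X z u\<bar> = exp (l * u) * \<bar>apply_bcontfun z u\<bar>" using False by (simp add: X_def abs_mult)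
        also have "\<dots> \<le> exp (l * s) * (N + norm z)"
          using u l N0 norm_bounded[of z u] by (intro mult_mono) auto
        finally show ?thesis by (simp add: mult.commute)
      qed
    qed
    then show ?thesis by (simp add: mult.assoc)
  qed
  \<comment> \<open>The clamp extends the Picard image to the whole line as a constant on negative
    times, so that it is an element of the space of bounded continuous functions on the
    line.\<close>
  define P where "P z t = exp (- l * max 0 t) * (\<phi> 0 + I z (max 0 t))" for z t
  have Ib: "\<bar>I z t\<bar> \<le> (N + norm z) * exp (l * t)" if "t \<ge> 0" for z t
  proof -
    have "\<bar>I z t\<bar> \<le> B * (N + norm z) * (exp (l * t) - 1) / l"
      unfolding I_def by (rule set_integral_exp_bound(2)[OF Lh_meas[OF admX] l that])
        (use Xb B_pos N0 in auto)
    also have "\<dots> = (N + norm z) / 2 * (exp (l * t) - 1)" using B_pos by (simp add: l_def)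
    also have "\<dots> \<le> (N + norm z) * exp (l * t)"
      using N0 that l by (intro mult_mono) auto
    finally show ?thesis .
  qed
  have Pb: "P z \<in> bcontfun" for z
  proof (rule bcontfun_normI)
    show "continuous_on UNIV (P z)"
      unfolding P_def I_def
      by (intro continuous_intros continuous_on_compose2[OF adm_integral[OF admX]]) auto
    fix t :: real
    have "\<bar>\<phi> 0 + I z (max 0 t)\<bar> \<le> N * exp (l * max 0 t) + (N + norm z) * exp (l * max 0 t)"
    proof -
      have "N \<le> N * exp (l * max 0 t)" using l N0 by (simp add: mult_le_cancel_left1)
      then show ?thesis using N[of 0] Ib[of "max 0 t" z] by auto
    qed
    then have "exp (- l * max 0 t) * \<bar>\<phi> 0 + I z (max 0 t)\<bar>
        \<le> exp (- l * max 0 t) * (N * exp (l * max 0 t) + (N + norm z) * exp (l * max 0 t))"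
      by (intro mult_left_mono) auto
    also have "\<dots> = 2 * N + norm z" by (simp add: exp_minus field_simps)
    finally show "norm (P z t) \<le> 2 * N + norm z" by (simp add: P_def abs_mult)
  qed
  define \<Phi> where "\<Phi> z = Bcontfun (P z)" for z
  have \<Phi>: "apply_bcontfun (\<Phi> z) = P z" for z
    by (simp add: \<Phi>_def Bcontfun_inverse Pb)
  have contr: "dist (\<Phi> z) (\<Phi> z') \<le> (1/2) * dist z z'" for z z'
  proof (rule dist_bound)
    fix t :: real
    let ?t = "max 0 t"
    have b: "\<bar>Lh (seg r 1 (X z) s) - Lh (seg r 1 (X z') s)\<bar> \<le> B * dist z z' * exp (l * s)" if "s \<ge> 0" for s
    proof -
      have "\<bar>Lh (seg r 1 (\<lambda>t. X z t - X z' t) s)\<bar> \<le> B * (dist z z' * exp (l * s))"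
      proof (rule Lh_bound[OF adm_diff[OF admX admX]])
        fix u assume u: "u \<in> {s-r..s}"
        show "\<bar>X z u - X z' u\<bar> \<le> dist z z' * exp (l * s)"
        proof (cases "u < 0")
          case False
          then have "\<bar>X z u - X z' u\<bar> = exp (l * u) * dist (apply_bcontfun z u) (apply_bcontfun z' u)"
            by (simp add: X_def dist_real_def abs_mult right_diff_distrib[symmetric])
          also have "\<dots> \<le> exp (l * s) * dist z z'"
            using u l by (intro mult_mono dist_bounded) auto
          finally show ?thesis by (simp add: mult.commute)
        qed (simp add: X_def)
      qed
      then show ?thesis by (simp add: seg_diff Lh_diff adm_seg admX mult.assoc)
    qed
    have "I z ?t - I z' ?t = (LBINT s:{0..?t}. Lh (seg r 1 (X z) s) - Lh (seg r 1 (X z') s))"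
      unfolding I_def by (intro set_integral_diff(2)[symmetric] Lh_integrable admX)
    also have "\<bar>\<dots>\<bar> \<le> B * dist z z' * (exp (l * ?t) - 1) / l"
    proof (rule set_integral_exp_bound(2)[OF _ l])
      show "(\<lambda>s. Lh (seg r 1 (X z) s) - Lh (seg r 1 (X z') s)) \<in> borel_measurable borel"
        using Lh_meas[OF admX] by measurable
    qed (use b B_pos in auto)
    also have "\<dots> = (dist z z' / 2) * (exp (l * ?t) - 1)" using B_pos by (simp add: l_def)
    also have "\<dots> \<le> (dist z z' / 2) * exp (l * ?t)" by (intro mult_left_mono) auto
    finally have "exp (- l * ?t) * \<bar>I z ?t - I z' ?t\<bar> \<le> exp (- l * ?t) * ((dist z z' / 2) * exp (l * ?t))"
      by (intro mult_left_mono) auto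
    also have "\<dots> = 1/2 * dist z z'" by (simp add: exp_minus field_simps)
    finally show "dist (apply_bcontfun (\<Phi> z) t) (apply_bcontfun (\<Phi> z') t) \<le> 1/2 * dist z z'"
      by (simp add: \<Phi> P_def dist_real_def abs_mult right_diff_distrib[symmetric])
  qed
  have "\<exists>!z. \<Phi> z = z"
    by (rule banach_fix_type[where c="1/2"]) (use contr in auto)
  then obtain z where z: "\<Phi> z = z" by auto
  define x where "x = X z"
  have xe: "x t = \<phi> 0 + (LBINT s:{0..t}. Lh (seg r 1 x s))" if "t \<ge> 0" for t
  proof -
    have "x t = exp (l * t) * P z t" using that \<Phi>[of z] z by (simp add: x_def X_def)
    also have "\<dots> = \<phi> 0 + I z t"
      using that by (simp add: P_def mult.assoc[symmetric] exp_add[symmetric])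
    finally show ?thesis by (simp add: I_def x_def)
  qed
  \<comment> \<open>\<open>X\<close> copies the initial function only at strictly negative times;
    agreement at 0 has to be read off the integral equation.\<close>
  have "x 0 = \<phi> 0"
    using xe[of 0] set_borel_integral_eq_integral(2)[OF Lh_integrable[of x 0 0]]
    by (simp add: x_def admX)
  then have "x \<theta> = \<phi> \<theta>" if "\<theta> \<le> 0" for \<theta>
    using that by (cases "\<theta> = 0") (auto simp: x_def X_def)
  moreover have "\<phi> t = 0" if "t < -r" for t using \<phi> that by (auto simp: Chat_space_def)
  ultimately have "dde_solution r Lh \<phi> x"
    using r_pos xe by (intro adm_dde_solutionI) (auto simp: x_def admX)
  then show ?thesis by blast
qed

section \<open>The solution operator and its semigroup\<close>

definition sol :: "(real \<Rightarrow> real) \<Rightarrow> real \<Rightarrow> real" where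
  "sol \<phi> = (THE x. dde_solution r Lh \<phi> x)"

lemma dde_semigroup_sol: "dde_semigroup r Lh t \<phi> = seg r 1 (sol \<phi>) t"
  by (simp add: dde_semigroup_def sol_def)

lemma sol: "\<phi> \<in> Chat_space r \<Longrightarrow> dde_solution r Lh \<phi> (sol \<phi>)"
  unfolding sol_def using dde_exists dde_unique by (metis theI)

lemma sol_eqI: "\<phi> \<in> Chat_space r \<Longrightarrow> dde_solution r Lh \<phi> x \<Longrightarrow> sol \<phi> = x"
  using sol dde_unique by blast

lemma sol_adm: "\<phi> \<in> Chat_space r \<Longrightarrow> adm (sol \<phi>)"
  and sol_cont: "\<phi> \<in> Chat_space r \<Longrightarrow> continuous_on {0..} (sol \<phi>)"
  using dde_solution_adm sol by blast+

lemma sol_init: "\<phi> \<in> Chat_space r \<Longrightarrow> t \<le> 0 \<Longrightarrow> sol \<phi> t = \<phi> t"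
  using sol[of \<phi>] by (cases "t < -r") (auto simp: dde_solution_def Chat_space_def)

lemma sol_left: "\<phi> \<in> Chat_space r \<Longrightarrow> t < -r \<Longrightarrow> sol \<phi> t = 0"
  using sol[of \<phi>] by (simp add: dde_solution_def)

lemma sol_eq: "\<phi> \<in> Chat_space r \<Longrightarrow> t \<ge> 0 \<Longrightarrow> sol \<phi> t = \<phi> 0 + (LBINT s:{0..t}. Lh (seg r 1 (sol \<phi>) s))"
  using sol[of \<phi>] by (auto simp: dde_solution_def)

lemma sol_increment:
  assumes \<phi>: "\<phi> \<in> Chat_space r" and "0 \<le> s" "s \<le> t"
  shows "sol \<phi> t = sol \<phi> s + (LBINT u:{s..t}. Lh (seg r 1 (sol \<phi>) u))"
proof -
  let ?g = "\<lambda>s. Lh (seg r 1 (sol \<phi>) s)"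
  have i: "set_integrable lborel {a..b} ?g" for a b by (intro Lh_integrable sol_adm \<phi>)
  have "integral {0..s} ?g + integral {s..t} ?g = integral {0..t} ?g"
    using assms i by (intro Henstock_Kurzweil_Integration.integral_combine set_borel_integral_eq_integral) auto
  then have "(LBINT u:{0..s}. ?g u) + (LBINT u:{s..t}. ?g u) = (LBINT u:{0..t}. ?g u)"
    using i by (simp add: set_borel_integral_eq_integral)
  then show ?thesis using sol_eq[OF \<phi>, of s] sol_eq[OF \<phi>, of t] assms by simp
qed

lemma sol_add:
  assumes "\<phi> \<in> Chat_space r" "\<psi> \<in> Chat_space r"
  shows "sol (\<lambda>\<theta>. \<phi> \<theta> + \<psi> \<theta>) = (\<lambda>t. sol \<phi> t + sol \<psi> t)"
proof (intro sol_eqI Chat_add assms adm_dde_solutionI adm_add sol_adm)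
  fix t :: real assume "t \<ge> 0"
  then show "sol \<phi> t + sol \<psi> t = \<phi> 0 + \<psi> 0 + (LBINT s:{0..t}. Lh (seg r 1 (\<lambda>t. sol \<phi> t + sol \<psi> t) s))"
    using assms
    by (simp add: seg_add Lh_add adm_seg sol_adm set_integral_add Lh_integrable sol_eq[of \<phi> t] sol_eq[of \<psi> t])
qed (use assms in \<open>auto simp: sol_init sol_left\<close>)

lemma sol_scale:
  assumes "\<phi> \<in> Chat_space r"
  shows "sol (\<lambda>\<theta>. c * \<phi> \<theta>) = (\<lambda>t. c * sol \<phi> t)"
proof (intro sol_eqI Chat_scale assms adm_dde_solutionI adm_scale sol_adm)
  fix t :: real assume "t \<ge> 0"
  then show "c * sol \<phi> t = c * \<phi> 0 + (LBINT s:{0..t}. Lh (seg r 1 (\<lambda>t. c * sol \<phi> t) s))"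
    using assms
    by (simp add: seg_scale Lh_scale adm_seg sol_adm sol_eq[of \<phi> t] algebra_simps)
qed (use assms in \<open>auto simp: sol_init sol_left\<close>)

lemma sol_diff:
  assumes "\<phi> \<in> Chat_space r" "\<psi> \<in> Chat_space r"
  shows "sol (\<lambda>\<theta>. \<phi> \<theta> - \<psi> \<theta>) = (\<lambda>t. sol \<phi> t - sol \<psi> t)"
  using sol_add[OF assms(1) Chat_scale[OF assms(2), of "-1"]] sol_scale[OF assms(2), of "-1"] by simp

lemma semigroup_Chat: "\<phi> \<in> Chat_space r \<Longrightarrow> dde_semigroup r Lh t \<phi> \<in> Chat_space r"
  by (simp add: dde_semigroup_sol adm_seg sol_adm)

text \<open>Uniqueness: the shifted solution solves the equation started from its own segment at
  \<open>s\<close>. Left of \<open>-r\<close> the restarted solution is 0 by convention while the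
  old one need not be, hence the restriction on \<open>t\<close>.\<close>

lemma sol_semigroup:
  assumes \<phi>: "\<phi> \<in> Chat_space r" and s: "s \<ge> 0" and t: "t \<ge> -r"
  shows "sol (dde_semigroup r Lh s \<phi>) t = sol \<phi> (t + s)"
proof -
  define x where "x t = (if t < -r then 0 else sol \<phi> (t + s))" for t
  have a: "adm x" unfolding x_def by (intro adm_cut adm_shift sol_adm \<phi>)
  have "dde_solution r Lh (dde_semigroup r Lh s \<phi>) x"
  proof (rule adm_dde_solutionI[OF a])
    fix \<theta> assume "\<theta> \<in> {-r..0}"
    then show "x \<theta> = dde_semigroup r Lh s \<phi> \<theta>"
      by (auto simp: x_def dde_semigroup_sol seg_1 on_seg_def add.commute)
  next
    fix t :: real assume t: "t \<ge> 0"
    have "(LBINT u:{0..t}. Lh (seg r 1 x u)) = (LBINT u:{0..t}. Lh (seg r 1 (sol \<phi>) (u + s)))"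
      by (intro set_lebesgue_integral_cong) (auto simp: seg_1 on_seg_def x_def algebra_simps intro!: arg_cong[where f=Lh])
    also have "\<dots> = (LBINT u:{s..t+s}. Lh (seg r 1 (sol \<phi>) u))"
      unfolding set_lebesgue_integral_def
      by (subst lborel_integral_real_affine[where c=1 and t=s and f="\<lambda>u. indicator {s..t+s} u *\<^sub>R Lh (seg r 1 (sol \<phi>) u)"])
         (auto intro!: Bochner_Integration.integral_cong simp: indicator_def add.commute)
    finally show "x t = dde_semigroup r Lh s \<phi> 0 + (LBINT u:{0..t}. Lh (seg r 1 x u))"
      using sol_increment[OF \<phi> s, of "t + s"] t s r_pos by (simp add: x_def dde_semigroup_sol seg_1 on_seg_def)
  qed (simp add: x_def)
  from sol_eqI[OF semigroup_Chat[OF \<phi>] this] t show ?thesis by (simp add: x_def)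
qed

lemma semigroup_semigroup:
  assumes \<phi>: "\<phi> \<in> Chat_space r" and s: "s \<ge> 0" and t: "t \<ge> 0"
  shows "dde_semigroup r Lh t (dde_semigroup r Lh s \<phi>) = dde_semigroup r Lh (t + s) \<phi>"
  using sol_semigroup[OF \<phi> s] t
  by (subst (1 3) dde_semigroup_sol) (auto simp: seg_1 on_seg_def fun_eq_iff algebra_simps)

text \<open>A crude growth bound; it is evaluated at one fixed time only, in the proof that the
  projection is bounded.\<close>

lemma semigroup_bound:
  assumes \<phi>: "\<phi> \<in> Chat_space r" and t: "t \<ge> 0"
  shows "supnorm r (dde_semigroup r Lh t \<phi>) \<le> 2 * exp (2 * B * t) * supnorm r \<phi>"
proof -
  let ?N = "supnorm r \<phi>"
  have N: "\<bar>\<phi> t\<bar> \<le> ?N" for t using Chat_supnorm[OF \<phi>] r_pos by simp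
  have g: "\<bar>sol \<phi> u\<bar> \<le> 2 * ?N * exp (2 * B * max 0 u)" if "u \<in> {-r..t}" for u
  proof (rule gronwall[OF sol_adm[OF \<phi>] t _ _ that])
    fix v assume v: "v \<in> {0..t}"
    have "\<bar>LBINT s:{0..v}. Lh (seg r 1 (sol \<phi>) s)\<bar> \<le> (LBINT s:{0..v}. \<bar>Lh (seg r 1 (sol \<phi>) s)\<bar>)"
      using set_integral_norm_bound[OF Lh_integrable[OF sol_adm[OF \<phi>]]] by simp
    then show "\<bar>sol \<phi> v\<bar> \<le> ?N + (LBINT s:{0..v}. \<bar>Lh (seg r 1 (sol \<phi>) s)\<bar>)"
      using sol_eq[OF \<phi>, of v] N[of 0] v by auto
  qed (use N in \<open>auto simp: sol_init \<phi>\<close>)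
  show ?thesis
  proof (rule supnorm_le)
    fix \<theta> assume \<theta>: "\<theta> \<in> {-r..0}"
    have "\<bar>sol \<phi> (t + \<theta>)\<bar> \<le> 2 * ?N * exp (2 * B * max 0 (t + \<theta>))" using \<theta> t by (intro g) auto
    also have "\<dots> \<le> 2 * ?N * exp (2 * B * t)"
      using \<theta> t B_pos N[of 0] by (intro mult_left_mono) auto
    finally show "\<bar>dde_semigroup r Lh t \<phi> \<theta>\<bar> \<le> 2 * exp (2 * B * t) * ?N"
      using \<theta> by (simp add: dde_semigroup_sol seg_1 on_seg_def mult_ac)
  qed (use r_pos in simp)
qed

end

section \<open>The spectral projection\<close>

lemma supnorm_add:
  assumes "\<phi> \<in> Chat_space r" "\<psi> \<in> Chat_space r" "r \<ge> 0"
  shows "supnorm r (\<lambda>\<theta>. \<phi> \<theta> + \<psi> \<theta>) \<le> supnorm r \<phi> + supnorm r \<psi>"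
  by (rule supnorm_le[OF assms(3)], rule order_trans[OF abs_triangle_ineq])
     (intro add_mono Chat_supnorm assms)

lemma supnorm_diff:
  assumes "\<phi> \<in> Chat_space r" "\<psi> \<in> Chat_space r" "r \<ge> 0"
  shows "supnorm r (\<lambda>\<theta>. \<phi> \<theta> - \<psi> \<theta>) \<le> supnorm r \<phi> + supnorm r \<psi>"
  by (rule supnorm_le[OF assms(3)], rule order_trans[OF abs_triangle_ineq4])
     (intro add_mono Chat_supnorm assms)

lemma supnorm_scale:
  assumes "\<phi> \<in> Chat_space r" "r \<ge> 0"
  shows "supnorm r (\<lambda>\<theta>. c * \<phi> \<theta>) \<le> \<bar>c\<bar> * supnorm r \<phi>"
  by (rule supnorm_le[OF assms(2)]) (simp add: abs_mult mult_left_mono Chat_supnorm assms)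

lemma C_spaceI: "continuous_on {-r..0} f \<Longrightarrow> on_seg r f \<in> C_space r"
  by (auto simp: C_space_def on_seg_def intro: continuous_on_eq)

lemma tendsto_zero_le:
  fixes f g :: "'b \<Rightarrow> real"
  assumes "(g \<longlongrightarrow> 0) F" "\<And>x. 0 \<le> f x" "\<And>x. f x \<le> g x"
  shows "(f \<longlongrightarrow> 0) F"
  by (rule tendsto_sandwich[OF _ _ tendsto_const assms(1)]) (use assms in auto)

text \<open>The values of \<open>Lh\<close> on cosine and sine are the imaginary-axis root
  \<open>\<i> * \<omega>c\<close> of the characteristic equation, split into real and imaginary
  parts. They make \<open>trig\<close> functions solutions of the delay equation.\<close>

locale delay_proj = delay +
  fixes \<omega>c :: real and p :: "(real \<Rightarrow> real) \<Rightarrow> real \<Rightarrow> real" and K \<kappa> :: real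
  assumes \<omega>c_pos: "\<omega>c > 0"
    and Lh_cos: "Lh (on_seg r (\<lambda>\<theta>. cos (\<omega>c * \<theta>))) = 0"
    and Lh_sin: "Lh (on_seg r (\<lambda>\<theta>. sin (\<omega>c * \<theta>))) = \<omega>c"
    and proj: "spectral_projection r Lh \<omega>c p"
    and K_pos: "K > 0" and \<kappa>_pos: "\<kappa> > 0"
    and decay: "\<And>\<phi> t. \<phi> \<in> Qhat_space r Lh \<Longrightarrow> t \<ge> 0 \<Longrightarrow>
           supnorm r (dde_semigroup r Lh t \<phi>) \<le> K * exp (- \<kappa> * t) * supnorm r \<phi>"
begin

section \<open>The rotation on the critical plane P\<close>

definition trig :: "real \<Rightarrow> real \<Rightarrow> real \<Rightarrow> real" where
  "trig a b t = a * cos (\<omega>c * t) + b * sin (\<omega>c * t)"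

text \<open>Time translation rotates the coefficient pair, so it preserves P and is the identity
  after a full period.\<close>

lemma trig_shift: "trig a b (t + s) =
    trig (a * cos (\<omega>c * s) + b * sin (\<omega>c * s)) (b * cos (\<omega>c * s) - a * sin (\<omega>c * s)) t"
  by (simp add: trig_def cos_add sin_add algebra_simps)

lemma trig_cont: "continuous_on A (trig a b)"
  unfolding trig_def by (intro continuous_intros)

lemma trig_Chat: "on_seg r (trig a b) \<in> Chat_space r"
  using C_spaceI[OF trig_cont] C_subset_Chat by blast

lemma Lh_trig: "Lh (on_seg r (trig a b)) = b * \<omega>c"
proof -
  have c: "on_seg r (\<lambda>\<theta>. cos (\<omega>c * \<theta>)) \<in> Chat_space r" using trig_Chat[of 1 0] by (simp add: trig_def[abs_def])
  have s: "on_seg r (\<lambda>\<theta>. sin (\<omega>c * \<theta>)) \<in> Chat_space r" using trig_Chat[of 0 1] by (simp add: trig_def[abs_def])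
  have "on_seg r (trig a b) = (\<lambda>\<theta>. a * on_seg r (\<lambda>\<theta>. cos (\<omega>c * \<theta>)) \<theta> + b * on_seg r (\<lambda>\<theta>. sin (\<omega>c * \<theta>)) \<theta>)"
    by (auto simp: trig_def on_seg_def)
  then show ?thesis
    by (simp add: Lh_add Chat_scale c s Lh_scale Lh_cos Lh_sin)
qed

text \<open>After rotating the coefficients, \<open>Lh\<close> of the segment at \<open>s\<close> is
  the derivative of the function at \<open>s\<close>; the integral equation is then the fundamental
  theorem of calculus.\<close>

lemma trig_sol:
  assumes "t \<ge> -r"
  shows "sol (on_seg r (trig a b)) t = trig a b t"
proof -
  define x where "x t = (if t < -r then 0 else trig a b t)" for t
  have a: "adm x"
  proof -
    have "adm (trig a b)"
      using trig_cont[of UNIV] unfolding adm_def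
      by (auto intro!: borel_measurable_continuous_onI compact_imp_bounded compact_continuous_image trig_cont)
    then show ?thesis unfolding x_def by (rule adm_cut)
  qed
  have "dde_solution r Lh (on_seg r (trig a b)) x"
  proof (rule adm_dde_solutionI[OF a])
    fix t :: real assume t: "t \<ge> 0"
    have e: "Lh (seg r 1 x s) = (b * cos (\<omega>c * s) - a * sin (\<omega>c * s)) * \<omega>c" if "s \<ge> 0" for s
    proof -
      have "seg r 1 x s = on_seg r (\<lambda>\<theta>. trig a b (\<theta> + s))"
        using that by (auto simp: seg_1 on_seg_def x_def add.commute)
      then show ?thesis by (simp add: trig_shift Lh_trig)
    qed
    have "(LBINT s:{0..t}. Lh (seg r 1 x s)) = (LBINT s:{0..t}. (b * cos (\<omega>c * s) - a * sin (\<omega>c * s)) * \<omega>c)"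
      by (intro set_lebesgue_integral_cong) (auto simp: e)
    also have "\<dots> = trig a b t - trig a b 0"
      unfolding set_lebesgue_integral_def
      by (rule integral_FTC_atLeastAtMost)
         (auto intro!: continuous_intros derivative_eq_intros t
           simp: trig_def has_real_derivative_iff_has_vector_derivative[symmetric] algebra_simps)
    finally show "x t = on_seg r (trig a b) 0 + (LBINT s:{0..t}. Lh (seg r 1 x s))"
      using t r_pos by (simp add: x_def on_seg_def)
  qed (auto simp: x_def on_seg_def)
  from sol_eqI[OF trig_Chat this] assms show ?thesis by (simp add: x_def)
qed

lemma P_space_trig: "P_space r \<omega>c = {on_seg r (trig a b) | a b. True}"
  unfolding P_space_def trig_def by simp

lemma P_E: assumes "\<phi> \<in> P_space r \<omega>c" obtains a b where "\<phi> = on_seg r (trig a b)"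
  using assms unfolding P_space_trig by blast

lemma P_Chat: "\<phi> \<in> P_space r \<omega>c \<Longrightarrow> \<phi> \<in> Chat_space r"
  by (elim P_E) (simp add: trig_Chat)

lemma P_add: "\<phi> \<in> P_space r \<omega>c \<Longrightarrow> \<psi> \<in> P_space r \<omega>c \<Longrightarrow> (\<lambda>\<theta>. \<phi> \<theta> + \<psi> \<theta>) \<in> P_space r \<omega>c"
proof (elim P_E)
  fix a b c d assume "\<phi> = on_seg r (trig a b)" "\<psi> = on_seg r (trig c d)"
  then have "(\<lambda>\<theta>. \<phi> \<theta> + \<psi> \<theta>) = on_seg r (trig (a + c) (b + d))"
    by (auto simp: trig_def on_seg_def algebra_simps)
  then show ?thesis unfolding P_space_trig by blast
qed

lemma P_scale: "\<phi> \<in> P_space r \<omega>c \<Longrightarrow> (\<lambda>\<theta>. k * \<phi> \<theta>) \<in> P_space r \<omega>c"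
proof (elim P_E)
  fix a b assume "\<phi> = on_seg r (trig a b)"
  then have "(\<lambda>\<theta>. k * \<phi> \<theta>) = on_seg r (trig (k * a) (k * b))"
    by (auto simp: trig_def on_seg_def algebra_simps)
  then show ?thesis unfolding P_space_trig by blast
qed

lemma P_diff: "\<phi> \<in> P_space r \<omega>c \<Longrightarrow> \<psi> \<in> P_space r \<omega>c \<Longrightarrow> (\<lambda>\<theta>. \<phi> \<theta> - \<psi> \<theta>) \<in> P_space r \<omega>c"
  using P_add[of \<phi> "\<lambda>\<theta>. (-1) * \<psi> \<theta>"] P_scale[of \<psi> "-1"] by simp

lemma semigroup_trig:
  "t \<ge> 0 \<Longrightarrow> dde_semigroup r Lh t (on_seg r (trig a b)) = on_seg r (\<lambda>\<theta>. trig a b (\<theta> + t))"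
  unfolding dde_semigroup_sol seg_1
  by (rule ext, subst (1 3) on_seg_def) (simp add: trig_sol add.commute)

lemma semigroup_P: "\<phi> \<in> P_space r \<omega>c \<Longrightarrow> t \<ge> 0 \<Longrightarrow> dde_semigroup r Lh t \<phi> \<in> P_space r \<omega>c"
  by (elim P_E) (auto simp: semigroup_trig trig_shift P_space_trig)

text \<open>Whole periods are the times at which the critical component can be read off unchanged.
  This excludes decay on P and later isolates the projection.\<close>

lemma semigroup_P_period:
  assumes "\<phi> \<in> P_space r \<omega>c"
  shows "dde_semigroup r Lh (2 * pi * real j / \<omega>c) \<phi> = \<phi>"
proof -
  obtain a b where \<phi>: "\<phi> = on_seg r (trig a b)" using assms by (rule P_E)
  have "\<omega>c * (2 * pi * real j / \<omega>c) = of_int (int j) * (2 * pi)" using \<omega>c_pos by simp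
  then have "trig a b (\<theta> + 2 * pi * real j / \<omega>c) = trig a b \<theta>" for \<theta>
    unfolding trig_shift by (simp only: cos_int_2pin sin_int_2pin mult.commute[of "of_int (int j)"]) simp
  then show ?thesis using \<omega>c_pos by (simp add: \<phi> semigroup_trig)
qed

section \<open>The stable subspace\<close>

lemma Q_Chat: "\<phi> \<in> Qhat_space r Lh \<Longrightarrow> \<phi> \<in> Chat_space r"
  by (simp add: Qhat_space_def)

lemma semigroup_add:
  "\<phi> \<in> Chat_space r \<Longrightarrow> \<psi> \<in> Chat_space r \<Longrightarrow> dde_semigroup r Lh t (\<lambda>\<theta>. \<phi> \<theta> + \<psi> \<theta>)
    = (\<lambda>\<theta>. dde_semigroup r Lh t \<phi> \<theta> + dde_semigroup r Lh t \<psi> \<theta>)"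
  by (simp add: dde_semigroup_sol sol_add seg_add)

lemma semigroup_scale:
  "\<phi> \<in> Chat_space r \<Longrightarrow> dde_semigroup r Lh t (\<lambda>\<theta>. c * \<phi> \<theta>) = (\<lambda>\<theta>. c * dde_semigroup r Lh t \<phi> \<theta>)"
  by (simp add: dde_semigroup_sol sol_scale seg_scale)

lemma Q_add:
  assumes "\<phi> \<in> Qhat_space r Lh" "\<psi> \<in> Qhat_space r Lh"
  shows "(\<lambda>\<theta>. \<phi> \<theta> + \<psi> \<theta>) \<in> Qhat_space r Lh"
proof -
  have c: "\<phi> \<in> Chat_space r" "\<psi> \<in> Chat_space r" using assms Q_Chat by auto
  have "((\<lambda>t. supnorm r (dde_semigroup r Lh t \<phi>) + supnorm r (dde_semigroup r Lh t \<psi>)) \<longlongrightarrow> 0 + 0) at_top"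
    using assms by (intro tendsto_add) (auto simp: Qhat_space_def)
  then have "((\<lambda>t. supnorm r (dde_semigroup r Lh t (\<lambda>\<theta>. \<phi> \<theta> + \<psi> \<theta>))) \<longlongrightarrow> 0) at_top"
    unfolding add_0
  proof (rule tendsto_zero_le)
    fix t
    show "0 \<le> supnorm r (dde_semigroup r Lh t (\<lambda>\<theta>. \<phi> \<theta> + \<psi> \<theta>))"
      using c r_pos by (intro supnorm_nonneg Chat_bounded[OF semigroup_Chat[OF Chat_add]]) auto
    show "supnorm r (dde_semigroup r Lh t (\<lambda>\<theta>. \<phi> \<theta> + \<psi> \<theta>))
        \<le> supnorm r (dde_semigroup r Lh t \<phi>) + supnorm r (dde_semigroup r Lh t \<psi>)"
      using c r_pos by (auto simp: semigroup_add intro!: supnorm_add semigroup_Chat)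
  qed
  then show ?thesis using c by (simp add: Qhat_space_def Chat_add)
qed

lemma Q_scale:
  assumes "\<phi> \<in> Qhat_space r Lh"
  shows "(\<lambda>\<theta>. k * \<phi> \<theta>) \<in> Qhat_space r Lh"
proof -
  have c: "\<phi> \<in> Chat_space r" using assms Q_Chat by auto
  have "((\<lambda>t. \<bar>k\<bar> * supnorm r (dde_semigroup r Lh t \<phi>)) \<longlongrightarrow> \<bar>k\<bar> * 0) at_top"
    using assms by (intro tendsto_mult tendsto_const) (auto simp: Qhat_space_def)
  then have "((\<lambda>t. supnorm r (dde_semigroup r Lh t (\<lambda>\<theta>. k * \<phi> \<theta>))) \<longlongrightarrow> 0) at_top"
    unfolding mult_zero_right
  proof (rule tendsto_zero_le)
    fix t
    show "0 \<le> supnorm r (dde_semigroup r Lh t (\<lambda>\<theta>. k * \<phi> \<theta>))"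
      using c r_pos by (intro supnorm_nonneg Chat_bounded[OF semigroup_Chat[OF Chat_scale]]) auto
    show "supnorm r (dde_semigroup r Lh t (\<lambda>\<theta>. k * \<phi> \<theta>))
        \<le> \<bar>k\<bar> * supnorm r (dde_semigroup r Lh t \<phi>)"
      using c r_pos by (auto simp: semigroup_scale intro!: supnorm_scale semigroup_Chat)
  qed
  then show ?thesis using c by (simp add: Qhat_space_def Chat_scale)
qed

lemma Q_diff: "\<phi> \<in> Qhat_space r Lh \<Longrightarrow> \<psi> \<in> Qhat_space r Lh \<Longrightarrow> (\<lambda>\<theta>. \<phi> \<theta> - \<psi> \<theta>) \<in> Qhat_space r Lh"
  using Q_add[of \<phi> "\<lambda>\<theta>. (-1) * \<psi> \<theta>"] Q_scale[of \<psi> "-1"] by simp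

lemma semigroup_Q:
  assumes "\<phi> \<in> Qhat_space r Lh" "t \<ge> 0"
  shows "dde_semigroup r Lh t \<phi> \<in> Qhat_space r Lh"
proof -
  have c: "\<phi> \<in> Chat_space r" using assms Q_Chat by auto
  have "((\<lambda>s. supnorm r (dde_semigroup r Lh s \<phi>)) \<longlongrightarrow> 0) at_top"
    using assms by (simp add: Qhat_space_def)
  then have "((\<lambda>s. supnorm r (dde_semigroup r Lh (s + t) \<phi>)) \<longlongrightarrow> 0) at_top"
    by (rule filterlim_compose) (rule filterlim_tendsto_add_at_top[OF tendsto_const filterlim_ident, of t, simplified add.commute])
  then have "((\<lambda>s. supnorm r (dde_semigroup r Lh s (dde_semigroup r Lh t \<phi>))) \<longlongrightarrow> 0) at_top"
    by (rule Lim_transform_eventually)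
       (use eventually_ge_at_top[of 0] in eventually_elim, simp add: semigroup_semigroup c assms)
  then show ?thesis by (simp add: Qhat_space_def semigroup_Chat c)
qed

text \<open>Along whole periods the norm of an orbit in P is constant, while in the stable space it
  tends to 0.\<close>

lemma P_Q_zero:
  assumes P: "\<phi> \<in> P_space r \<omega>c" and Q: "\<phi> \<in> Qhat_space r Lh"
  shows "\<phi> = (\<lambda>_. 0)"
proof -
  have "filterlim (\<lambda>j. 2 * pi * real j / \<omega>c) at_top sequentially"
    using \<omega>c_pos by real_asymp
  then have "(\<lambda>j. supnorm r (dde_semigroup r Lh (2 * pi * real j / \<omega>c) \<phi>)) \<longlonglongrightarrow> 0"
    using Q by (auto simp: Qhat_space_def elim: filterlim_compose)
  then have "supnorm r \<phi> = 0" by (simp add: semigroup_P_period[OF P] LIMSEQ_const_iff)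
  with Chat_supnorm[OF Q_Chat[OF Q]] r_pos show ?thesis by (auto simp: fun_eq_iff)
qed

section \<open>Uniqueness, linearity and boundedness of the projection\<close>

lemma proj_P: "\<phi> \<in> Chat_space r \<Longrightarrow> p \<phi> \<in> P_space r \<omega>c"
  and proj_Q: "\<phi> \<in> Chat_space r \<Longrightarrow> proj_compl p \<phi> \<in> Qhat_space r Lh"
  using proj by (auto simp: spectral_projection_def)

text \<open>\<open>spectral_projection\<close> only places the two components of each argument in
  the right spaces. Triviality of the intersection makes the splitting unique, and additivity,
  homogeneity and commutation with the semigroup all follow from this lemma.\<close>

lemma proj_unique:
  assumes P: "a \<in> P_space r \<omega>c" and Q: "b \<in> Qhat_space r Lh" and \<phi>: "\<phi> = (\<lambda>\<theta>. a \<theta> + b \<theta>)"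
  shows "proj_compl p \<phi> = b"
proof -
  have c: "\<phi> \<in> Chat_space r" unfolding \<phi> by (intro Chat_add P_Chat P Q_Chat Q)
  have e: "(\<lambda>\<theta>. proj_compl p \<phi> \<theta> - b \<theta>) = (\<lambda>\<theta>. a \<theta> - p \<phi> \<theta>)"
    by (auto simp: proj_compl_def \<phi>)
  have "(\<lambda>\<theta>. proj_compl p \<phi> \<theta> - b \<theta>) = (\<lambda>_. 0)"
    by (rule P_Q_zero) (use Q_diff[OF proj_Q[OF c] Q] P_diff[OF P proj_P[OF c]] e in auto)
  then show ?thesis by (auto simp: fun_eq_iff)
qed

lemma proj_split: "\<phi> = (\<lambda>\<theta>. p \<phi> \<theta> + proj_compl p \<phi> \<theta>)"
  by (auto simp: proj_compl_def)

lemma proj_add: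
  assumes "\<phi> \<in> Chat_space r" "\<psi> \<in> Chat_space r"
  shows "proj_compl p (\<lambda>\<theta>. \<phi> \<theta> + \<psi> \<theta>) = (\<lambda>\<theta>. proj_compl p \<phi> \<theta> + proj_compl p \<psi> \<theta>)"
  by (rule proj_unique[OF P_add[OF proj_P proj_P] Q_add[OF proj_Q proj_Q], OF assms assms])
     (auto simp: proj_compl_def)

lemma proj_scale:
  assumes "\<phi> \<in> Chat_space r"
  shows "proj_compl p (\<lambda>\<theta>. k * \<phi> \<theta>) = (\<lambda>\<theta>. k * proj_compl p \<phi> \<theta>)"
  by (rule proj_unique[OF P_scale[OF proj_P] Q_scale[OF proj_Q], OF assms assms])
     (auto simp: proj_compl_def algebra_simps)

lemma proj_diff:
  assumes "\<phi> \<in> Chat_space r" "\<psi> \<in> Chat_space r"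
  shows "proj_compl p (\<lambda>\<theta>. \<phi> \<theta> - \<psi> \<theta>) = (\<lambda>\<theta>. proj_compl p \<phi> \<theta> - proj_compl p \<psi> \<theta>)"
  by (rule proj_unique[OF P_diff[OF proj_P proj_P] Q_diff[OF proj_Q proj_Q], OF assms assms])
     (auto simp: proj_compl_def)

lemma Chat_sum: "(\<And>i. i \<in> I \<Longrightarrow> \<phi> i \<in> Chat_space r) \<Longrightarrow> (\<lambda>\<theta>. \<Sum>i\<in>I. \<phi> i \<theta>) \<in> Chat_space r"
  by (induction I rule: infinite_finite_induct) (auto simp: Chat_zero Chat_add)

lemma proj_zero: "proj_compl p (\<lambda>_. 0) = (\<lambda>_. 0)"
  using proj_scale[OF Chat_zero, of 0] by simp

lemma proj_sum:
  assumes "\<And>i. i \<in> I \<Longrightarrow> \<phi> i \<in> Chat_space r"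
  shows "proj_compl p (\<lambda>\<theta>. \<Sum>i\<in>I. \<phi> i \<theta>) = (\<lambda>\<theta>. \<Sum>i\<in>I. proj_compl p (\<phi> i) \<theta>)"
  using assms
  by (induction I rule: infinite_finite_induct) (auto simp: proj_zero proj_add Chat_sum)

lemma proj_semigroup:
  assumes \<phi>: "\<phi> \<in> Chat_space r" and t: "t \<ge> 0"
  shows "proj_compl p (dde_semigroup r Lh t \<phi>) = dde_semigroup r Lh t (proj_compl p \<phi>)"
proof (rule proj_unique)
  show "dde_semigroup r Lh t (p \<phi>) \<in> P_space r \<omega>c" by (intro semigroup_P proj_P \<phi> t)
  show "dde_semigroup r Lh t (proj_compl p \<phi>) \<in> Qhat_space r Lh" by (intro semigroup_Q proj_Q \<phi> t)
  show "dde_semigroup r Lh t \<phi> = (\<lambda>\<theta>. dde_semigroup r Lh t (p \<phi>) \<theta> + dde_semigroup r Lh t (proj_compl p \<phi>) \<theta>)"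
    by (subst semigroup_add[symmetric]) (simp_all add: P_Chat[OF proj_P[OF \<phi>]] Q_Chat[OF proj_Q[OF \<phi>]] proj_split[symmetric])
qed

text \<open>Wait a whole number of periods: the P-component returns to itself, while the stable one
  has shrunk by more than half. So the P-component equals the evolved function minus a term of at
  most half the norm of the stable component, and that half can be absorbed.\<close>

lemma proj_bounded: "\<exists>C\<ge>0. \<forall>\<phi>\<in>Chat_space r. supnorm r (proj_compl p \<phi>) \<le> C * supnorm r \<phi>"
proof -
  have "filterlim (\<lambda>j. 2 * pi * real j / \<omega>c) at_top sequentially"
    using \<omega>c_pos by real_asymp
  moreover have "((\<lambda>t. K * exp (- \<kappa> * t)) \<longlongrightarrow> 0) at_top"
    using \<kappa>_pos by real_asymp
  ultimately have "(\<lambda>j. K * exp (- \<kappa> * (2 * pi * real j / \<omega>c))) \<longlonglongrightarrow> 0"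
    by (rule filterlim_compose[rotated])
  then have "\<forall>\<^sub>F j in sequentially. K * exp (- \<kappa> * (2 * pi * real j / \<omega>c)) < 1/2"
    by (rule order_tendstoD) simp
  then obtain j where j: "K * exp (- \<kappa> * (2 * pi * real j / \<omega>c)) < 1/2"
    by (auto dest: eventually_happens)
  \<comment> \<open>A whole number of periods, large enough for the decay factor
    \<open>K * exp (- \<kappa> * t)\<close> to be below 1/2.\<close>
  define t where "t = 2 * pi * real j / \<omega>c"
  have t: "t \<ge> 0" using \<omega>c_pos by (simp add: t_def)
  have "supnorm r (proj_compl p \<phi>) \<le> (4 * exp (2 * B * t) + 2) * supnorm r \<phi>" if \<phi>: "\<phi> \<in> Chat_space r" for \<phi>
  proof -
    let ?q = "proj_compl p \<phi>"
    have r: "r \<ge> 0" using r_pos by simp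
    have P: "p \<phi> \<in> Chat_space r" by (intro P_Chat proj_P \<phi>)
    have Q: "?q \<in> Chat_space r" by (intro Q_Chat proj_Q \<phi>)
    have q0: "0 \<le> supnorm r ?q" by (rule supnorm_nonneg[OF Chat_bounded[OF Q] r])
    have 0: "dde_semigroup r Lh t (p \<phi>) = p \<phi>"
      unfolding t_def by (simp add: semigroup_P_period proj_P \<phi>)
    have "p \<phi> = (\<lambda>\<theta>. \<phi> \<theta> - ?q \<theta>)" by (auto simp: proj_compl_def)
    then have "dde_semigroup r Lh t (p \<phi>) = dde_semigroup r Lh t (\<lambda>\<theta>. \<phi> \<theta> - ?q \<theta>)" by simp
    also have "\<dots> = (\<lambda>\<theta>. dde_semigroup r Lh t \<phi> \<theta> - dde_semigroup r Lh t ?q \<theta>)"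
      by (simp add: dde_semigroup_sol sol_diff \<phi> Q seg_diff)
    finally have "supnorm r (p \<phi>) = supnorm r (\<lambda>\<theta>. dde_semigroup r Lh t \<phi> \<theta> - dde_semigroup r Lh t ?q \<theta>)"
      by (simp add: 0)
    also have "\<dots> \<le> supnorm r (dde_semigroup r Lh t \<phi>) + supnorm r (dde_semigroup r Lh t ?q)"
      by (intro supnorm_diff semigroup_Chat \<phi> Q r)
    also have "\<dots> \<le> 2 * exp (2 * B * t) * supnorm r \<phi> + 1/2 * supnorm r ?q"
    proof (rule add_mono[OF semigroup_bound[OF \<phi> t]])
      have "supnorm r (dde_semigroup r Lh t ?q) \<le> K * exp (- \<kappa> * t) * supnorm r ?q"
        by (intro decay proj_Q \<phi> t)
      also have "\<dots> \<le> 1/2 * supnorm r ?q"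
        using j q0 unfolding t_def[symmetric] by (intro mult_right_mono) auto
      finally show "supnorm r (dde_semigroup r Lh t ?q) \<le> 1/2 * supnorm r ?q" .
    qed
    finally have 1: "supnorm r (p \<phi>) \<le> 2 * exp (2 * B * t) * supnorm r \<phi> + 1/2 * supnorm r ?q" .
    have "supnorm r ?q \<le> supnorm r \<phi> + supnorm r (p \<phi>)"
      unfolding proj_compl_def by (intro supnorm_diff \<phi> P r)
    with 1 show ?thesis by (simp add: algebra_simps)
  qed
  then show ?thesis by (intro exI[of _ "4 * exp (2 * B * t) + 2"]) (auto intro: add_nonneg_nonneg)
qed

end

section \<open>Variation of constants\<close>

text \<open>A step function that jumps at the left end of each cell by the increment over that cell
  already carries the value of \<open>f\<close> at the right end. It is therefore within one mesh
  width of the current time.\<close>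

lemma step_approx:
  fixes f :: "real \<Rightarrow> real"
  assumes A: "A > 0" and N: "N > 0" and t: "t \<in> {0..A}"
  defines "\<delta> \<equiv> A / real N"
  shows "\<exists>u\<in>{0..A}. \<bar>t - u\<bar> \<le> \<delta> \<and>
    (\<Sum>i<N. (f (real (Suc i) * \<delta>) - f (real i * \<delta>)) * (if real i * \<delta> \<le> t then 1 else 0)) = f u - f 0"
proof -
  have \<delta>: "\<delta> > 0" using A N by (simp add: \<delta>_def)
  define j where "j = nat \<lfloor>t / \<delta>\<rfloor>"
  have j1: "real j * \<delta> \<le> t" and j2: "t < (real j + 1) * \<delta>"
  proof -
    have "real j = of_int \<lfloor>t / \<delta>\<rfloor>" using t \<delta> by (simp add: j_def)
    then have "real j \<le> t / \<delta>" "t / \<delta> < real j + 1" by linarith+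
    then show "real j * \<delta> \<le> t" "t < (real j + 1) * \<delta>" using \<delta> by (simp_all add: field_simps)
  qed
  \<comment> \<open>The minimum matters at \<open>t = A\<close>, where the floor reaches
    \<open>N\<close> although there is no cell with that index.\<close>
  define m where "m = min (Suc j) N"
  have iff: "real i * \<delta> \<le> t \<longleftrightarrow> i \<le> j" for i
  proof
    assume "real i * \<delta> \<le> t"
    then have "real i * \<delta> < (real j + 1) * \<delta>" using j2 by simp
    then have "real i < real j + 1" using \<delta> by (simp only: mult_less_cancel_right_pos)
    then show "i \<le> j" by linarith
  next
    assume "i \<le> j"
    then have "real i * \<delta> \<le> real j * \<delta>" using \<delta> by simp
    then show "real i * \<delta> \<le> t" using j1 by simp
  qed
  have "(\<Sum>i<N. (f (real (Suc i) * \<delta>) - f (real i * \<delta>)) * (if real i * \<delta> \<le> t then 1 else 0))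
      = (\<Sum>i<m. f (real (Suc i) * \<delta>) - f (real i * \<delta>))"
    unfolding iff by (rule sum.mono_neutral_cong_right) (auto simp: m_def)
  also have "\<dots> = f (real m * \<delta>) - f (real 0 * \<delta>)"
    by (rule sum_lessThan_telescope)
  finally have s: "(\<Sum>i<N. (f (real (Suc i) * \<delta>) - f (real i * \<delta>)) * (if real i * \<delta> \<le> t then 1 else 0)) = f (real m * \<delta>) - f 0"
    by simp
  have NA: "real N * \<delta> = A" using N by (simp add: \<delta>_def)
  have mA: "real m * \<delta> \<le> A" 
    using \<delta> unfolding NA[symmetric] m_def by (intro mult_right_mono) auto
  have "\<bar>t - real m * \<delta>\<bar> \<le> \<delta>"
  proof (cases "Suc j \<le> N")
    case True
    then have "real m * \<delta> = real j * \<delta> + \<delta>" by (simp add: m_def algebra_simps)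
    with j1 j2 \<delta> show ?thesis by (simp add: algebra_simps abs_le_iff)
  next
    case False
    then have "m = N" "N \<le> j" by (auto simp: m_def)
    then have "A \<le> t" using iff[of N] NA by simp
    then show ?thesis using NA \<open>m = N\<close> \<delta> t by auto
  qed
  moreover have "real m * \<delta> \<in> {0..A}" using mA \<delta> by simp
  ultimately show ?thesis using s by blast
qed

context delay begin

lemma ind_Chat: "indicator {0} \<in> Chat_space r"
  using r_pos by (auto simp: Chat_space_def indicator_def bounded_iff intro!: exI[of _ 1])

lemma Lh_zero: "Lh (\<lambda>_. 0) = 0"
  using Lh_scale[OF Chat_zero, of 0] by simp

text \<open>A unit jump in the forcing at time \<open>a\<close> produces the fundamental solution
  started at \<open>a\<close>. Superposing such responses solves the equation exactly for step
  forcings.\<close>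

lemma fundamental_shift:
  assumes a: "a \<ge> 0" and t: "t \<ge> 0"
  shows "sol (indicator {0}) (t - a) = (if a \<le> t then 1 else 0)
    + (LBINT s:{0..t}. Lh (seg r 1 (\<lambda>t. sol (indicator {0}) (t - a)) s))"
proof -
  define U where "U = sol (indicator {0})"
  have U0: "U s = 0" if "s < 0" for s using that sol_init[OF ind_Chat, of s] by (simp add: U_def)
  have z: "Lh (seg r 1 U (s - a)) = 0" if "s < a" for s
  proof -
    have "seg r 1 U (s - a) = (\<lambda>_. 0)" using that U0 by (auto simp: seg_1 on_seg_def)
    then show ?thesis by (simp add: Lh_zero)
  qed
  have sg: "seg r 1 (\<lambda>t. U (t - a)) s = seg r 1 U (s - a)" for s
    using seg_shift[of U "-a" s] by simp
  have "(LBINT s:{0..t}. Lh (seg r 1 U (s - a))) = (if a \<le> t then U (t - a) - 1 else 0)"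
  proof (cases "a \<le> t")
    case True
    have "(LBINT s:{0..t}. Lh (seg r 1 U (s - a))) = (LBINT s. indicator {0..t-a} (s - a) *\<^sub>R Lh (seg r 1 U (s - a)))"
      unfolding set_lebesgue_integral_def
      by (rule Bochner_Integration.integral_cong) (use a z in \<open>auto simp: indicator_def\<close>)
    also have "\<dots> = (LBINT s:{0..t-a}. Lh (seg r 1 U s))"
      unfolding set_lebesgue_integral_def
      by (subst lborel_integral_real_affine[where c=1 and t="-a" and f="\<lambda>s. indicator {0..t-a} s *\<^sub>R Lh (seg r 1 U s)"]) auto
    also have "\<dots> = U (t - a) - 1"
      using sol_eq[OF ind_Chat, of "t - a"] True by (simp add: U_def)
    finally show ?thesis using True by simp
  next
    case False
    then have "(LBINT s:{0..t}. Lh (seg r 1 U (s - a))) = (LBINT s:{0..t}. 0)"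
      by (intro set_lebesgue_integral_cong) (auto simp: z)
    with False show ?thesis by simp
  qed
  then show ?thesis
    using U0[of "t - a"] by (auto simp: U_def[symmetric] sg)
qed

end

context delay_proj begin

definition \<psi> :: "real \<Rightarrow> real" where "\<psi> = proj_compl p (indicator {0})"

lemma \<psi>_Q: "\<psi> \<in> Qhat_space r Lh" and \<psi>_Chat: "\<psi> \<in> Chat_space r"
  using proj_Q[OF ind_Chat] Q_Chat by (auto simp: \<psi>_def)

text \<open>The forcing is merely continuous, so the convolution with it is expressed as a limit of
  Riemann sums. Replace \<open>f\<close> by its step approximation, whose response is explicit; the
  remainder solves the equation with a forcing no larger than the oscillation of \<open>f\<close> on
  the mesh. Gronwall makes the remainder small, and boundedness of the projection carries this over
  to the stable part.\<close>

lemma voc: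
  assumes A: "A > 0" and x: "continuous_on {-r..A} x" and f: "continuous_on {0..A} f" "f 0 = 0"
    and eq: "\<And>t. t \<in> {0..A} \<Longrightarrow> x t = x 0 + (LBINT s:{0..t}. Lh (seg r 1 x s)) + f t"
    and \<theta>: "\<theta> \<in> {-r..0}"
  shows "(\<lambda>N. \<Sum>i<N. (f (real (Suc i) * (A / N)) - f (real i * (A / N)))
            * dde_semigroup r Lh (A - real i * (A / N)) \<psi> \<theta>)
     \<longlonglongrightarrow> proj_compl p (seg r 1 x A) \<theta> - dde_semigroup r Lh A (proj_compl p (seg r 1 x 0)) \<theta>"
    (is "?S \<longlonglongrightarrow> ?L")
proof -
  \<comment> \<open>The given path is controlled on the interval only; extension by zero gives a
    path on the whole line to which the solution theory applies.\<close>
  define x' where "x' t = (if t \<in> {-r..A} then x t else 0)" for t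
  have ax: "adm x'"
  proof -
    have "(\<lambda>t. indicator {-r..A} t *\<^sub>R x t) \<in> borel_measurable borel"
      using borel_measurable_continuous_on_indicator[OF _ x] by simp
    also have "(\<lambda>t. indicator {-r..A} t *\<^sub>R x t) = x'" by (auto simp: x'_def indicator_def)
    finally have m: "x' \<in> borel_measurable borel" .
    have "bounded (insert 0 (x ` {-r..A}))"
      using x by (simp add: compact_imp_bounded compact_continuous_image)
    then have "bounded (x' ` S)" for S by (rule bounded_subset) (auto simp: x'_def)
    with m show ?thesis by (simp add: adm_def)
  qed
  have sx: "seg r 1 x s = seg r 1 x' s" if "s \<in> {0..A}" for s
    using that by (intro seg_cong) (auto simp: x'_def)
  define \<phi> where "\<phi> = seg r 1 x 0"
  have \<phi>: "\<phi> \<in> Chat_space r" using sx[of 0] A by (simp add: \<phi>_def adm_seg[OF ax])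
  define U where "U = sol (indicator {0})"
  have aU: "adm (\<lambda>t. U (t - a))" for a using adm_shift[of U "-a"] by (simp add: U_def sol_adm ind_Chat)
  obtain C where C: "C \<ge> 0" "\<And>\<phi>. \<phi> \<in> Chat_space r \<Longrightarrow> supnorm r (proj_compl p \<phi>) \<le> C * supnorm r \<phi>"
    using proj_bounded by blast
  have main: "\<bar>?L - ?S N\<bar> \<le> C * (2 * \<eta> * exp (2 * B * A))"
    if N: "N > 0" and \<eta>: "\<And>t u. t \<in> {0..A} \<Longrightarrow> u \<in> {0..A} \<Longrightarrow> \<bar>t - u\<bar> \<le> A / N \<Longrightarrow> \<bar>f t - f u\<bar> \<le> \<eta>" for N \<eta>
  proof -
    define \<delta> where "\<delta> = A / real N"
    have \<delta>: "\<delta> > 0" using A N by (simp add: \<delta>_def)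
    have NA: "real i * \<delta> \<le> A" if "i < N" for i
    proof -
      have "real i * \<delta> \<le> real N * \<delta>" using that \<delta> by (intro mult_right_mono) auto
      then show ?thesis using N by (simp add: \<delta>_def)
    qed
    define D where "D i = f (real (Suc i) * \<delta>) - f (real i * \<delta>)" for i
    \<comment> \<open>The exact response to the step forcing \<open>fN\<close>: one shifted
      fundamental solution per jump.\<close>
    define w where "w t = (\<Sum>i<N. D i * U (t - real i * \<delta>))" for t
    have aw: "adm w" unfolding w_def by (intro adm_sum adm_scale aU)
    define fN where "fN t = (\<Sum>i<N. D i * (if real i * \<delta> \<le> t then 1 else 0))" for t
    have Ls: "Lh (seg r 1 w s) = (\<Sum>i<N. D i * Lh (seg r 1 (\<lambda>t. U (t - real i * \<delta>)) s))" for s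
    proof -
      have "Lh (seg r 1 (\<lambda>t. \<Sum>i\<in>I. D i * U (t - real i * \<delta>)) s) = (\<Sum>i\<in>I. D i * Lh (seg r 1 (\<lambda>t. U (t - real i * \<delta>)) s))"
        if "finite I" for I
        using that
      proof (induction I)
        case empty
        have "seg r 1 (\<lambda>t. 0) s = (\<lambda>_. 0)" by (auto simp: seg_1 on_seg_def)
        then show ?case by (simp add: Lh_zero)
      next
        case (insert i I)
        then show ?case
          by (simp add: seg_add seg_scale Lh_add Lh_scale Chat_scale adm_seg aU adm_sum adm_scale)
      qed
      from this[of "{..<N}"] show ?thesis by (simp add: w_def[abs_def])
    qed
    have wi: "w t = (LBINT s:{0..t}. Lh (seg r 1 w s)) + fN t" if t: "t \<ge> 0" for t
    proof -
      have "(LBINT s:{0..t}. Lh (seg r 1 w s)) = (\<Sum>i<N. D i * (LBINT s:{0..t}. Lh (seg r 1 (\<lambda>t. U (t - real i * \<delta>)) s)))"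
        unfolding Ls
        using Lh_integrable[OF aU]
        by (simp add: set_lebesgue_integral_def set_integrable_def sum_distrib_left mult.left_commute)
      then show ?thesis
        unfolding w_def fN_def using t \<delta>
        by (simp add: sum.distrib[symmetric] distrib_left[symmetric] U_def fundamental_shift add.commute)
    qed
    \<comment> \<open>The remainder: true path, minus the free evolution of its history, minus the
      response to the step forcing.\<close>
    define d where "d t = x' t - sol \<phi> t - w t" for t
    have ad: "adm d" unfolding d_def by (intro adm_diff ax sol_adm \<phi> aw)
    have \<eta>0: "\<eta> \<ge> 0" using \<eta>[of 0 0] A by auto
    have dneg: "d v = 0" if "v \<in> {-r..<0}" for v
    proof -
      have "U (v - real i * \<delta>) = 0" for i
      proof -
        have "0 \<le> real i * \<delta>" using \<delta> by simp
        then have "v - real i * \<delta> < 0" using that by auto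
        then show ?thesis unfolding U_def by (subst sol_init[OF ind_Chat]) auto
      qed
      moreover have "sol \<phi> v = x' v"
        using that A by (simp add: sol_init[OF \<phi>]) (simp add: \<phi>_def seg_1 on_seg_def x'_def)
      ultimately show ?thesis by (simp add: d_def w_def)
    qed
    have di: "d t = (LBINT s:{0..t}. Lh (seg r 1 d s)) + (f t - fN t)" if t: "t \<in> {0..A}" for t
    proof -
      have "(LBINT s:{0..t}. Lh (seg r 1 x s)) = (LBINT s:{0..t}. Lh (seg r 1 x' s))"
        by (intro set_lebesgue_integral_cong) (use t in \<open>auto simp: sx\<close>)
      then have "x' t = x 0 + (LBINT s:{0..t}. Lh (seg r 1 x' s)) + f t"
        using eq[OF t] t r_pos by (simp add: x'_def)
      moreover have "sol \<phi> t = x 0 + (LBINT s:{0..t}. Lh (seg r 1 (sol \<phi>) s))"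
        using sol_eq[OF \<phi>, of t] t r_pos by (simp add: \<phi>_def seg_1 on_seg_def)
      moreover have "(LBINT s:{0..t}. Lh (seg r 1 d s)) = (LBINT s:{0..t}. Lh (seg r 1 x' s))
          - (LBINT s:{0..t}. Lh (seg r 1 (sol \<phi>) s)) - (LBINT s:{0..t}. Lh (seg r 1 w s))"
        unfolding d_def
        by (simp add: seg_diff Lh_diff Chat_diff adm_seg ax sol_adm \<phi> aw Lh_integrable set_integral_diff)
      ultimately show ?thesis using wi[of t] t by (simp add: d_def)
    qed
    have fb: "\<bar>f t - fN t\<bar> \<le> \<eta>" if t: "t \<in> {0..A}" for t
    proof -
      obtain u where "u \<in> {0..A}" "\<bar>t - u\<bar> \<le> \<delta>" "fN t = f u - f 0"
        using step_approx[OF A N t, of f] unfolding fN_def D_def \<delta>_def by blast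
      then show ?thesis using \<eta>[OF t, of u] f(2) by (simp add: \<delta>_def)
    qed
    \<comment> \<open>Time 0 needs its own argument: the first jump of \<open>fN\<close> sits
      exactly there, so \<open>d 0\<close> is small but in general not zero.\<close>
    have d0: "\<bar>d v\<bar> \<le> \<eta>" if "v \<in> {-r..0}" for v
    proof (cases "v = 0")
      case True
      have "(LBINT s:{0..0}. Lh (seg r 1 d s)) = 0"
        using set_borel_integral_eq_integral(2)[OF Lh_integrable[OF ad, of 0 0]] by simp
      then show ?thesis using di[of 0] fb[of 0] A True by simp
    next
      case False
      then show ?thesis using dneg[of v] that \<eta>0 by simp
    qed
    have dA: "\<bar>d t\<bar> \<le> 2 * \<eta> * exp (2 * B * max 0 t)" if "t \<in> {-r..A}" for t
    proof (rule gronwall[OF ad _ d0 _ that])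
      fix t assume t: "t \<in> {0..A}"
      have "\<bar>LBINT s:{0..t}. Lh (seg r 1 d s)\<bar> \<le> (LBINT s:{0..t}. \<bar>Lh (seg r 1 d s)\<bar>)"
        using set_integral_norm_bound[OF Lh_integrable[OF ad]] by simp
      then show "\<bar>d t\<bar> \<le> \<eta> + (LBINT s:{0..t}. \<bar>Lh (seg r 1 d s)\<bar>)"
        using di[OF t] fb[OF t] by linarith
    qed (use A in auto)
    have sd: "supnorm r (seg r 1 d A) \<le> 2 * \<eta> * exp (2 * B * A)"
    proof (rule supnorm_le)
      fix v assume v: "v \<in> {-r..0}"
      have "\<bar>d (A + v)\<bar> \<le> 2 * \<eta> * exp (2 * B * max 0 (A + v))" using v A by (intro dA) auto
      also have "\<dots> \<le> 2 * \<eta> * exp (2 * B * A)"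
        using v A B_pos \<eta>0 by (intro mult_left_mono) auto
      finally show "\<bar>seg r 1 d A v\<bar> \<le> 2 * \<eta> * exp (2 * B * A)" using v by (simp add: seg_1 on_seg_def)
    qed (use r_pos in simp)
    have TU: "seg r 1 (\<lambda>t. U (t - real i * \<delta>)) A = dde_semigroup r Lh (A - real i * \<delta>) (indicator {0})" for i
      using seg_shift[of U "- (real i * \<delta>)" A] by (simp add: U_def dde_semigroup_sol)
    have sw: "seg r 1 w A = (\<lambda>\<theta>. \<Sum>i<N. D i * dde_semigroup r Lh (A - real i * \<delta>) (indicator {0}) \<theta>)"
    proof
      fix v
      show "seg r 1 w A v = (\<Sum>i<N. D i * dde_semigroup r Lh (A - real i * \<delta>) (indicator {0}) v)"
        unfolding TU[symmetric]
        by (cases "v \<in> {-r..0}") (simp_all add: w_def seg_1 on_seg_def del: atLeastAtMost_iff)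
    qed
    have pw: "proj_compl p (seg r 1 w A) = (\<lambda>\<theta>. \<Sum>i<N. D i * dde_semigroup r Lh (A - real i * \<delta>) \<psi> \<theta>)"
    proof -
      have "proj_compl p (seg r 1 w A) = (\<lambda>\<theta>. \<Sum>i<N. proj_compl p (\<lambda>\<theta>. D i * dde_semigroup r Lh (A - real i * \<delta>) (indicator {0}) \<theta>) \<theta>)"
        unfolding sw by (intro proj_sum Chat_scale semigroup_Chat ind_Chat)
      also have "\<dots> = (\<lambda>\<theta>. \<Sum>i<N. D i * dde_semigroup r Lh (A - real i * \<delta>) \<psi> \<theta>)"
        using NA by (auto simp: proj_scale semigroup_Chat ind_Chat proj_semigroup \<psi>_def intro!: ext sum.cong)
      finally show ?thesis .
    qed
    have "proj_compl p (seg r 1 d A) = (\<lambda>\<theta>. proj_compl p (seg r 1 x' A) \<theta>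
        - dde_semigroup r Lh A (proj_compl p \<phi>) \<theta> - proj_compl p (seg r 1 w A) \<theta>)"
      using A unfolding d_def
      by (simp add: seg_diff proj_diff Chat_diff adm_seg ax sol_adm \<phi> aw proj_semigroup[symmetric] dde_semigroup_sol[of A \<phi>])
    then have "?L - ?S N = proj_compl p (seg r 1 d A) \<theta>"
      using sx[of A] A unfolding pw by (simp add: \<phi>_def D_def \<delta>_def)
    also have "\<bar>\<dots>\<bar> \<le> supnorm r (proj_compl p (seg r 1 d A))"
      by (rule Chat_supnorm[OF Q_Chat[OF proj_Q[OF adm_seg[OF ad]]]]) (use r_pos in simp)
    also have "\<dots> \<le> C * supnorm r (seg r 1 d A)" by (rule C(2)[OF adm_seg[OF ad]])
    also have "\<dots> \<le> C * (2 * \<eta> * exp (2 * B * A))" by (rule mult_left_mono[OF sd C(1)])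
    finally show ?thesis .
  qed
  show ?thesis
  proof (rule LIMSEQ_I)
    fix e :: real assume e: "e > 0"
    \<comment> \<open>Chosen so that the final bound is \<open>e / 2\<close>; \<open>C + 1\<close>
      avoids dividing by a constant that may be 0.\<close>
    define \<eta> where "\<eta> = e / (2 * (C + 1) * exp (2 * B * A)) / 2"
    have \<eta>: "\<eta> > 0" using e C(1) by (simp add: \<eta>_def)
    have "uniformly_continuous_on {0..A} f" using f(1) by (rule compact_uniformly_continuous) simp
    then obtain \<rho> where \<rho>: "\<rho> > 0" "\<And>t u. t \<in> {0..A} \<Longrightarrow> u \<in> {0..A} \<Longrightarrow> \<bar>t - u\<bar> < \<rho> \<Longrightarrow> \<bar>f t - f u\<bar> < \<eta>"
      using \<eta> unfolding uniformly_continuous_on_def dist_real_def by metis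
    obtain N0 :: nat where N0: "A / \<rho> < real N0" using reals_Archimedean2 by blast
    show "\<exists>N0. \<forall>N\<ge>N0. norm (?S N - ?L) < e"
    proof (intro exI[of _ "max 1 N0"] allI impI)
      fix N assume N: "max 1 N0 \<le> N"
      have "A / real N < \<rho>"
      proof -
        have "A / \<rho> < real N" using N0 N by linarith
        then show ?thesis using \<rho>(1) N by (simp add: field_simps)
      qed
      then have "\<bar>?L - ?S N\<bar> \<le> C * (2 * \<eta> * exp (2 * B * A))"
        using N \<rho>(2) by (intro main) (auto intro!: less_imp_le)
      also have "\<dots> \<le> (C + 1) * (2 * \<eta> * exp (2 * B * A))" using \<eta> by (intro mult_right_mono) auto
      also have "\<dots> = e / 2"
      proof -
        have "c * (2 * (e / (2 * c * E) / 2) * E) = e / 2" if "c > 0" "E > 0" for c E :: real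
          using that by (simp add: field_simps)
        from this[of "C + 1" "exp (2 * B * A)"] C(1) show ?thesis by (simp add: \<eta>_def)
      qed
      also have "\<dots> < e" using e by simp
      finally show "norm (?S N - ?L) < e" by (simp add: abs_minus_commute)
    qed
  qed
qed

section \<open>Kernel estimates\<close>

text \<open>One scalar path carries all kernels: evaluating a segment at \<open>\<theta>\<close> is
  only a time shift. Its discontinuity is at time 0, where the initial function
  \<open>\<psi>\<close> contains the indicator.\<close>

definition kern :: "real \<Rightarrow> real" where "kern = sol \<psi>"

lemma semigroup_kern: "\<theta> \<in> {-r..0} \<Longrightarrow> dde_semigroup r Lh t \<psi> \<theta> = kern (t + \<theta>)"
  by (simp add: dde_semigroup_sol seg_1 on_seg_def kern_def)

lemma supnorm_\<psi>: "0 \<le> supnorm r \<psi>"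
  using supnorm_nonneg[OF Chat_bounded[OF \<psi>_Chat]] r_pos by simp

lemma semigroup_\<psi>_bound:
  assumes "t \<ge> 0"
  shows "\<bar>dde_semigroup r Lh t \<psi> \<theta>\<bar> \<le> K * supnorm r \<psi> * exp (- \<kappa> * t)"
proof -
  have "\<bar>dde_semigroup r Lh t \<psi> \<theta>\<bar> \<le> supnorm r (dde_semigroup r Lh t \<psi>)"
    using r_pos by (intro Chat_supnorm semigroup_Chat \<psi>_Chat) simp
  also have "\<dots> \<le> K * exp (- \<kappa> * t) * supnorm r \<psi>" by (rule decay[OF \<psi>_Q assms])
  finally show ?thesis by (simp add: mult_ac)
qed

text \<open>The decay hypothesis covers times from 0 on. On the initial segment the plain bound by
  \<open>supnorm r \<psi>\<close> is used, and \<open>K + 1\<close> accommodates both cases.\<close>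

lemma kern_bound:
  obtains C0 where "C0 \<ge> 0" "\<And>t. t \<ge> -r \<Longrightarrow> \<bar>kern t\<bar> \<le> C0 * exp (- \<kappa> * t)"
proof
  define C0 where "C0 = (K + 1) * supnorm r \<psi>"
  show "(K + 1) * supnorm r \<psi> \<ge> 0" using K_pos supnorm_\<psi> by simp
  fix t :: real assume t: "t \<ge> -r"
  show "\<bar>kern t\<bar> \<le> (K + 1) * supnorm r \<psi> * exp (- \<kappa> * t)"
  proof (cases "t \<ge> 0")
    case True
    have "\<bar>kern t\<bar> \<le> K * supnorm r \<psi> * exp (- \<kappa> * t)"
      using semigroup_\<psi>_bound[OF True, of 0] semigroup_kern[of 0 t] r_pos by simp
    also have "\<dots> \<le> (K + 1) * supnorm r \<psi> * exp (- \<kappa> * t)"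
      using supnorm_\<psi> by (intro mult_right_mono) auto
    finally show ?thesis .
  next
    case False
    have "\<bar>kern t\<bar> \<le> 1 * supnorm r \<psi> * 1"
      using False Chat_supnorm[OF \<psi>_Chat] r_pos by (simp add: kern_def sol_init[OF \<psi>_Chat])
    also have "\<dots> \<le> (K + 1) * supnorm r \<psi> * exp (- \<kappa> * t)"
      using False K_pos \<kappa>_pos supnorm_\<psi> by (intro mult_mono) (auto simp: mult_le_0_iff)
    finally show ?thesis .
  qed
qed

text \<open>From time 0 on the kernel is an integral of \<open>Lh\<close> along the stable orbit,
  and this integrand decays exponentially.\<close>

lemma kern_increment_nonneg:
  assumes "0 \<le> s" "s \<le> t"
  shows "\<bar>kern t - kern s\<bar> \<le> B * (K * supnorm r \<psi>) * exp (- \<kappa> * s) * (t - s)"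
proof -
  let ?g = "\<lambda>u. Lh (seg r 1 kern u)"
  have b: "\<bar>?g u\<bar> \<le> B * (K * supnorm r \<psi>) * exp (- \<kappa> * s)" if "u \<in> {s..t}" for u
  proof -
    have "\<bar>?g u\<bar> \<le> B * supnorm r (dde_semigroup r Lh u \<psi>)"
      unfolding kern_def dde_semigroup_sol[symmetric] by (intro Lh_supnorm semigroup_Chat \<psi>_Chat)
    also have "\<dots> \<le> B * (K * exp (- \<kappa> * u) * supnorm r \<psi>)"
      using B_pos that assms by (intro mult_left_mono decay \<psi>_Q) auto
    also have "\<dots> \<le> B * (K * exp (- \<kappa> * s) * supnorm r \<psi>)"
      using that B_pos K_pos \<kappa>_pos supnorm_\<psi> by (intro mult_left_mono mult_right_mono) auto
    finally show ?thesis by (simp add: mult_ac)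
  qed
  have i: "set_integrable lborel {s..t} ?g" unfolding kern_def by (intro Lh_integrable sol_adm \<psi>_Chat)
  have "kern t - kern s = (LBINT u:{s..t}. ?g u)"
    using sol_increment[OF \<psi>_Chat assms] by (simp add: kern_def)
  also have "\<bar>\<dots>\<bar> \<le> (LBINT u:{s..t}. \<bar>?g u\<bar>)"
    using set_integral_norm_bound[OF i] by simp
  also have "\<dots> \<le> (LBINT u:{s..t}. B * (K * supnorm r \<psi>) * exp (- \<kappa> * s))"
    by (rule set_integral_mono[OF set_integrable_abs[OF i]])
       (use b in \<open>auto intro!: set_integrable_bounded_interval[OF _ order_refl]\<close>)
  also have "\<dots> = B * (K * supnorm r \<psi>) * exp (- \<kappa> * s) * (t - s)"
    using assms by (simp add: set_lebesgue_integral_def)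
  finally show ?thesis .
qed

text \<open>At negative times the kernel is minus a trigonometric function, hence Lipschitz; from 0
  on the derivative decays. The condition \<open>0 \<le> s \<or> t < 0\<close> keeps the increment
  from straddling the jump.\<close>

lemma kern_increment:
  obtains C1 where "C1 \<ge> 0"
    "\<And>s t. -r \<le> s \<Longrightarrow> s \<le> t \<Longrightarrow> 0 \<le> s \<or> t < 0 \<Longrightarrow> \<bar>kern t - kern s\<bar> \<le> C1 * exp (- \<kappa> * s) * (t - s)"
proof -
  obtain a b where ab: "p (indicator {0}) = on_seg r (trig a b)"
    using proj_P[OF ind_Chat] by (rule P_E)
  define E where "E = \<omega>c * (\<bar>a\<bar> + \<bar>b\<bar>)"
  have E0: "E \<ge> 0" using \<omega>c_pos by (simp add: E_def)
  have neg: "\<bar>kern t - kern s\<bar> \<le> E * (t - s)" if "-r \<le> s" "s \<le> t" "t < 0" for s t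
  proof -
    have k: "kern u = - trig a b u" if "-r \<le> u" "u < 0" for u
      using that by (simp add: kern_def sol_init[OF \<psi>_Chat]) (simp add: \<psi>_def proj_compl_def ab on_seg_def)
    have "\<bar>trig a b t - trig a b s\<bar> \<le> E * \<bar>t - s\<bar>"
    proof -
      have "norm (trig a b t - trig a b s) \<le> E * norm (t - s)"
      proof (rule field_differentiable_bound[of UNIV _ "\<lambda>u. (b * cos (\<omega>c * u) - a * sin (\<omega>c * u)) * \<omega>c"])
        fix u :: real
        show "(trig a b has_field_derivative (b * cos (\<omega>c * u) - a * sin (\<omega>c * u)) * \<omega>c) (at u within UNIV)"
          unfolding trig_def by (auto intro!: derivative_eq_intros simp: algebra_simps)
        have "\<bar>b * cos (\<omega>c * u) - a * sin (\<omega>c * u)\<bar> \<le> \<bar>b\<bar> * \<bar>cos (\<omega>c * u)\<bar> + \<bar>a\<bar> * \<bar>sin (\<omega>c * u)\<bar>"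
          by (metis abs_mult abs_triangle_ineq4)
        also have "\<dots> \<le> \<bar>b\<bar> * 1 + \<bar>a\<bar> * 1" by (intro add_mono mult_left_mono) auto
        finally show "norm ((b * cos (\<omega>c * u) - a * sin (\<omega>c * u)) * \<omega>c) \<le> E"
          using \<omega>c_pos by (simp add: E_def abs_mult mult.commute)
      qed auto
      then show ?thesis by simp
    qed
    then show ?thesis using that by (simp add: k)
  qed
  show thesis
  proof (rule that)
    let ?C = "B * (K * supnorm r \<psi>) + E"
    have BK: "B * (K * supnorm r \<psi>) \<ge> 0" using B_pos K_pos supnorm_\<psi> by simp
    show "?C \<ge> 0" using BK E0 by simp
    fix s t assume st: "-r \<le> s" "s \<le> t" "0 \<le> s \<or> t < (0::real)"
    show "\<bar>kern t - kern s\<bar> \<le> ?C * exp (- \<kappa> * s) * (t - s)"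
    proof (cases "0 \<le> s")
      case True
      have "\<bar>kern t - kern s\<bar> \<le> B * (K * supnorm r \<psi>) * exp (- \<kappa> * s) * (t - s)"
        by (rule kern_increment_nonneg[OF True st(2)])
      also have "\<dots> \<le> ?C * exp (- \<kappa> * s) * (t - s)"
        using E0 st by (intro mult_right_mono) auto
      finally show ?thesis .
    next
      case False
      have "\<bar>kern t - kern s\<bar> \<le> E * 1 * (t - s)" using neg[OF st(1,2)] False st by simp
      also have "\<dots> \<le> ?C * exp (- \<kappa> * s) * (t - s)"
        using BK E0 False \<kappa>_pos st by (intro mult_right_mono mult_mono) (auto simp: mult_le_0_iff)
      finally show ?thesis .
    qed
  qed
qed

text \<open>The summand increases towards the end of the interval, so the left-endpoint sum stays
  below the integral of the exponential. The bound does not depend on the number of cells or the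
  length of the interval.\<close>

lemma exp_sum_bound:
  fixes a \<delta> :: real assumes "a > 0" "\<delta> > 0"
  shows "(\<Sum>i<N. exp (- a * (real N * \<delta> - real i * \<delta>)) * \<delta>) \<le> 1 / a"
proof -
  define q where "q = exp (- a * \<delta>)"
  have q: "0 < q" "q < 1" using assms by (auto simp: q_def)
  have "(\<Sum>i<N. exp (- a * (real N * \<delta> - real i * \<delta>)) * \<delta>) = (\<Sum>i<N. q * q ^ i * \<delta>)"
  proof (subst sum.nat_diff_reindex[symmetric], rule sum.cong)
    fix i assume "i \<in> {..<N}"
    then have "- a * (real N * \<delta> - real (N - Suc i) * \<delta>) = real (Suc i) * (- a * \<delta>)"
      by (simp add: of_nat_diff algebra_simps)
    then show "exp (- a * (real N * \<delta> - real (N - Suc i) * \<delta>)) * \<delta> = q * q ^ i * \<delta>"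
      by (simp add: q_def exp_of_nat_mult[symmetric] exp_add[symmetric] algebra_simps)
  qed simp
  also have "\<dots> = q * \<delta> * ((1 - q ^ N) / (1 - q))"
    using q by (simp add: sum_distrib_left[symmetric] sum_distrib_right[symmetric] sum_gp_strict mult_ac)
  also have "\<dots> \<le> q * \<delta> * (1 / (1 - q))"
    using q assms by (intro mult_left_mono divide_right_mono) auto
  also have "\<dots> \<le> 1 / a"
  proof -
    have "1 + a * \<delta> \<le> exp (a * \<delta>)" by (rule exp_ge_add_one_self)
    then have "(1 + a * \<delta>) * q \<le> exp (a * \<delta>) * q" using q by simp
    also have "exp (a * \<delta>) * q = 1" by (simp add: q_def exp_add[symmetric])
    finally have "a * (q * \<delta>) \<le> 1 - q" by (simp add: algebra_simps)
    then show ?thesis using q assms by (simp add: field_simps)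
  qed
  finally show ?thesis .
qed

text \<open>Each cell contributes at most \<open>g * \<delta>\<close> times the decayed kernel, and
  the exponentials sum to \<open>1 / \<kappa>\<close>. This is the source of the constant in the
  first term of the theorem.\<close>

lemma lipschitz_forcing_bound:
  assumes A: "A > 0" and N: "N > 0" and g: "g \<ge> 0"
    and f: "\<And>s t. 0 \<le> s \<Longrightarrow> s \<le> t \<Longrightarrow> t \<le> A \<Longrightarrow> \<bar>f t - f s\<bar> \<le> g * (t - s)"
  shows "\<bar>\<Sum>i<N. (f (real (Suc i) * (A / real N)) - f (real i * (A / real N)))
            * dde_semigroup r Lh (A - real i * (A / real N)) \<psi> \<theta>\<bar> \<le> g * (K * supnorm r \<psi>) / \<kappa>"
proof -
  define \<delta> where "\<delta> = A / real N"
  have \<delta>: "\<delta> > 0" and NA: "real N * \<delta> = A" using A N by (auto simp: \<delta>_def)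
  have le: "real i * \<delta> \<le> A" if "i \<le> N" for i
    unfolding NA[symmetric] using that \<delta> by (intro mult_right_mono) auto
  have "\<bar>\<Sum>i<N. (f (real (Suc i) * \<delta>) - f (real i * \<delta>)) * dde_semigroup r Lh (A - real i * \<delta>) \<psi> \<theta>\<bar>
      \<le> (\<Sum>i<N. (g * \<delta>) * (K * supnorm r \<psi> * exp (- \<kappa> * (A - real i * \<delta>))))"
  proof (rule order_trans[OF sum_abs], rule sum_mono)
    fix i assume "i \<in> {..<N}"
    then have i: "real i * \<delta> \<le> A" "real (Suc i) * \<delta> \<le> A" using le[of i] le[of "Suc i"] by auto
    have "\<bar>f (real (Suc i) * \<delta>) - f (real i * \<delta>)\<bar> \<le> g * (real (Suc i) * \<delta> - real i * \<delta>)"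
      using i \<delta> by (intro f) auto
    also have "\<dots> = g * \<delta>" by (simp add: algebra_simps)
    finally show "\<bar>(f (real (Suc i) * \<delta>) - f (real i * \<delta>)) * dde_semigroup r Lh (A - real i * \<delta>) \<psi> \<theta>\<bar>
        \<le> (g * \<delta>) * (K * supnorm r \<psi> * exp (- \<kappa> * (A - real i * \<delta>)))"
      unfolding abs_mult using i g \<delta> by (intro mult_mono semigroup_\<psi>_bound) auto
  qed
  also have "\<dots> = g * (K * supnorm r \<psi>) * (\<Sum>i<N. exp (- \<kappa> * (real N * \<delta> - real i * \<delta>)) * \<delta>)"
    unfolding NA by (simp add: sum_distrib_left mult_ac)
  also have "\<dots> \<le> g * (K * supnorm r \<psi>) * (1 / \<kappa>)"
    using g K_pos supnorm_\<psi> by (intro mult_left_mono exp_sum_bound \<kappa>_pos \<delta>) auto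
  finally show ?thesis by (simp add: \<delta>_def)
qed

text \<open>Half of the exponential decay pays for the Hoelder modulus; the other half remains
  available for summation.\<close>

lemma root4_exp_bound:
  assumes "x \<ge> 0"
  shows "x powr (1/4) \<le> max 1 (2 / \<kappa>) * exp (\<kappa> / 2 * x)"
proof -
  have "x powr (1/4) \<le> 1 + x"
  proof (cases "x \<le> 1")
    case True then show ?thesis using assms powr_mono2[of "1/4" x 1] by simp
  next
    case False then show ?thesis using powr_mono[of "1/4" 1 x] by simp
  qed
  also have "\<dots> \<le> max 1 (2 / \<kappa>) * (1 + \<kappa> / 2 * x)"
  proof -
    have "x \<le> max 1 (2 / \<kappa>) * (\<kappa> / 2 * x)"
    proof -
      have "2 / \<kappa> * (\<kappa> / 2 * x) \<le> max 1 (2 / \<kappa>) * (\<kappa> / 2 * x)"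
        using assms \<kappa>_pos by (intro mult_right_mono) auto
      then show ?thesis using \<kappa>_pos by simp
    qed
    moreover have "1 \<le> max 1 (2 / \<kappa>)" by simp
    ultimately show ?thesis unfolding distrib_left by linarith
  qed
  also have "\<dots> \<le> max 1 (2 / \<kappa>) * exp (\<kappa> / 2 * x)"
    using exp_ge_add_one_self by (intro mult_left_mono) auto
  finally show ?thesis .
qed

lemma sum_by_parts:
  fixes k F :: "nat \<Rightarrow> real"
  shows "(\<Sum>i<Suc n. k i * (F (Suc i) - F i)) = k n * F (Suc n) - k 0 * F 0 - (\<Sum>i<n. F (Suc i) * (k (Suc i) - k i))"
  by (induction n) (auto simp: algebra_simps)

text \<open>The forcing has no bounded variation but the kernel does, so the differences are moved
  onto the kernel. Measured from the final value, the forcing is small exactly where the kernel has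
  not decayed yet, and where it is large the kernel differences are exponentially small. The
  constant must not depend on \<open>A\<close>, since \<open>A\<close> will be of size
  \<open>s / \<epsilon>\<^sup>2\<close>.\<close>

lemma hoelder_forcing_bound:
  obtains C where "C \<ge> 0"
    "\<And>A f H N \<theta>. A > 0 \<Longrightarrow> N > 0 \<Longrightarrow> \<theta> \<in> {-r..0} \<Longrightarrow> H \<ge> 0 \<Longrightarrow>
      (\<And>s t. 0 \<le> s \<Longrightarrow> s \<le> t \<Longrightarrow> t \<le> A \<Longrightarrow> \<bar>f t - f s\<bar> \<le> H * (t - s) powr (1/4)) \<Longrightarrow>
      \<bar>\<Sum>i<N. (f (real (Suc i) * (A / real N)) - f (real i * (A / real N)))
            * dde_semigroup r Lh (A - real i * (A / real N)) \<psi> \<theta>\<bar> \<le> C * H"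
proof -
  obtain C0 where C0: "C0 \<ge> 0" "\<And>t. t \<ge> -r \<Longrightarrow> \<bar>kern t\<bar> \<le> C0 * exp (- \<kappa> * t)" by (rule kern_bound) blast
  obtain C1 where C1: "C1 \<ge> 0"
    "\<And>s t. -r \<le> s \<Longrightarrow> s \<le> t \<Longrightarrow> 0 \<le> s \<or> t < 0 \<Longrightarrow> \<bar>kern t - kern s\<bar> \<le> C1 * exp (- \<kappa> * s) * (t - s)"
    by (rule kern_increment) blast
  define M where "M = max 1 (2 / \<kappa>)"
  define R where "R = exp (\<kappa> * r)"
  have M: "M \<ge> 1" "M \<ge> 0" by (auto simp: M_def)
  have R: "R > 0" by (simp add: R_def)
  \<comment> \<open>Three contributions: the boundary term at time 0, the regular kernel increments,
    and the single cell that contains the jump of the kernel.\<close>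
  define C where "C = C0 * R * M + (C1 * R * M * (2 / \<kappa>) + 2 * C0 * R * r powr (1/4))"
  show thesis
  proof (rule that)
    show "C \<ge> 0" using C0 C1 M R \<kappa>_pos r_pos unfolding C_def by (intro add_nonneg_nonneg mult_nonneg_nonneg) auto
    fix A f H \<theta> and N :: nat
    assume A: "A > 0" and N: "N > 0" and \<theta>: "\<theta> \<in> {-r..0}" and H: "H \<ge> (0::real)"
      and f: "\<And>s t. 0 \<le> s \<Longrightarrow> s \<le> t \<Longrightarrow> t \<le> A \<Longrightarrow> \<bar>f t - f s\<bar> \<le> H * (t - s) powr (1/4)"
    define \<delta> where "\<delta> = A / real N"
    have \<delta>: "\<delta> > 0" and NA: "real N * \<delta> = A" using A N by (auto simp: \<delta>_def)
    have le: "real i * \<delta> \<le> A" if "i \<le> N" for i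
      unfolding NA[symmetric] using that \<delta> by (intro mult_right_mono) auto
    \<comment> \<open>Subtracting the final value removes the boundary term at the right end and
      makes \<open>F i\<close> small near it.\<close>
    define F where "F i = f (real i * \<delta>) - f A" for i
    define k where "k i = kern (A - real i * \<delta> + \<theta>)" for i
    define x where "x i = A - real i * \<delta>" for i :: nat
    have x0: "x i \<ge> 0" if "i \<le> N" for i using le[OF that] by (simp add: x_def)
    have F: "\<bar>F i\<bar> \<le> H * x i powr (1/4)" if "i \<le> N" for i
      using f[of "real i * \<delta>" A] le[OF that] \<delta> by (simp add: F_def x_def abs_minus_commute)
    have FN: "F N = 0" by (simp add: F_def NA)
    \<comment> \<open>The shift by \<open>\<theta>\<close> in the kernel costs at most the fixed
      factor \<open>exp (\<kappa> * r)\<close>.\<close>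
    have er: "exp (- \<kappa> * (y + \<theta>)) \<le> R * exp (- \<kappa> * y)" for y
      unfolding R_def exp_add[symmetric] using \<theta> \<kappa>_pos by (simp add: algebra_simps) (metis atLeastAtMost_iff minus_le_iff mult_left_mono less_imp_le mult.commute minus_mult_right)
    obtain n where n: "N = Suc n" using N by (cases N) auto
    have kx: "k i = kern (x i + \<theta>)" for i by (simp add: k_def x_def)
    have kb: "\<bar>k i\<bar> \<le> C0 * (R * exp (- \<kappa> * x i))" if "i \<le> N" for i
    proof -
      have "\<bar>k i\<bar> \<le> C0 * exp (- \<kappa> * (x i + \<theta>))"
        unfolding kx using x0[OF that] \<theta> by (intro C0) auto
      also have "\<dots> \<le> C0 * (R * exp (- \<kappa> * x i))" by (intro mult_left_mono er C0)
      finally show ?thesis .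
    qed
    have "(\<Sum>i<N. (f (real (Suc i) * \<delta>) - f (real i * \<delta>)) * dde_semigroup r Lh (A - real i * \<delta>) \<psi> \<theta>)
        = (\<Sum>i<Suc n. k i * (F (Suc i) - F i))"
      unfolding n using \<theta> by (intro sum.cong refl) (simp add: F_def k_def semigroup_kern)
    also have "\<dots> = - k 0 * F 0 - (\<Sum>i<n. F (Suc i) * (k (Suc i) - k i))"
      unfolding sum_by_parts using FN by (simp add: n)
    also have "\<bar>\<dots>\<bar> \<le> \<bar>k 0\<bar> * \<bar>F 0\<bar> + (\<Sum>i<n. \<bar>F (Suc i)\<bar> * \<bar>k (Suc i) - k i\<bar>)"
      by (rule order_trans[OF abs_triangle_ineq4])
         (auto simp: abs_mult intro!: order_trans[OF sum_abs] )
    also have "\<dots> \<le> C0 * R * M * H + (C1 * R * M * (2 / \<kappa>) + 2 * C0 * R * r powr (1/4)) * H"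
    proof (rule add_mono)
      have pe: "x i powr (1/4) \<le> M * exp (\<kappa> / 2 * x i)" if "i \<le> N" for i
        unfolding M_def by (rule root4_exp_bound[OF x0[OF that]])
      have "\<bar>k 0\<bar> * \<bar>F 0\<bar> \<le> C0 * (R * exp (- \<kappa> * x 0)) * (H * (M * exp (\<kappa> / 2 * x 0)))"
        using H C0 R M
        by (intro mult_mono kb order_trans[OF F] mult_left_mono pe) auto
      also have "\<dots> = C0 * R * M * H * exp (- \<kappa> / 2 * x 0)"
        by (simp add: exp_add[symmetric] mult_ac field_simps)
      also have "\<dots> \<le> C0 * R * M * H * 1"
        using x0[of 0] \<kappa>_pos C0 R M H by (intro mult_left_mono) (auto intro!: mult_nonneg_nonneg)
      finally show "\<bar>k 0\<bar> * \<bar>F 0\<bar> \<le> C0 * R * M * H" by simp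
      \<comment> \<open>The cells over which the kernel argument crosses 0. As the argument
        decreases strictly along the grid, there is at most one; in it the distance to the end is at
        most \<open>r\<close>, which bounds \<open>F\<close>.\<close>
      define J where "J = {i. i < n \<and> x (Suc i) + \<theta> < 0 \<and> 0 \<le> x i + \<theta>}"
      have xS: "x i = x (Suc i) + \<delta>" for i by (simp add: x_def algebra_simps)
      have "i = j" if "i \<in> J" "j \<in> J" for i j
      proof -
        have "i < j \<Longrightarrow> False" if "i \<in> J" "j \<in> J" for i j
        proof -
          assume "i < j"
          then have "real (Suc i) * \<delta> \<le> real j * \<delta>" using \<delta> by (intro mult_right_mono) auto
          then have "x j \<le> x (Suc i)" by (simp add: x_def)
          with that show False by (auto simp: J_def)
        qed
        with that show ?thesis by (meson linorder_neqE_nat)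
      qed
      then have cJ: "card J \<le> 1"
        by (auto simp: J_def card_le_Suc0_iff_eq)
      have "(\<Sum>i<n. \<bar>F (Suc i)\<bar> * \<bar>k (Suc i) - k i\<bar>)
          \<le> (\<Sum>i<n. C1 * R * M * H * (exp (- (\<kappa> / 2) * x (Suc i)) * \<delta>) + (if i \<in> J then 2 * C0 * R * r powr (1/4) * H else 0))"
      proof (rule sum_mono)
        fix i assume "i \<in> {..<n}"
        then have i: "i < n" "Suc i \<le> N" "i \<le> N" by (auto simp: n)
        have nn: "C1 * R * M * H * (exp (- (\<kappa> / 2) * x (Suc i)) * \<delta>) \<ge> 0"
          using C1 R M H \<delta> by simp
        show "\<bar>F (Suc i)\<bar> * \<bar>k (Suc i) - k i\<bar> \<le> C1 * R * M * H * (exp (- (\<kappa> / 2) * x (Suc i)) * \<delta>) + (if i \<in> J then 2 * C0 * R * r powr (1/4) * H else 0)"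
        proof (cases "i \<in> J")
          case True
          then have xr: "x (Suc i) \<le> r" using \<theta> by (auto simp: J_def)
          have "\<bar>k (Suc i)\<bar> \<le> C0 * (R * 1)"
            using x0[OF i(2)] C0 R \<kappa>_pos by (intro order_trans[OF kb[OF i(2)]] mult_left_mono) auto
          moreover have "\<bar>k i\<bar> \<le> C0 * (R * 1)"
            using x0[OF i(3)] C0 R \<kappa>_pos by (intro order_trans[OF kb[OF i(3)]] mult_left_mono) auto
          ultimately have "\<bar>k (Suc i) - k i\<bar> \<le> 2 * C0 * R" by linarith
          moreover have "\<bar>F (Suc i)\<bar> \<le> H * r powr (1/4)"
            using xr x0[OF i(2)] H by (intro order_trans[OF F[OF i(2)]] mult_left_mono powr_mono2) auto
          ultimately have "\<bar>F (Suc i)\<bar> * \<bar>k (Suc i) - k i\<bar> \<le> H * r powr (1/4) * (2 * C0 * R)"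
            using H by (intro mult_mono) auto
          with True nn show ?thesis by (simp add: mult_ac)
        next
          case False
          have "\<bar>k i - k (Suc i)\<bar> \<le> C1 * exp (- \<kappa> * (x (Suc i) + \<theta>)) * (x i + \<theta> - (x (Suc i) + \<theta>))"
            unfolding kx using False i \<theta> x0[OF i(2)] \<delta> xS[of i] by (intro C1) (auto simp: J_def)
          also have "\<dots> \<le> C1 * (R * exp (- \<kappa> * x (Suc i))) * \<delta>"
            using xS[of i] \<delta> C1(1) er R by (intro mult_mono mult_left_mono) auto
          finally have "\<bar>F (Suc i)\<bar> * \<bar>k (Suc i) - k i\<bar>
              \<le> (H * (M * exp (\<kappa> / 2 * x (Suc i)))) * (C1 * (R * exp (- \<kappa> * x (Suc i))) * \<delta>)"
            using H M i by (intro mult_mono order_trans[OF F] mult_left_mono pe) (auto simp: abs_minus_commute)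
          also have "\<dots> = C1 * R * M * H * ((exp (\<kappa> / 2 * x (Suc i)) * exp (- \<kappa> * x (Suc i))) * \<delta>)"
            by (simp only: mult_ac)
          also have "exp (\<kappa> / 2 * x (Suc i)) * exp (- \<kappa> * x (Suc i)) = exp (- (\<kappa> / 2) * x (Suc i))"
            unfolding exp_add[symmetric] by (simp add: field_simps)
          finally show ?thesis using False by simp
        qed
      qed
      also have "\<dots> = C1 * R * M * H * (\<Sum>i<n. exp (- (\<kappa> / 2) * x (Suc i)) * \<delta>) + real (card J) * (2 * C0 * R * r powr (1/4) * H)"
      proof -
        have "{..<n} \<inter> J = J" by (auto simp: J_def)
        then have "(\<Sum>i<n. if i \<in> J then 2 * C0 * R * r powr (1/4) * H else 0) = real (card J) * (2 * C0 * R * r powr (1/4) * H)"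
          by (subst sum.inter_restrict[symmetric]) auto
        then show ?thesis by (simp only: sum.distrib sum_distrib_left)
      qed
      also have "\<dots> \<le> C1 * R * M * H * (2 / \<kappa>) + 1 * (2 * C0 * R * r powr (1/4) * H)"
      proof (rule add_mono; rule mult_left_mono mult_right_mono)
        have "(\<Sum>i<n. exp (- (\<kappa> / 2) * x (Suc i)) * \<delta>) \<le> (\<Sum>i<N. exp (- (\<kappa> / 2) * x i) * \<delta>)"
          unfolding n sum.lessThan_Suc_shift using \<delta> by simp
        also have "\<dots> \<le> 1 / (\<kappa> / 2)"
          unfolding x_def NA[symmetric] using \<kappa>_pos \<delta> by (intro exp_sum_bound) auto
        finally show "(\<Sum>i<n. exp (- (\<kappa> / 2) * x (Suc i)) * \<delta>) \<le> 2 / \<kappa>" by simp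
      qed (use C0 C1 R M H cJ in auto)
      finally show "(\<Sum>i<n. \<bar>F (Suc i)\<bar> * \<bar>k (Suc i) - k i\<bar>)
          \<le> (C1 * R * M * (2 / \<kappa>) + 2 * C0 * R * r powr (1/4)) * H"
        by (simp add: algebra_simps)
    qed
    also have "\<dots> = C * H" by (simp add: C_def algebra_simps)
    finally show "\<bar>\<Sum>i<N. (f (real (Suc i) * (A / real N)) - f (real i * (A / real N)))
            * dde_semigroup r Lh (A - real i * (A / real N)) \<psi> \<theta>\<bar> \<le> C * H"
      by (simp add: \<delta>_def)
  qed
qed

end

section \<open>Integrals of simple processes\<close>

definition gsum :: "(real \<Rightarrow> 'a \<Rightarrow> real) \<Rightarrow> nat \<Rightarrow> (nat \<Rightarrow> real) \<Rightarrow> (nat \<Rightarrow> 'a \<Rightarrow> real) \<Rightarrow> 'a \<Rightarrow> real" where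
  "gsum W m \<tau> g \<omega> = (\<Sum>i<m. g i \<omega> * (W (\<tau> (Suc i)) \<omega> - W (\<tau> i) \<omega>))"

locale wiener = prob_space M for M :: "'a measure" +
  fixes F :: "real \<Rightarrow> 'a measure" and W :: "real \<Rightarrow> 'a \<Rightarrow> real"
  assumes filt: "filtration (space M) F" and sub: "\<And>t. sets (F t) \<subseteq> sets M"
    and wp: "wiener_process M F W"
begin

lemma space_F: "space (F t) = space M"
  using filt by (simp add: filtration_def)

lemma meas_F_M: "f \<in> measurable (F t) N \<Longrightarrow> f \<in> measurable M N"
  using sub[of t] by (auto simp: measurable_def space_F)

lemma meas_F_mono: "s \<le> t \<Longrightarrow> f \<in> measurable (F s) N \<Longrightarrow> f \<in> measurable (F t) N"
proof -
  assume "s \<le> t"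
  then have "sets (F s) \<subseteq> sets (F t)" using filt by (auto simp: filtration_def)
  then show "f \<in> measurable (F s) N \<Longrightarrow> f \<in> measurable (F t) N"
    by (auto simp: measurable_def space_F)
qed

lemma meas_W: "t \<ge> 0 \<Longrightarrow> W t \<in> borel_measurable (F t)"
  using wp by (auto simp: wiener_process_def)

lemma meas_W_M: "t \<ge> 0 \<Longrightarrow> W t \<in> borel_measurable M"
  by (rule meas_F_M[OF meas_W])

text \<open>Equal times are split off because the normal law is postulated for \<open>s < t\<close>
  only; there the increment is 0 and the moment formula relies on \<open>0 ^ 0 = 1\<close>.\<close>

lemma increment_moments:
  assumes "0 \<le> s" "s \<le> t"
  shows "integrable M (\<lambda>\<omega>. (W t \<omega> - W s \<omega>) ^ k)"
    "expectation (\<lambda>\<omega>. (W t \<omega> - W s \<omega>) ^ (2 * j)) = fact (2 * j) / (2 ^ j * fact j) * (t - s) ^ j"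
    "expectation (\<lambda>\<omega>. (W t \<omega> - W s \<omega>) ^ (2 * j + 1)) = 0"
proof -
  have "integrable M (\<lambda>\<omega>. (W t \<omega> - W s \<omega>) ^ k) \<and>
    expectation (\<lambda>\<omega>. (W t \<omega> - W s \<omega>) ^ (2 * j)) = fact (2 * j) / (2 ^ j * fact j) * (t - s) ^ j \<and>
    expectation (\<lambda>\<omega>. (W t \<omega> - W s \<omega>) ^ (2 * j + 1)) = 0"
  proof (cases "s = t")
    case True
    then show ?thesis by (auto simp: prob_space power_0_left)
  next
    case False
    let ?\<sigma> = "sqrt (t - s)"
    have \<sigma>: "?\<sigma> > 0" and st: "s < t" using False assms by auto
    have d: "distributed M lborel (\<lambda>\<omega>. W t \<omega> - W s \<omega>) (normal_density 0 ?\<sigma>)"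
      using wp assms st by (auto simp: wiener_process_def)
    have "integrable M (\<lambda>\<omega>. (W t \<omega> - W s \<omega>) ^ k)"
      using integrable_normal_moment[OF \<sigma>, of 0 k]
      by (subst distributed_integrable[OF d, symmetric]) auto
    moreover have "expectation (\<lambda>\<omega>. (W t \<omega> - W s \<omega>) ^ (2 * j)) = fact (2 * j) / ((2 / ?\<sigma>\<^sup>2) ^ j * fact j)"
      using integral_normal_moment_even[OF \<sigma>, of 0 j]
      by (subst distributed_integral[OF d, symmetric]) auto
    moreover have "expectation (\<lambda>\<omega>. (W t \<omega> - W s \<omega>) ^ (2 * j + 1)) = 0"
      using integral_normal_moment_odd[OF \<sigma>, of 0 j]
      by (subst distributed_integral[OF d, symmetric]) auto
    ultimately show ?thesis using st by (simp add: power_divide)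
  qed
  then show "integrable M (\<lambda>\<omega>. (W t \<omega> - W s \<omega>) ^ k)"
    "expectation (\<lambda>\<omega>. (W t \<omega> - W s \<omega>) ^ (2 * j)) = fact (2 * j) / (2 ^ j * fact j) * (t - s) ^ j"
    "expectation (\<lambda>\<omega>. (W t \<omega> - W s \<omega>) ^ (2 * j + 1)) = 0" by auto
qed

lemma increment_indep:
  assumes s: "0 \<le> s" "s < t" and Y: "Y \<in> borel_measurable (F s)"
  shows "indep_var borel Y borel (\<lambda>\<omega>. W t \<omega> - W s \<omega>)"
  unfolding indep_var_eq
proof (intro conjI)
  let ?D = "\<lambda>\<omega>. W t \<omega> - W s \<omega>"
  show "random_variable borel Y" by (rule meas_F_M[OF Y])
  show D: "random_variable borel ?D" using meas_W_M[of s] meas_W_M[of t] s by simp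
  have i: "indep_set (sets (F s)) (sets (vimage_algebra (space M) ?D borel))"
    using wp s by (auto simp: wiener_process_def)
  have 1: "sigma_sets (space M) {Y -` A \<inter> space M |A. A \<in> sets borel} \<subseteq> sets (F s)"
  proof -
    have "{Y -` A \<inter> space M |A. A \<in> sets borel} \<subseteq> sets (F s)"
      using Y by (auto simp: measurable_def space_F)
    then show ?thesis
      using sets.sigma_sets_subset[of _ "F s"] by (simp add: space_F)
  qed
  have 2: "sigma_sets (space M) {?D -` A \<inter> space M |A. A \<in> sets borel} \<subseteq> sets (vimage_algebra (space M) ?D borel)"
    by (simp add: sets_vimage_algebra)
  show "indep_set (sigma_sets (space M) {Y -` A \<inter> space M |A. A \<in> sets borel})
     (sigma_sets (space M) {?D -` A \<inter> space M |A. A \<in> sets borel})"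
    using i unfolding indep_set_def
    by (rule indep_sets_mono_sets) (use 1 2 in \<open>auto split: bool.split\<close>)
qed

text \<open>\<open>Y\<close> may depend on everything up to time \<open>s\<close>. All later moment
  computations use independence of the increments through this factorisation.\<close>

lemma increment_mult:
  assumes s: "0 \<le> s" "s \<le> t" and Y: "Y \<in> borel_measurable (F s)" "integrable M Y"
  shows "integrable M (\<lambda>\<omega>. Y \<omega> * (W t \<omega> - W s \<omega>) ^ k)"
    "expectation (\<lambda>\<omega>. Y \<omega> * (W t \<omega> - W s \<omega>) ^ k) = expectation Y * expectation (\<lambda>\<omega>. (W t \<omega> - W s \<omega>) ^ k)"
proof -
  have "integrable M (\<lambda>\<omega>. Y \<omega> * (W t \<omega> - W s \<omega>) ^ k) \<and>
    expectation (\<lambda>\<omega>. Y \<omega> * (W t \<omega> - W s \<omega>) ^ k) = expectation Y * expectation (\<lambda>\<omega>. (W t \<omega> - W s \<omega>) ^ k)"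
  proof (cases "s = t")
    case True
    then show ?thesis using Y by (cases k) (auto simp: prob_space)
  next
    case False
    have "indep_var borel (id \<circ> Y) borel ((\<lambda>x. x ^ k) \<circ> (\<lambda>\<omega>. W t \<omega> - W s \<omega>))"
      by (rule indep_var_compose[OF increment_indep]) (use s Y False in auto)
    then have i: "indep_var borel Y borel (\<lambda>\<omega>. (W t \<omega> - W s \<omega>) ^ k)" by (simp add: comp_def)
    show ?thesis
      using indep_var_lebesgue_integral[OF i Y(2) increment_moments(1)[OF s]]
        indep_var_integrable[OF i Y(2) increment_moments(1)[OF s]] by simp
  qed
  then show "integrable M (\<lambda>\<omega>. Y \<omega> * (W t \<omega> - W s \<omega>) ^ k)"
    "expectation (\<lambda>\<omega>. Y \<omega> * (W t \<omega> - W s \<omega>) ^ k) = expectation Y * expectation (\<lambda>\<omega>. (W t \<omega> - W s \<omega>) ^ k)" by auto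
qed

lemma integrable_mult_bounded:
  fixes X Y :: "'a \<Rightarrow> real"
  assumes "integrable M X" "Y \<in> borel_measurable M" "\<And>\<omega>. \<omega> \<in> space M \<Longrightarrow> \<bar>Y \<omega>\<bar> \<le> b"
  shows "integrable M (\<lambda>\<omega>. X \<omega> * Y \<omega>)"
proof (rule Bochner_Integration.integrable_bound)
  show "integrable M (\<lambda>\<omega>. b * X \<omega>)" using assms by simp
  have "\<bar>X \<omega> * Y \<omega>\<bar> \<le> \<bar>b * X \<omega>\<bar>" if "\<omega> \<in> space M" for \<omega>
  proof -
    have "\<bar>X \<omega>\<bar> * \<bar>Y \<omega>\<bar> \<le> \<bar>X \<omega>\<bar> * \<bar>b\<bar>"
      using assms(3)[OF that] by (intro mult_left_mono) auto
    then show ?thesis by (simp add: abs_mult mult.commute)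
  qed
  then show "AE \<omega> in M. norm (X \<omega> * Y \<omega>) \<le> norm (b * X \<omega>)" by (intro AE_I2) simp
qed (use assms in measurable)

lemma gsum_Suc: "gsum W (Suc j) \<tau> g \<omega> = gsum W j \<tau> g \<omega> + g j \<omega> * (W (\<tau> (Suc j)) \<omega> - W (\<tau> j) \<omega>)"
  by (simp add: gsum_def)

lemma data_bound:
  assumes "simple_proc_data M F m \<tau> g"
  obtains b where "\<And>i \<omega>. i < m \<Longrightarrow> \<omega> \<in> space M \<Longrightarrow> \<bar>g i \<omega>\<bar> \<le> b"
  using assms unfolding simple_proc_data_def by blast

lemma data_mono:
  assumes "simple_proc_data M F m \<tau> g" "i \<le> j" "j \<le> m"
  shows "\<tau> i \<le> \<tau> j"
  using assms(2,3)
proof (induction j)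
  case (Suc j)
  have "\<tau> j \<le> \<tau> (Suc j)" using assms(1) Suc by (auto simp: simple_proc_data_def)
  with Suc show ?case by (cases "i = Suc j") auto
qed simp

lemma data_nonneg: "simple_proc_data M F m \<tau> g \<Longrightarrow> i \<le> m \<Longrightarrow> 0 \<le> \<tau> i"
  using data_mono[of m \<tau> g 0 i] by (auto simp: simple_proc_data_def)

text \<open>Expand the next sum binomially: the products of the old sum and the new coefficient are
  measurable at the left end of the cell, so the powers of the Wiener increment split off.
  Integrability of all powers has to be carried through the same induction.\<close>

lemma gsum_moments:
  assumes d: "simple_proc_data M F m \<tau> g" and j: "j \<le> m"
  shows "gsum W j \<tau> g \<in> borel_measurable (F (\<tau> j))" "integrable M (\<lambda>\<omega>. gsum W j \<tau> g \<omega> ^ k)"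
    "j < m \<Longrightarrow> expectation (\<lambda>\<omega>. gsum W (Suc j) \<tau> g \<omega> ^ k) =
      (\<Sum>l\<le>k. of_nat (k choose l) * (expectation (\<lambda>\<omega>. gsum W j \<tau> g \<omega> ^ (k - l) * g j \<omega> ^ l)
        * expectation (\<lambda>\<omega>. (W (\<tau> (Suc j)) \<omega> - W (\<tau> j) \<omega>) ^ l)))"
proof -
  obtain b where b: "\<And>i \<omega>. i < m \<Longrightarrow> \<omega> \<in> space M \<Longrightarrow> \<bar>g i \<omega>\<bar> \<le> b"
    using data_bound[OF d] by blast
  have gF: "g i \<in> borel_measurable (F (\<tau> i))" if "i < m" for i using d that by (auto simp: simple_proc_data_def)
  have step: "integrable M (\<lambda>\<omega>. gsum W (Suc j) \<tau> g \<omega> ^ k) \<and> expectation (\<lambda>\<omega>. gsum W (Suc j) \<tau> g \<omega> ^ k) =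
      (\<Sum>l\<le>k. of_nat (k choose l) * (expectation (\<lambda>\<omega>. gsum W j \<tau> g \<omega> ^ (k - l) * g j \<omega> ^ l)
        * expectation (\<lambda>\<omega>. (W (\<tau> (Suc j)) \<omega> - W (\<tau> j) \<omega>) ^ l)))"
    if j: "j < m" and m: "gsum W j \<tau> g \<in> borel_measurable (F (\<tau> j))" and i: "\<And>k. integrable M (\<lambda>\<omega>. gsum W j \<tau> g \<omega> ^ k)" for j k
  proof -
    let ?S = "gsum W j \<tau> g" and ?D = "\<lambda>\<omega>. W (\<tau> (Suc j)) \<omega> - W (\<tau> j) \<omega>"
    have t: "0 \<le> \<tau> j" "\<tau> j \<le> \<tau> (Suc j)" using data_nonneg[OF d] data_mono[OF d] j by auto
    have e: "gsum W (Suc j) \<tau> g \<omega> ^ k = (\<Sum>l\<le>k. of_nat (k choose l) * ((?S \<omega> ^ (k - l) * g j \<omega> ^ l) * ?D \<omega> ^ l))" for \<omega>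
      unfolding gsum_Suc by (subst add.commute, subst binomial_ring) (simp add: power_mult_distrib mult_ac)
    have Y: "integrable M (\<lambda>\<omega>. ?S \<omega> ^ (k - l) * g j \<omega> ^ l)" for l
      by (rule integrable_mult_bounded[OF i, where b="b ^ l"])
         (use meas_F_M[OF gF[OF j]] b[OF j] in \<open>auto simp: power_abs intro!: power_mono\<close>)
    have YF: "(\<lambda>\<omega>. ?S \<omega> ^ (k - l) * g j \<omega> ^ l) \<in> borel_measurable (F (\<tau> j))" for l
      using m gF[OF j] by measurable
    note im = increment_mult[OF t YF Y]
    show ?thesis unfolding e using im by (simp add: Bochner_Integration.integral_sum)
  qed
  have "gsum W j \<tau> g \<in> borel_measurable (F (\<tau> j)) \<and> (\<forall>k. integrable M (\<lambda>\<omega>. gsum W j \<tau> g \<omega> ^ k))"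
    using j
  proof (induction j)
    case 0
    then show ?case by (simp add: gsum_def power_0_left)
  next
    case (Suc j)
    then have t: "0 \<le> \<tau> j" "\<tau> j \<le> \<tau> (Suc j)" using data_nonneg[OF d] data_mono[OF d] by auto
    have "(\<lambda>\<omega>. gsum W j \<tau> g \<omega> + g j \<omega> * (W (\<tau> (Suc j)) \<omega> - W (\<tau> j) \<omega>)) \<in> borel_measurable (F (\<tau> (Suc j)))"
      using Suc t meas_F_mono[OF t(2)] gF[of j] meas_W[of "\<tau> j"] meas_W[of "\<tau> (Suc j)"]
      by (intro borel_measurable_add borel_measurable_times borel_measurable_diff) auto
    then show ?case using Suc step[of j] by (auto simp: gsum_Suc[abs_def])
  qed
  then show "gsum W j \<tau> g \<in> borel_measurable (F (\<tau> j))" "integrable M (\<lambda>\<omega>. gsum W j \<tau> g \<omega> ^ k)" by auto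
  with step[of j] j show "j < m \<Longrightarrow> expectation (\<lambda>\<omega>. gsum W (Suc j) \<tau> g \<omega> ^ k) =
      (\<Sum>l\<le>k. of_nat (k choose l) * (expectation (\<lambda>\<omega>. gsum W j \<tau> g \<omega> ^ (k - l) * g j \<omega> ^ l)
        * expectation (\<lambda>\<omega>. (W (\<tau> (Suc j)) \<omega> - W (\<tau> j) \<omega>) ^ l)))"
    using \<open>gsum W j \<tau> g \<in> borel_measurable (F (\<tau> j)) \<and> (\<forall>k. integrable M (\<lambda>\<omega>. gsum W j \<tau> g \<omega> ^ k))\<close> by blast
qed

lemma data_integrable_square:
  assumes d: "simple_proc_data M F m \<tau> g" and i: "i < m"
  shows "integrable M (\<lambda>\<omega>. (g i \<omega>)\<^sup>2)"
proof -
  obtain b where b: "\<And>i \<omega>. i < m \<Longrightarrow> \<omega> \<in> space M \<Longrightarrow> \<bar>g i \<omega>\<bar> \<le> b"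
    using data_bound[OF d] by blast
  have [measurable]: "g i \<in> borel_measurable M"
    using d i meas_F_M[of "g i" "\<tau> i" borel] by (auto simp: simple_proc_data_def)
  have "\<bar>(g i \<omega>)\<^sup>2\<bar> \<le> b\<^sup>2" if "\<omega> \<in> space M" for \<omega>
    using power_mono[OF b[OF i that], of 2] by simp
  then have "integrable M (\<lambda>\<omega>. (1::real) * (g i \<omega>)\<^sup>2)"
    by (intro integrable_mult_bounded[where b="b\<^sup>2"]) auto
  then show ?thesis by simp
qed

text \<open>The Ito isometry: of the binomial expansion with exponent 2, the mixed term has mean
  0.\<close>

lemma gsum_second_moment:
  assumes d: "simple_proc_data M F m \<tau> g" and j: "j \<le> m"
  shows "expectation (\<lambda>\<omega>. (gsum W j \<tau> g \<omega>)\<^sup>2) = (\<Sum>i<j. expectation (\<lambda>\<omega>. (g i \<omega>)\<^sup>2) * (\<tau> (Suc i) - \<tau> i))"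
  using j
proof (induction j)
  case 0 then show ?case by (simp add: gsum_def)
next
  case (Suc j)
  then have t: "0 \<le> \<tau> j" "\<tau> j \<le> \<tau> (Suc j)" using data_nonneg[OF d] data_mono[OF d] by auto
  have e: "{..2::nat} = {0, 1, 2}" by auto
  have E1: "expectation (\<lambda>\<omega>. W (\<tau> (Suc j)) \<omega> - W (\<tau> j) \<omega>) = 0"
    using increment_moments(3)[OF t, of 0] by simp
  have E2: "expectation (\<lambda>\<omega>. (W (\<tau> (Suc j)) \<omega> - W (\<tau> j) \<omega>)\<^sup>2) = \<tau> (Suc j) - \<tau> j"
    using increment_moments(2)[OF t, of 1] by simp
  have "expectation (\<lambda>\<omega>. (gsum W (Suc j) \<tau> g \<omega>)\<^sup>2) = expectation (\<lambda>\<omega>. (gsum W j \<tau> g \<omega>)\<^sup>2) + expectation (\<lambda>\<omega>. (g j \<omega>)\<^sup>2) * (\<tau> (Suc j) - \<tau> j)"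
    using gsum_moments(3)[OF d, of j 2] Suc.prems by (simp add: e E1 E2 prob_space)
  with Suc show ?case by simp
qed

text \<open>Switch the coefficients off before the accumulated quadratic variation exceeds
  \<open>\<rho>\<close>. The truncated sum has second moment at most \<open>\<rho>\<close> and obeys
  Chebyshev's inequality; it differs from the original one only where the quadratic variation is
  large. No moment of the coefficients appears in the bound.\<close>

lemma gsum_tail:
  assumes d: "simple_proc_data M F m \<tau> g" and \<rho>: "\<rho> \<ge> 0" and \<delta>: "\<delta> > 0"
  shows "prob {\<omega>\<in>space M. \<bar>gsum W m \<tau> g \<omega>\<bar> > \<delta>} \<le>
    prob {\<omega>\<in>space M. (\<Sum>i<m. (g i \<omega>)\<^sup>2 * (\<tau> (Suc i) - \<tau> i)) > \<rho>} + \<rho> / \<delta>\<^sup>2"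
proof -
  define A where "A j \<omega> = (\<Sum>i<j. (g i \<omega>)\<^sup>2 * (\<tau> (Suc i) - \<tau> i))" for j \<omega>
  \<comment> \<open>The test uses \<open>A (Suc i)\<close>, which includes the current cell. It is
    nevertheless known at the left end of that cell, because the times are deterministic and
    \<open>g i\<close> is known there.\<close>
  define g' where "g' i \<omega> = (if A (Suc i) \<omega> \<le> \<rho> then g i \<omega> else 0)" for i \<omega>
  have dm: "\<tau> i \<le> \<tau> (Suc i)" if "i < m" for i using data_mono[OF d] that by simp
  have gF: "g i \<in> borel_measurable (F (\<tau> i))" if "i < m" for i using d that by (auto simp: simple_proc_data_def)
  have AF: "A (Suc j) \<in> borel_measurable (F (\<tau> j))" if "j < m" for j
    unfolding A_def
    by (intro borel_measurable_sum borel_measurable_times borel_measurable_power borel_measurable_const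
        meas_F_mono[OF data_mono[OF d] gF]) (use that in auto)
  have Amono: "A i \<omega> \<le> A j \<omega>" if "i \<le> j" "j \<le> m" for i j \<omega>
    unfolding A_def using that dm by (intro sum_mono2) auto
  have d': "simple_proc_data M F m \<tau> g'"
    unfolding simple_proc_data_def
  proof (intro conjI allI impI)
    show "0 \<le> \<tau> 0" using d by (simp add: simple_proc_data_def)
    show "\<tau> i \<le> \<tau> (Suc i)" if "i < m" for i by (rule dm[OF that])
    show "g' i \<in> borel_measurable (F (\<tau> i))" if "i < m" for i
    proof -
      have [measurable]: "g i \<in> borel_measurable (F (\<tau> i))" "A (Suc i) \<in> borel_measurable (F (\<tau> i))"
        using gF AF that by auto
      show ?thesis unfolding g'_def by measurable
    qed
    obtain b where "\<forall>i<m. \<forall>\<omega>\<in>space M. \<bar>g i \<omega>\<bar> \<le> b" using d by (auto simp: simple_proc_data_def)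
    then have "\<forall>i<m. \<forall>\<omega>\<in>space M. \<bar>g' i \<omega>\<bar> \<le> max b 0" by (auto simp: g'_def le_max_iff_disj)
    then show "\<exists>B. \<forall>i<m. \<forall>\<omega>\<in>space M. \<bar>g' i \<omega>\<bar> \<le> B" by blast
  qed
  have eq: "gsum W m \<tau> g' \<omega> = gsum W m \<tau> g \<omega>" if "A m \<omega> \<le> \<rho>" for \<omega>
    unfolding gsum_def
  proof (rule sum.cong)
    fix i assume "i \<in> {..<m}"
    then have "A (Suc i) \<omega> \<le> \<rho>" using Amono[of "Suc i" m \<omega>] that by simp
    then show "g' i \<omega> * (W (\<tau> (Suc i)) \<omega> - W (\<tau> i) \<omega>) = g i \<omega> * (W (\<tau> (Suc i)) \<omega> - W (\<tau> i) \<omega>)" by (simp add: g'_def)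
  qed simp
  \<comment> \<open>The bound by \<open>A j\<close> is carried along since a further term is added
    only while \<open>A (Suc j)\<close> is still at most \<open>\<rho>\<close>.\<close>
  have A'b: "(\<Sum>i<j. (g' i \<omega>)\<^sup>2 * (\<tau> (Suc i) - \<tau> i)) \<le> min \<rho> (A j \<omega>)" if "j \<le> m" for j \<omega>
    using that
  proof (induction j)
    case 0 then show ?case using \<rho> by (simp add: A_def)
  next
    case (Suc j)
    have AS: "A (Suc j) \<omega> = A j \<omega> + (g j \<omega>)\<^sup>2 * (\<tau> (Suc j) - \<tau> j)" by (simp add: A_def)
    have nn: "0 \<le> (g j \<omega>)\<^sup>2 * (\<tau> (Suc j) - \<tau> j)" using dm[of j] Suc.prems by simp
    show ?case using Suc AS nn by (auto simp: g'_def)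
  qed
  have gm: "gsum W m \<tau> g' \<in> borel_measurable M" "gsum W m \<tau> g \<in> borel_measurable M"
    using gsum_moments(1)[OF d', of m] gsum_moments(1)[OF d, of m] meas_F_M by auto
  have Am: "A m \<in> borel_measurable M"
    unfolding A_def
    by (intro borel_measurable_sum borel_measurable_times borel_measurable_power borel_measurable_const
        meas_F_M[OF gF]) auto
  have "expectation (\<lambda>\<omega>. (gsum W m \<tau> g' \<omega>)\<^sup>2) = (\<Sum>i<m. expectation (\<lambda>\<omega>. (g' i \<omega>)\<^sup>2) * (\<tau> (Suc i) - \<tau> i))"
    by (rule gsum_second_moment[OF d']) simp
  also have "\<dots> = expectation (\<lambda>\<omega>. \<Sum>i<m. (g' i \<omega>)\<^sup>2 * (\<tau> (Suc i) - \<tau> i))"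
    by (subst Bochner_Integration.integral_sum) (auto intro!: integrable_mult_left data_integrable_square[OF d'])
  also have "\<dots> \<le> expectation (\<lambda>\<omega>. \<rho>)"
    by (intro integral_mono Bochner_Integration.integrable_sum integrable_mult_left data_integrable_square[OF d'])
       (use A'b[of m] in auto)
  finally have E: "expectation (\<lambda>\<omega>. (gsum W m \<tau> g' \<omega>)\<^sup>2) \<le> \<rho>" by (simp add: prob_space)
  have "prob {\<omega>\<in>space M. \<bar>gsum W m \<tau> g' \<omega>\<bar> > \<delta>} \<le> prob {\<omega>\<in>space M. (gsum W m \<tau> g' \<omega>)\<^sup>2 \<ge> \<delta>\<^sup>2}"
    by (rule finite_measure_mono) (use gm \<delta> in \<open>auto simp: abs_le_square_iff[symmetric]\<close>)
  also have "\<dots> \<le> expectation (\<lambda>\<omega>. (gsum W m \<tau> g' \<omega>)\<^sup>2) / \<delta>\<^sup>2"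
    by (rule integral_Markov_inequality_measure[where A="space M" and u="\<lambda>\<omega>. (gsum W m \<tau> g' \<omega>)\<^sup>2", simplified])
       (use gsum_moments(2)[OF d', of m 2] \<delta> in auto)
  also have "\<dots> \<le> \<rho> / \<delta>\<^sup>2" using E \<delta> by (intro divide_right_mono) auto
  finally have 1: "prob {\<omega>\<in>space M. \<bar>gsum W m \<tau> g' \<omega>\<bar> > \<delta>} \<le> \<rho> / \<delta>\<^sup>2" .
  have "prob {\<omega>\<in>space M. \<bar>gsum W m \<tau> g \<omega>\<bar> > \<delta>} \<le> prob ({\<omega>\<in>space M. A m \<omega> > \<rho>} \<union> {\<omega>\<in>space M. \<bar>gsum W m \<tau> g' \<omega>\<bar> > \<delta>})"
  proof (rule finite_measure_mono)
    show "{\<omega>\<in>space M. \<bar>gsum W m \<tau> g \<omega>\<bar> > \<delta>} \<subseteq> {\<omega>\<in>space M. A m \<omega> > \<rho>} \<union> {\<omega>\<in>space M. \<bar>gsum W m \<tau> g' \<omega>\<bar> > \<delta>}"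
    proof
      fix \<omega> assume "\<omega> \<in> {\<omega>\<in>space M. \<bar>gsum W m \<tau> g \<omega>\<bar> > \<delta>}"
      then show "\<omega> \<in> {\<omega>\<in>space M. A m \<omega> > \<rho>} \<union> {\<omega>\<in>space M. \<bar>gsum W m \<tau> g' \<omega>\<bar> > \<delta>}"
        using eq[of \<omega>] by (cases "A m \<omega> \<le> \<rho>") auto
    qed
  qed (use gm Am in auto)
  also have "\<dots> \<le> prob {\<omega>\<in>space M. A m \<omega> > \<rho>} + prob {\<omega>\<in>space M. \<bar>gsum W m \<tau> g' \<omega>\<bar> > \<delta>}"
    by (rule measure_Un_le) (use gm Am in auto)
  finally show ?thesis using 1 by (simp add: A_def)
qed

end

text \<open>Sampled at the right end of each cell, the half-open indicator selects exactly the cells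
  inside the interval, so the sum telescopes.\<close>

lemma sum_telescope_slice:
  fixes w :: "real \<Rightarrow> real" and s :: "real list"
  assumes s: "sorted_wrt (<) s" and a: "a \<in> set s" and b: "b \<in> set s" and ab: "a \<le> b"
  shows "(\<Sum>j<length s - 1. indicator {a<..b} (s ! Suc j) * (w (s ! Suc j) - w (s ! j))) = w b - w a"
proof -
  obtain i where i: "i < length s" "s ! i = a" using a by (auto simp: in_set_conv_nth)
  obtain k where k: "k < length s" "s ! k = b" using b by (auto simp: in_set_conv_nth)
  have less: "s ! x < s ! y \<longleftrightarrow> x < y" if "x < length s" "y < length s" for x y
    using s that by (metis linorder_neqE_nat not_less_iff_gr_or_eq sorted_wrt_iff_nth_less)
  have ik: "i \<le> k" using less[OF k(1) i(1)] ab i k by (simp add: not_less[symmetric])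
  have "(\<Sum>j<length s - 1. indicator {a<..b} (s ! Suc j) * (w (s ! Suc j) - w (s ! j)))
      = (\<Sum>j\<in>{i..<k}. w (s ! Suc j) - w (s ! j))"
  proof (rule sum.mono_neutral_cong_right)
    show "{i..<k} \<subseteq> {..<length s - 1}" using k by auto
    have iff: "s ! Suc j \<in> {a<..b} \<longleftrightarrow> j \<in> {i..<k}" if "j < length s - 1" for j
    proof -
      have j: "Suc j < length s" using that by simp
      show ?thesis
        using less[OF i(1) j] less[OF k(1) j] i k by (auto simp: less_Suc_eq_le not_less[symmetric] Suc_le_eq)
    qed
    show "\<forall>j\<in>{..<length s - 1} - {i..<k}. indicator {a<..b} (s ! Suc j) * (w (s ! Suc j) - w (s ! j)) = 0"
      using iff by (auto simp: indicator_def)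
    show "indicator {a<..b} (s ! Suc j) * (w (s ! Suc j) - w (s ! j)) = w (s ! Suc j) - w (s ! j)" if "j \<in> {i..<k}" for j
      using iff[of j] that k by auto
  qed simp
  also have "\<dots> = w (s ! k) - w (s ! i)" using sum_Suc_diff'[OF ik, of "\<lambda>j. w (s ! j)"] by simp
  finally show ?thesis using i k by simp
qed

section \<open>Refinement, sums and stopping of simple processes\<close>

context wiener begin

text \<open>The integrator \<open>w\<close> is arbitrary on purpose: with the Wiener path it refines
  the integral, and with a step function it refines the value of the process itself.\<close>

lemma refine_sum:
  fixes w :: "real \<Rightarrow> real"
  assumes d: "simple_proc_data M F m \<tau> \<eta>" and s: "sorted_wrt (<) s" and t: "\<tau> ` {..m} \<subseteq> set s"
  shows "(\<Sum>i<m. \<eta> i \<omega> * (w (\<tau> (Suc i)) - w (\<tau> i))) =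
    (\<Sum>j<length s - 1. simple_proc m \<tau> \<eta> (s ! Suc j) \<omega> * (w (s ! Suc j) - w (s ! j)))"
proof -
  have "(\<Sum>i<m. \<eta> i \<omega> * (w (\<tau> (Suc i)) - w (\<tau> i)))
    = (\<Sum>i<m. \<eta> i \<omega> * (\<Sum>j<length s - 1. indicator {\<tau> i<..\<tau> (Suc i)} (s ! Suc j) * (w (s ! Suc j) - w (s ! j))))"
  proof (rule sum.cong)
    fix i assume i: "i \<in> {..<m}"
    have "(\<Sum>j<length s - 1. indicator {\<tau> i<..\<tau> (Suc i)} (s ! Suc j) * (w (s ! Suc j) - w (s ! j))) = w (\<tau> (Suc i)) - w (\<tau> i)"
      by (rule sum_telescope_slice[OF s]) (use t i data_mono[OF d, of i "Suc i"] in auto)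
    then show "\<eta> i \<omega> * (w (\<tau> (Suc i)) - w (\<tau> i))
      = \<eta> i \<omega> * (\<Sum>j<length s - 1. indicator {\<tau> i<..\<tau> (Suc i)} (s ! Suc j) * (w (s ! Suc j) - w (s ! j)))" by simp
  qed simp
  also have "\<dots> = (\<Sum>j<length s - 1. \<Sum>i<m. \<eta> i \<omega> * indicator {\<tau> i<..\<tau> (Suc i)} (s ! Suc j) * (w (s ! Suc j) - w (s ! j)))"
    unfolding sum_distrib_left by (subst sum.swap) (simp add: mult.assoc)
  finally show ?thesis unfolding simple_proc_def sum_distrib_right .
qed

text \<open>A half-open indicator is an increment of a step function, so the process value is an
  integral sum for a deterministic integrator. One refinement identity then settles both values and
  integrals.\<close>

lemma simple_proc_alt:
  assumes d: "simple_proc_data M F m \<tau> \<eta>"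
  shows "simple_proc m \<tau> \<eta> u \<omega> = (\<Sum>i<m. \<eta> i \<omega> * (- indicator {..<u} (\<tau> (Suc i)) - - indicator {..<u} (\<tau> i)))"
  unfolding simple_proc_def
proof (rule sum.cong)
  fix i assume "i \<in> {..<m}"
  then have "\<tau> i \<le> \<tau> (Suc i)" using data_mono[OF d] by auto
  then show "\<eta> i \<omega> * indicator {\<tau> i<..\<tau> (Suc i)} u = \<eta> i \<omega> * (- indicator {..<u} (\<tau> (Suc i)) - - indicator {..<u} (\<tau> i))"
    by (auto simp: indicator_def)
qed simp

lemma simple_proc_bound:
  assumes "simple_proc_data M F m \<tau> \<eta>"
  obtains b where "\<And>u \<omega>. \<omega> \<in> space M \<Longrightarrow> \<bar>simple_proc m \<tau> \<eta> u \<omega>\<bar> \<le> b"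
proof -
  obtain b where b: "\<And>i \<omega>. i < m \<Longrightarrow> \<omega> \<in> space M \<Longrightarrow> \<bar>\<eta> i \<omega>\<bar> \<le> b" using data_bound[OF assms] by blast
  show thesis
  proof (rule that)
    fix u \<omega> assume w: "\<omega> \<in> space M"
    have "\<bar>simple_proc m \<tau> \<eta> u \<omega>\<bar> \<le> (\<Sum>i<m. \<bar>b\<bar>)"
      unfolding simple_proc_def
      by (rule order_trans[OF sum_abs], rule sum_mono)
         (use b w in \<open>auto simp: indicator_def intro: order_trans[OF _ abs_ge_self]\<close>)
    then show "\<bar>simple_proc m \<tau> \<eta> u \<omega>\<bar> \<le> (\<Sum>i<m. \<bar>b\<bar>)" .
  qed
qed

text \<open>On the union of both partitions take as coefficient the sum of the two processes at the
  right end of the cell. Both are constant on the cell, so this coefficient is already determined at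
  its left end.\<close>

lemma simple_proc_data_add:
  assumes d1: "simple_proc_data M F m1 \<tau>1 \<eta>1" and d2: "simple_proc_data M F m2 \<tau>2 \<eta>2"
  shows "\<exists>m \<tau> \<eta>. simple_proc_data M F m \<tau> \<eta> \<and>
    (\<forall>u \<omega>. simple_proc m \<tau> \<eta> u \<omega> = simple_proc m1 \<tau>1 \<eta>1 u \<omega> + simple_proc m2 \<tau>2 \<eta>2 u \<omega>) \<and>
    (\<forall>W t \<omega>. simple_integral_wrt W m \<tau> \<eta> t \<omega> = simple_integral_wrt W m1 \<tau>1 \<eta>1 t \<omega> + simple_integral_wrt W m2 \<tau>2 \<eta>2 t \<omega>)"
proof -
  define A where "A = \<tau>1 ` {..m1} \<union> \<tau>2 ` {..m2}"
  define s where "s = sorted_list_of_set A"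
  have fin: "finite A" by (simp add: A_def)
  have ss: "sorted_wrt (<) s" unfolding s_def by (rule strict_sorted_list_of_set)
  have set: "set s = A" using fin by (simp add: s_def)
  have t1: "\<tau>1 ` {..m1} \<subseteq> set s" and t2: "\<tau>2 ` {..m2} \<subseteq> set s" by (auto simp: set A_def)
  have "s \<noteq> []" using set by (auto simp: A_def)
  then have len: "0 < length s" by simp
  define m where "m = length s - 1"
  define \<tau> where "\<tau> j = s ! j" for j
  define \<eta> where "\<eta> j \<omega> = simple_proc m1 \<tau>1 \<eta>1 (s ! Suc j) \<omega> + simple_proc m2 \<tau>2 \<eta>2 (s ! Suc j) \<omega>" for j \<omega>
  \<comment> \<open>No partition point lies strictly inside a cell. Hence a coefficient active at
    the right end started no later than the left end, which gives the required
    measurability.\<close>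
  have gap: "x \<le> s ! j" if "x \<in> set s" "x < s ! Suc j" "Suc j < length s" for x j
  proof -
    obtain i where i: "i < length s" "s ! i = x" using \<open>x \<in> set s\<close> by (auto simp: in_set_conv_nth)
    have "i < Suc j"
    proof (rule ccontr)
      assume "\<not> i < Suc j"
      then have "i = Suc j \<or> Suc j < i" by auto
      then have "s ! Suc j \<le> s ! i" using ss i by (auto simp: sorted_wrt_iff_nth_less less_imp_le)
      with i that show False by simp
    qed
    then have "i = j \<or> i < j" by auto
    then show ?thesis using ss i that by (auto simp: sorted_wrt_iff_nth_less less_imp_le)
  qed
  have meas: "simple_proc m' \<tau>' \<eta>' (s ! Suc j) \<in> borel_measurable (F (s ! j))"
    if d: "simple_proc_data M F m' \<tau>' \<eta>'" and t: "\<tau>' ` {..m'} \<subseteq> set s" and j: "Suc j < length s" for m' \<tau>' \<eta>' j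
    unfolding simple_proc_def[abs_def]
  proof (rule borel_measurable_sum)
    fix i assume i: "i \<in> {..<m'}"
    show "(\<lambda>\<omega>. \<eta>' i \<omega> * indicator {\<tau>' i<..\<tau>' (Suc i)} (s ! Suc j)) \<in> borel_measurable (F (s ! j))"
    proof (cases "\<tau>' i < s ! Suc j")
      case True
      have "\<tau>' i \<le> s ! j" by (rule gap[OF _ True j]) (use t i in auto)
      then have "\<eta>' i \<in> borel_measurable (F (s ! j))"
        using d i by (auto simp: simple_proc_data_def intro: meas_F_mono)
      then show ?thesis by simp
    qed simp
  qed
  have "simple_proc_data M F m \<tau> \<eta>"
    unfolding simple_proc_data_def
  proof (intro conjI allI impI)
    have "s ! 0 \<in> set s" using len by simp
    then show "0 \<le> \<tau> 0" unfolding \<tau>_def set A_def using data_nonneg[OF d1] data_nonneg[OF d2] by auto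
    show "\<tau> i \<le> \<tau> (Suc i)" if "i < m" for i
      using ss that by (auto simp: \<tau>_def m_def sorted_wrt_iff_nth_less less_imp_le)
    show "\<eta> i \<in> borel_measurable (F (\<tau> i))" if "i < m" for i
      unfolding \<eta>_def[abs_def] \<tau>_def using that meas[OF d1 t1, of i] meas[OF d2 t2, of i]
      by (intro borel_measurable_add) (auto simp: m_def)
    obtain b1 where b1: "\<And>u \<omega>. \<omega> \<in> space M \<Longrightarrow> \<bar>simple_proc m1 \<tau>1 \<eta>1 u \<omega>\<bar> \<le> b1" using simple_proc_bound[OF d1] by blast
    obtain b2 where b2: "\<And>u \<omega>. \<omega> \<in> space M \<Longrightarrow> \<bar>simple_proc m2 \<tau>2 \<eta>2 u \<omega>\<bar> \<le> b2" using simple_proc_bound[OF d2] by blast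
    have "\<bar>\<eta> i \<omega>\<bar> \<le> b1 + b2" if "\<omega> \<in> space M" for i \<omega>
      unfolding \<eta>_def using b1[OF that] b2[OF that] by (intro order_trans[OF abs_triangle_ineq] add_mono)
    then show "\<exists>B. \<forall>i<m. \<forall>\<omega>\<in>space M. \<bar>\<eta> i \<omega>\<bar> \<le> B" by blast
  qed
  moreover have R: "(\<Sum>i<m. \<eta> i \<omega> * (w (\<tau> (Suc i)) - w (\<tau> i))) =
      (\<Sum>i<m1. \<eta>1 i \<omega> * (w (\<tau>1 (Suc i)) - w (\<tau>1 i))) + (\<Sum>i<m2. \<eta>2 i \<omega> * (w (\<tau>2 (Suc i)) - w (\<tau>2 i)))" for w :: "real \<Rightarrow> real" and \<omega>
    unfolding refine_sum[OF d1 ss t1] refine_sum[OF d2 ss t2]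
    by (simp add: \<eta>_def \<tau>_def m_def distrib_right sum.distrib)
  moreover have "simple_proc m \<tau> \<eta> u \<omega> = simple_proc m1 \<tau>1 \<eta>1 u \<omega> + simple_proc m2 \<tau>2 \<eta>2 u \<omega>" for u \<omega>
    unfolding simple_proc_alt[OF calculation(1)] simple_proc_alt[OF d1] simple_proc_alt[OF d2] by (rule R)
  moreover have "simple_integral_wrt W m \<tau> \<eta> t \<omega> = simple_integral_wrt W m1 \<tau>1 \<eta>1 t \<omega> + simple_integral_wrt W m2 \<tau>2 \<eta>2 t \<omega>" for W t \<omega>
    unfolding simple_integral_wrt_def by (rule R[of _ "\<lambda>x. W (min t x) \<omega>"])
  ultimately show ?thesis by blast
qed

lemma simple_proc_data_scale:
  assumes d: "simple_proc_data M F m \<tau> \<eta>"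
  shows "simple_proc_data M F m \<tau> (\<lambda>i \<omega>. c * \<eta> i \<omega>)"
    "simple_proc m \<tau> (\<lambda>i \<omega>. c * \<eta> i \<omega>) u \<omega> = c * simple_proc m \<tau> \<eta> u \<omega>"
    "simple_integral_wrt W m \<tau> (\<lambda>i \<omega>. c * \<eta> i \<omega>) t \<omega> = c * simple_integral_wrt W m \<tau> \<eta> t \<omega>"
proof -
  obtain b where b: "\<And>i \<omega>. i < m \<Longrightarrow> \<omega> \<in> space M \<Longrightarrow> \<bar>\<eta> i \<omega>\<bar> \<le> b" using data_bound[OF d] by blast
  then have "\<forall>i<m. \<forall>\<omega>\<in>space M. \<bar>c * \<eta> i \<omega>\<bar> \<le> \<bar>c\<bar> * b" by (auto simp: abs_mult intro!: mult_left_mono)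
  then show "simple_proc_data M F m \<tau> (\<lambda>i \<omega>. c * \<eta> i \<omega>)"
    using d unfolding simple_proc_data_def by auto
qed (simp_all only: simple_proc_def simple_integral_wrt_def sum_distrib_left mult.assoc)

text \<open>Cells starting at or after \<open>a\<close> collapse to empty ones at \<open>a\<close>.
  Their coefficients must be replaced by 0, because they may depend on information later than
  \<open>a\<close>.\<close>

lemma simple_proc_data_stop:
  assumes d: "simple_proc_data M F m \<tau> \<eta>" and a: "a \<ge> 0"
  defines "\<tau>' \<equiv> \<lambda>i. min a (\<tau> i)" and "\<eta>' \<equiv> \<lambda>i \<omega>. if \<tau> i < a then \<eta> i \<omega> else 0"
  shows "simple_proc_data M F m \<tau>' \<eta>'"
    "simple_proc m \<tau>' \<eta>' u \<omega> = indicator {..a} u * simple_proc m \<tau> \<eta> u \<omega>"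
    "a \<le> t \<Longrightarrow> simple_integral_wrt W m \<tau>' \<eta>' t \<omega> = simple_integral_wrt W m \<tau> \<eta> a \<omega>"
    "gsum W m \<tau>' \<eta>' \<omega> = simple_integral_wrt W m \<tau> \<eta> a \<omega>"
proof -
  show "simple_proc_data M F m \<tau>' \<eta>'"
    unfolding simple_proc_data_def
  proof (intro conjI allI impI)
    show "0 \<le> \<tau>' 0" using d a by (auto simp: simple_proc_data_def \<tau>'_def)
    show "\<tau>' i \<le> \<tau>' (Suc i)" if "i < m" for i
      using data_mono[OF d, of i "Suc i"] that by (auto simp: \<tau>'_def)
    show "\<eta>' i \<in> borel_measurable (F (\<tau>' i))" if "i < m" for i
      using d that by (cases "\<tau> i < a") (auto simp: simple_proc_data_def \<tau>'_def \<eta>'_def)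
    obtain b where b: "\<And>i \<omega>. i < m \<Longrightarrow> \<omega> \<in> space M \<Longrightarrow> \<bar>\<eta> i \<omega>\<bar> \<le> b" using data_bound[OF d] by blast
    have "\<forall>i<m. \<forall>\<omega>\<in>space M. \<bar>\<eta>' i \<omega>\<bar> \<le> \<bar>b\<bar>"
      unfolding \<eta>'_def by (auto intro: order_trans[OF b abs_ge_self])
    then show "\<exists>B. \<forall>i<m. \<forall>\<omega>\<in>space M. \<bar>\<eta>' i \<omega>\<bar> \<le> B" by blast
  qed
  show "simple_proc m \<tau>' \<eta>' u \<omega> = indicator {..a} u * simple_proc m \<tau> \<eta> u \<omega>"
    unfolding simple_proc_def sum_distrib_left
    by (rule sum.cong) (auto simp: \<tau>'_def \<eta>'_def indicator_def)
  have mono: "\<tau> i \<le> \<tau> (Suc i)" if "i < m" for i using data_mono[OF d] that by auto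
  show "a \<le> t \<Longrightarrow> simple_integral_wrt W m \<tau>' \<eta>' t \<omega> = simple_integral_wrt W m \<tau> \<eta> a \<omega>"
    unfolding simple_integral_wrt_def
  proof (rule sum.cong)
    fix i assume t: "a \<le> t" and "i \<in> {..<m}"
    then have m: "\<tau> i \<le> \<tau> (Suc i)" using mono by simp
    have e: "min t (min a x) = min a x" for x using t by simp
    show "\<eta>' i \<omega> * (W (min t (\<tau>' (Suc i))) \<omega> - W (min t (\<tau>' i)) \<omega>) = \<eta> i \<omega> * (W (min a (\<tau> (Suc i))) \<omega> - W (min a (\<tau> i)) \<omega>)"
      unfolding \<tau>'_def e using m by (cases "\<tau> i < a") (simp_all add: \<eta>'_def)
  qed simp
  show "gsum W m \<tau>' \<eta>' \<omega> = simple_integral_wrt W m \<tau> \<eta> a \<omega>"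
    unfolding simple_integral_wrt_def gsum_def
  proof (rule sum.cong)
    fix i assume "i \<in> {..<m}"
    then have m: "\<tau> i \<le> \<tau> (Suc i)" using mono by simp
    show "\<eta>' i \<omega> * (W (\<tau>' (Suc i)) \<omega> - W (\<tau>' i) \<omega>) = \<eta> i \<omega> * (W (min a (\<tau> (Suc i))) \<omega> - W (min a (\<tau> i)) \<omega>)"
      unfolding \<tau>'_def using m by (cases "\<tau> i < a") (simp_all add: \<eta>'_def)
  qed simp
qed

text \<open>The cells are disjoint, so the cross terms vanish.\<close>

lemma simple_proc_sq:
  assumes d: "simple_proc_data M F m \<tau> \<eta>" and k: "k \<le> m"
  shows "(simple_proc k \<tau> \<eta> u \<omega>)\<^sup>2 = (\<Sum>i<k. (\<eta> i \<omega>)\<^sup>2 * indicator {\<tau> i<..\<tau> (Suc i)} u)"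
  using k
proof (induction k)
  case (Suc k)
  have "simple_proc k \<tau> \<eta> u \<omega> * (\<eta> k \<omega> * indicator {\<tau> k<..\<tau> (Suc k)} u) = 0"
  proof (cases "u \<in> {\<tau> k<..\<tau> (Suc k)}")
    case True
    have "u \<notin> {\<tau> i<..\<tau> (Suc i)}" if "i < k" for i
      using data_mono[OF d, of "Suc i" k] Suc.prems that True by auto
    then have "simple_proc k \<tau> \<eta> u \<omega> = 0" by (auto simp: simple_proc_def intro!: sum.neutral)
    then show ?thesis by simp
  qed simp
  then have "(simple_proc (Suc k) \<tau> \<eta> u \<omega>)\<^sup>2 = (simple_proc k \<tau> \<eta> u \<omega>)\<^sup>2 + (\<eta> k \<omega> * indicator {\<tau> k<..\<tau> (Suc k)} u)\<^sup>2"
    by (simp add: simple_proc_def power2_sum)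
  then show ?case using Suc by (simp add: power_mult_distrib indicator_def)
qed (simp add: simple_proc_def)

text \<open>The quadratic variation of the integral of \<open>H\<close> up to \<open>t\<close>. It
  takes values in \<open>ennreal\<close>, so that it is meaningful without any integrability of the
  path.\<close>

definition qv :: "real \<Rightarrow> (real \<Rightarrow> 'a \<Rightarrow> real) \<Rightarrow> 'a \<Rightarrow> ennreal" where
  "qv t H \<omega> = (\<integral>\<^sup>+s\<in>{0..t}. ennreal ((H s \<omega>)\<^sup>2) \<partial>lborel)"

lemma qv_simple:
  assumes d: "simple_proc_data M F m \<tau> \<eta>" and t: "\<And>i. i \<le> m \<Longrightarrow> \<tau> i \<le> t"
  shows "qv t (simple_proc m \<tau> \<eta>) \<omega> = ennreal (\<Sum>i<m. (\<eta> i \<omega>)\<^sup>2 * (\<tau> (Suc i) - \<tau> i))"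
proof -
  have m: "\<tau> i \<le> \<tau> (Suc i)" "0 \<le> \<tau> i" "\<tau> (Suc i) \<le> t" if "i < m" for i
    using data_mono[OF d] data_nonneg[OF d] t that by auto
  have "ennreal ((simple_proc m \<tau> \<eta> s \<omega>)\<^sup>2) * indicator {0..t} s
      = (\<Sum>i<m. ennreal ((\<eta> i \<omega>)\<^sup>2) * indicator {\<tau> i<..\<tau> (Suc i)} s)" for s
  proof -
    have "ennreal ((simple_proc m \<tau> \<eta> s \<omega>)\<^sup>2) = (\<Sum>i<m. ennreal ((\<eta> i \<omega>)\<^sup>2 * indicator {\<tau> i<..\<tau> (Suc i)} s))"
      unfolding simple_proc_sq[OF d order_refl] by (subst sum_ennreal) auto
    then have "ennreal ((simple_proc m \<tau> \<eta> s \<omega>)\<^sup>2) * indicator {0..t} s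
      = (\<Sum>i<m. ennreal ((\<eta> i \<omega>)\<^sup>2 * indicator {\<tau> i<..\<tau> (Suc i)} s) * indicator {0..t} s)"
      by (simp only: sum_distrib_right)
    also have "\<dots> = (\<Sum>i<m. ennreal ((\<eta> i \<omega>)\<^sup>2) * indicator {\<tau> i<..\<tau> (Suc i)} s)"
    proof (rule sum.cong)
      fix i assume "i \<in> {..<m}"
      then show "ennreal ((\<eta> i \<omega>)\<^sup>2 * indicator {\<tau> i<..\<tau> (Suc i)} s) * indicator {0..t} s = ennreal ((\<eta> i \<omega>)\<^sup>2) * indicator {\<tau> i<..\<tau> (Suc i)} s"
        using m[of i] by (auto simp: indicator_def)
    qed simp
    finally show ?thesis .
  qed
  then have "qv t (simple_proc m \<tau> \<eta>) \<omega> = (\<integral>\<^sup>+s. (\<Sum>i<m. ennreal ((\<eta> i \<omega>)\<^sup>2) * indicator {\<tau> i<..\<tau> (Suc i)} s) \<partial>lborel)"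
    unfolding qv_def by (intro nn_integral_cong)
  also have "\<dots> = (\<Sum>i<m. (\<integral>\<^sup>+s. ennreal ((\<eta> i \<omega>)\<^sup>2) * indicator {\<tau> i<..\<tau> (Suc i)} s \<partial>lborel))"
    by (rule nn_integral_sum) simp
  also have "\<dots> = (\<Sum>i<m. ennreal ((\<eta> i \<omega>)\<^sup>2) * emeasure lborel {\<tau> i<..\<tau> (Suc i)})"
    by (intro sum.cong refl nn_integral_cmult_indicator) simp
  also have "\<dots> = (\<Sum>i<m. ennreal ((\<eta> i \<omega>)\<^sup>2 * (\<tau> (Suc i) - \<tau> i)))"
    using m by (intro sum.cong) (auto simp: ennreal_mult)
  also have "\<dots> = ennreal (\<Sum>i<m. (\<eta> i \<omega>)\<^sup>2 * (\<tau> (Suc i) - \<tau> i))"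
    using m by (intro sum_ennreal) auto
  finally show ?thesis .
qed

lemma simple_integral_tail:
  assumes d: "simple_proc_data M F m \<tau> \<eta>" and t: "t \<ge> 0" and \<rho>: "\<rho> \<ge> 0" and \<delta>: "\<delta> > 0"
  shows "prob {\<omega>\<in>space M. \<bar>simple_integral_wrt W m \<tau> \<eta> t \<omega>\<bar> > \<delta>}
    \<le> prob {\<omega>\<in>space M. qv t (simple_proc m \<tau> \<eta>) \<omega> > ennreal \<rho>} + \<rho> / \<delta>\<^sup>2"
proof -
  let ?\<tau> = "\<lambda>i. min t (\<tau> i)" and ?\<eta> = "\<lambda>i \<omega>. if \<tau> i < t then \<eta> i \<omega> else 0"
  note st = simple_proc_data_stop[OF d t]
  have "qv t (simple_proc m \<tau> \<eta>) \<omega> = qv t (simple_proc m ?\<tau> ?\<eta>) \<omega>" for \<omega>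
    unfolding qv_def by (rule nn_integral_cong) (simp add: st(2) indicator_def)
  also have "\<dots> \<omega> = ennreal (\<Sum>i<m. (?\<eta> i \<omega>)\<^sup>2 * (?\<tau> (Suc i) - ?\<tau> i))" for \<omega>
    by (rule qv_simple[OF st(1)]) simp
  finally have q: "qv t (simple_proc m \<tau> \<eta>) \<omega> = ennreal (\<Sum>i<m. (?\<eta> i \<omega>)\<^sup>2 * (?\<tau> (Suc i) - ?\<tau> i))" for \<omega> .
  have l: "ennreal \<rho> < ennreal x \<longleftrightarrow> \<rho> < x" for x using \<rho> by (rule ennreal_less_iff)
  show ?thesis
    using gsum_tail[OF st(1) \<rho> \<delta>] unfolding st(4) q l .
qed

end

section \<open>Convergence in probability\<close>

context prob_space begin

definition cprob :: "(nat \<Rightarrow> 'a \<Rightarrow> real) \<Rightarrow> ('a \<Rightarrow> real) \<Rightarrow> bool" where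
  "cprob X Y \<longleftrightarrow> (\<forall>\<delta>>0. (\<lambda>k. prob {\<omega>\<in>space M. \<bar>X k \<omega> - Y \<omega>\<bar> > \<delta>}) \<longlonglongrightarrow> 0)"

lemma cprob_add:
  assumes X: "cprob X Y" "cprob X' Y'"
    and m: "\<And>k. X k \<in> borel_measurable M" "\<And>k. X' k \<in> borel_measurable M"
      "Y \<in> borel_measurable M" "Y' \<in> borel_measurable M"
  shows "cprob (\<lambda>k \<omega>. X k \<omega> + X' k \<omega>) (\<lambda>\<omega>. Y \<omega> + Y' \<omega>)"
  unfolding cprob_def
proof (intro allI impI)
  note [measurable] = m
  fix \<delta> :: real assume \<delta>: "\<delta> > 0"
  have 1: "(\<lambda>k. prob {\<omega>\<in>space M. \<bar>X k \<omega> - Y \<omega>\<bar> > \<delta>/2} + prob {\<omega>\<in>space M. \<bar>X' k \<omega> - Y' \<omega>\<bar> > \<delta>/2}) \<longlonglongrightarrow> 0 + 0"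
    using X[unfolded cprob_def, rule_format, of "\<delta>/2"] \<delta> by (intro tendsto_add) simp_all
  have 2: "prob {\<omega>\<in>space M. \<bar>X k \<omega> + X' k \<omega> - (Y \<omega> + Y' \<omega>)\<bar> > \<delta>}
    \<le> prob {\<omega>\<in>space M. \<bar>X k \<omega> - Y \<omega>\<bar> > \<delta>/2} + prob {\<omega>\<in>space M. \<bar>X' k \<omega> - Y' \<omega>\<bar> > \<delta>/2}" for k
  proof -
    have "prob {\<omega>\<in>space M. \<bar>X k \<omega> + X' k \<omega> - (Y \<omega> + Y' \<omega>)\<bar> > \<delta>}
      \<le> prob ({\<omega>\<in>space M. \<bar>X k \<omega> - Y \<omega>\<bar> > \<delta>/2} \<union> {\<omega>\<in>space M. \<bar>X' k \<omega> - Y' \<omega>\<bar> > \<delta>/2})"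
      proof (rule finite_measure_mono)
      have "\<delta>/2 < \<bar>x - y\<bar> \<or> \<delta>/2 < \<bar>x' - y'\<bar>" if "\<delta> < \<bar>x + x' - (y + y')\<bar>" for x x' y y' :: real
        using that by linarith
      then show "{\<omega>\<in>space M. \<bar>X k \<omega> + X' k \<omega> - (Y \<omega> + Y' \<omega>)\<bar> > \<delta>}
        \<subseteq> {\<omega>\<in>space M. \<bar>X k \<omega> - Y \<omega>\<bar> > \<delta>/2} \<union> {\<omega>\<in>space M. \<bar>X' k \<omega> - Y' \<omega>\<bar> > \<delta>/2}" by blast
    qed simp
    also have "\<dots> \<le> prob {\<omega>\<in>space M. \<bar>X k \<omega> - Y \<omega>\<bar> > \<delta>/2} + prob {\<omega>\<in>space M. \<bar>X' k \<omega> - Y' \<omega>\<bar> > \<delta>/2}"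
      by (rule measure_Un_le) auto
    finally show ?thesis .
  qed
  show "(\<lambda>k. prob {\<omega>\<in>space M. \<bar>X k \<omega> + X' k \<omega> - (Y \<omega> + Y' \<omega>)\<bar> > \<delta>}) \<longlonglongrightarrow> 0"
    using 1 2 by (intro tendsto_sandwich[OF _ _ tendsto_const 1[simplified]]) auto
qed

lemma cprob_const: "cprob (\<lambda>k. Y) Y"
  by (auto simp: cprob_def)

lemma cprob_scale:
  assumes X: "cprob X Y"
  shows "cprob (\<lambda>k \<omega>. c * X k \<omega>) (\<lambda>\<omega>. c * Y \<omega>)"
proof (cases "c = 0")
  case False
  show ?thesis unfolding cprob_def
  proof (intro allI impI)
    fix \<delta> :: real assume \<delta>: "\<delta> > 0"
    have "\<bar>c * X k \<omega> - c * Y \<omega>\<bar> > \<delta> \<longleftrightarrow> \<bar>X k \<omega> - Y \<omega>\<bar> > \<delta> / \<bar>c\<bar>" for k \<omega>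
      using False by (simp add: right_diff_distrib[symmetric] abs_mult divide_less_eq mult.commute)
    then show "(\<lambda>k. prob {\<omega>\<in>space M. \<bar>c * X k \<omega> - c * Y \<omega>\<bar> > \<delta>}) \<longlonglongrightarrow> 0"
      using X \<delta> False by (simp add: cprob_def)
  qed
qed (auto simp: cprob_def)

lemma cprob_sum:
  assumes "finite I" "\<And>i. i \<in> I \<Longrightarrow> cprob (\<lambda>k. X k i) (Y i)"
    and "\<And>k i. i \<in> I \<Longrightarrow> X k i \<in> borel_measurable M" "\<And>i. i \<in> I \<Longrightarrow> Y i \<in> borel_measurable M"
  shows "cprob (\<lambda>k \<omega>. \<Sum>i\<in>I. X k i \<omega>) (\<lambda>\<omega>. \<Sum>i\<in>I. Y i \<omega>)"
  using assms
proof (induction I)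
  case empty then show ?case using cprob_const[of "\<lambda>_. 0"] by simp
next
  case (insert i I)
  then show ?case by (simp, intro cprob_add borel_measurable_sum) auto
qed

lemma cprob_zero_abs: "cprob X Y \<Longrightarrow> cprob (\<lambda>k \<omega>. \<bar>X k \<omega> - Y \<omega>\<bar>) (\<lambda>_. 0)"
  by (simp add: cprob_def)

text \<open>Borel-Cantelli: choose indices along which missing the accuracy \<open>(1/2) ^ n\<close>
  has probability below \<open>(1/2) ^ n\<close>, which is summable.\<close>

lemma cprob_subseq:
  assumes X: "cprob X Y" and m: "\<And>k. X k \<in> borel_measurable M" "Y \<in> borel_measurable M"
  obtains r :: "nat \<Rightarrow> nat" where "strict_mono r" "AE \<omega> in M. (\<lambda>k. X (r k) \<omega>) \<longlonglongrightarrow> Y \<omega>"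
proof -
  note [measurable] = m
  define A where "A n k = {\<omega>\<in>space M. \<bar>X k \<omega> - Y \<omega>\<bar> > (1/2) ^ n}" for n k
  have "\<forall>n N. \<exists>k. k > N \<and> prob (A n k) < (1/2) ^ n"
  proof (intro allI)
    fix n N
    have "(\<lambda>k. prob (A n k)) \<longlonglongrightarrow> 0" using X unfolding cprob_def A_def by simp
    then have "\<forall>\<^sub>F k in sequentially. prob (A n k) < (1/2) ^ n" by (rule order_tendstoD) simp
    then obtain k0 where "\<And>k. k \<ge> k0 \<Longrightarrow> prob (A n k) < (1/2) ^ n" by (auto simp: eventually_sequentially)
    then show "\<exists>k. k > N \<and> prob (A n k) < (1/2) ^ n" by (intro exI[of _ "max k0 (Suc N)"]) auto
  qed
  then obtain nx where nx: "\<And>n N. nx n N > N" "\<And>n N. prob (A n (nx n N)) < (1/2) ^ n" by metis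
  define r where "r = rec_nat (nx 0 0) (\<lambda>n k. nx (Suc n) k)"
  have r: "strict_mono r" unfolding strict_mono_Suc_iff by (auto simp: r_def nx)
  have p: "prob (A n (r n)) < (1/2) ^ n" for n
  proof (cases n)
    case 0 then show ?thesis using nx(2)[of 0 0] by (simp add: r_def)
  next
    case (Suc m) then show ?thesis using nx(2)[of "Suc m" "r m"] by (simp add: r_def)
  qed
  have "AE \<omega> in M. \<forall>\<^sub>F n in sequentially. \<omega> \<in> space M - A n (r n)"
  proof (rule borel_cantelli_AE1)
    show "A n (r n) \<in> sets M" for n unfolding A_def by simp
    show "summable (\<lambda>n. prob (A n (r n)))"
      by (rule summable_comparison_test'[OF summable_geometric[of "1/2::real"], of 0])
         (use p in \<open>auto intro: less_imp_le\<close>)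
  qed (simp add: emeasure_eq_measure)
  then have "AE \<omega> in M. (\<lambda>k. X (r k) \<omega>) \<longlonglongrightarrow> Y \<omega>"
  proof (rule AE_mp, intro AE_I2 impI)
    fix \<omega> assume "\<omega> \<in> space M" and ev: "\<forall>\<^sub>F n in sequentially. \<omega> \<in> space M - A n (r n)"
    have "(\<lambda>k. X (r k) \<omega> - Y \<omega>) \<longlonglongrightarrow> 0"
    proof (rule Lim_null_comparison)
      show "\<forall>\<^sub>F n in sequentially. norm (X (r n) \<omega> - Y \<omega>) \<le> (1/2) ^ n"
        using ev by eventually_elim (auto simp: A_def)
      show "(\<lambda>n. (1/2::real) ^ n) \<longlonglongrightarrow> 0" by (rule LIMSEQ_realpow_zero) auto
    qed
    then show "(\<lambda>k. X (r k) \<omega>) \<longlonglongrightarrow> Y \<omega>" by (rule LIM_zero_cancel)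
  qed
  with r show thesis by (rule that)
qed

lemma prob_gt_tendsto_zero:
  fixes q :: "nat \<Rightarrow> 'a \<Rightarrow> ennreal"
  assumes m: "\<And>k. q k \<in> borel_measurable M" and l: "\<And>\<omega>. \<omega> \<in> space M \<Longrightarrow> (\<lambda>k. q k \<omega>) \<longlonglongrightarrow> 0" and \<rho>: "\<rho> > 0"
  shows "(\<lambda>k. prob {\<omega>\<in>space M. q k \<omega> > \<rho>}) \<longlonglongrightarrow> 0"
proof -
  note [measurable] = m
  have "(\<lambda>k. expectation (\<lambda>\<omega>. indicator {\<omega>\<in>space M. q k \<omega> > \<rho>} \<omega>)) \<longlonglongrightarrow> expectation (\<lambda>\<omega>. 0 :: real)"
  proof (rule integral_dominated_convergence[where w="\<lambda>_. 1"])
    show "AE \<omega> in M. (\<lambda>k. indicator {\<omega>\<in>space M. q k \<omega> > \<rho>} \<omega> :: real) \<longlonglongrightarrow> 0"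
    proof (rule AE_I2)
      fix \<omega> assume "\<omega> \<in> space M"
      from order_tendstoD(2)[OF l[OF this] \<rho>]
      show "(\<lambda>k. indicator {\<omega>\<in>space M. q k \<omega> > \<rho>} \<omega> :: real) \<longlonglongrightarrow> 0"
        by (intro tendsto_eventually) (auto elim: eventually_mono simp: indicator_def)
    qed
  qed auto
  then show ?thesis by (simp cong: conj_cong)
qed

end

section \<open>The Ito integral\<close>

context wiener begin

definition prog :: "real \<Rightarrow> (real \<Rightarrow> 'a \<Rightarrow> real) \<Rightarrow> bool" where
  "prog t H \<longleftrightarrow> (\<forall>u\<in>{0..t}. (\<lambda>(s, \<omega>). H s \<omega>) \<in> borel_measurable (restrict_space borel {0..u} \<Otimes>\<^sub>M F u))"

lemma ito_integral_alt: "ito_integral M F W H t I \<longleftrightarrow> prog t H \<and> I \<in> borel_measurable M \<and>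
   (\<exists>m \<tau> \<eta>. (\<forall>k. simple_proc_data M F (m k) (\<tau> k) (\<eta> k)) \<and>
      (\<forall>\<rho>>0. (\<lambda>k. prob {\<omega>\<in>space M. qv t (\<lambda>s \<omega>. simple_proc (m k) (\<tau> k) (\<eta> k) s \<omega> - H s \<omega>) \<omega> > ennreal \<rho>}) \<longlonglongrightarrow> 0) \<and>
      cprob (\<lambda>k. simple_integral_wrt W (m k) (\<tau> k) (\<eta> k) t) I)"
  unfolding ito_integral_def prog_def qv_def cprob_def ..

text \<open>Clamping time trades the restricted time interval for the whole line, where products and
  compositions obey the usual measurability rules. \<open>prog_clampD\<close> is the way
  back.\<close>

lemma prog_clamp:
  assumes H: "prog t H" and t: "0 \<le> a" "a \<le> u" "a \<le> t"
  shows "(\<lambda>(s, \<omega>). H (max 0 (min s a)) \<omega>) \<in> borel_measurable (borel \<Otimes>\<^sub>M F u)"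
proof -
  have H': "(\<lambda>(s, \<omega>). H s \<omega>) \<in> borel_measurable (restrict_space borel {0..a} \<Otimes>\<^sub>M F a)"
    using H t by (auto simp: prog_def)
  have 1: "(\<lambda>z. max 0 (min (fst z) a)) \<in> measurable (borel \<Otimes>\<^sub>M F u) (restrict_space borel {0..a})"
    using t by (intro measurable_restrict_space2) (auto intro!: borel_measurable_max borel_measurable_min measurable_fst)
  have 2: "snd \<in> measurable (borel \<Otimes>\<^sub>M F u) (F a)"
  proof -
    have *: "(\<lambda>x. x) \<in> measurable (F u) (F a)" using t(2) by (rule meas_F_mono) simp
    show ?thesis by (rule measurable_compose[OF measurable_snd *])
  qed
  from measurable_compose[OF measurable_Pair[OF 1 2] H'] show ?thesis
    by (simp add: case_prod_beta)
qed

lemma prog_clampD: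
  assumes "(\<lambda>(s, \<omega>). H (max 0 (min s u)) \<omega>) \<in> borel_measurable (borel \<Otimes>\<^sub>M F u)"
  shows "(\<lambda>(s, \<omega>). H s \<omega>) \<in> borel_measurable (restrict_space borel {0..u} \<Otimes>\<^sub>M F u)"
proof -
  have 1: "(\<lambda>z. (fst z, snd z)) \<in> measurable (restrict_space borel {0..u} \<Otimes>\<^sub>M F u) (borel \<Otimes>\<^sub>M F u)"
    by (intro measurable_Pair measurable_snd measurable_compose[OF measurable_fst measurable_restrict_space1]) simp
  from measurable_compose[OF 1 assms]
  have "(\<lambda>z. H (max 0 (min (fst z) u)) (snd z)) \<in> borel_measurable (restrict_space borel {0..u} \<Otimes>\<^sub>M F u)"
    by (simp add: case_prod_beta)
  then show ?thesis
    by (rule measurable_cong[THEN iffD1, rotated]) (auto simp: space_pair_measure space_restrict_space)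
qed

lemma prog_add: "prog t H \<Longrightarrow> prog t H' \<Longrightarrow> prog t (\<lambda>s \<omega>. H s \<omega> + H' s \<omega>)"
  unfolding prog_def case_prod_beta by (auto intro!: borel_measurable_add)

lemma prog_diff: "prog t H \<Longrightarrow> prog t H' \<Longrightarrow> prog t (\<lambda>s \<omega>. H s \<omega> - H' s \<omega>)"
  unfolding prog_def case_prod_beta by (auto intro!: borel_measurable_diff)

lemma prog_scale: "prog t H \<Longrightarrow> prog t (\<lambda>s \<omega>. c * H s \<omega>)"
  unfolding prog_def by (auto simp: case_prod_beta)

lemma prog_mono: "prog t H \<Longrightarrow> s \<le> t \<Longrightarrow> prog s H"
  unfolding prog_def by auto

lemma prog_adapted:
  assumes "prog t H" "s \<in> {0..t}"
  shows "H s \<in> borel_measurable (F s)"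
proof -
  have 1: "(\<lambda>\<omega>. (s, \<omega>)) \<in> measurable (F s) (restrict_space borel {0..s} \<Otimes>\<^sub>M F s)"
    using assms by (intro measurable_Pair) (auto simp: space_restrict_space)
  have "(\<lambda>(s, \<omega>). H s \<omega>) \<in> borel_measurable (restrict_space borel {0..s} \<Otimes>\<^sub>M F s)"
    using assms by (auto simp: prog_def)
  from measurable_compose[OF 1 this] show ?thesis by simp
qed

lemma prog_path:
  assumes "prog t H" "\<omega> \<in> space M" "0 \<le> t"
  shows "(\<lambda>s. H (max 0 (min s t)) \<omega>) \<in> borel_measurable borel"
proof -
  have "(\<lambda>s. (s, \<omega>)) \<in> measurable borel (borel \<Otimes>\<^sub>M F t)"
    using assms by (intro measurable_Pair) (auto simp: space_F)
  from measurable_compose[OF this prog_clamp[OF assms(1,3) order_refl order_refl]] show ?thesis by simp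
qed

lemma prog_stop:
  assumes H: "prog a H" and a: "0 \<le> a"
  shows "prog t (\<lambda>s \<omega>. indicator {..a} s * H s \<omega>)"
  unfolding prog_def
proof
  fix u assume u: "u \<in> {0..t}"
  \<comment> \<open>The indicator hides \<open>H\<close> beyond time \<open>a\<close>, so
    \<open>H\<close> is needed up to \<open>min a u\<close> only, where it is measurable with
    respect to the information at \<open>u\<close>.\<close>
  have *: "(\<lambda>z. H (max 0 (min (fst z) (min a u))) (snd z)) \<in> borel_measurable (borel \<Otimes>\<^sub>M F u)"
    using prog_clamp[OF H, of "min a u" u] a u by (simp add: case_prod_beta)
  have "(\<lambda>z. indicator {..a} (max 0 (min (fst z) u)) * H (max 0 (min (fst z) (min a u))) (snd z)) \<in> borel_measurable (borel \<Otimes>\<^sub>M F u)"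
    by (intro borel_measurable_times *) simp
  also have "(\<lambda>z. indicator {..a} (max 0 (min (fst z) u)) * H (max 0 (min (fst z) (min a u))) (snd z))
     = (\<lambda>(s, \<omega>). indicator {..a} (max 0 (min s u)) * H (max 0 (min s u)) \<omega>)"
  proof (rule ext, clarify)
    fix s \<omega>
    show "indicator {..a} (max 0 (min (fst (s, \<omega>)) u)) * H (max 0 (min (fst (s, \<omega>)) (min a u))) (snd (s, \<omega>))
      = indicator {..a} (max 0 (min s u)) * H (max 0 (min s u)) \<omega>"
    proof (cases "max 0 (min s u) \<le> a")
      case True
      then have "max 0 (min s (min a u)) = max 0 (min s u)" using a by (auto simp: min_def max_def split: if_splits)
      then show ?thesis by simp
    qed simp
  qed
  finally show "(\<lambda>(s, \<omega>). indicator {..a} s * H s \<omega>) \<in> borel_measurable (restrict_space borel {0..u} \<Otimes>\<^sub>M F u)"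
    by (rule prog_clampD)
qed

lemma prog_simple:
  assumes d: "simple_proc_data M F m \<tau> \<eta>"
  shows "prog t (simple_proc m \<tau> \<eta>)"
  unfolding prog_def
proof
  fix u assume u: "u \<in> {0..t}"
  have "(\<lambda>z. \<eta> i (snd z) * indicator {\<tau> i<..\<tau> (Suc i)} (max 0 (min (fst z) u))) \<in> borel_measurable (borel \<Otimes>\<^sub>M F u)"
    if i: "i < m" for i
  proof (cases "\<tau> i < u")
    case True
    then have "\<eta> i \<in> borel_measurable (F u)"
      using d i by (auto simp: simple_proc_data_def intro: meas_F_mono[where s="\<tau> i"])
    from measurable_compose[OF measurable_snd this] show ?thesis
      by (intro borel_measurable_times) auto
  next
    case False
    then have "max 0 (min x u) \<notin> {\<tau> i<..\<tau> (Suc i)}" for x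
      using data_nonneg[OF d, of i] i u by auto
    then show ?thesis by simp
  qed
  then have "(\<lambda>(s, \<omega>). simple_proc m \<tau> \<eta> (max 0 (min s u)) \<omega>) \<in> borel_measurable (borel \<Otimes>\<^sub>M F u)"
    unfolding simple_proc_def case_prod_beta by (intro borel_measurable_sum) auto
  then show "(\<lambda>(s, \<omega>). simple_proc m \<tau> \<eta> s \<omega>) \<in> borel_measurable (restrict_space borel {0..u} \<Otimes>\<^sub>M F u)"
    by (rule prog_clampD)
qed

section \<open>Quadratic variation and stability of the integral\<close>

lemma qv_clamp: "0 \<le> t \<Longrightarrow> qv t H \<omega> = (\<integral>\<^sup>+s. ennreal ((H (max 0 (min s t)) \<omega>)\<^sup>2) * indicator {0..t} s \<partial>lborel)"
  unfolding qv_def by (rule nn_integral_cong) (auto simp: indicator_def)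

lemma qv_measurable:
  assumes H: "prog t H" and t: "0 \<le> t"
  shows "qv t H \<in> borel_measurable M"
proof -
  have 1: "(\<lambda>z. (snd z, fst z)) \<in> measurable (F t \<Otimes>\<^sub>M lborel) (borel \<Otimes>\<^sub>M F t)"
    by (intro measurable_Pair measurable_fst) (use measurable_snd[of "F t" lborel] in simp)
  from measurable_compose[OF 1 prog_clamp[OF H t order_refl order_refl]]
  have [measurable]: "(\<lambda>z. H (max 0 (min (snd z) t)) (fst z)) \<in> borel_measurable (F t \<Otimes>\<^sub>M lborel)" by simp
  have "(\<lambda>\<omega>. \<integral>\<^sup>+s. ennreal ((H (max 0 (min s t)) \<omega>)\<^sup>2) * indicator {0..t} s \<partial>lborel) \<in> borel_measurable (F t)"
    by (rule lborel.borel_measurable_nn_integral) (simp add: case_prod_beta)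
  then have "qv t H \<in> borel_measurable (F t)" by (simp add: qv_clamp[OF t, abs_def])
  then show ?thesis by (rule meas_F_M)
qed

text \<open>The factor 3 is that of \<open>(a + b + c)\<^sup>2 \<le> 3 * (a\<^sup>2 + b\<^sup>2 +
  c\<^sup>2)\<close>. Only a pointwise bound on \<open>D\<close> is asked for, which suffices for
  monotonicity of the integral.\<close>

lemma qv_three:
  assumes p: "prog t A" "prog t B" "prog t C" and t: "0 \<le> t" and w: "\<omega> \<in> space M"
    and b: "\<And>s. s \<in> {0..t} \<Longrightarrow> \<bar>D s \<omega>\<bar> \<le> \<bar>A s \<omega>\<bar> + \<bar>B s \<omega>\<bar> + \<bar>C s \<omega>\<bar>"
  shows "qv t D \<omega> \<le> 3 * (qv t A \<omega> + qv t B \<omega> + qv t C \<omega>)"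
proof -
  note [measurable] = prog_path[OF p(1) w t] prog_path[OF p(2) w t] prog_path[OF p(3) w t]
  let ?c = "\<lambda>s. max 0 (min s t)"
  have sq: "x\<^sup>2 \<le> 3 * (a\<^sup>2 + b\<^sup>2 + c\<^sup>2)" if "\<bar>x\<bar> \<le> \<bar>a\<bar> + \<bar>b\<bar> + \<bar>c\<bar>" for x a b c :: real
  proof -
    have "x\<^sup>2 \<le> (\<bar>a\<bar> + \<bar>b\<bar> + \<bar>c\<bar>)\<^sup>2" using that by (simp add: abs_le_square_iff[symmetric])
    also have "\<dots> \<le> 3 * (\<bar>a\<bar>\<^sup>2 + \<bar>b\<bar>\<^sup>2 + \<bar>c\<bar>\<^sup>2)"
      using sum_squares_ge_zero[of "\<bar>a\<bar> - \<bar>b\<bar>" "\<bar>b\<bar> - \<bar>c\<bar>"] zero_le_power2[of "\<bar>a\<bar> - \<bar>c\<bar>"]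
      by (simp add: power2_eq_square algebra_simps)
    finally show ?thesis by simp
  qed
  have "qv t D \<omega> \<le> (\<integral>\<^sup>+s. ennreal 3 * (ennreal ((A (?c s) \<omega>)\<^sup>2) * indicator {0..t} s + ennreal ((B (?c s) \<omega>)\<^sup>2) * indicator {0..t} s
      + ennreal ((C (?c s) \<omega>)\<^sup>2) * indicator {0..t} s) \<partial>lborel)"
    unfolding qv_def
  proof (rule nn_integral_mono)
    fix s
    show "ennreal ((D s \<omega>)\<^sup>2) * indicator {0..t} s \<le> ennreal 3 * (ennreal ((A (?c s) \<omega>)\<^sup>2) * indicator {0..t} s + ennreal ((B (?c s) \<omega>)\<^sup>2) * indicator {0..t} s
      + ennreal ((C (?c s) \<omega>)\<^sup>2) * indicator {0..t} s)"
    proof (cases "s \<in> {0..t}")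
      case True
      then have "ennreal ((D s \<omega>)\<^sup>2) \<le> ennreal (3 * ((A s \<omega>)\<^sup>2 + (B s \<omega>)\<^sup>2 + (C s \<omega>)\<^sup>2))"
        by (intro ennreal_leI sq b)
      also have "\<dots> = ennreal 3 * (ennreal ((A s \<omega>)\<^sup>2) + ennreal ((B s \<omega>)\<^sup>2) + ennreal ((C s \<omega>)\<^sup>2))"
        by (subst ennreal_mult) auto
      finally show ?thesis using True by simp
    qed simp
  qed
  also have "\<dots> = 3 * (qv t A \<omega> + qv t B \<omega> + qv t C \<omega>)"
    unfolding qv_clamp[OF t]
    by (subst nn_integral_cmult) (auto simp: nn_integral_add)
  finally show ?thesis .
qed

text \<open>The tail inequality for simple processes survives the limit in probability. Splitting
  into two approximation errors and the difference proper gives quadratic variation at most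
  \<open>3 * (\<rho> + \<rho> + \<rho>)\<close> and threshold \<open>\<delta>/3\<close>, whence
  \<open>9 * \<rho> / (\<delta>/3)\<^sup>2\<close>. For equal integrands it shows that the integral
  is unique almost surely.\<close>

lemma ito_stability:
  assumes I: "ito_integral M F W H t I" and I': "ito_integral M F W H' t I'" and t: "0 \<le> t"
    and \<rho>: "\<rho> > 0" and \<delta>: "\<delta> > 0"
  shows "prob {\<omega>\<in>space M. \<bar>I \<omega> - I' \<omega>\<bar> > \<delta>}
    \<le> prob {\<omega>\<in>space M. qv t (\<lambda>s \<omega>. H s \<omega> - H' s \<omega>) \<omega> > ennreal \<rho>} + 81 * \<rho> / \<delta>\<^sup>2"
proof -
  obtain m \<tau> \<eta> where d: "\<And>k. simple_proc_data M F (m k) (\<tau> k) (\<eta> k)"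
    and q: "\<And>\<rho>. \<rho> > 0 \<Longrightarrow> (\<lambda>k. prob {\<omega>\<in>space M. qv t (\<lambda>s \<omega>. simple_proc (m k) (\<tau> k) (\<eta> k) s \<omega> - H s \<omega>) \<omega> > ennreal \<rho>}) \<longlonglongrightarrow> 0"
    and c: "cprob (\<lambda>k. simple_integral_wrt W (m k) (\<tau> k) (\<eta> k) t) I" and pH: "prog t H" and mI: "I \<in> borel_measurable M"
    using I unfolding ito_integral_alt by blast
  obtain m' \<tau>' \<eta>' where d': "\<And>k. simple_proc_data M F (m' k) (\<tau>' k) (\<eta>' k)"
    and q': "\<And>\<rho>. \<rho> > 0 \<Longrightarrow> (\<lambda>k. prob {\<omega>\<in>space M. qv t (\<lambda>s \<omega>. simple_proc (m' k) (\<tau>' k) (\<eta>' k) s \<omega> - H' s \<omega>) \<omega> > ennreal \<rho>}) \<longlonglongrightarrow> 0"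
    and c': "cprob (\<lambda>k. simple_integral_wrt W (m' k) (\<tau>' k) (\<eta>' k) t) I'" and pH': "prog t H'" and mI': "I' \<in> borel_measurable M"
    using I' unfolding ito_integral_alt by blast
  have mS: "simple_integral_wrt W m \<tau> \<eta> t \<in> borel_measurable M" if "simple_proc_data M F m \<tau> \<eta>" for m \<tau> \<eta>
    using gsum_moments(1)[OF simple_proc_data_stop(1)[OF that t] order_refl]
    unfolding simple_proc_data_stop(4)[OF that t, abs_def] by (rule meas_F_M)
  define S where "S k = simple_integral_wrt W (m k) (\<tau> k) (\<eta> k) t" for k
  define S' where "S' k = simple_integral_wrt W (m' k) (\<tau>' k) (\<eta>' k) t" for k
  have [measurable]: "S k \<in> borel_measurable M" "S' k \<in> borel_measurable M" for k
    unfolding S_def S'_def using mS d d' by auto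
  note [measurable] = mI mI'
  define h where "h k = simple_proc (m k) (\<tau> k) (\<eta> k)" for k
  define h' where "h' k = simple_proc (m' k) (\<tau>' k) (\<eta>' k)" for k
  have ph: "prog t (h k)" "prog t (h' k)" for k unfolding h_def h'_def by (intro prog_simple d d')+
  note [measurable] = qv_measurable[OF prog_diff[OF ph(1) pH] t] qv_measurable[OF prog_diff[OF ph(2) pH'] t]
    qv_measurable[OF prog_diff[OF pH pH'] t]
  let ?P = "\<lambda>A. prob {\<omega>\<in>space M. A \<omega>}"
  let ?a = "\<lambda>k \<omega>. qv t (\<lambda>s \<omega>. h k s \<omega> - H s \<omega>) \<omega>" and ?a' = "\<lambda>k \<omega>. qv t (\<lambda>s \<omega>. h' k s \<omega> - H' s \<omega>) \<omega>"
  let ?b = "\<lambda>\<omega>. qv t (\<lambda>s \<omega>. H s \<omega> - H' s \<omega>) \<omega>"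
  have 1: "?P (\<lambda>\<omega>. \<bar>S k \<omega> - S' k \<omega>\<bar> > \<delta>/3) \<le> ?P (\<lambda>\<omega>. ?a k \<omega> > ennreal \<rho>) + ?P (\<lambda>\<omega>. ?b \<omega> > ennreal \<rho>) + ?P (\<lambda>\<omega>. ?a' k \<omega> > ennreal \<rho>) + 81 * \<rho> / \<delta>\<^sup>2" for k
  proof -
    \<comment> \<open>The difference of the two approximants is one simple process on a common
      partition, so the tail inequality applies to it directly.\<close>
    obtain m0 \<tau>0 \<eta>0 where d0: "simple_proc_data M F m0 \<tau>0 \<eta>0"
      and p0: "\<And>u \<omega>. simple_proc m0 \<tau>0 \<eta>0 u \<omega> = h k u \<omega> + (-1) * h' k u \<omega>"
      and i: "\<And>\<omega>. simple_integral_wrt W m0 \<tau>0 \<eta>0 t \<omega> = S k \<omega> + simple_integral_wrt W (m' k) (\<tau>' k) (\<lambda>i \<omega>. -1 * \<eta>' k i \<omega>) t \<omega>"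
      using simple_proc_data_add[OF d[of k] simple_proc_data_scale(1)[OF d'[of k], of "-1"]]
      unfolding simple_proc_data_scale(2)[OF d'[of k]] S_def h_def h'_def by blast
    have i0: "simple_integral_wrt W m0 \<tau>0 \<eta>0 t \<omega> = S k \<omega> + (-1) * S' k \<omega>" for \<omega>
      unfolding i simple_proc_data_scale(3)[OF d'[of k]] S'_def ..
    have "?P (\<lambda>\<omega>. \<bar>S k \<omega> - S' k \<omega>\<bar> > \<delta>/3) \<le> ?P (\<lambda>\<omega>. qv t (simple_proc m0 \<tau>0 \<eta>0) \<omega> > ennreal (9 * \<rho>)) + 9 * \<rho> / (\<delta>/3)\<^sup>2"
      using simple_integral_tail[OF d0 t, of "9 * \<rho>" "\<delta>/3"] \<rho> \<delta> by (simp add: i0)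
    also have "9 * \<rho> / (\<delta>/3)\<^sup>2 = 81 * \<rho> / \<delta>\<^sup>2" by (simp add: power_divide)
    also have "?P (\<lambda>\<omega>. qv t (simple_proc m0 \<tau>0 \<eta>0) \<omega> > ennreal (9 * \<rho>))
      \<le> prob ({\<omega>\<in>space M. ?a k \<omega> > ennreal \<rho>} \<union> {\<omega>\<in>space M. ?b \<omega> > ennreal \<rho>} \<union> {\<omega>\<in>space M. ?a' k \<omega> > ennreal \<rho>})"
    proof (rule finite_measure_mono)
      show "{\<omega>\<in>space M. qv t (simple_proc m0 \<tau>0 \<eta>0) \<omega> > ennreal (9 * \<rho>)}
        \<subseteq> {\<omega>\<in>space M. ?a k \<omega> > ennreal \<rho>} \<union> {\<omega>\<in>space M. ?b \<omega> > ennreal \<rho>} \<union> {\<omega>\<in>space M. ?a' k \<omega> > ennreal \<rho>}"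
      proof -
        have "qv t (simple_proc m0 \<tau>0 \<eta>0) \<omega> \<le> ennreal (9 * \<rho>)" if w: "\<omega> \<in> space M"
          and a: "?a k \<omega> \<le> ennreal \<rho>" "?b \<omega> \<le> ennreal \<rho>" "?a' k \<omega> \<le> ennreal \<rho>" for \<omega>
        proof -
        have "qv t (simple_proc m0 \<tau>0 \<eta>0) \<omega> \<le> 3 * (?a k \<omega> + ?b \<omega> + ?a' k \<omega>)"
          by (rule qv_three[OF prog_diff[OF ph(1) pH] prog_diff[OF pH pH'] prog_diff[OF ph(2) pH'] t w]) (simp add: p0)
        also have "\<dots> \<le> 3 * (ennreal \<rho> + ennreal \<rho> + ennreal \<rho>)" by (intro mult_left_mono add_mono a) auto
        also have "\<dots> = ennreal 3 * ennreal (\<rho> + \<rho> + \<rho>)" using \<rho> by (simp add: ennreal_plus[symmetric] del: ennreal_plus)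
        also have "\<dots> = ennreal (9 * \<rho>)" using \<rho> by (subst ennreal_mult[symmetric]) auto
        finally show ?thesis .
        qed
        then show ?thesis unfolding not_le[symmetric] by blast
      qed
    qed simp
    also have "\<dots> \<le> ?P (\<lambda>\<omega>. ?a k \<omega> > ennreal \<rho>) + ?P (\<lambda>\<omega>. ?b \<omega> > ennreal \<rho>) + ?P (\<lambda>\<omega>. ?a' k \<omega> > ennreal \<rho>)"
      by (intro order_trans[OF measure_Un_le] add_right_mono measure_Un_le) auto
    finally show ?thesis by simp
  qed
  have 2: "?P (\<lambda>\<omega>. \<bar>I \<omega> - I' \<omega>\<bar> > \<delta>) \<le> ?P (\<lambda>\<omega>. \<bar>S k \<omega> - I \<omega>\<bar> > \<delta>/3) + ?P (\<lambda>\<omega>. \<bar>S' k \<omega> - I' \<omega>\<bar> > \<delta>/3)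
    + (?P (\<lambda>\<omega>. ?a k \<omega> > ennreal \<rho>) + ?P (\<lambda>\<omega>. ?b \<omega> > ennreal \<rho>) + ?P (\<lambda>\<omega>. ?a' k \<omega> > ennreal \<rho>) + 81 * \<rho> / \<delta>\<^sup>2)" for k
  proof -
    have "?P (\<lambda>\<omega>. \<bar>I \<omega> - I' \<omega>\<bar> > \<delta>) \<le> prob ({\<omega>\<in>space M. \<bar>S k \<omega> - I \<omega>\<bar> > \<delta>/3} \<union> {\<omega>\<in>space M. \<bar>S' k \<omega> - I' \<omega>\<bar> > \<delta>/3}
      \<union> {\<omega>\<in>space M. \<bar>S k \<omega> - S' k \<omega>\<bar> > \<delta>/3})"
      proof (rule finite_measure_mono)
      have "\<delta>/3 < \<bar>s - x\<bar> \<or> \<delta>/3 < \<bar>s' - y\<bar> \<or> \<delta>/3 < \<bar>s - s'\<bar>" if "\<delta> < \<bar>x - y\<bar>" for x y s s' :: real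
        using that by linarith
      then show "{\<omega>\<in>space M. \<bar>I \<omega> - I' \<omega>\<bar> > \<delta>} \<subseteq> {\<omega>\<in>space M. \<bar>S k \<omega> - I \<omega>\<bar> > \<delta>/3} \<union> {\<omega>\<in>space M. \<bar>S' k \<omega> - I' \<omega>\<bar> > \<delta>/3}
        \<union> {\<omega>\<in>space M. \<bar>S k \<omega> - S' k \<omega>\<bar> > \<delta>/3}" by blast
    qed simp
    also have "\<dots> \<le> ?P (\<lambda>\<omega>. \<bar>S k \<omega> - I \<omega>\<bar> > \<delta>/3) + ?P (\<lambda>\<omega>. \<bar>S' k \<omega> - I' \<omega>\<bar> > \<delta>/3) + ?P (\<lambda>\<omega>. \<bar>S k \<omega> - S' k \<omega>\<bar> > \<delta>/3)"
      by (intro order_trans[OF measure_Un_le] add_right_mono measure_Un_le) auto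
    finally show ?thesis using 1[of k] by simp
  qed
  have "(\<lambda>k. ?P (\<lambda>\<omega>. \<bar>S k \<omega> - I \<omega>\<bar> > \<delta>/3) + ?P (\<lambda>\<omega>. \<bar>S' k \<omega> - I' \<omega>\<bar> > \<delta>/3)
    + (?P (\<lambda>\<omega>. ?a k \<omega> > ennreal \<rho>) + ?P (\<lambda>\<omega>. ?b \<omega> > ennreal \<rho>) + ?P (\<lambda>\<omega>. ?a' k \<omega> > ennreal \<rho>) + 81 * \<rho> / \<delta>\<^sup>2))
    \<longlonglongrightarrow> 0 + 0 + (0 + ?P (\<lambda>\<omega>. ?b \<omega> > ennreal \<rho>) + 0 + 81 * \<rho> / \<delta>\<^sup>2)"
    using c[unfolded cprob_def, rule_format, of "\<delta>/3"] c'[unfolded cprob_def, rule_format, of "\<delta>/3"]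
      \<delta> q[OF \<rho>] q'[OF \<rho>] unfolding S_def S'_def h_def h'_def
    by (intro tendsto_add tendsto_const) simp_all
  from LIMSEQ_le_const[OF this, of "?P (\<lambda>\<omega>. \<bar>I \<omega> - I' \<omega>\<bar> > \<delta>)"] 2 show ?thesis by auto
qed

lemma ito_simple:
  assumes d: "simple_proc_data M F m \<tau> \<eta>" and t: "0 \<le> t"
  shows "ito_integral M F W (simple_proc m \<tau> \<eta>) t (simple_integral_wrt W m \<tau> \<eta> t)"
proof -
  have "simple_integral_wrt W m \<tau> \<eta> t \<in> borel_measurable M"
    using gsum_moments(1)[OF simple_proc_data_stop(1)[OF d t] order_refl]
    unfolding simple_proc_data_stop(4)[OF d t, abs_def] by (rule meas_F_M)
  then show ?thesis
    unfolding ito_integral_alt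
    using d by (intro conjI prog_simple[OF d] exI[of _ "\<lambda>_. m"] exI[of _ "\<lambda>_. \<tau>"] exI[of _ "\<lambda>_. \<eta>"]) (auto simp: qv_def cprob_const)
qed

lemma ito_measurable: "ito_integral M F W H t I \<Longrightarrow> I \<in> borel_measurable M"
  and ito_prog: "ito_integral M F W H t I \<Longrightarrow> prog t H"
  by (auto simp: ito_integral_alt)

text \<open>Pathwise convergence of the quadratic variation is enough, with no moments: it implies
  convergence in probability, which is all that the stability estimate uses.\<close>

lemma ito_continuity:
  assumes I: "ito_integral M F W H t I" and I': "\<And>k. ito_integral M F W (H' k) t (I' k)" and t: "0 \<le> t"
    and q: "\<And>\<omega>. \<omega> \<in> space M \<Longrightarrow> (\<lambda>k. qv t (\<lambda>s \<omega>. H' k s \<omega> - H s \<omega>) \<omega>) \<longlonglongrightarrow> 0"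
  shows "cprob I' I"
  unfolding cprob_def
proof (intro allI impI)
  fix \<delta> :: real assume \<delta>: "\<delta> > 0"
  show "(\<lambda>k. prob {\<omega>\<in>space M. \<bar>I' k \<omega> - I \<omega>\<bar> > \<delta>}) \<longlonglongrightarrow> 0"
  proof (rule LIMSEQ_I)
    fix e :: real assume e: "e > 0"
    define \<rho> where "\<rho> = e / 2 * \<delta>\<^sup>2 / 81"
    have \<rho>: "\<rho> > 0" using e \<delta> by (simp add: \<rho>_def)
    have \<rho>e: "81 * \<rho> / \<delta>\<^sup>2 = e / 2" using \<delta> by (simp add: \<rho>_def)
    have "(\<lambda>k. prob {\<omega>\<in>space M. qv t (\<lambda>s \<omega>. H' k s \<omega> - H s \<omega>) \<omega> > ennreal \<rho>}) \<longlonglongrightarrow> 0"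
      by (rule prob_gt_tendsto_zero) (use q \<rho> in \<open>auto intro!: qv_measurable[OF prog_diff t] ito_prog[OF I] ito_prog[OF I']\<close>)
    then have "\<forall>\<^sub>F k in sequentially. prob {\<omega>\<in>space M. qv t (\<lambda>s \<omega>. H' k s \<omega> - H s \<omega>) \<omega> > ennreal \<rho>} < e / 2"
      by (rule order_tendstoD) (use e in simp)
    then obtain k0 where k0: "\<And>k. k \<ge> k0 \<Longrightarrow> prob {\<omega>\<in>space M. qv t (\<lambda>s \<omega>. H' k s \<omega> - H s \<omega>) \<omega> > ennreal \<rho>} < e / 2"
      by (auto simp: eventually_sequentially)
    have "prob {\<omega>\<in>space M. \<bar>I' k \<omega> - I \<omega>\<bar> > \<delta>} < e" if "k \<ge> k0" for k
      using ito_stability[OF I'[of k] I t \<rho> \<delta>] k0[OF that] unfolding \<rho>e by linarith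
    then show "\<exists>k0. \<forall>k\<ge>k0. norm (prob {\<omega>\<in>space M. \<bar>I' k \<omega> - I \<omega>\<bar> > \<delta>} - 0) < e" by auto
  qed
qed

lemma ito_scale:
  assumes I: "ito_integral M F W H t I" and t: "0 \<le> t"
  shows "ito_integral M F W (\<lambda>s \<omega>. c * H s \<omega>) t (\<lambda>\<omega>. c * I \<omega>)"
proof (cases "c = 0")
  case True
  then show ?thesis
    unfolding ito_integral_alt
    by (intro conjI exI[of _ "\<lambda>_. 0"] exI[of _ "\<lambda>_ _. 0"] exI[of _ "\<lambda>_ _ _. 0"])
       (auto simp: simple_proc_data_def prog_def qv_def simple_proc_def simple_integral_wrt_def cprob_def)
next
  case False
  obtain m \<tau> \<eta> where d: "\<And>k. simple_proc_data M F (m k) (\<tau> k) (\<eta> k)"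
    and q: "\<And>\<rho>. \<rho> > 0 \<Longrightarrow> (\<lambda>k. prob {\<omega>\<in>space M. qv t (\<lambda>s \<omega>. simple_proc (m k) (\<tau> k) (\<eta> k) s \<omega> - H s \<omega>) \<omega> > ennreal \<rho>}) \<longlonglongrightarrow> 0"
    and c: "cprob (\<lambda>k. simple_integral_wrt W (m k) (\<tau> k) (\<eta> k) t) I" and pH: "prog t H" and mI: "I \<in> borel_measurable M"
    using I unfolding ito_integral_alt by blast
  show ?thesis
    unfolding ito_integral_alt
  proof (intro conjI exI[of _ m] exI[of _ \<tau>] exI[of _ "\<lambda>k i \<omega>. c * \<eta> k i \<omega>"] allI impI)
    show "cprob (\<lambda>k. simple_integral_wrt W (m k) (\<tau> k) (\<lambda>i \<omega>. c * \<eta> k i \<omega>) t) (\<lambda>\<omega>. c * I \<omega>)"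
      using cprob_scale[OF c, of c] by (simp add: simple_proc_data_scale(3)[OF d, abs_def])
    fix \<rho> :: real assume \<rho>: "\<rho> > 0"
    show "(\<lambda>k. prob {\<omega>\<in>space M. qv t (\<lambda>s \<omega>. simple_proc (m k) (\<tau> k) (\<lambda>i \<omega>. c * \<eta> k i \<omega>) s \<omega> - c * H s \<omega>) \<omega> > ennreal \<rho>}) \<longlonglongrightarrow> 0"
    proof (rule tendsto_sandwich[OF _ _ tendsto_const q[of "\<rho> / c\<^sup>2"]])
      show "\<forall>\<^sub>F k in sequentially. prob {\<omega>\<in>space M. qv t (\<lambda>s \<omega>. simple_proc (m k) (\<tau> k) (\<lambda>i \<omega>. c * \<eta> k i \<omega>) s \<omega> - c * H s \<omega>) \<omega> > ennreal \<rho>}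
        \<le> prob {\<omega>\<in>space M. qv t (\<lambda>s \<omega>. simple_proc (m k) (\<tau> k) (\<eta> k) s \<omega> - H s \<omega>) \<omega> > ennreal (\<rho> / c\<^sup>2)}"
      proof (rule always_eventually, rule allI, rule finite_measure_mono)
        fix k
        let ?D = "\<lambda>s \<omega>. simple_proc (m k) (\<tau> k) (\<eta> k) s \<omega> - H s \<omega>"
        let ?C = "\<lambda>s \<omega>. simple_proc (m k) (\<tau> k) (\<lambda>i \<omega>. c * \<eta> k i \<omega>) s \<omega> - c * H s \<omega>"
        have "prog t ?D" by (intro prog_diff prog_simple d pH)
        then show "{\<omega>\<in>space M. qv t ?D \<omega> > ennreal (\<rho> / c\<^sup>2)} \<in> events"
          using qv_measurable[of t ?D] t by measurable
        have "qv t ?C \<omega> \<le> ennreal \<rho>" if "qv t ?D \<omega> \<le> ennreal (\<rho> / c\<^sup>2)" and w: "\<omega> \<in> space M" for \<omega>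
        proof -
          note [measurable] = prog_path[OF prog_diff[OF prog_simple[OF d[of k], of t] pH] w t]
          have "qv t ?C \<omega> = ennreal (c\<^sup>2) * qv t ?D \<omega>"
            unfolding qv_clamp[OF t]
            by (subst nn_integral_cmult[symmetric])
               (auto intro!: nn_integral_cong simp: simple_proc_data_scale(2)[OF d] right_diff_distrib[symmetric]
                 power_mult_distrib ennreal_mult mult.assoc)
          also have "\<dots> \<le> ennreal (c\<^sup>2) * ennreal (\<rho> / c\<^sup>2)" by (intro mult_left_mono that) simp
          also have "\<dots> = ennreal \<rho>" using False \<rho> by (subst ennreal_mult[symmetric]) auto
          finally show ?thesis .
        qed
        then show "{\<omega>\<in>space M. qv t ?C \<omega> > ennreal \<rho>} \<subseteq> {\<omega>\<in>space M. qv t ?D \<omega> > ennreal (\<rho> / c\<^sup>2)}"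
          by (auto simp: not_less[symmetric])
      qed
    qed (use \<rho> False in auto)
  qed (use mI prog_scale[OF pH] simple_proc_data_scale(1)[OF d] in auto)
qed

lemma ito_add:
  assumes I: "ito_integral M F W H t I" and I': "ito_integral M F W H' t I'" and t: "0 \<le> t"
  shows "ito_integral M F W (\<lambda>s \<omega>. H s \<omega> + H' s \<omega>) t (\<lambda>\<omega>. I \<omega> + I' \<omega>)"
proof -
  obtain m \<tau> \<eta> where d: "\<And>k. simple_proc_data M F (m k) (\<tau> k) (\<eta> k)"
    and q: "\<And>\<rho>. \<rho> > 0 \<Longrightarrow> (\<lambda>k. prob {\<omega>\<in>space M. qv t (\<lambda>s \<omega>. simple_proc (m k) (\<tau> k) (\<eta> k) s \<omega> - H s \<omega>) \<omega> > ennreal \<rho>}) \<longlonglongrightarrow> 0"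
    and c: "cprob (\<lambda>k. simple_integral_wrt W (m k) (\<tau> k) (\<eta> k) t) I" and pH: "prog t H" and mI: "I \<in> borel_measurable M"
    using I unfolding ito_integral_alt by blast
  obtain m' \<tau>' \<eta>' where d': "\<And>k. simple_proc_data M F (m' k) (\<tau>' k) (\<eta>' k)"
    and q': "\<And>\<rho>. \<rho> > 0 \<Longrightarrow> (\<lambda>k. prob {\<omega>\<in>space M. qv t (\<lambda>s \<omega>. simple_proc (m' k) (\<tau>' k) (\<eta>' k) s \<omega> - H' s \<omega>) \<omega> > ennreal \<rho>}) \<longlonglongrightarrow> 0"
    and c': "cprob (\<lambda>k. simple_integral_wrt W (m' k) (\<tau>' k) (\<eta>' k) t) I'" and pH': "prog t H'" and mI': "I' \<in> borel_measurable M"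
    using I' unfolding ito_integral_alt by blast
  have "\<forall>k. \<exists>m0 \<tau>0 \<eta>0. simple_proc_data M F m0 \<tau>0 \<eta>0 \<and>
    (\<forall>u \<omega>. simple_proc m0 \<tau>0 \<eta>0 u \<omega> = simple_proc (m k) (\<tau> k) (\<eta> k) u \<omega> + simple_proc (m' k) (\<tau>' k) (\<eta>' k) u \<omega>) \<and>
    (\<forall>W t \<omega>. simple_integral_wrt W m0 \<tau>0 \<eta>0 t \<omega> = simple_integral_wrt W (m k) (\<tau> k) (\<eta> k) t \<omega> + simple_integral_wrt W (m' k) (\<tau>' k) (\<eta>' k) t \<omega>)"
    using simple_proc_data_add[OF d d'] by blast
  then obtain m0 \<tau>0 \<eta>0 where d0: "\<And>k. simple_proc_data M F (m0 k) (\<tau>0 k) (\<eta>0 k)"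
    and p0: "\<And>k u \<omega>. simple_proc (m0 k) (\<tau>0 k) (\<eta>0 k) u \<omega> = simple_proc (m k) (\<tau> k) (\<eta> k) u \<omega> + simple_proc (m' k) (\<tau>' k) (\<eta>' k) u \<omega>"
    and i0: "\<And>k t \<omega>. simple_integral_wrt W (m0 k) (\<tau>0 k) (\<eta>0 k) t \<omega> = simple_integral_wrt W (m k) (\<tau> k) (\<eta> k) t \<omega> + simple_integral_wrt W (m' k) (\<tau>' k) (\<eta>' k) t \<omega>"
    by metis
  show ?thesis
    unfolding ito_integral_alt
  proof (intro conjI exI[of _ m0] exI[of _ \<tau>0] exI[of _ \<eta>0] allI impI)
    show "cprob (\<lambda>k. simple_integral_wrt W (m0 k) (\<tau>0 k) (\<eta>0 k) t) (\<lambda>\<omega>. I \<omega> + I' \<omega>)"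
      using cprob_add[OF c c'] ito_measurable[OF ito_simple[OF d t]] ito_measurable[OF ito_simple[OF d' t]] mI mI'
      by (simp add: i0[abs_def])
    fix \<rho> :: real assume \<rho>: "\<rho> > 0"
    let ?E = "\<lambda>k s \<omega>. simple_proc (m0 k) (\<tau>0 k) (\<eta>0 k) s \<omega> - (H s \<omega> + H' s \<omega>)"
    let ?D = "\<lambda>k s \<omega>. simple_proc (m k) (\<tau> k) (\<eta> k) s \<omega> - H s \<omega>"
    let ?D' = "\<lambda>k s \<omega>. simple_proc (m' k) (\<tau>' k) (\<eta>' k) s \<omega> - H' s \<omega>"
    have pD: "prog t (?D k)" "prog t (?D' k)" for k by (intro prog_diff prog_simple d d' pH pH')+
    note [measurable] = qv_measurable[OF pD(1) t] qv_measurable[OF pD(2) t]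
    \<comment> \<open>The share \<open>\<rho>/6\<close> is what \<open>qv_three\<close> needs when
      its third process is 0: \<open>3 * (\<rho>/6 + \<rho>/6) = \<rho>\<close>.\<close>
    have lim: "(\<lambda>k. prob {\<omega>\<in>space M. qv t (?D k) \<omega> > ennreal (\<rho>/6)} + prob {\<omega>\<in>space M. qv t (?D' k) \<omega> > ennreal (\<rho>/6)}) \<longlonglongrightarrow> 0"
      using tendsto_add[OF q[of "\<rho>/6"] q'[of "\<rho>/6"]] \<rho> by simp
    have le: "prob {\<omega>\<in>space M. qv t (?E k) \<omega> > ennreal \<rho>}
      \<le> prob {\<omega>\<in>space M. qv t (?D k) \<omega> > ennreal (\<rho>/6)} + prob {\<omega>\<in>space M. qv t (?D' k) \<omega> > ennreal (\<rho>/6)}" for k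
    proof -
      have "qv t (?E k) \<omega> \<le> ennreal \<rho>" if w: "\<omega> \<in> space M" and l: "qv t (?D k) \<omega> \<le> ennreal (\<rho>/6)" "qv t (?D' k) \<omega> \<le> ennreal (\<rho>/6)" for \<omega>
      proof -
        have p: "prog t (\<lambda>_ _. 0)" by (simp add: prog_def)
        have "qv t (?E k) \<omega> \<le> 3 * (qv t (?D k) \<omega> + qv t (?D' k) \<omega> + qv t (\<lambda>_ _. 0) \<omega>)"
          by (rule qv_three[OF pD p t w]) (simp add: p0)
        also have "\<dots> \<le> 3 * (ennreal (\<rho>/6) + ennreal (\<rho>/6) + 0)"
          using l by (intro mult_left_mono add_mono) (auto simp: qv_def)
        also have "\<dots> = ennreal 3 * ennreal (\<rho>/6 + \<rho>/6)" using \<rho> by (simp add: ennreal_plus[symmetric] del: ennreal_plus)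
        also have "\<dots> = ennreal \<rho>" using \<rho> by (subst ennreal_mult[symmetric]) auto
        finally show ?thesis .
      qed
      then have "{\<omega>\<in>space M. qv t (?E k) \<omega> > ennreal \<rho>} \<subseteq> {\<omega>\<in>space M. qv t (?D k) \<omega> > ennreal (\<rho>/6)} \<union> {\<omega>\<in>space M. qv t (?D' k) \<omega> > ennreal (\<rho>/6)}"
        unfolding not_le[symmetric] by blast
      then have "prob {\<omega>\<in>space M. qv t (?E k) \<omega> > ennreal \<rho>} \<le> prob ({\<omega>\<in>space M. qv t (?D k) \<omega> > ennreal (\<rho>/6)} \<union> {\<omega>\<in>space M. qv t (?D' k) \<omega> > ennreal (\<rho>/6)})"
        by (rule finite_measure_mono) simp
      also have "\<dots> \<le> prob {\<omega>\<in>space M. qv t (?D k) \<omega> > ennreal (\<rho>/6)} + prob {\<omega>\<in>space M. qv t (?D' k) \<omega> > ennreal (\<rho>/6)}"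
        by (rule measure_Un_le) auto
      finally show ?thesis .
    qed
    show "(\<lambda>k. prob {\<omega>\<in>space M. qv t (?E k) \<omega> > ennreal \<rho>}) \<longlonglongrightarrow> 0"
      by (rule tendsto_sandwich[OF _ _ tendsto_const lim]) (use le in auto)
  qed (use mI mI' prog_add[OF pH pH'] d0 in auto)
qed

lemma ito_sum:
  assumes "finite A" and t: "0 \<le> t"
    and "\<And>i. i \<in> A \<Longrightarrow> ito_integral M F W (H i) t (I i)"
  shows "ito_integral M F W (\<lambda>s \<omega>. \<Sum>i\<in>A. H i s \<omega>) t (\<lambda>\<omega>. \<Sum>i\<in>A. I i \<omega>)"
  using assms
proof (induction A)
  case empty
  have "simple_proc_data M F 0 (\<lambda>_. 0) (\<lambda>_ _. 0)" by (simp add: simple_proc_data_def)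
  from ito_simple[OF this t] show ?case by (simp add: simple_proc_def[abs_def] simple_integral_wrt_def[abs_def])
next
  case (insert i A)
  then show ?case by (simp add: ito_add)
qed

text \<open>Integrals up to different end times become integrals up to the common time
  \<open>t\<close>. Only then can increments over grid cells be added as one Ito integral, as in
  \<open>ito_slice\<close> and \<open>riemann_ito\<close>.\<close>

lemma ito_stop:
  assumes I: "ito_integral M F W H a I" and a: "0 \<le> a" "a \<le> t"
  shows "ito_integral M F W (\<lambda>s \<omega>. indicator {..a} s * H s \<omega>) t I"
proof -
  obtain m \<tau> \<eta> where d: "\<And>k. simple_proc_data M F (m k) (\<tau> k) (\<eta> k)"
    and q: "\<And>\<rho>. \<rho> > 0 \<Longrightarrow> (\<lambda>k. prob {\<omega>\<in>space M. qv a (\<lambda>s \<omega>. simple_proc (m k) (\<tau> k) (\<eta> k) s \<omega> - H s \<omega>) \<omega> > ennreal \<rho>}) \<longlonglongrightarrow> 0"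
    and c: "cprob (\<lambda>k. simple_integral_wrt W (m k) (\<tau> k) (\<eta> k) a) I" and pH: "prog a H" and mI: "I \<in> borel_measurable M"
    using I unfolding ito_integral_alt by blast
  have e: "qv t (\<lambda>s \<omega>. simple_proc (m k) (\<lambda>i. min a (\<tau> k i)) (\<lambda>i \<omega>. if \<tau> k i < a then \<eta> k i \<omega> else 0) s \<omega> - indicator {..a} s * H s \<omega>) \<omega>
    = qv a (\<lambda>s \<omega>. simple_proc (m k) (\<tau> k) (\<eta> k) s \<omega> - H s \<omega>) \<omega>" for k \<omega>
    unfolding qv_def simple_proc_data_stop(2)[OF d a(1)]
    by (rule nn_integral_cong) (use a in \<open>auto simp: indicator_def\<close>)
  show ?thesis
    unfolding ito_integral_alt
  proof (intro conjI exI[of _ m] exI[of _ "\<lambda>k i. min a (\<tau> k i)"] exI[of _ "\<lambda>k i \<omega>. if \<tau> k i < a then \<eta> k i \<omega> else 0"] allI impI)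
    show "cprob (\<lambda>k. simple_integral_wrt W (m k) (\<lambda>i. min a (\<tau> k i)) (\<lambda>i \<omega>. if \<tau> k i < a then \<eta> k i \<omega> else 0) t) I"
      using c unfolding simple_proc_data_stop(3)[OF d a, abs_def] .
  qed (use mI prog_stop[OF pH a(1)] q simple_proc_data_stop(1)[OF d a(1)] in \<open>auto simp: e\<close>)
qed

lemma ito_slice:
  assumes I: "ito_integral M F W H a I" and I': "ito_integral M F W H b I'" and ab: "0 \<le> a" "a \<le> b" "b \<le> t"
  shows "ito_integral M F W (\<lambda>s \<omega>. c * (indicator {a<..b} s * H s \<omega>)) t (\<lambda>\<omega>. c * (I' \<omega> - I \<omega>))"
proof -
  have 1: "ito_integral M F W (\<lambda>s \<omega>. indicator {..b} s * H s \<omega>) t I'" using ito_stop[OF I'] ab by simp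
  have 2: "ito_integral M F W (\<lambda>s \<omega>. (-1) * (indicator {..a} s * H s \<omega>)) t (\<lambda>\<omega>. (-1) * I \<omega>)"
    using ito_scale[OF ito_stop[OF I, of t], of "-1"] ab by simp
  have "ito_integral M F W (\<lambda>s \<omega>. c * (indicator {..b} s * H s \<omega> + (-1) * (indicator {..a} s * H s \<omega>))) t (\<lambda>\<omega>. c * (I' \<omega> + (-1) * I \<omega>))"
    using ito_scale[OF ito_add[OF 1 2], of c] ab by simp
  moreover have "(\<lambda>s \<omega>. c * (indicator {..b} s * H s \<omega> + (-1) * (indicator {..a} s * H s \<omega>))) = (\<lambda>s \<omega>. c * (indicator {a<..b} s * H s \<omega>))"
    using ab by (auto simp: fun_eq_iff indicator_def)
  ultimately show ?thesis by simp
qed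

end

text \<open>The half-open cells partition the interval without its left end, so the step process
  takes the value of \<open>g\<close> at the left end of the cell containing
  \<open>u\<close>.\<close>

lemma step_process_value:
  fixes g :: "real \<Rightarrow> real"
  assumes s: "s > 0" and N: "N > 0" and u: "u \<in> {0<..s}"
  defines "\<delta> \<equiv> s / real N"
  shows "\<exists>v\<ge>0. v < u \<and> u - v \<le> \<delta> \<and>
    (\<Sum>i<N. g (real i * \<delta>) * indicator {real i * \<delta><..real (Suc i) * \<delta>} u) = g v"
proof -
  have \<delta>: "\<delta> > 0" and NA: "real N * \<delta> = s" using s N by (auto simp: \<delta>_def)
  \<comment> \<open>Ceiling minus one instead of the floor, because the cells are open on the left
    and closed on the right.\<close>
  define j where "j = nat (\<lceil>u / \<delta>\<rceil> - 1)"
  have "u / \<delta> > 0" using u \<delta> by simp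
  then have c: "\<lceil>u / \<delta>\<rceil> \<ge> 1" by (simp add: le_ceiling_iff)
  then have rj: "real j = of_int \<lceil>u / \<delta>\<rceil> - 1" by (simp add: j_def)
  have "real j < u / \<delta>" "u / \<delta> \<le> real j + 1" using rj by linarith+
  then have j1: "real j * \<delta> < u" and j2: "u \<le> real (Suc j) * \<delta>"
    using \<delta> by (auto simp: field_simps)
  have jN: "j < N"
  proof (rule ccontr)
    assume "\<not> j < N"
    then have "real N * \<delta> \<le> real j * \<delta>" using \<delta> by simp
    then show False using j1 u NA by simp
  qed
  have iff: "u \<in> {real i * \<delta><..real (Suc i) * \<delta>} \<longleftrightarrow> i = j" for i
  proof
    assume i: "u \<in> {real i * \<delta><..real (Suc i) * \<delta>}"
    have "real i * \<delta> < real (Suc j) * \<delta>" using i j2 by (auto intro: less_le_trans)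
    then have "i < Suc j" using \<delta> by (simp only: mult_less_cancel_right_pos of_nat_less_iff)
    moreover have "real j * \<delta> < real (Suc i) * \<delta>" using i j1 by (auto intro: less_le_trans)
    then have "j < Suc i" using \<delta> by (simp only: mult_less_cancel_right_pos of_nat_less_iff)
    ultimately show "i = j" by simp
  qed (use j1 j2 in auto)
  have "(\<Sum>i<N. g (real i * \<delta>) * indicator {real i * \<delta><..real (Suc i) * \<delta>} u) = (\<Sum>i<N. if i = j then g (real j * \<delta>) else 0)"
    by (rule sum.cong) (simp_all only: indicator_def iff, auto)
  also have "\<dots> = g (real j * \<delta>)" using jN by simp
  finally show ?thesis
    using j1 j2 \<delta> by (intro exI[of _ "real j * \<delta>"]) (auto simp: algebra_simps)
qed

context wiener begin

text \<open>A Riemann sum is itself an Ito integral, with \<open>g\<close> replaced by its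
  left-endpoint step function. Left continuity makes the step functions converge, and dominated
  convergence on each path gives convergence of the quadratic variations; the bound on
  \<open>h\<close> may depend on the path.\<close>

lemma riemann_ito:
  assumes s: "s > 0"
    and V: "ito_integral M F W (\<lambda>u \<omega>. g u * h u \<omega>) s V"
    and Z: "\<And>t. t \<in> {0..s} \<Longrightarrow> ito_integral M F W h t (Z t)"
    and hb: "\<And>\<omega> u. \<omega> \<in> space M \<Longrightarrow> u \<in> {0..s} \<Longrightarrow> \<bar>h u \<omega>\<bar> \<le> b \<omega>"
    and gb: "\<And>u. u \<in> {0..s} \<Longrightarrow> \<bar>g u\<bar> \<le> c"
    and gl: "\<And>u. u \<in> {0<..s} \<Longrightarrow> (g \<longlongrightarrow> g u) (at_left u)"
  shows "cprob (\<lambda>N \<omega>. \<Sum>i<N. g (real i * (s / real N)) * (Z (real (Suc i) * (s / real N)) \<omega> - Z (real i * (s / real N)) \<omega>)) V"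
proof (rule ito_continuity[OF V])
  let ?\<delta> = "\<lambda>N. s / real N"
  let ?g = "\<lambda>N u. \<Sum>i<N. g (real i * ?\<delta> N) * indicator {real i * ?\<delta> N<..real (Suc i) * ?\<delta> N} u"
  have le: "real i * ?\<delta> N \<le> s" if "i \<le> N" "N > 0" for i N
  proof -
    have "real i * ?\<delta> N \<le> real N * ?\<delta> N" using that s by (intro mult_right_mono) auto
    then show ?thesis using that by simp
  qed
  have I: "ito_integral M F W (\<lambda>u \<omega>. \<Sum>i<N. g (real i * ?\<delta> N) * (indicator {real i * ?\<delta> N<..real (Suc i) * ?\<delta> N} u * h u \<omega>)) s
      (\<lambda>\<omega>. \<Sum>i<N. g (real i * ?\<delta> N) * (Z (real (Suc i) * ?\<delta> N) \<omega> - Z (real i * ?\<delta> N) \<omega>))" for N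
  proof (rule ito_sum)
    fix i assume i: "i \<in> {..<N}"
    then have "real i * ?\<delta> N \<le> s" "real (Suc i) * ?\<delta> N \<le> s" using le[of i N] le[of "Suc i" N] by auto
    moreover have "0 \<le> real i * ?\<delta> N" "real i * ?\<delta> N \<le> real (Suc i) * ?\<delta> N"
      using s by (auto intro!: mult_right_mono divide_right_mono)
    ultimately show "ito_integral M F W (\<lambda>u \<omega>. g (real i * ?\<delta> N) * (indicator {real i * ?\<delta> N<..real (Suc i) * ?\<delta> N} u * h u \<omega>)) s
      (\<lambda>\<omega>. g (real i * ?\<delta> N) * (Z (real (Suc i) * ?\<delta> N) \<omega> - Z (real i * ?\<delta> N) \<omega>))"
      by (intro ito_slice Z) auto
  qed (use s in auto)
  then show "ito_integral M F W (\<lambda>u \<omega>. ?g N u * h u \<omega>) s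
      (\<lambda>\<omega>. \<Sum>i<N. g (real i * ?\<delta> N) * (Z (real (Suc i) * ?\<delta> N) \<omega> - Z (real i * ?\<delta> N) \<omega>))" for N
    by (simp only: sum_distrib_right mult.assoc)
  show "0 \<le> s" using s by simp
  fix \<omega> assume w: "\<omega> \<in> space M"
  define D where "D N u = ?g N u * h u \<omega> - g u * h u \<omega>" for N u
  have pD: "prog s (\<lambda>u \<omega>. ?g N u * h u \<omega> - g u * h u \<omega>)" for N
    using prog_diff[OF ito_prog[OF I[of N]] ito_prog[OF V]] by (simp only: sum_distrib_right mult.assoc)
  let ?c = "\<lambda>u. max 0 (min u s)"
  have [measurable]: "(\<lambda>u. D N (?c u)) \<in> borel_measurable borel" for N
    using prog_path[OF pD w, of N] s by (simp add: D_def)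
  have gv: "\<exists>v\<ge>0. v < u \<and> u - v \<le> ?\<delta> N \<and> ?g N u = g v" if "u \<in> {0<..s}" "N > 0" for u N
    by (rule step_process_value[OF s that(2,1)])
  have c0: "c \<ge> 0" using gb[of 0] s by auto
  have "(\<lambda>N. \<integral>\<^sup>+u. ennreal ((D N (?c u))\<^sup>2) * indicator {0..s} u \<partial>lborel) \<longlonglongrightarrow> (\<integral>\<^sup>+u. 0 \<partial>(lborel :: real measure))"
  proof (rule nn_integral_dominated_convergence[where w="\<lambda>u. ennreal ((2 * c * b \<omega>)\<^sup>2) * indicator {0..s} u"])
    show "(\<integral>\<^sup>+u. ennreal ((2 * c * b \<omega>)\<^sup>2) * indicator {0..s} u \<partial>lborel) < \<infinity>"
      using s by (simp add: nn_integral_cmult_indicator ennreal_mult_less_top)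
    \<comment> \<open>The point 0 belongs to no cell, so all step functions vanish there; it is
      discarded as a null set.\<close>
    have n0: "AE u in lborel. u \<noteq> (0::real)" by (rule AE_lborel_singleton)
    show "AE u in lborel. ennreal ((D N (?c u))\<^sup>2) * indicator {0..s} u \<le> ennreal ((2 * c * b \<omega>)\<^sup>2) * indicator {0..s} u" for N
      using n0
    proof eventually_elim
      fix u :: real assume u0: "u \<noteq> 0"
      show "ennreal ((D N (?c u))\<^sup>2) * indicator {0..s} u \<le> ennreal ((2 * c * b \<omega>)\<^sup>2) * indicator {0..s} u"
      proof (cases "u \<in> {0..s}")
        case True
        have "\<bar>?g N u\<bar> \<le> c"
        proof (cases "N = 0")
          case False
          then obtain v where "v \<ge> 0" "v < u" "?g N u = g v" using gv[of u N] True u0 by auto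
          then show ?thesis using gb[of v] True by simp
        qed (use c0 in simp)
        then have "\<bar>?g N u - g u\<bar> \<le> 2 * c" using gb[OF True] by linarith
        then have "\<bar>?g N u - g u\<bar> * \<bar>h u \<omega>\<bar> \<le> 2 * c * b \<omega>" by (intro mult_mono hb[OF w True]) (use c0 in auto)
        then have "\<bar>D N u\<bar> \<le> 2 * c * b \<omega>" unfolding D_def left_diff_distrib[symmetric] abs_mult .
        then have "\<bar>D N u\<bar> \<le> \<bar>2 * c * b \<omega>\<bar>" by (rule order_trans[OF _ abs_ge_self])
        then show ?thesis using True by (auto simp: abs_le_square_iff)
      qed simp
    qed
    show "AE u in lborel. (\<lambda>N. ennreal ((D N (?c u))\<^sup>2) * indicator {0..s} u) \<longlonglongrightarrow> 0"
      using n0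
    proof eventually_elim
      fix u :: real assume u0: "u \<noteq> 0"
      show "(\<lambda>N. ennreal ((D N (?c u))\<^sup>2) * indicator {0..s} u) \<longlonglongrightarrow> 0"
      proof (cases "u \<in> {0..s}")
        case True
        then have us: "u \<in> {0<..s}" using u0 by auto
        have "(\<lambda>N. ?g N u) \<longlonglongrightarrow> g u"
        proof (rule LIMSEQ_I)
          fix e :: real assume "e > 0"
          then have "\<forall>\<^sub>F v in at_left u. dist (g v) (g u) < e" by (rule tendstoD[OF gl[OF us]])
          then obtain y where y: "y < u" "\<And>v. v > y \<Longrightarrow> v < u \<Longrightarrow> dist (g v) (g u) < e"
            unfolding eventually_at_left_field by blast
          obtain N0 :: nat where N0: "s / (u - y) < real N0" using reals_Archimedean2 by blast
          have "norm (?g N u - g u) < e" if N: "N \<ge> max 1 N0" for N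
          proof -
            have "s / (u - y) < real N" using N0 N by linarith
            then have d: "?\<delta> N < u - y" using y(1) N by (simp add: field_simps)
            obtain v where v: "v < u" "u - v \<le> ?\<delta> N" "?g N u = g v" using gv[OF us, of N] N by auto
            then have "y < v" using d by linarith
            from y(2)[OF this v(1)] show ?thesis using v(3) by (simp add: dist_real_def)
          qed
          then show "\<exists>N0. \<forall>N\<ge>N0. norm (?g N u - g u) < e" by blast
        qed
        then have "(\<lambda>N. (?g N u * h u \<omega> - g u * h u \<omega>)\<^sup>2) \<longlonglongrightarrow> (g u * h u \<omega> - g u * h u \<omega>)\<^sup>2"
          by (intro tendsto_power tendsto_diff tendsto_mult tendsto_const)
        then have "(\<lambda>N. ennreal ((D N u)\<^sup>2)) \<longlonglongrightarrow> ennreal 0"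
          unfolding D_def by (intro tendsto_ennrealI) simp
        then show ?thesis using True by simp
      qed simp
    qed
  qed auto
  then show "(\<lambda>N. qv s (\<lambda>u \<omega>. ?g N u * h u \<omega> - g u * h u \<omega>) \<omega>) \<longlonglongrightarrow> 0"
    using s by (simp add: qv_clamp D_def)
qed

end

section \<open>Moments and Hoelder continuity\<close>

lemma sum_even_indices:
  fixes f :: "nat \<Rightarrow> real"
  assumes "\<And>j. f (2 * j + 1) = 0"
  shows "(\<Sum>l\<le>2 * m. f l) = (\<Sum>j\<le>m. f (2 * j))"
proof (induction m)
  case (Suc m)
  have "{..2 * Suc m} = insert (2 * m + 2) (insert (2 * m + 1) {..2 * m})" by auto
  with Suc assms[of m] show ?case by simp
qed simp

text \<open>A crude Young inequality: the larger of the two numbers alone dominates the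
  product.\<close>

lemma power_mult_le_add_power:
  fixes a b :: real
  assumes "a \<ge> 0" "b \<ge> 0" "j \<le> m"
  shows "a ^ (m - j) * b ^ j \<le> a ^ m + b ^ m"
proof (cases "a \<le> b")
  case True
  then have "a ^ (m - j) * b ^ j \<le> b ^ (m - j) * b ^ j" using assms by (intro mult_right_mono power_mono) auto
  also have "\<dots> = b ^ m" using assms by (simp add: power_add[symmetric])
  finally show ?thesis using assms by (simp add: add_increasing)
next
  case False
  then have "a ^ (m - j) * b ^ j \<le> a ^ (m - j) * a ^ j" using assms by (intro mult_left_mono power_mono) auto
  also have "\<dots> = a ^ m" using assms by (simp add: power_add[symmetric])
  finally show ?thesis using assms by (simp add: add_increasing2)
qed

section \<open>Even moments of integral sums\<close>

context wiener begin

text \<open>Odd Wiener moments vanish, so in each inductive step the new terms carry at least one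
  full power of \<open>\<delta>\<close>. They are of order \<open>(i + 1) ^ (m - 1)\<close>, and
  \<open>i ^ m + (i + 1) ^ (m - 1) \<le> (i + 1) ^ m\<close> closes the induction. Only a common
  bound on the moments of the individual coefficients is needed, and \<open>C\<close> depends on
  \<open>m\<close> alone.\<close>

lemma gsum_moment_bound:
  assumes m: "m \<ge> 1"
  obtains C where "C \<ge> 1"
    "\<And>N \<tau> g \<delta> A j. simple_proc_data M F N \<tau> g \<Longrightarrow> \<delta> > 0 \<Longrightarrow> (\<And>i. i < N \<Longrightarrow> \<tau> (Suc i) - \<tau> i = \<delta>) \<Longrightarrow> A \<ge> 0 \<Longrightarrow>
      (\<And>i. i < N \<Longrightarrow> expectation (\<lambda>\<omega>. g i \<omega> ^ (2 * m)) \<le> A) \<Longrightarrow> j \<le> N \<Longrightarrow>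
      expectation (\<lambda>\<omega>. gsum W j \<tau> g \<omega> ^ (2 * m)) \<le> (C * (real j * \<delta>)) ^ m * A"
proof -
  define c :: "nat \<Rightarrow> real" where "c j = fact (2 * j) / (2 ^ j * fact j)" for j
  \<comment> \<open>The factor 2 anticipates the sum \<open>A + A\<close> from the Young step. The
    summand 1 ensures \<open>C \<ge> 1\<close>, so that lower powers of \<open>C\<close> can be
    raised to \<open>m - 1\<close>.\<close>
  define C where "C = 1 + (\<Sum>j=1..m. 2 * real (2 * m choose (2 * j)) * c j)"
  have c0: "c j \<ge> 0" for j by (simp add: c_def)
  have "(\<Sum>j=1..m. 2 * real (2 * m choose (2 * j)) * c j) \<ge> 0" using c0 by (intro sum_nonneg mult_nonneg_nonneg) auto
  then have C: "C \<ge> 1" by (simp add: C_def)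
  show thesis
  proof (rule that[OF C])
    fix N \<tau> g \<delta> A j
    assume d: "simple_proc_data M F N \<tau> g" and \<delta>: "\<delta> > (0::real)"
      and t: "\<And>i. i < N \<Longrightarrow> \<tau> (Suc i) - \<tau> i = \<delta>" and A: "A \<ge> (0::real)"
      and g: "\<And>i. i < N \<Longrightarrow> expectation (\<lambda>\<omega>. g i \<omega> ^ (2 * m)) \<le> A" and j: "j \<le> N"
    show "expectation (\<lambda>\<omega>. gsum W j \<tau> g \<omega> ^ (2 * m)) \<le> (C * (real j * \<delta>)) ^ m * A"
      using j
    proof (induction j)
      case 0
      then show ?case using m A by (simp add: gsum_def power_0_left)
    next
      case (Suc i)
      then have i: "i < N" "i \<le> N" by auto
      define S where "S = gsum W i \<tau> g"
      \<comment> \<open>The scale that balances Young's inequality: after division by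
        \<open>L ^ m\<close> the moment of \<open>S\<close> is at most \<open>A\<close>, like that
        of \<open>g i\<close>. Using \<open>real i + 1\<close> keeps it positive at the first
        step.\<close>
      define L where "L = C * ((real i + 1) * \<delta>)"
      have L: "L > 0" using C \<delta> by (simp add: L_def)
      have t': "0 \<le> \<tau> i" "\<tau> i \<le> \<tau> (Suc i)" using data_nonneg[OF d i(2)] t[OF i(1)] \<delta> by auto
      have IH: "expectation (\<lambda>\<omega>. S \<omega> ^ (2 * m)) \<le> (C * (real i * \<delta>)) ^ m * A"
        using Suc by (simp add: S_def)
      have iS: "integrable M (\<lambda>\<omega>. S \<omega> ^ k)" for k unfolding S_def by (rule gsum_moments(2)[OF d i(2)])
      obtain b where b: "\<And>i \<omega>. i < N \<Longrightarrow> \<omega> \<in> space M \<Longrightarrow> \<bar>g i \<omega>\<bar> \<le> b" using data_bound[OF d] by blast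
      have gm: "g i \<in> borel_measurable M" using d i meas_F_M[of "g i" "\<tau> i" borel] by (auto simp: simple_proc_data_def)
      have iSg: "integrable M (\<lambda>\<omega>. S \<omega> ^ k * g i \<omega> ^ l)" for k l
        by (rule integrable_mult_bounded[OF iS, where b="b ^ l"])
           (use gm b[OF i(1)] in \<open>auto simp: power_abs intro!: power_mono\<close>)
      have ig: "integrable M (\<lambda>\<omega>. g i \<omega> ^ l)" for l using iSg[of 0 l] by simp
      have tm: "expectation (\<lambda>\<omega>. S \<omega> ^ (2 * m - 2 * j) * g i \<omega> ^ (2 * j)) \<le> L ^ (m - j) * (2 * A)" if jm: "j \<le> m" for j
      proof -
        have "expectation (\<lambda>\<omega>. S \<omega> ^ (2 * m - 2 * j) * g i \<omega> ^ (2 * j))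
          \<le> expectation (\<lambda>\<omega>. L ^ (m - j) * (S \<omega> ^ (2 * m) / L ^ m + g i \<omega> ^ (2 * m)))"
        proof (rule integral_mono[OF iSg])
          show "integrable M (\<lambda>\<omega>. L ^ (m - j) * (S \<omega> ^ (2 * m) / L ^ m + g i \<omega> ^ (2 * m)))"
            using iS ig by simp
          fix \<omega>
          have e: "2 * m - 2 * j = 2 * (m - j)" by simp
          have "S \<omega> ^ (2 * m - 2 * j) * g i \<omega> ^ (2 * j) = L ^ (m - j) * (((S \<omega>)\<^sup>2 / L) ^ (m - j) * ((g i \<omega>)\<^sup>2) ^ j)"
            using L unfolding e by (simp add: power_mult power_divide)
          also have "\<dots> \<le> L ^ (m - j) * (((S \<omega>)\<^sup>2 / L) ^ m + ((g i \<omega>)\<^sup>2) ^ m)"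
            using L jm by (intro mult_left_mono power_mult_le_add_power) auto
          also have "\<dots> = L ^ (m - j) * (S \<omega> ^ (2 * m) / L ^ m + g i \<omega> ^ (2 * m))"
            by (simp add: power_mult power_divide)
          finally show "S \<omega> ^ (2 * m - 2 * j) * g i \<omega> ^ (2 * j) \<le> L ^ (m - j) * (S \<omega> ^ (2 * m) / L ^ m + g i \<omega> ^ (2 * m))" .
        qed
        also have "\<dots> = L ^ (m - j) * (expectation (\<lambda>\<omega>. S \<omega> ^ (2 * m)) / L ^ m + expectation (\<lambda>\<omega>. g i \<omega> ^ (2 * m)))"
          using iS ig by simp
        also have "\<dots> \<le> L ^ (m - j) * (A + A)"
        proof (intro mult_left_mono add_mono g i)
          have "expectation (\<lambda>\<omega>. S \<omega> ^ (2 * m)) \<le> L ^ m * A"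
            using IH C \<delta> A unfolding L_def by (elim order_trans) (intro mult_right_mono power_mono mult_left_mono, auto)
          then show "expectation (\<lambda>\<omega>. S \<omega> ^ (2 * m)) / L ^ m \<le> A" using L by (simp add: field_simps)
        qed (use L in auto)
        finally show ?thesis by simp
      qed
      let ?D = "\<lambda>\<omega>. W (\<tau> (Suc i)) \<omega> - W (\<tau> i) \<omega>"
      have "expectation (\<lambda>\<omega>. gsum W (Suc i) \<tau> g \<omega> ^ (2 * m)) =
        (\<Sum>l\<le>2 * m. real (2 * m choose l) * (expectation (\<lambda>\<omega>. S \<omega> ^ (2 * m - l) * g i \<omega> ^ l) * expectation (\<lambda>\<omega>. ?D \<omega> ^ l)))"
        unfolding S_def using gsum_moments(3)[OF d i(2,1)] by simp
      also have "\<dots> = (\<Sum>j\<le>m. real (2 * m choose (2 * j)) * (expectation (\<lambda>\<omega>. S \<omega> ^ (2 * m - 2 * j) * g i \<omega> ^ (2 * j)) * (c j * \<delta> ^ j)))"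
        by (subst sum_even_indices) (simp_all only: increment_moments(2,3)[OF t'] t[OF i(1)] c_def mult_zero_right)
      \<comment> \<open>The term \<open>j = 0\<close> is left to the induction hypothesis; only the
        others enlarge the constant.\<close>
      also have "\<dots> = expectation (\<lambda>\<omega>. S \<omega> ^ (2 * m)) + (\<Sum>j=1..m. real (2 * m choose (2 * j)) * (expectation (\<lambda>\<omega>. S \<omega> ^ (2 * m - 2 * j) * g i \<omega> ^ (2 * j)) * (c j * \<delta> ^ j)))"
        by (subst atMost_atLeast0, subst sum.atLeast_Suc_atMost) (simp_all add: c_def)
      also have "\<dots> \<le> (C * (real i * \<delta>)) ^ m * A + (\<Sum>j=1..m. (2 * real (2 * m choose (2 * j)) * c j) * (\<delta> ^ m * C ^ (m - 1) * (real i + 1) ^ (m - 1) * A))"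
      proof (intro add_mono IH sum_mono)
        fix j assume j: "j \<in> {1..m}"
        have "real (2 * m choose (2 * j)) * (expectation (\<lambda>\<omega>. S \<omega> ^ (2 * m - 2 * j) * g i \<omega> ^ (2 * j)) * (c j * \<delta> ^ j))
          \<le> real (2 * m choose (2 * j)) * (L ^ (m - j) * (2 * A) * (c j * \<delta> ^ j))"
          using j c0 \<delta> by (intro mult_left_mono mult_right_mono tm) auto
        also have "\<dots> = (2 * real (2 * m choose (2 * j)) * c j) * ((L ^ (m - j) * \<delta> ^ j) * A)" by (simp add: mult_ac)
        also have "\<dots> \<le> (2 * real (2 * m choose (2 * j)) * c j) * ((\<delta> ^ m * C ^ (m - 1) * (real i + 1) ^ (m - 1)) * A)"
        proof (intro mult_left_mono mult_right_mono A)
          have "L ^ (m - j) * \<delta> ^ j = \<delta> ^ m * (C ^ (m - j) * (real i + 1) ^ (m - j))"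
          proof -
            have "\<delta> ^ m = \<delta> ^ (m - j) * \<delta> ^ j" using j by (simp add: power_add[symmetric])
            then show ?thesis by (simp add: L_def power_mult_distrib mult_ac)
          qed
          also have "\<dots> \<le> \<delta> ^ m * (C ^ (m - 1) * (real i + 1) ^ (m - 1))"
            using \<delta> C j by (intro mult_left_mono mult_mono power_increasing) auto
          finally show "L ^ (m - j) * \<delta> ^ j \<le> \<delta> ^ m * C ^ (m - 1) * (real i + 1) ^ (m - 1)" by (simp add: mult.assoc)
        qed (use c0 in auto)
        finally show "real (2 * m choose (2 * j)) * (expectation (\<lambda>\<omega>. S \<omega> ^ (2 * m - 2 * j) * g i \<omega> ^ (2 * j)) * (c j * \<delta> ^ j))
          \<le> (2 * real (2 * m choose (2 * j)) * c j) * (\<delta> ^ m * C ^ (m - 1) * (real i + 1) ^ (m - 1) * A)" .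
      qed
      also have "\<dots> = (C * (real i * \<delta>)) ^ m * A + (C - 1) * (\<delta> ^ m * C ^ (m - 1) * (real i + 1) ^ (m - 1) * A)"
        by (simp add: C_def sum_distrib_right)
      also have "\<dots> \<le> (C * (real i * \<delta>)) ^ m * A + C * (\<delta> ^ m * C ^ (m - 1) * (real i + 1) ^ (m - 1) * A)"
        using C \<delta> A by (intro add_left_mono mult_right_mono) auto
      also have "\<dots> = (C ^ m * \<delta> ^ m * A) * (real i ^ m + (real i + 1) ^ (m - 1))"
        using m by (cases m) (auto simp: power_mult_distrib algebra_simps)
      also have "\<dots> \<le> (C ^ m * \<delta> ^ m * A) * (real i + 1) ^ m"
      proof (intro mult_left_mono)
        have "real i ^ m = real i * real i ^ (m - 1)" using m by (cases m) auto
        also have "\<dots> \<le> real i * (real i + 1) ^ (m - 1)" by (intro mult_left_mono power_mono) auto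
        finally have "real i ^ m + (real i + 1) ^ (m - 1) \<le> (real i + 1) * (real i + 1) ^ (m - 1)" by (simp add: algebra_simps)
        also have "\<dots> = (real i + 1) ^ m" using m by (cases m) auto
        finally show "real i ^ m + (real i + 1) ^ (m - 1) \<le> (real i + 1) ^ m" .
      qed (use C \<delta> A in auto)
      also have "\<dots> = (C * (real (Suc i) * \<delta>)) ^ m * A" by (simp add: power_mult_distrib mult_ac add.commute)
      finally show ?case .
    qed
  qed
qed

lemma simple_proc_data_shift:
  assumes d: "simple_proc_data M F N \<tau> g" and a: "a \<le> b" "b \<le> N"
  shows "simple_proc_data M F (b - a) (\<lambda>i. \<tau> (a + i)) (\<lambda>i. g (a + i))"
    "gsum W (b - a) (\<lambda>i. \<tau> (a + i)) (\<lambda>i. g (a + i)) \<omega> = gsum W b \<tau> g \<omega> - gsum W a \<tau> g \<omega>"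
proof -
  obtain B where "\<And>i \<omega>. i < N \<Longrightarrow> \<omega> \<in> space M \<Longrightarrow> \<bar>g i \<omega>\<bar> \<le> B" using data_bound[OF d] by blast
  then show "simple_proc_data M F (b - a) (\<lambda>i. \<tau> (a + i)) (\<lambda>i. g (a + i))"
    using d a data_nonneg[OF d, of a] unfolding simple_proc_data_def by (auto intro!: exI[of _ B])
  have "gsum W b \<tau> g \<omega> - gsum W a \<tau> g \<omega> = (\<Sum>i\<in>{a..<b}. g i \<omega> * (W (\<tau> (Suc i)) \<omega> - W (\<tau> i) \<omega>))"
    unfolding gsum_def using a by (simp add: lessThan_atLeast0 sum_diff_nat_ivl[of 0 a b, symmetric])
  also have "\<dots> = gsum W (b - a) (\<lambda>i. \<tau> (a + i)) (\<lambda>i. g (a + i)) \<omega>"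
    unfolding gsum_def using a sum.shift_bounds_nat_ivl[of "\<lambda>i. g i \<omega> * (W (\<tau> (Suc i)) \<omega> - W (\<tau> i) \<omega>)" 0 a "b - a"]
    by (simp add: lessThan_atLeast0 add.commute)
  finally show "gsum W (b - a) (\<lambda>i. \<tau> (a + i)) (\<lambda>i. g (a + i)) \<omega> = gsum W b \<tau> g \<omega> - gsum W a \<tau> g \<omega>" ..
qed

end

text \<open>Move \<open>a\<close> up and \<open>b\<close> down to even indices, at the cost of one
  unit step each, then halve all indices and continue on the coarser grid. Thus every level below
  the top contributes twice and the top level once.\<close>

lemma dyadic_chaining:
  fixes B d :: "nat \<Rightarrow> real"
  assumes "\<And>l i. l \<le> j \<Longrightarrow> (i + 1) * 2 ^ l \<le> n \<Longrightarrow> \<bar>B ((i + 1) * 2 ^ l) - B (i * 2 ^ l)\<bar> \<le> d l"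
    and "\<And>l. d l \<ge> 0" "a \<le> b" "b \<le> n" "b - a \<le> 2 ^ j"
  shows "\<bar>B b - B a\<bar> \<le> d j + 2 * (\<Sum>l<j. d l)"
  using assms
proof (induction j arbitrary: B n d a b)
  case 0
  then consider "b = a" | "b = a + 1" by fastforce
  then show ?case
  proof cases
    case 2
    then show ?thesis using 0(1)[of 0 a] 0(4) by simp
  qed (use 0(2) in simp)
next
  case (Suc j)
  note d0 = Suc.prems(2)
  have unit: "\<bar>B x - B (2 * (x div 2))\<bar> \<le> d 0" if "x \<le> n" for x
  proof (cases "even x")
    case False
    then have "x = 2 * (x div 2) + 1" by presburger
    then show ?thesis using Suc.prems(1)[of 0 "2 * (x div 2)"] that by simp
  qed (use d0 in simp)
  have unit': "\<bar>B (2 * ((x + 1) div 2)) - B x\<bar> \<le> d 0" if "2 * ((x + 1) div 2) \<le> n" for x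
  proof (cases "even x")
    case False
    then have "2 * ((x + 1) div 2) = x + 1" by presburger
    then show ?thesis using Suc.prems(1)[of 0 x] that by simp
  next
    case True
    then have "2 * ((x + 1) div 2) = x" by presburger
    then show ?thesis using d0 by simp
  qed
  show ?case
  proof (cases "(a + 1) div 2 \<le> b div 2")
    case True
    have "\<bar>B (2 * (b div 2)) - B (2 * ((a + 1) div 2))\<bar> \<le> d (Suc j) + 2 * (\<Sum>l<j. d (Suc l))"
    proof (rule Suc.IH[of "n div 2" "\<lambda>i. B (2 * i)" "\<lambda>l. d (Suc l)"])
      fix l i assume l: "l \<le> j" "(i + 1) * 2 ^ l \<le> n div 2"
      then have "(i + 1) * 2 ^ Suc l \<le> n" by (simp add: mult.left_commute)
      then show "\<bar>B (2 * ((i + 1) * 2 ^ l)) - B (2 * (i * 2 ^ l))\<bar> \<le> d (Suc l)"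
        using Suc.prems(1)[of "Suc l" i] l by (simp add: mult.left_commute)
    qed (use d0 True Suc.prems(3-5) in \<open>auto intro: div_le_mono\<close>)
    moreover have "\<bar>B b - B (2 * (b div 2))\<bar> \<le> d 0" using unit Suc.prems by simp
    moreover have "\<bar>B (2 * ((a + 1) div 2)) - B a\<bar> \<le> d 0"
      using Suc.prems(4) True by (intro unit') linarith
    moreover have "(\<Sum>l<Suc j. d l) = d 0 + (\<Sum>l<j. d (Suc l))" by (rule sum.lessThan_Suc_shift)
    ultimately show ?thesis by linarith
  next
    case False
    \<comment> \<open>The inward rounding crosses only if both indices are the same odd
      number.\<close>
    then have "a = b" using Suc.prems(3) by linarith
    then show ?thesis using d0 by (simp add: sum_nonneg add_nonneg_nonneg)
  qed
qed

text \<open>Take the smallest \<open>j\<close> with \<open>b - a \<le> 2 ^ j\<close>. Level bounds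
  grow with ratio \<open>2 powr (1/4) \<ge> 7/6\<close>, so all levels below \<open>j\<close> sum to
  at most 6 times the top one, giving \<open>1 + 2 * 6 = 13\<close>; replacing \<open>2 ^ j\<close>
  by \<open>2 * (b - a)\<close> costs another factor at most 2.\<close>

lemma dyadic_hoelder:
  fixes B :: "nat \<Rightarrow> real"
  assumes D: "D \<ge> 0" and h: "\<And>l i. l \<le> k \<Longrightarrow> (i + 1) * 2 ^ l \<le> (2::nat) ^ k \<Longrightarrow>
      \<bar>B ((i + 1) * 2 ^ l) - B (i * 2 ^ l)\<bar> \<le> D * (2 ^ l / 2 ^ k) powr (1/4)"
    and ab: "a \<le> b" "b \<le> 2 ^ k"
  shows "\<bar>B b - B a\<bar> \<le> 26 * D * ((real b - real a) / 2 ^ k) powr (1/4)"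
proof (cases "a = b")
  case False
  define \<rho> :: real where "\<rho> = 2 powr (1/4)"
  have \<rho>4: "\<rho> ^ 4 = 2" by (simp add: \<rho>_def powr_power)
  have \<rho>1: "\<rho> \<ge> 7/6"
  proof (rule ccontr)
    assume "\<not> \<rho> \<ge> 7/6"
    then have "\<rho> ^ 4 \<le> (7/6) ^ 4" by (intro power_mono) (auto simp: \<rho>_def)
    then show False unfolding \<rho>4 by (simp add: power_divide)
  qed
  define j where "j = (LEAST j. b - a \<le> 2 ^ j)"
  have j: "b - a \<le> 2 ^ j" unfolding j_def by (rule LeastI[of _ "b - a"]) (simp add: less_imp_le[OF less_exp])
  have jk: "j \<le> k" unfolding j_def by (rule Least_le) (use ab in simp)
  have j2: "2 ^ j \<le> 2 * (b - a)"
  proof (cases j)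
    case 0 then show ?thesis using False ab by simp
  next
    case (Suc i)
    then have "\<not> b - a \<le> 2 ^ i" using not_less_Least[of i "\<lambda>j. b - a \<le> 2 ^ j"] by (simp add: j_def)
    then show ?thesis using Suc by simp
  qed
  define E where "E = D * (1 / 2 ^ k) powr (1/4)"
  have E: "E \<ge> 0" using D by (simp add: E_def)
  have dl: "D * (2 ^ l / 2 ^ k) powr (1/4) = E * \<rho> ^ l" for l
  proof -
    have "(2 ^ l / 2 ^ k :: real) powr (1/4) = (2 ^ l) powr (1/4) * (1 / 2 ^ k) powr (1/4)"
      by (subst powr_mult[symmetric]) auto
    also have "(2 ^ l :: real) powr (1/4) = \<rho> ^ l"
      by (simp add: \<rho>_def powr_realpow[symmetric] powr_powr mult.commute)
    finally show ?thesis by (simp add: E_def mult_ac)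
  qed
  have "\<bar>B b - B a\<bar> \<le> E * \<rho> ^ j + 2 * (\<Sum>l<j. E * \<rho> ^ l)"
    by (rule dyadic_chaining[where n="2 ^ k"]) (use h jk ab j E \<rho>1 in \<open>auto simp: dl\<close>)
  also have "\<dots> \<le> 13 * (E * \<rho> ^ j)"
  proof -
    have "(\<Sum>l<j. \<rho> ^ l) = (\<rho> ^ j - 1) / (\<rho> - 1)" using \<rho>1 by (simp add: geometric_sum)
    also have "\<dots> \<le> \<rho> ^ j / (1/6)" using \<rho>1 by (intro frac_le) auto
    finally have "E * (\<Sum>l<j. \<rho> ^ l) \<le> E * (6 * \<rho> ^ j)" using E by (intro mult_left_mono) auto
    moreover have "(\<Sum>l<j. E * \<rho> ^ l) = E * (\<Sum>l<j. \<rho> ^ l)" by (rule sum_distrib_left[symmetric])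
    ultimately show ?thesis by simp
  qed
  also have "\<dots> = 13 * D * (2 ^ j / 2 ^ k) powr (1/4)" using dl[of j] by simp
  also have "\<dots> \<le> 13 * D * (2 * ((real b - real a) / 2 ^ k)) powr (1/4)"
  proof (intro mult_left_mono powr_mono2)
    have "real (2 ^ j) \<le> real (2 * (b - a))" using j2 by (simp only: of_nat_le_iff)
    then have "(2::real) ^ j \<le> 2 * (real b - real a)" using ab by (simp add: of_nat_diff)
    then show "2 ^ j / 2 ^ k \<le> 2 * ((real b - real a) / 2 ^ k)" by (simp add: divide_right_mono)
  qed (use D in auto)
  also have "\<dots> = 13 * D * (\<rho> * ((real b - real a) / 2 ^ k) powr (1/4))"
    using ab by (subst powr_mult) (auto simp: \<rho>_def)
  also have "\<dots> \<le> 13 * D * (2 * ((real b - real a) / 2 ^ k) powr (1/4))"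
  proof (intro mult_left_mono mult_right_mono)
    show "\<rho> \<le> 2" unfolding \<rho>_def using powr_mono[of "1/4" 1 "2::real"] by simp
  qed (use D in auto)
  finally show ?thesis by simp
qed simp

text \<open>Summation by parts against increasing weights: their total variation is at most
  \<open>Q\<close>, and the terminal weight contributes once more, hence the 2. The variation of
  \<open>x\<close> itself never enters.\<close>

lemma abel_monotone_bound:
  fixes q x :: "nat \<Rightarrow> real"
  assumes ab: "a \<le> b" and q: "\<And>i. 0 \<le> q i" "\<And>i j. i \<le> j \<Longrightarrow> j < b \<Longrightarrow> q i \<le> q j" "\<And>i. i < b \<Longrightarrow> q i \<le> Q"
    and x: "\<And>i. a \<le> i \<Longrightarrow> i \<le> b \<Longrightarrow> \<bar>x i - x a\<bar> \<le> E" and E: "E \<ge> 0" "Q \<ge> 0"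
  shows "\<bar>\<Sum>i\<in>{a..<b}. q i * (x (Suc i) - x i)\<bar> \<le> 2 * Q * E"
proof (cases "a = b")
  case False
  define S where "S c = (\<Sum>i\<in>{a..<c}. q i * (x (Suc i) - x i))" for c
  \<comment> \<open>The invariant removes the terminal term of the summation by parts; what is left
    is controlled by the growth of the weights so far.\<close>
  have "\<bar>S (Suc c) - q c * (x (Suc c) - x a)\<bar> \<le> (q c - q a) * E" if "a \<le> c" "c < b" for c
    using that
  proof (induction c rule: dec_induct)
    case base
    then show ?case by (simp add: S_def)
  next
    case (step c)
    have "S (Suc (Suc c)) - q (Suc c) * (x (Suc (Suc c)) - x a)
      = (S (Suc c) - q c * (x (Suc c) - x a)) - (q (Suc c) - q c) * (x (Suc c) - x a)"
      using step by (simp add: S_def algebra_simps)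
    also have "\<bar>\<dots>\<bar> \<le> (q c - q a) * E + (q (Suc c) - q c) * E"
    proof (rule order_trans[OF abs_triangle_ineq4 add_mono])
      show "\<bar>S (Suc c) - q c * (x (Suc c) - x a)\<bar> \<le> (q c - q a) * E" using step by simp
      show "\<bar>(q (Suc c) - q c) * (x (Suc c) - x a)\<bar> \<le> (q (Suc c) - q c) * E"
        using q(2)[of c "Suc c"] step x[of "Suc c"] by (simp add: abs_mult mult_left_mono)
    qed
    finally show ?case by (simp add: algebra_simps)
  qed
  from this[of "b - 1"] have "\<bar>S b - q (b - 1) * (x b - x a)\<bar> \<le> (q (b - 1) - q a) * E" using ab False by simp
  moreover have "\<bar>q (b - 1) * (x b - x a)\<bar> \<le> q (b - 1) * E"
    using q(1) x[of b] ab by (simp add: abs_mult mult_left_mono)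
  ultimately have "\<bar>S b\<bar> \<le> q (b - 1) * E + (q (b - 1) - q a) * E" by linarith
  also have "\<dots> \<le> 2 * q (b - 1) * E" using q(1)[of a] E(1) by (simp add: algebra_simps)
  also have "\<dots> \<le> 2 * Q * E" using q(3)[of "b - 1"] False ab E by (intro mult_right_mono) auto
  finally show ?thesis by (simp add: S_def)
qed (use E in simp)

section \<open>Hoelder moments on a dyadic grid\<close>

context wiener begin

lemma integrable_bounded:
  fixes f :: "'a \<Rightarrow> real"
  assumes "f \<in> borel_measurable M" "\<And>\<omega>. \<omega> \<in> space M \<Longrightarrow> \<bar>f \<omega>\<bar> \<le> b"
  shows "integrable M f"
  using integrable_mult_bounded[of "\<lambda>_. 1" f b] assms by simp

text \<open>The weight is known at the left end of each cell, so \<open>g = h / Q ^ 7\<close> is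
  admissible simple-process data. As \<open>C\<close> depends neither on the level \<open>k\<close>
  nor on the bound that makes \<open>h\<close> admissible, the estimate survives refinement and
  removal of that bound.\<close>

lemma discrete_hoelder_moment:
  assumes T: "T > 0" and n: "n \<ge> 1"
  obtains C where "C \<ge> 0"
    "\<And>k h Y A. (\<And>i. i < 2 ^ k \<Longrightarrow> h i \<in> borel_measurable (F (real i * (T / 2 ^ k)))) \<Longrightarrow>
      (\<exists>b. \<forall>i<2 ^ k. \<forall>\<omega>\<in>space M. \<bar>h i \<omega>\<bar> \<le> b) \<Longrightarrow>
      (\<And>i \<omega>. i < 2 ^ k \<Longrightarrow> \<omega> \<in> space M \<Longrightarrow> \<bar>h i \<omega>\<bar> \<le> Y \<omega>) \<Longrightarrow>
      (\<integral>\<^sup>+\<omega>. ennreal (Y \<omega> ^ n) \<partial>M) \<le> ennreal A \<Longrightarrow> A \<ge> 0 \<Longrightarrow>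
      \<exists>R\<in>borel_measurable M. (\<integral>\<^sup>+\<omega>. ennreal (R \<omega>) \<partial>M) \<le> ennreal (C * A) \<and>
        (\<forall>\<omega>\<in>space M. \<forall>a b. a \<le> b \<longrightarrow> b \<le> 2 ^ k \<longrightarrow>
          \<bar>gsum W b (\<lambda>i. real i * (T / 2 ^ k)) h \<omega> - gsum W a (\<lambda>i. real i * (T / 2 ^ k)) h \<omega>\<bar> ^ n
            \<le> R \<omega> * ((real b - real a) / 2 ^ k) powr (real n / 4))"
proof -
  obtain C0 where C0: "C0 \<ge> 1" and mom: "\<And>N \<tau> g \<delta> A j. simple_proc_data M F N \<tau> g \<Longrightarrow> \<delta> > 0 \<Longrightarrow> (\<And>i. i < N \<Longrightarrow> \<tau> (Suc i) - \<tau> i = \<delta>) \<Longrightarrow> A \<ge> 0 \<Longrightarrow>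
      (\<And>i. i < N \<Longrightarrow> expectation (\<lambda>\<omega>. g i \<omega> ^ (2 * (4 * n))) \<le> A) \<Longrightarrow> j \<le> N \<Longrightarrow>
      expectation (\<lambda>\<omega>. gsum W j \<tau> g \<omega> ^ (2 * (4 * n))) \<le> (C0 * (real j * \<delta>)) ^ (4 * n) * A"
    using gsum_moment_bound[of "4 * n"] n by (metis mult_is_0 less_one not_less zero_neq_numeral)
  \<comment> \<open>\<open>52 = 2 * 26\<close> joins the Abel and the chaining constants. In the
    bracket, 1 comes from \<open>Qt\<close> and the other term from the chaining sum.\<close>
  define C where "C = 52 ^ n * (1 + 2 * (C0 * T) ^ (4 * n))"
  show thesis
  proof (rule that)
    show "C \<ge> 0" using C0 T by (simp add: C_def)
    fix k :: nat and h :: "nat \<Rightarrow> 'a \<Rightarrow> real" and Y A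
    assume hF: "\<And>i. i < 2 ^ k \<Longrightarrow> h i \<in> borel_measurable (F (real i * (T / 2 ^ k)))"
      and "\<exists>b. \<forall>i<2 ^ k. \<forall>\<omega>\<in>space M. \<bar>h i \<omega>\<bar> \<le> b"
      and hY: "\<And>i \<omega>. i < 2 ^ k \<Longrightarrow> \<omega> \<in> space M \<Longrightarrow> \<bar>h i \<omega>\<bar> \<le> Y \<omega>"
      and YA: "(\<integral>\<^sup>+\<omega>. ennreal (Y \<omega> ^ n) \<partial>M) \<le> ennreal A" and A: "A \<ge> (0::real)"
    then obtain b where hb: "\<And>i \<omega>. i < 2 ^ k \<Longrightarrow> \<omega> \<in> space M \<Longrightarrow> \<bar>h i \<omega>\<bar> \<le> b" by blast
    define N where "N = (2::nat) ^ k"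
    have N: "N > 0" by (simp add: N_def)
    define \<tau> where "\<tau> i = real i * (T / 2 ^ k)" for i :: nat
    have \<tau>d: "\<tau> (Suc i) - \<tau> i = T / 2 ^ k" for i by (simp add: \<tau>_def field_simps)
    have \<tau>m: "\<tau> i \<le> \<tau> j" if "i \<le> j" for i j using that T by (auto simp: \<tau>_def intro!: divide_right_mono mult_right_mono)
    define mx where "mx i \<omega> = Max ((\<lambda>l. \<bar>h l \<omega>\<bar>) ` {..i})" for i \<omega>
    define Q where "Q i \<omega> = root 8 (mx i \<omega>)" for i \<omega>
    have mx_ge: "\<bar>h l \<omega>\<bar> \<le> mx i \<omega>" if "l \<le> i" for l i \<omega> unfolding mx_def using that by (intro Max_ge) auto
    have mx0: "mx i \<omega> \<ge> 0" for i \<omega> using mx_ge[of i i \<omega>] by linarith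
    have mx_le: "mx i \<omega> \<le> c" if "\<And>l. l \<le> i \<Longrightarrow> \<bar>h l \<omega>\<bar> \<le> c" for i \<omega> c
      unfolding mx_def using that by (intro Max.boundedI) auto
    have mx_mono: "mx i \<omega> \<le> mx j \<omega>" if "i \<le> j" for i j \<omega> using that by (intro mx_le mx_ge) auto
    have Q0: "Q i \<omega> \<ge> 0" for i \<omega> using mx0 by (simp add: Q_def)
    have Q8: "Q i \<omega> ^ 8 = mx i \<omega>" for i \<omega> unfolding Q_def using mx0 by (simp add: real_root_pow_pos2)
    have Q_mono: "Q i \<omega> \<le> Q j \<omega>" if "i \<le> j" for i j \<omega> using mx_mono[OF that] by (simp add: Q_def)
    have mxF: "mx i \<in> borel_measurable (F (\<tau> i))" if "i < N" for i
      unfolding mx_def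
    proof (rule borel_measurable_Max)
      fix l assume "l \<in> {..i}"
      then have "h l \<in> borel_measurable (F (\<tau> i))"
        using hF[of l] that \<tau>m[of l i] unfolding \<tau>_def[symmetric] N_def by (intro meas_F_mono[of "\<tau> l" "\<tau> i"]) auto
      then show "(\<lambda>\<omega>. \<bar>h l \<omega>\<bar>) \<in> borel_measurable (F (\<tau> i))" by simp
    qed simp
    have QF: "Q i \<in> borel_measurable (F (\<tau> i))" if "i < N" for i
    proof -
      have "root 8 \<in> borel_measurable borel" by (intro borel_measurable_continuous_onI continuous_intros)
      from measurable_compose[OF mxF[OF that] this] show ?thesis by (simp add: Q_def[abs_def])
    qed
    \<comment> \<open>Where \<open>Q i\<close> is 0, the quotient is 0 by convention; there
      \<open>h i\<close> vanishes as well, so the factorisation \<open>hg\<close> still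
      holds.\<close>
    define g where "g i \<omega> = h i \<omega> / Q i \<omega> ^ 7" for i \<omega>
    have hg: "Q i \<omega> ^ 7 * g i \<omega> = h i \<omega>" for i \<omega>
    proof (cases "Q i \<omega> = 0")
      case True
      then have "mx i \<omega> = 0" using Q8[of i \<omega>] by simp
      then show ?thesis using mx_ge[of i i \<omega>] True by simp
    qed (simp add: g_def)
    have gQ: "\<bar>g i \<omega>\<bar> \<le> Q i \<omega>" for i \<omega>
    proof (cases "Q i \<omega> = 0")
      case False
      have "\<bar>h i \<omega>\<bar> \<le> Q i \<omega> * Q i \<omega> ^ 7" using mx_ge[of i i \<omega>] Q8[of i \<omega>] by (simp add: numeral_eq_Suc)
      then show ?thesis using False Q0[of i \<omega>] by (simp add: g_def abs_mult divide_le_eq)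
    qed (simp add: g_def)
    define Qt where "Qt = Q (N - 1)"
    have QQt: "Q i \<omega> \<le> Qt \<omega>" if "i < N" for i \<omega> unfolding Qt_def using that by (intro Q_mono) auto
    have Qt0: "Qt \<omega> \<ge> 0" for \<omega> unfolding Qt_def by (rule Q0)
    have mxb: "mx i \<omega> \<le> b" if "i < N" "\<omega> \<in> space M" for i \<omega>
      using that hb by (intro mx_le) (auto simp: N_def)
    have mxY: "mx i \<omega> \<le> Y \<omega>" if "i < N" "\<omega> \<in> space M" for i \<omega>
      using that hY by (intro mx_le) (auto simp: N_def)
    have Qb: "Q i \<omega> \<le> root 8 b" if "i < N" "\<omega> \<in> space M" for i \<omega>
      using mxb[OF that] by (simp add: Q_def)
    have d: "simple_proc_data M F N \<tau> g"
      unfolding simple_proc_data_def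
    proof (intro conjI allI impI)
      show "g i \<in> borel_measurable (F (\<tau> i))" if "i < N" for i
        unfolding g_def[abs_def] using hF[of i] that QF[OF that] by (simp add: N_def \<tau>_def)
      show "\<exists>B. \<forall>i<N. \<forall>\<omega>\<in>space M. \<bar>g i \<omega>\<bar> \<le> B" using order_trans[OF gQ Qb] by blast
    qed (use \<tau>m in \<open>auto simp: \<tau>_def[of 0]\<close>)
    have QtM: "Qt \<in> borel_measurable M" unfolding Qt_def using QF[of "N - 1"] N meas_F_M by simp
    have iQt: "integrable M (\<lambda>\<omega>. Qt \<omega> ^ (8 * n))"
      using QtM Qb[of "N - 1"] N Qt0
      by (intro integrable_bounded[where b="root 8 b ^ (8 * n)"]) (auto simp: Qt_def power_abs abs_of_nonneg intro!: power_mono)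
    have EQ: "expectation (\<lambda>\<omega>. Qt \<omega> ^ (8 * n)) \<le> A"
    proof -
      have "ennreal (expectation (\<lambda>\<omega>. Qt \<omega> ^ (8 * n))) = (\<integral>\<^sup>+\<omega>. ennreal (Qt \<omega> ^ (8 * n)) \<partial>M)"
        using iQt Qt0 by (intro nn_integral_eq_integral[symmetric]) auto
      also have "\<dots> \<le> (\<integral>\<^sup>+\<omega>. ennreal (Y \<omega> ^ n) \<partial>M)"
      proof (rule nn_integral_mono, rule ennreal_leI)
        fix \<omega> assume "\<omega> \<in> space M"
        then show "Qt \<omega> ^ (8 * n) \<le> Y \<omega> ^ n"
          using mxY[of "N - 1" \<omega>] mx0 N unfolding Qt_def power_mult Q8 by (intro power_mono) auto
      qed
      also note YA
      finally show ?thesis using A by simp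
    qed
    have Eg: "expectation (\<lambda>\<omega>. g i \<omega> ^ (2 * (4 * n))) \<le> A" if "i < N" for i
    proof -
      have p: "g i \<omega> ^ (2 * (4 * n)) \<le> Qt \<omega> ^ (8 * n)" for \<omega>
      proof -
        have "g i \<omega> ^ (2 * (4 * n)) = \<bar>g i \<omega>\<bar> ^ (2 * (4 * n))" by (simp add: power_mult)
        also have "\<dots> \<le> Qt \<omega> ^ (2 * (4 * n))" using order_trans[OF gQ QQt[OF that]] by (intro power_mono) auto
        finally show ?thesis by simp
      qed
      have gM: "g i \<in> borel_measurable M" using d that meas_F_M[of "g i" "\<tau> i" borel] by (auto simp: simple_proc_data_def)
      have "integrable M (\<lambda>\<omega>. g i \<omega> ^ (2 * (4 * n)))"
        by (rule Bochner_Integration.integrable_bound[OF iQt])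
           (use gM p Qt0 in \<open>auto simp: power_mult intro!: AE_I2\<close>)
      then have "expectation (\<lambda>\<omega>. g i \<omega> ^ (2 * (4 * n))) \<le> expectation (\<lambda>\<omega>. Qt \<omega> ^ (8 * n))"
        by (rule integral_mono[OF _ iQt p])
      with EQ show ?thesis by simp
    qed
    define B where "B \<omega> j = gsum W j \<tau> g \<omega>" for \<omega> j
    have EB: "integrable M (\<lambda>\<omega>. (B \<omega> y - B \<omega> x) ^ (8 * n))"
      "expectation (\<lambda>\<omega>. (B \<omega> y - B \<omega> x) ^ (8 * n)) \<le> (C0 * (real (y - x) * (T / 2 ^ k))) ^ (4 * n) * A"
      if "x \<le> y" "y \<le> N" for x y
    proof -
      note sh = simple_proc_data_shift[OF d that]
      show "integrable M (\<lambda>\<omega>. (B \<omega> y - B \<omega> x) ^ (8 * n))"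
        using gsum_moments(2)[OF sh(1) order_refl, of "8 * n"] unfolding sh(2) B_def .
      have "expectation (\<lambda>\<omega>. gsum W (y - x) (\<lambda>i. \<tau> (x + i)) (\<lambda>i. g (x + i)) \<omega> ^ (2 * (4 * n))) \<le> (C0 * (real (y - x) * (T / 2 ^ k))) ^ (4 * n) * A"
        by (rule mom[OF sh(1)]) (use T A Eg that \<tau>d in auto)
      then show "expectation (\<lambda>\<omega>. (B \<omega> y - B \<omega> x) ^ (8 * n)) \<le> (C0 * (real (y - x) * (T / 2 ^ k))) ^ (4 * n) * A"
        unfolding sh(2) B_def by simp
    qed
    define p :: "nat \<Rightarrow> real" where "p l = 2 ^ l / 2 ^ k" for l
    have p0: "p l > 0" for l by (simp add: p_def)
    \<comment> \<open>All dyadic increments at all levels, to the power \<open>8 * n\<close> and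
      normalised by \<open>p l ^ (2 * n)\<close>. The ratio of the two exponents is the Hoelder
      exponent 1/4.\<close>
    define \<Lambda> where "\<Lambda> \<omega> = (\<Sum>l\<le>k. \<Sum>i<2 ^ (k - l). (B \<omega> ((i + 1) * 2 ^ l) - B \<omega> (i * 2 ^ l)) ^ (8 * n) / p l ^ (2 * n))" for \<omega>
    have iN: "(i + 1) * 2 ^ l \<le> N" if "i < 2 ^ (k - l)" "l \<le> k" for i l
    proof -
      have "(i + 1) * 2 ^ l \<le> 2 ^ (k - l) * 2 ^ l" using that by (intro mult_right_mono) auto
      then show ?thesis using that by (simp add: N_def power_add[symmetric])
    qed
    have ev0: "0 \<le> x ^ (8 * n)" for x :: real by (simp add: power_mult)
    have t0: "0 \<le> (B \<omega> y - B \<omega> x) ^ (8 * n) / p l ^ (2 * n)" for \<omega> x y l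
      using p0[of l] ev0 by (intro divide_nonneg_nonneg) auto
    have \<Lambda>0: "\<Lambda> \<omega> \<ge> 0" for \<omega> unfolding \<Lambda>_def by (intro sum_nonneg t0)
    have iterm: "integrable M (\<lambda>\<omega>. (B \<omega> ((i + 1) * 2 ^ l) - B \<omega> (i * 2 ^ l)) ^ (8 * n) / p l ^ (2 * n))"
      if "i < 2 ^ (k - l)" "l \<le> k" for i l
      using EB(1)[of "i * 2 ^ l" "(i + 1) * 2 ^ l"] iN[OF that] by simp
    have i\<Lambda>: "integrable M \<Lambda>"
      unfolding \<Lambda>_def[abs_def] by (intro Bochner_Integration.integrable_sum iterm) auto
    have E\<Lambda>: "expectation \<Lambda> \<le> 2 * (C0 * T) ^ (4 * n) * A"
    proof -
      have "expectation \<Lambda> = (\<Sum>l\<le>k. \<Sum>i<2 ^ (k - l). expectation (\<lambda>\<omega>. (B \<omega> ((i + 1) * 2 ^ l) - B \<omega> (i * 2 ^ l)) ^ (8 * n) / p l ^ (2 * n)))"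
      proof -
        have "expectation \<Lambda> = (\<Sum>l\<le>k. expectation (\<lambda>\<omega>. \<Sum>i<2 ^ (k - l). (B \<omega> ((i + 1) * 2 ^ l) - B \<omega> (i * 2 ^ l)) ^ (8 * n) / p l ^ (2 * n)))"
          unfolding \<Lambda>_def by (rule Bochner_Integration.integral_sum, intro Bochner_Integration.integrable_sum iterm) simp_all
        also have "\<dots> = (\<Sum>l\<le>k. \<Sum>i<2 ^ (k - l). expectation (\<lambda>\<omega>. (B \<omega> ((i + 1) * 2 ^ l) - B \<omega> (i * 2 ^ l)) ^ (8 * n) / p l ^ (2 * n)))"
          by (intro sum.cong refl Bochner_Integration.integral_sum iterm) simp_all
        finally show ?thesis .
      qed
      also have "\<dots> \<le> (\<Sum>l\<le>k. \<Sum>i<(2::nat) ^ (k - l). (C0 * T) ^ (4 * n) * A * (p l * p l))"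
      proof (intro sum_mono)
        fix l i :: nat assume "l \<in> {..k}" "i \<in> {..<2 ^ (k - l)}"
        then have li: "i < 2 ^ (k - l)" "l \<le> k" by auto
        have "expectation (\<lambda>\<omega>. (B \<omega> ((i + 1) * 2 ^ l) - B \<omega> (i * 2 ^ l)) ^ (8 * n) / p l ^ (2 * n))
          = expectation (\<lambda>\<omega>. (B \<omega> ((i + 1) * 2 ^ l) - B \<omega> (i * 2 ^ l)) ^ (8 * n)) / p l ^ (2 * n)" by simp
        also have "\<dots> \<le> ((C0 * (real ((i + 1) * 2 ^ l - i * 2 ^ l) * (T / 2 ^ k))) ^ (4 * n) * A) / p l ^ (2 * n)"
          using p0[of l] iN[OF li] by (intro divide_right_mono EB(2)) auto
        also have "real ((i + 1) * 2 ^ l - i * 2 ^ l) * (T / 2 ^ k) = T * p l" by (simp add: p_def)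
        also have "(C0 * (T * p l)) ^ (4 * n) * A / p l ^ (2 * n) = (C0 * T) ^ (4 * n) * A * p l ^ (2 * n)"
        proof -
          have "p l ^ (4 * n) = p l ^ (2 * n) * p l ^ (2 * n)" by (simp add: power_add[symmetric])
          then show ?thesis using p0[of l] by (simp add: power_mult_distrib field_simps)
        qed
        \<comment> \<open>Moments of order \<open>8 * n\<close> give \<open>p l ^ (4 * n)\<close>,
          of which \<open>p l ^ (2 * n)\<close> is left. Since \<open>p l \<le> 1\<close> and
          \<open>n \<ge> 1\<close>, this is at most \<open>p l ^ 2\<close>: one factor for the
          number \<open>1 / p l\<close> of cells, one to sum over the levels.\<close>
        also have "\<dots> \<le> (C0 * T) ^ (4 * n) * A * p l ^ 2"
        proof (intro mult_left_mono power_decreasing)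
          show "p l \<le> 1" using li by (simp add: p_def)
        qed (use n p0[of l] C0 T A in auto)
        finally show "expectation (\<lambda>\<omega>. (B \<omega> ((i + 1) * 2 ^ l) - B \<omega> (i * 2 ^ l)) ^ (8 * n) / p l ^ (2 * n)) \<le> (C0 * T) ^ (4 * n) * A * (p l * p l)"
          by (simp add: power2_eq_square)
      qed
      also have "\<dots> = (C0 * T) ^ (4 * n) * A * (\<Sum>l\<le>k. p l)"
      proof -
        have "(\<Sum>i<(2::nat) ^ (k - l). (C0 * T) ^ (4 * n) * A * (p l * p l)) = (C0 * T) ^ (4 * n) * A * p l" if "l \<le> k" for l
        proof -
          have "2 ^ (k - l) * p l = 1" using that by (simp add: p_def power_add[symmetric])
          then show ?thesis by (simp add: mult_ac)
        qed
        then show ?thesis unfolding sum_distrib_left by (intro sum.cong refl) simp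
      qed
      also have "\<dots> \<le> (C0 * T) ^ (4 * n) * A * 2"
      proof (intro mult_left_mono)
        have "(\<Sum>l\<le>k. p l) = (\<Sum>l<Suc k. 2 ^ l) / 2 ^ k"
          unfolding p_def sum_divide_distrib lessThan_Suc_atMost ..
        also have "\<dots> = (2 ^ Suc k - 1) / 2 ^ k" by (subst geometric_sum) auto
        also have "\<dots> \<le> 2" by (simp add: divide_le_eq)
        finally show "(\<Sum>l\<le>k. p l) \<le> 2" .
      qed (use C0 T A in auto)
      finally show ?thesis by (simp add: mult_ac)
    qed
    define D where "D \<omega> = root (8 * n) (\<Lambda> \<omega>)" for \<omega>
    have D0: "D \<omega> \<ge> 0" for \<omega> unfolding D_def by (rule real_root_ge_zero[OF \<Lambda>0])
    have D8: "D \<omega> ^ (8 * n) = \<Lambda> \<omega>" for \<omega> unfolding D_def using n \<Lambda>0 by (intro real_root_pow_pos2) auto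
    have incr: "\<bar>B \<omega> ((i + 1) * 2 ^ l) - B \<omega> (i * 2 ^ l)\<bar> \<le> D \<omega> * (2 ^ l / 2 ^ k) powr (1/4)"
      if l: "l \<le> k" and i: "(i + 1) * 2 ^ l \<le> (2::nat) ^ k" for \<omega> l i
    proof -
      have i': "i < 2 ^ (k - l)"
      proof -
        have "(i + 1) * 2 ^ l \<le> 2 ^ (k - l) * 2 ^ l" using l i by (simp add: power_add[symmetric])
        then have "i + 1 \<le> 2 ^ (k - l)" by (simp only: mult_le_cancel2) simp
        then show ?thesis by simp
      qed
      let ?x = "B \<omega> ((i + 1) * 2 ^ l) - B \<omega> (i * 2 ^ l)"
      have "?x ^ (8 * n) / p l ^ (2 * n) \<le> (\<Sum>i<2 ^ (k - l). (B \<omega> ((i + 1) * 2 ^ l) - B \<omega> (i * 2 ^ l)) ^ (8 * n) / p l ^ (2 * n))"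
        using i' by (intro member_le_sum[where f="\<lambda>i. (B \<omega> ((i + 1) * 2 ^ l) - B \<omega> (i * 2 ^ l)) ^ (8 * n) / p l ^ (2 * n)"]) (auto simp only: t0 lessThan_iff finite_lessThan)
      also have "\<dots> \<le> \<Lambda> \<omega>"
        unfolding \<Lambda>_def using l
        by (intro member_le_sum[where f="\<lambda>l. \<Sum>i<2 ^ (k - l). (B \<omega> ((i + 1) * 2 ^ l) - B \<omega> (i * 2 ^ l)) ^ (8 * n) / p l ^ (2 * n)"] sum_nonneg t0) auto
      finally have "?x ^ (8 * n) \<le> \<Lambda> \<omega> * p l ^ (2 * n)" using p0[of l] by (simp add: divide_le_eq)
      also have "\<dots> = (D \<omega> * p l powr (1/4)) ^ (8 * n)"
      proof -
        have "(p l powr (1/4)) ^ (8 * n) = p l powr (2 * real n)" using p0[of l] by (simp add: powr_power)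
        also have "\<dots> = p l ^ (2 * n)" using powr_realpow[OF p0[of l], of "2 * n"] by simp
        finally show ?thesis by (simp add: power_mult_distrib D8)
      qed
      finally have "\<bar>?x\<bar> ^ (8 * n) \<le> (D \<omega> * p l powr (1/4)) ^ (8 * n)" by (simp add: power_mult)
      then have "\<bar>?x\<bar> \<le> D \<omega> * p l powr (1/4)"
        using power_mono_iff[of "\<bar>?x\<bar>" "D \<omega> * p l powr (1/4)" "8 * n"] D0[of \<omega>] n by simp
      then show ?thesis by (simp add: p_def)
    qed
    define R where "R \<omega> = 52 ^ n * (Qt \<omega> ^ (8 * n) + \<Lambda> \<omega>)" for \<omega>
    have "R \<in> borel_measurable M" unfolding R_def[abs_def] using iQt i\<Lambda> by simp
    moreover have "(\<integral>\<^sup>+\<omega>. ennreal (R \<omega>) \<partial>M) \<le> ennreal (C * A)"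
    proof -
      have iR: "integrable M R" unfolding R_def[abs_def] using iQt i\<Lambda> by simp
      have R0: "R \<omega> \<ge> 0" for \<omega> unfolding R_def using \<Lambda>0 ev0 by (intro mult_nonneg_nonneg add_nonneg_nonneg) auto
      have "(\<integral>\<^sup>+\<omega>. ennreal (R \<omega>) \<partial>M) = ennreal (expectation R)"
        using iR R0 by (intro nn_integral_eq_integral) auto
      also have "expectation R = 52 ^ n * (expectation (\<lambda>\<omega>. Qt \<omega> ^ (8 * n)) + expectation \<Lambda>)"
        unfolding R_def[abs_def] using iQt i\<Lambda> by simp
      also have "\<dots> \<le> 52 ^ n * (A + 2 * (C0 * T) ^ (4 * n) * A)" by (intro mult_left_mono add_mono EQ E\<Lambda>) auto
      also have "\<dots> = C * A" by (simp add: C_def algebra_simps)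
      finally show ?thesis by (simp add: ennreal_leI)
    qed
    moreover have "\<bar>gsum W y \<tau> h \<omega> - gsum W x \<tau> h \<omega>\<bar> ^ n \<le> R \<omega> * ((real y - real x) / 2 ^ k) powr (real n / 4)"
      if w: "\<omega> \<in> space M" and xy: "x \<le> y" "y \<le> 2 ^ k" for \<omega> x y
    proof -
      let ?q = "(real y - real x) / 2 ^ k"
      have "gsum W y \<tau> h \<omega> - gsum W x \<tau> h \<omega> = (\<Sum>i\<in>{x..<y}. h i \<omega> * (W (\<tau> (Suc i)) \<omega> - W (\<tau> i) \<omega>))"
        unfolding gsum_def using xy by (simp add: lessThan_atLeast0 sum_diff_nat_ivl[of 0 x y, symmetric])
      also have "\<dots> = (\<Sum>i\<in>{x..<y}. Q i \<omega> ^ 7 * (B \<omega> (Suc i) - B \<omega> i))"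
        unfolding B_def gsum_Suc by (simp add: mult.assoc[symmetric] hg)
      also have "\<bar>\<dots>\<bar> \<le> 2 * Qt \<omega> ^ 7 * (26 * D \<omega> * ?q powr (1/4))"
      proof (rule abel_monotone_bound[OF xy(1)])
        fix i assume i: "x \<le> i" "i \<le> y"
        have "\<bar>B \<omega> i - B \<omega> x\<bar> \<le> 26 * D \<omega> * ((real i - real x) / 2 ^ k) powr (1/4)"
          by (rule dyadic_hoelder[OF D0 incr]) (use i xy in auto)
        also have "\<dots> \<le> 26 * D \<omega> * ?q powr (1/4)"
          using i D0[of \<omega>] by (intro mult_left_mono powr_mono2 divide_right_mono) auto
        finally show "\<bar>B \<omega> i - B \<omega> x\<bar> \<le> 26 * D \<omega> * ?q powr (1/4)" .
      next
        show "Q i \<omega> ^ 7 \<le> Qt \<omega> ^ 7" if "i < y" for i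
          using that xy Q0 by (intro power_mono QQt) (auto simp: N_def)
        show "Q i \<omega> ^ 7 \<le> Q j \<omega> ^ 7" if "i \<le> j" for i j using Q0 that by (intro power_mono Q_mono) auto
      qed (use Q0 Qt0 D0 in auto)
      finally have "\<bar>gsum W y \<tau> h \<omega> - gsum W x \<tau> h \<omega>\<bar> ^ n \<le> (2 * Qt \<omega> ^ 7 * (26 * D \<omega> * ?q powr (1/4))) ^ n"
        by (intro power_mono) auto
      also have "\<dots> = 52 ^ n * ((Qt \<omega> ^ n) ^ (8 - 1) * (D \<omega> ^ n) ^ 1) * (?q powr (1/4)) ^ n"
      proof -
        have "2 * Qt \<omega> ^ 7 * (26 * D \<omega> * ?q powr (1/4)) = 52 * Qt \<omega> ^ 7 * D \<omega> * ?q powr (1/4)" by simp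
        then show ?thesis by (simp add: power_mult_distrib power_mult[symmetric] mult.commute[of n] mult.assoc)
      qed
      \<comment> \<open>Here the product of seven powers of \<open>Qt\<close> and one of
        \<open>D\<close> is split, leaving the two integrable quantities \<open>Qt ^ (8 * n)\<close>
        and \<open>\<Lambda>\<close>.\<close>
      also have "\<dots> \<le> 52 ^ n * ((Qt \<omega> ^ n) ^ 8 + (D \<omega> ^ n) ^ 8) * (?q powr (1/4)) ^ n"
        using Qt0[of \<omega>] D0[of \<omega>] by (intro mult_right_mono mult_left_mono power_mult_le_add_power) auto
      also have "(Qt \<omega> ^ n) ^ 8 = Qt \<omega> ^ (8 * n)" by (simp add: power_mult[symmetric] mult.commute)
      also have "(D \<omega> ^ n) ^ 8 = \<Lambda> \<omega>" using D8[of \<omega>] by (simp add: power_mult[symmetric] mult.commute)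
      also have "(?q powr (1/4)) ^ n = ?q powr (real n / 4)"
      proof (cases "?q = 0")
        case True
        then show ?thesis using n by (simp only: True) (simp add: power_0_left)
      next
        case False
        then have "?q powr (1/4) > 0" by simp
        from powr_realpow[OF this, of n] show ?thesis by (simp add: powr_powr)
      qed
      finally show ?thesis unfolding R_def .
    qed
    ultimately show "\<exists>R\<in>borel_measurable M. (\<integral>\<^sup>+\<omega>. ennreal (R \<omega>) \<partial>M) \<le> ennreal (C * A) \<and>
        (\<forall>\<omega>\<in>space M. \<forall>a b. a \<le> b \<longrightarrow> b \<le> 2 ^ k \<longrightarrow>
          \<bar>gsum W b (\<lambda>i. real i * (T / 2 ^ k)) h \<omega> - gsum W a (\<lambda>i. real i * (T / 2 ^ k)) h \<omega>\<bar> ^ n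
            \<le> R \<omega> * ((real b - real a) / 2 ^ k) powr (real n / 4))"
      unfolding \<tau>_def[abs_def] by (intro bexI[of _ R] conjI) auto
  qed
qed

end

text \<open>Simple processes need bounded coefficients. Clipping at a level that rises with the grid
  level is eventually inactive on each path and never enlarges a value.\<close>

definition clip :: "real \<Rightarrow> real \<Rightarrow> real" where "clip c x = max (- c) (min c x)"

lemma clip_bounds: "c \<ge> 0 \<Longrightarrow> \<bar>clip c x\<bar> \<le> c" "c \<ge> 0 \<Longrightarrow> \<bar>clip c x\<bar> \<le> \<bar>x\<bar>" "\<bar>x\<bar> \<le> c \<Longrightarrow> clip c x = x"
  by (auto simp: clip_def)

lemma liminf_upper:
  fixes x :: "nat \<Rightarrow> ennreal"
  assumes "\<And>n. x n \<le> C" shows "liminf x \<le> C"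
proof -
  have "liminf x \<le> limsup x" by (rule Liminf_le_Limsup) simp
  also have "\<dots> \<le> C" using assms by (intro Limsup_bounded) auto
  finally show ?thesis .
qed

section \<open>Hoelder moments in continuous time\<close>

context wiener begin

text \<open>A dyadic time of level \<open>l\<close> stays a grid point at all finer levels, so the
  sampled sums up to it are integrals of left-endpoint samples of \<open>h\<close>. Path continuity
  of \<open>h\<close> gives pathwise convergence of the quadratic variation, and
  \<open>ito_continuity\<close> does the rest.\<close>

lemma sampled_integrals:
  assumes T: "T > 0" and t: "t = real a * (T / 2 ^ l)" and a: "a \<le> 2 ^ l"
    and Z: "\<And>t. t \<in> {0..T} \<Longrightarrow> ito_integral M F W h t (Z t)"
    and hc: "\<And>\<omega>. \<omega> \<in> space M \<Longrightarrow> continuous_on {0..T} (\<lambda>u. h u \<omega>)"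
  defines "\<tau> \<equiv> \<lambda>c i. real i * (T / 2 ^ c)"
  defines "hk \<equiv> \<lambda>c i \<omega>. clip (real c) (h (\<tau> c i) \<omega>)"
  shows "simple_proc_data M F (2 ^ c) (\<tau> c) (hk c)"
    and "cprob (\<lambda>k. gsum W (a * 2 ^ k) (\<tau> (l + k)) (hk (l + k))) (Z t)"
proof -
  have \<tau>T: "\<tau> c i \<in> {0..T}" if "i \<le> 2 ^ c" for c i
  proof -
    have "\<tau> c i \<le> real (2 ^ c) * (T / 2 ^ c)" unfolding \<tau>_def
      using that T by (intro mult_right_mono) (simp_all only: of_nat_le_iff, simp)
    then show ?thesis using T by (simp add: \<tau>_def)
  qed
  have mono: "\<tau> c i \<le> \<tau> c j" if "i \<le> j" for c i j using that T by (auto simp: \<tau>_def intro!: divide_right_mono mult_right_mono)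
  have p: "prog T h" using ito_prog[OF Z[of T]] T by simp
  have dd: "simple_proc_data M F j (\<tau> c) (hk c)" if "j \<le> 2 ^ c" for j c
    unfolding simple_proc_data_def
  proof (intro conjI allI impI)
    show "0 \<le> \<tau> c 0" by (simp add: \<tau>_def)
    show "\<tau> c i \<le> \<tau> c (Suc i)" for i by (rule mono) simp
    show "hk c i \<in> borel_measurable (F (\<tau> c i))" if "i < j" for i
    proof -
      have "h (\<tau> c i) \<in> borel_measurable (F (\<tau> c i))"
        using \<tau>T[of i c] that \<open>j \<le> 2 ^ c\<close> by (intro prog_adapted[OF p]) auto
      then show ?thesis unfolding hk_def clip_def by measurable
    qed
    show "\<exists>B. \<forall>i<j. \<forall>\<omega>\<in>space M. \<bar>hk c i \<omega>\<bar> \<le> B" unfolding hk_def by (intro exI[of _ "real c"]) (auto intro: clip_bounds)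
  qed
  then show "simple_proc_data M F (2 ^ c) (\<tau> c) (hk c)" by simp
  define j where "j k = a * 2 ^ k" for k :: nat
  have jl: "j k \<le> 2 ^ (l + k)" for k using a by (simp add: j_def power_add)
  have tj: "\<tau> (l + k) (j k) = t" for k by (simp add: \<tau>_def j_def t power_add)
  have tT: "t \<in> {0..T}" using \<tau>T[OF jl, of 0] tj[of 0] by simp
  then have t0: "0 \<le> t" by simp
  have "cprob (\<lambda>k. simple_integral_wrt W (j k) (\<tau> (l + k)) (hk (l + k)) t) (Z t)"
  proof (rule ito_continuity[OF Z[OF tT] ito_simple[OF dd[OF jl] t0] t0])
    fix \<omega> assume w: "\<omega> \<in> space M"
    define D where "D k u = simple_proc (j k) (\<tau> (l + k)) (hk (l + k)) u \<omega> - h u \<omega>" for k u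
    let ?c = "\<lambda>u. max 0 (min u t)"
    have [measurable]: "(\<lambda>u. D k (?c u)) \<in> borel_measurable borel" for k
      using prog_path[OF prog_diff[OF prog_simple[OF dd[OF jl, of k], of t] prog_mono[OF p]] w t0] tT by (simp add: D_def)
    have "bounded ((\<lambda>u. h u \<omega>) ` {0..T})" by (intro compact_imp_bounded compact_continuous_image hc w) simp
    then obtain b where b: "\<And>u. u \<in> {0..T} \<Longrightarrow> \<bar>h u \<omega>\<bar> \<le> b" by (rule bounded_image_realE) blast
    have gv: "\<exists>v\<ge>0. v < u \<and> u - v \<le> T / 2 ^ (l + k) \<and> simple_proc (j k) (\<tau> (l + k)) (hk (l + k)) u \<omega> = clip (real (l + k)) (h v \<omega>)"
      if u: "u \<in> {0<..t}" for u k
    proof -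
      have tp: "t > 0" using u by simp
      then have jp: "j k > 0" using tj[of k] by (cases "j k") (auto simp: \<tau>_def)
      have dt: "t / real (j k) = T / 2 ^ (l + k)" using tj[of k] jp by (simp add: \<tau>_def field_simps)
      show ?thesis
        using step_process_value[OF tp jp u, of "\<lambda>v. clip (real (l + k)) (h v \<omega>)"]
        unfolding dt simple_proc_def hk_def \<tau>_def .
    qed
    have "(\<lambda>k. \<integral>\<^sup>+u. ennreal ((D k (?c u))\<^sup>2) * indicator {0..t} u \<partial>lborel) \<longlonglongrightarrow> (\<integral>\<^sup>+u. 0 \<partial>(lborel :: real measure))"
    proof (rule nn_integral_dominated_convergence[where w="\<lambda>u. ennreal ((2 * b)\<^sup>2) * indicator {0..t} u"])
      show "(\<integral>\<^sup>+u. ennreal ((2 * b)\<^sup>2) * indicator {0..t} u \<partial>lborel) < \<infinity>"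
        using t0 by (simp add: nn_integral_cmult_indicator ennreal_mult_less_top)
      have n0: "AE u in lborel. u \<noteq> (0::real)" by (rule AE_lborel_singleton)
      show "AE u in lborel. ennreal ((D k (?c u))\<^sup>2) * indicator {0..t} u \<le> ennreal ((2 * b)\<^sup>2) * indicator {0..t} u" for k
        using n0
      proof eventually_elim
        fix u :: real assume u0: "u \<noteq> 0"
        show "ennreal ((D k (?c u))\<^sup>2) * indicator {0..t} u \<le> ennreal ((2 * b)\<^sup>2) * indicator {0..t} u"
        proof (cases "u \<in> {0..t}")
          case True
          then obtain v where v: "v \<ge> 0" "v < u" "simple_proc (j k) (\<tau> (l + k)) (hk (l + k)) u \<omega> = clip (real (l + k)) (h v \<omega>)"
            using gv[of u k] u0 by auto
          have "\<bar>clip (real (l + k)) (h v \<omega>)\<bar> \<le> b"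
            using clip_bounds(2)[of "real (l + k)" "h v \<omega>"] b[of v] v True tT by auto
          then have "\<bar>D k u\<bar> \<le> 2 * b" using b[of u] True tT v(3) by (auto simp: D_def)
          then have "\<bar>D k u\<bar> \<le> \<bar>2 * b\<bar>" by simp
          then show ?thesis using True by (auto simp: abs_le_square_iff)
        qed simp
      qed
      show "AE u in lborel. (\<lambda>k. ennreal ((D k (?c u))\<^sup>2) * indicator {0..t} u) \<longlonglongrightarrow> 0"
        using n0
      proof eventually_elim
        fix u :: real assume u0: "u \<noteq> 0"
        show "(\<lambda>k. ennreal ((D k (?c u))\<^sup>2) * indicator {0..t} u) \<longlonglongrightarrow> 0"
        proof (cases "u \<in> {0..t}")
          case True
          then have us: "u \<in> {0<..t}" using u0 by auto
          then have uT: "u \<in> {0..T}" using tT by auto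
          have "\<exists>v. \<forall>k. v k \<ge> 0 \<and> v k < u \<and> u - v k \<le> T / 2 ^ (l + k) \<and> simple_proc (j k) (\<tau> (l + k)) (hk (l + k)) u \<omega> = clip (real (l + k)) (h (v k) \<omega>)"
            using gv[OF us] by metis
          then obtain v where v: "\<And>k. v k \<ge> 0" "\<And>k. v k < u" "\<And>k. u - v k \<le> T / 2 ^ (l + k)"
            "\<And>k. simple_proc (j k) (\<tau> (l + k)) (hk (l + k)) u \<omega> = clip (real (l + k)) (h (v k) \<omega>)" by blast
          have "(\<lambda>k. T / 2 ^ (l + k)) \<longlonglongrightarrow> 0" unfolding power_add by real_asymp
          then have "(\<lambda>k. v k - u) \<longlonglongrightarrow> 0"
            by (rule Lim_null_comparison[rotated]) (use v in \<open>auto intro!: always_eventually less_imp_le simp: abs_minus_commute abs_of_pos\<close>)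
          then have "v \<longlonglongrightarrow> u" by (rule LIM_zero_cancel)
          moreover have vT: "v k \<in> {0..T}" for k using v(1,2)[of k] uT by auto
          ultimately have lim: "(\<lambda>k. h (v k) \<omega>) \<longlonglongrightarrow> h u \<omega>"
            by (intro continuous_on_tendsto_compose[OF hc[OF w]] uT always_eventually allI)
          have "\<forall>\<^sub>F k in sequentially. h (v k) \<omega> = simple_proc (j k) (\<tau> (l + k)) (hk (l + k)) u \<omega>"
            using eventually_ge_at_top[of "nat \<lceil>b\<rceil>"]
          proof eventually_elim
            case (elim k)
            \<comment> \<open>From this level on the clip bound exceeds the bound of the path, so
              clipping no longer acts on it.\<close>
            then have "b \<le> real (l + k)" by linarith
            then show ?case unfolding v(4) using b[OF vT[of k]] by (intro clip_bounds(3)[symmetric]) linarith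
          qed
          then have "(\<lambda>k. simple_proc (j k) (\<tau> (l + k)) (hk (l + k)) u \<omega>) \<longlonglongrightarrow> h u \<omega>"
            by (rule Lim_transform_eventually[OF lim])
          then have "(\<lambda>k. (simple_proc (j k) (\<tau> (l + k)) (hk (l + k)) u \<omega> - h u \<omega>)\<^sup>2) \<longlonglongrightarrow> (h u \<omega> - h u \<omega>)\<^sup>2"
            by (intro tendsto_power tendsto_diff tendsto_const)
          then have "(\<lambda>k. ennreal ((D k u)\<^sup>2)) \<longlonglongrightarrow> ennreal 0"
            unfolding D_def by (intro tendsto_ennrealI) simp
          then show ?thesis using True by simp
        qed simp
      qed
    qed auto
    then show "(\<lambda>k. qv t (\<lambda>s \<omega>. simple_proc (j k) (\<tau> (l + k)) (hk (l + k)) s \<omega> - h s \<omega>) \<omega>) \<longlonglongrightarrow> 0"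
      using t0 by (simp add: qv_clamp D_def)
  qed
  moreover have "simple_integral_wrt W (j k) (\<tau> (l + k)) (hk (l + k)) t = gsum W (j k) (\<tau> (l + k)) (hk (l + k))" for k
    unfolding simple_integral_wrt_def gsum_def tj[of k, symmetric]
    by (rule ext, rule sum.cong) (auto simp: min_absorb2 mono)
  ultimately show "cprob (\<lambda>k. gsum W (a * 2 ^ k) (\<tau> (l + k)) (hk (l + k))) (Z t)" by (simp add: j_def)
qed

text \<open>Fatou is applied twice: first the grid is refined with the dyadic endpoints held fixed,
  then the endpoints are refined. Lower limits keep the integral bound without monotonicity of the
  discrete majorants. The constant is chosen before \<open>h\<close> and \<open>Z\<close>, so one
  value will serve for every \<open>\<epsilon>\<close>.\<close>

lemma ito_hoelder_moment:
  assumes T: "T > 0" and n: "n \<ge> 1"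
  obtains C where "C \<ge> 0"
    "\<And>h Z Y A. (\<And>t. t \<in> {0..T} \<Longrightarrow> ito_integral M F W h t (Z t)) \<Longrightarrow>
      (\<And>\<omega>. \<omega> \<in> space M \<Longrightarrow> continuous_on {0..T} (\<lambda>u. h u \<omega>)) \<Longrightarrow>
      (\<And>\<omega>. \<omega> \<in> space M \<Longrightarrow> continuous_on {0..T} (\<lambda>t. Z t \<omega>)) \<Longrightarrow>
      (\<And>\<omega> u. \<omega> \<in> space M \<Longrightarrow> u \<in> {0..T} \<Longrightarrow> \<bar>h u \<omega>\<bar> \<le> Y \<omega>) \<Longrightarrow>
      (\<integral>\<^sup>+\<omega>. ennreal (Y \<omega> ^ n) \<partial>M) \<le> ennreal A \<Longrightarrow> A \<ge> 0 \<Longrightarrow>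
      \<exists>H\<in>borel_measurable M. (\<integral>\<^sup>+\<omega>. H \<omega> \<partial>M) \<le> ennreal (C * A) \<and>
        (AE \<omega> in M. \<forall>s t. 0 \<le> s \<longrightarrow> s < t \<longrightarrow> t \<le> T \<longrightarrow>
          ennreal (\<bar>Z t \<omega> - Z s \<omega>\<bar> ^ n / ((t - s) / T) powr (real n / 4)) \<le> H \<omega>)"
proof -
  obtain C where C0: "C \<ge> 0" and C: "\<And>k h Y A. (\<And>i. i < 2 ^ k \<Longrightarrow> h i \<in> borel_measurable (F (real i * (T / 2 ^ k)))) \<Longrightarrow>
      (\<exists>b. \<forall>i<2 ^ k. \<forall>\<omega>\<in>space M. \<bar>h i \<omega>\<bar> \<le> b) \<Longrightarrow>
      (\<And>i \<omega>. i < 2 ^ k \<Longrightarrow> \<omega> \<in> space M \<Longrightarrow> \<bar>h i \<omega>\<bar> \<le> Y \<omega>) \<Longrightarrow>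
      (\<integral>\<^sup>+\<omega>. ennreal (Y \<omega> ^ n) \<partial>M) \<le> ennreal A \<Longrightarrow> A \<ge> 0 \<Longrightarrow>
      \<exists>R\<in>borel_measurable M. (\<integral>\<^sup>+\<omega>. ennreal (R \<omega>) \<partial>M) \<le> ennreal (C * A) \<and>
        (\<forall>\<omega>\<in>space M. \<forall>a b. a \<le> b \<longrightarrow> b \<le> 2 ^ k \<longrightarrow>
          \<bar>gsum W b (\<lambda>i. real i * (T / 2 ^ k)) h \<omega> - gsum W a (\<lambda>i. real i * (T / 2 ^ k)) h \<omega>\<bar> ^ n
            \<le> R \<omega> * ((real b - real a) / 2 ^ k) powr (real n / 4))"
    using discrete_hoelder_moment[OF T n] by blast
  show thesis
  proof (rule that[OF C0])
    fix h and Z :: "real \<Rightarrow> 'a \<Rightarrow> real" and Y A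
    assume Z: "\<And>t. t \<in> {0..T} \<Longrightarrow> ito_integral M F W h t (Z t)"
      and hc: "\<And>\<omega>. \<omega> \<in> space M \<Longrightarrow> continuous_on {0..T} (\<lambda>u. h u \<omega>)"
      and Zc: "\<And>\<omega>. \<omega> \<in> space M \<Longrightarrow> continuous_on {0..T} (\<lambda>t. Z t \<omega>)"
      and hY: "\<And>\<omega> u. \<omega> \<in> space M \<Longrightarrow> u \<in> {0..T} \<Longrightarrow> \<bar>h u \<omega>\<bar> \<le> Y \<omega>"
      and YA: "(\<integral>\<^sup>+\<omega>. ennreal (Y \<omega> ^ n) \<partial>M) \<le> ennreal A" and A: "A \<ge> (0::real)"
    define \<tau> where "\<tau> c i = real i * (T / 2 ^ c)" for c i :: nat
    define hk where "hk c i \<omega> = clip (real c) (h (\<tau> c i) \<omega>)" for c i \<omega>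
    have \<tau>T: "\<tau> c i \<in> {0..T}" if "i \<le> 2 ^ c" for c i
    proof -
      have "\<tau> c i \<le> real (2 ^ c) * (T / 2 ^ c)" unfolding \<tau>_def
        using that T by (intro mult_right_mono) (simp_all only: of_nat_le_iff, simp)
      then show ?thesis using T by (simp add: \<tau>_def)
    qed
    note sam = sampled_integrals[OF T _ _ Z hc, folded \<tau>_def hk_def]
    have d: "simple_proc_data M F (2 ^ c) (\<tau> c) (hk c)" for c
      by (rule sam(1)[of 0 0 0]) (simp_all add: \<tau>_def)
    have "\<forall>c. \<exists>R\<in>borel_measurable M. (\<integral>\<^sup>+\<omega>. ennreal (R \<omega>) \<partial>M) \<le> ennreal (C * A) \<and>
        (\<forall>\<omega>\<in>space M. \<forall>a b. a \<le> b \<longrightarrow> b \<le> 2 ^ c \<longrightarrow>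
          \<bar>gsum W b (\<tau> c) (hk c) \<omega> - gsum W a (\<tau> c) (hk c) \<omega>\<bar> ^ n
            \<le> R \<omega> * ((real b - real a) / 2 ^ c) powr (real n / 4))"
    proof
      fix c
      show "\<exists>R\<in>borel_measurable M. (\<integral>\<^sup>+\<omega>. ennreal (R \<omega>) \<partial>M) \<le> ennreal (C * A) \<and>
        (\<forall>\<omega>\<in>space M. \<forall>a b. a \<le> b \<longrightarrow> b \<le> 2 ^ c \<longrightarrow>
          \<bar>gsum W b (\<tau> c) (hk c) \<omega> - gsum W a (\<tau> c) (hk c) \<omega>\<bar> ^ n
            \<le> R \<omega> * ((real b - real a) / 2 ^ c) powr (real n / 4))"
        unfolding \<tau>_def[abs_def]
      proof (rule C[OF _ _ _ YA A])
        show "hk c i \<in> borel_measurable (F (real i * (T / 2 ^ c)))" if "i < 2 ^ c" for i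
          using d[of c] that by (auto simp: simple_proc_data_def \<tau>_def)
        show "\<exists>b. \<forall>i<2 ^ c. \<forall>\<omega>\<in>space M. \<bar>hk c i \<omega>\<bar> \<le> b"
          using d[of c] by (auto simp: simple_proc_data_def)
        show "\<bar>hk c i \<omega>\<bar> \<le> Y \<omega>" if "i < 2 ^ c" "\<omega> \<in> space M" for i \<omega>
          unfolding hk_def using hY[OF that(2) \<tau>T[of i c]] that(1)
          by (intro order_trans[OF clip_bounds(2)]) auto
      qed
    qed
    then obtain R where RM: "\<And>c. R c \<in> borel_measurable M" and RI: "\<And>c. (\<integral>\<^sup>+\<omega>. ennreal (R c \<omega>) \<partial>M) \<le> ennreal (C * A)"
      and RB: "\<And>c \<omega> a b. \<omega> \<in> space M \<Longrightarrow> a \<le> b \<Longrightarrow> b \<le> 2 ^ c \<Longrightarrow>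
          \<bar>gsum W b (\<tau> c) (hk c) \<omega> - gsum W a (\<tau> c) (hk c) \<omega>\<bar> ^ n \<le> R c \<omega> * ((real b - real a) / 2 ^ c) powr (real n / 4)"
      by metis
    define X where "X l k a = gsum W (a * 2 ^ k) (\<tau> (l + k)) (hk (l + k))" for l k a
    have al: "a * 2 ^ k \<le> 2 ^ (l + k)" if "a \<le> 2 ^ l" for a k l :: nat using that by (simp add: power_add)
    have XM: "X l k a \<in> borel_measurable M" if "a \<le> 2 ^ l" for l k a
      unfolding X_def using gsum_moments(1)[OF d al[OF that]] by (rule meas_F_M)
    have ZM: "Z (\<tau> l a) \<in> borel_measurable M" if "a \<le> 2 ^ l" for l a
      by (rule ito_measurable[OF Z[OF \<tau>T[OF that]]])
    have XZ: "cprob (\<lambda>k. X l k a) (Z (\<tau> l a))" if "a \<le> 2 ^ l" for l a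
      unfolding X_def by (rule sam(2)[OF _ that]) (simp add: \<tau>_def)
    have XR: "\<bar>X l k b \<omega> - X l k a \<omega>\<bar> ^ n / ((real b - real a) / 2 ^ l) powr (real n / 4) \<le> R (l + k) \<omega>"
      if w: "\<omega> \<in> space M" and ab: "a < b" "b \<le> 2 ^ l" for l k a b \<omega>
    proof -
      have "(real (b * 2 ^ k) - real (a * 2 ^ k)) / 2 ^ (l + k) = (real b - real a) / 2 ^ l"
        by (simp add: power_add left_diff_distrib[symmetric])
      then have "\<bar>X l k b \<omega> - X l k a \<omega>\<bar> ^ n \<le> R (l + k) \<omega> * ((real b - real a) / 2 ^ l) powr (real n / 4)"
        using RB[OF w _ al[OF ab(2)], of "a * 2 ^ k" k] ab unfolding X_def by simp
      then show ?thesis using ab by (simp add: divide_le_eq)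
    qed
    have "\<forall>l. \<exists>H\<in>borel_measurable M. (\<integral>\<^sup>+\<omega>. H \<omega> \<partial>M) \<le> ennreal (C * A) \<and>
      (AE \<omega> in M. \<forall>a b. a < b \<longrightarrow> b \<le> 2 ^ l \<longrightarrow>
        ennreal (\<bar>Z (\<tau> l b) \<omega> - Z (\<tau> l a) \<omega>\<bar> ^ n / ((real b - real a) / 2 ^ l) powr (real n / 4)) \<le> H \<omega>)"
    proof
      fix l
      \<comment> \<open>Summing the errors over the finitely many grid points of level
        \<open>l\<close> yields one subsequence that works for all of them.\<close>
      have "cprob (\<lambda>k \<omega>. \<Sum>a\<in>{..2 ^ l}. \<bar>X l k a \<omega> - Z (\<tau> l a) \<omega>\<bar>) (\<lambda>\<omega>. \<Sum>a\<in>{..(2::nat) ^ l}. 0)"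
        by (rule cprob_sum) (use XM ZM XZ in \<open>auto intro: cprob_zero_abs\<close>)
      then obtain r where r: "strict_mono r" and "AE \<omega> in M. (\<lambda>k. \<Sum>a\<in>{..2 ^ l}. \<bar>X l (r k) a \<omega> - Z (\<tau> l a) \<omega>\<bar>) \<longlonglongrightarrow> (\<Sum>a\<in>{..(2::nat) ^ l}. 0)"
        by (rule cprob_subseq) (use XM ZM in auto)
      then have AE1: "AE \<omega> in M. (\<lambda>k. \<Sum>a\<in>{..2 ^ l}. \<bar>X l (r k) a \<omega> - Z (\<tau> l a) \<omega>\<bar>) \<longlonglongrightarrow> 0" by simp
      define H where "H \<omega> = liminf (\<lambda>k. ennreal (R (l + r k) \<omega>))" for \<omega>
      have "H \<in> borel_measurable M" unfolding H_def using RM by measurable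
      moreover have "(\<integral>\<^sup>+\<omega>. H \<omega> \<partial>M) \<le> ennreal (C * A)"
      proof -
        have "(\<integral>\<^sup>+\<omega>. H \<omega> \<partial>M) \<le> liminf (\<lambda>k. \<integral>\<^sup>+\<omega>. ennreal (R (l + r k) \<omega>) \<partial>M)"
          unfolding H_def using RM by (intro nn_integral_liminf) auto
        also have "\<dots> \<le> ennreal (C * A)" by (intro liminf_upper RI)
        finally show ?thesis .
      qed
      moreover have "AE \<omega> in M. \<forall>a b. a < b \<longrightarrow> b \<le> 2 ^ l \<longrightarrow>
        ennreal (\<bar>Z (\<tau> l b) \<omega> - Z (\<tau> l a) \<omega>\<bar> ^ n / ((real b - real a) / 2 ^ l) powr (real n / 4)) \<le> H \<omega>"
        using AE1
      proof (rule AE_mp, intro AE_I2 impI allI)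
        fix \<omega> a b assume w: "\<omega> \<in> space M" and s0: "(\<lambda>k. \<Sum>a\<in>{..2 ^ l}. \<bar>X l (r k) a \<omega> - Z (\<tau> l a) \<omega>\<bar>) \<longlonglongrightarrow> 0"
          and ab: "a < b" "b \<le> (2::nat) ^ l"
        have lim: "(\<lambda>k. X l (r k) a \<omega>) \<longlonglongrightarrow> Z (\<tau> l a) \<omega>" if "a \<le> 2 ^ l" for a
        proof (rule LIM_zero_cancel, rule Lim_null_comparison[OF _ s0], rule always_eventually, rule allI)
          fix k
          show "norm (X l (r k) a \<omega> - Z (\<tau> l a) \<omega>) \<le> (\<Sum>a\<in>{..2 ^ l}. \<bar>X l (r k) a \<omega> - Z (\<tau> l a) \<omega>\<bar>)"
            using that member_le_sum[of a "{..2 ^ l}" "\<lambda>a. \<bar>X l (r k) a \<omega> - Z (\<tau> l a) \<omega>\<bar>"] by simp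
        qed
        let ?p = "((real b - real a) / 2 ^ l) powr (real n / 4)"
        have "(\<lambda>k. ennreal (\<bar>X l (r k) b \<omega> - X l (r k) a \<omega>\<bar> ^ n / ?p)) \<longlonglongrightarrow> ennreal (\<bar>Z (\<tau> l b) \<omega> - Z (\<tau> l a) \<omega>\<bar> ^ n / ?p)"
          using ab by (intro tendsto_ennrealI tendsto_divide tendsto_power tendsto_rabs tendsto_diff lim tendsto_const) auto
        then have "ennreal (\<bar>Z (\<tau> l b) \<omega> - Z (\<tau> l a) \<omega>\<bar> ^ n / ?p) = liminf (\<lambda>k. ennreal (\<bar>X l (r k) b \<omega> - X l (r k) a \<omega>\<bar> ^ n / ?p))"
          by (intro lim_imp_Liminf[symmetric]) auto
        also have "\<dots> \<le> H \<omega>"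
          unfolding H_def by (intro Liminf_mono always_eventually allI ennreal_leI XR w ab)
        finally show "ennreal (\<bar>Z (\<tau> l b) \<omega> - Z (\<tau> l a) \<omega>\<bar> ^ n / ?p) \<le> H \<omega>" .
      qed
      ultimately show "\<exists>H\<in>borel_measurable M. (\<integral>\<^sup>+\<omega>. H \<omega> \<partial>M) \<le> ennreal (C * A) \<and>
        (AE \<omega> in M. \<forall>a b. a < b \<longrightarrow> b \<le> 2 ^ l \<longrightarrow>
          ennreal (\<bar>Z (\<tau> l b) \<omega> - Z (\<tau> l a) \<omega>\<bar> ^ n / ((real b - real a) / 2 ^ l) powr (real n / 4)) \<le> H \<omega>)" by blast
    qed
    from choice[OF this[unfolded Bex_def]] obtain G where G: "\<forall>l. G l \<in> borel_measurable M \<and>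
      (\<integral>\<^sup>+\<omega>. G l \<omega> \<partial>M) \<le> ennreal (C * A) \<and> (AE \<omega> in M. \<forall>a b. a < b \<longrightarrow> b \<le> 2 ^ l \<longrightarrow>
        ennreal (\<bar>Z (\<tau> l b) \<omega> - Z (\<tau> l a) \<omega>\<bar> ^ n / ((real b - real a) / 2 ^ l) powr (real n / 4)) \<le> G l \<omega>)" ..
    have GM: "\<And>l. G l \<in> borel_measurable M" and GI: "\<And>l. (\<integral>\<^sup>+\<omega>. G l \<omega> \<partial>M) \<le> ennreal (C * A)"
      and GB: "\<And>l. AE \<omega> in M. \<forall>a b. a < b \<longrightarrow> b \<le> 2 ^ l \<longrightarrow>
        ennreal (\<bar>Z (\<tau> l b) \<omega> - Z (\<tau> l a) \<omega>\<bar> ^ n / ((real b - real a) / 2 ^ l) powr (real n / 4)) \<le> G l \<omega>"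
      using G by simp_all
    \<comment> \<open>A lower limit over the levels suffices as majorant: a fixed pair of times is
      approximated at every level, and each approximate quotient lies below
      \<open>G l\<close>.\<close>
    define H where "H \<omega> = liminf (\<lambda>l. G l \<omega>)" for \<omega>
    have "H \<in> borel_measurable M" unfolding H_def using GM by measurable
    moreover have "(\<integral>\<^sup>+\<omega>. H \<omega> \<partial>M) \<le> ennreal (C * A)"
    proof -
      have "(\<integral>\<^sup>+\<omega>. H \<omega> \<partial>M) \<le> liminf (\<lambda>l. \<integral>\<^sup>+\<omega>. G l \<omega> \<partial>M)"
        unfolding H_def using GM by (intro nn_integral_liminf) auto
      also have "\<dots> \<le> ennreal (C * A)" by (intro liminf_upper GI)
      finally show ?thesis .
    qed
    moreover have "AE \<omega> in M. \<forall>s t. 0 \<le> s \<longrightarrow> s < t \<longrightarrow> t \<le> T \<longrightarrow>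
          ennreal (\<bar>Z t \<omega> - Z s \<omega>\<bar> ^ n / ((t - s) / T) powr (real n / 4)) \<le> H \<omega>"
    proof -
      have "AE \<omega> in M. \<forall>l a b. a < b \<longrightarrow> b \<le> 2 ^ l \<longrightarrow>
        ennreal (\<bar>Z (\<tau> l b) \<omega> - Z (\<tau> l a) \<omega>\<bar> ^ n / ((real b - real a) / 2 ^ l) powr (real n / 4)) \<le> G l \<omega>"
        by (subst AE_all_countable) (intro allI GB)
      then show ?thesis
      proof (rule AE_mp, intro AE_I2 impI allI)
        fix \<omega> s t
        assume w: "\<omega> \<in> space M" and G: "\<forall>l a b. a < b \<longrightarrow> b \<le> 2 ^ l \<longrightarrow>
          ennreal (\<bar>Z (\<tau> l b) \<omega> - Z (\<tau> l a) \<omega>\<bar> ^ n / ((real b - real a) / 2 ^ l) powr (real n / 4)) \<le> G l \<omega>"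
          and st: "0 \<le> s" "s < t" "t \<le> T"
        \<comment> \<open>The index of the dyadic point of level \<open>l\<close> just below
          \<open>x\<close>; path continuity of \<open>Z\<close> carries the bound from these points
          to arbitrary times.\<close>
        define f where "f x l = nat \<lfloor>x / T * 2 ^ l\<rfloor>" for x and l :: nat
        have fr: "real (f x l) \<le> x / T * 2 ^ l" "x / T * 2 ^ l - 1 \<le> real (f x l)" if "x \<ge> 0" for x l
        proof -
          have "0 \<le> x / T * 2 ^ l" using that T by simp
          then have "real (f x l) = of_int \<lfloor>x / T * 2 ^ l\<rfloor>" by (simp add: f_def)
          then show "real (f x l) \<le> x / T * 2 ^ l" "x / T * 2 ^ l - 1 \<le> real (f x l)" by linarith+
        qed
        have z: "(\<lambda>l. (1/2::real) ^ l) \<longlonglongrightarrow> 0" by (rule LIMSEQ_realpow_zero) auto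
        have fl: "(\<lambda>l. real (f x l) / 2 ^ l) \<longlonglongrightarrow> x / T" if x: "x \<ge> 0" for x
        proof (rule tendsto_sandwich[OF _ _ _ tendsto_const])
          have "(\<lambda>l. x / T - (1/2) ^ l) \<longlonglongrightarrow> x / T - 0" by (intro tendsto_diff tendsto_const z)
          then show "(\<lambda>l. x / T - (1/2) ^ l) \<longlonglongrightarrow> x / T" by simp
          show "\<forall>\<^sub>F l in sequentially. x / T - (1/2) ^ l \<le> real (f x l) / 2 ^ l"
          proof (rule always_eventually, rule allI)
            fix l
            have "x / T - (1/2) ^ l = (x / T * 2 ^ l - 1) / 2 ^ l" by (simp add: power_one_over diff_divide_distrib)
            also have "\<dots> \<le> real (f x l) / 2 ^ l" using fr[OF x, of l] by (intro divide_right_mono) auto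
            finally show "x / T - (1/2) ^ l \<le> real (f x l) / 2 ^ l" .
          qed
          show "\<forall>\<^sub>F l in sequentially. real (f x l) / 2 ^ l \<le> x / T"
            using fr[OF x] by (intro always_eventually) (simp add: divide_le_eq)
        qed
        have \<tau>l: "(\<lambda>l. \<tau> l (f x l)) \<longlonglongrightarrow> x" if "x \<ge> 0" for x
        proof -
          have "(\<lambda>l. real (f x l) / 2 ^ l * T) \<longlonglongrightarrow> x / T * T" by (intro tendsto_mult fl that tendsto_const)
          then show ?thesis using T by (simp add: \<tau>_def)
        qed
        have fT: "f x l \<le> 2 ^ l" if "0 \<le> x" "x \<le> T" for x l
        proof -
          have "real (f x l) \<le> x / T * 2 ^ l" by (rule fr(1)[OF that(1)])
          also have "\<dots> \<le> 1 * 2 ^ l" using that T by (intro mult_right_mono) auto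
          finally have "real (f x l) \<le> real (2 ^ l)" by simp
          then show ?thesis by (simp only: of_nat_le_iff)
        qed
        have Zl: "(\<lambda>l. Z (\<tau> l (f x l)) \<omega>) \<longlonglongrightarrow> Z x \<omega>" if "0 \<le> x" "x \<le> T" for x
          by (rule continuous_on_tendsto_compose[OF Zc[OF w] \<tau>l]) (use that \<tau>T fT in \<open>auto intro!: always_eventually\<close>)
        let ?F = "\<lambda>l. ennreal (\<bar>Z (\<tau> l (f t l)) \<omega> - Z (\<tau> l (f s l)) \<omega>\<bar> ^ n / ((real (f t l) - real (f s l)) / 2 ^ l) powr (real n / 4))"
        have dl: "(\<lambda>l. (real (f t l) - real (f s l)) / 2 ^ l) \<longlonglongrightarrow> (t - s) / T"
          using tendsto_diff[OF fl[of t] fl[of s]] st by (simp add: diff_divide_distrib)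
        have pos: "(t - s) / T > 0" using st T by simp
        have "?F \<longlonglongrightarrow> ennreal (\<bar>Z t \<omega> - Z s \<omega>\<bar> ^ n / ((t - s) / T) powr (real n / 4))"
          using st pos by (intro tendsto_ennrealI tendsto_divide tendsto_power tendsto_rabs tendsto_diff Zl tendsto_powr dl tendsto_const) auto
        then have "ennreal (\<bar>Z t \<omega> - Z s \<omega>\<bar> ^ n / ((t - s) / T) powr (real n / 4)) = liminf ?F"
          by (intro lim_imp_Liminf[symmetric]) auto
        also have "\<dots> \<le> H \<omega>"
          unfolding H_def
        proof (rule Liminf_mono)
          have "\<forall>\<^sub>F l in sequentially. (real (f t l) - real (f s l)) / 2 ^ l > 0" by (rule order_tendstoD(1)[OF dl pos])
          then show "\<forall>\<^sub>F l in sequentially. ?F l \<le> G l \<omega>"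
          proof eventually_elim
            case (elim l)
            \<comment> \<open>The grid bound needs distinct indices, which holds once the mesh is
              finer than \<open>t - s\<close>.\<close>
            then have "f s l < f t l" by (simp add: zero_less_divide_iff)
            then show ?case using G fT[of t l] st by auto
          qed
        qed
        finally show "ennreal (\<bar>Z t \<omega> - Z s \<omega>\<bar> ^ n / ((t - s) / T) powr (real n / 4)) \<le> H \<omega>" .
      qed
    qed
    ultimately show "\<exists>H\<in>borel_measurable M. (\<integral>\<^sup>+\<omega>. H \<omega> \<partial>M) \<le> ennreal (C * A) \<and>
        (AE \<omega> in M. \<forall>s t. 0 \<le> s \<longrightarrow> s < t \<longrightarrow> t \<le> T \<longrightarrow>
          ennreal (\<bar>Z t \<omega> - Z s \<omega>\<bar> ^ n / ((t - s) / T) powr (real n / 4)) \<le> H \<omega>)" by blast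
  qed
qed

end

section \<open>The Riesz extension\<close>

text \<open>The two finite measures give linearity and the norm bound; measurability in
  \<open>s\<close> is that of an integral with a parameter, since evaluating the path at
  \<open>s + \<theta>\<close> is jointly measurable.\<close>

lemma riesz_delay:
  assumes r: "r > 0" and R: "riesz_extension r L Lh"
  shows "\<exists>B. delay r Lh B" and "\<And>\<phi>. \<phi> \<in> C_space r \<Longrightarrow> Lh \<phi> = L \<phi>"
proof -
  obtain \<mu> \<nu> where fin: "finite_measure \<mu>" "finite_measure \<nu>"
    and sets: "sets \<mu> = sets (restrict_space borel {-r..0})" "sets \<nu> = sets (restrict_space borel {-r..0})"
    and L: "\<And>\<phi>. \<phi> \<in> C_space r \<Longrightarrow> L \<phi> = (LINT \<theta>|\<mu>. \<phi> \<theta>) - (LINT \<theta>|\<nu>. \<phi> \<theta>)"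
    and Lh: "\<And>\<phi>. \<phi> \<in> Chat_space r \<Longrightarrow> Lh \<phi> = (LINT \<theta>|\<mu>. \<phi> \<theta>) - (LINT \<theta>|\<nu>. \<phi> \<theta>)"
    using R unfolding riesz_extension_def by blast
  show "Lh \<phi> = L \<phi>" if "\<phi> \<in> C_space r" for \<phi> using L[OF that] Lh[of \<phi>] C_subset_Chat that by auto
  have int: "integrable m \<phi>" "\<bar>LINT \<theta>|m. \<phi> \<theta>\<bar> \<le> measure m (space m) * supnorm r \<phi>"
    if m: "finite_measure m" "sets m = sets (restrict_space borel {-r..0})" and \<phi>: "\<phi> \<in> Chat_space r" for m \<phi>
  proof -
    interpret finite_measure m by fact
    have b: "\<bar>\<phi> \<theta>\<bar> \<le> supnorm r \<phi>" for \<theta> using Chat_supnorm[OF \<phi>] r by simp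
    have "\<phi> \<in> borel_measurable (restrict_space borel {-r..0})"
      using \<phi> by (auto simp: Chat_space_def intro: measurable_restrict_space1)
    then have "\<phi> \<in> borel_measurable m" by (simp add: measurable_cong_sets[OF m(2) refl])
    then show i: "integrable m \<phi>" by (intro integrable_const_bound[where B="supnorm r \<phi>"]) (use b in auto)
    have "\<bar>LINT \<theta>|m. \<phi> \<theta>\<bar> \<le> (LINT \<theta>|m. \<bar>\<phi> \<theta>\<bar>)" using integral_norm_bound[of m \<phi>] by simp
    also have "\<dots> \<le> (LINT \<theta>|m. supnorm r \<phi>)" by (intro integral_mono) (use i b in auto)
    finally show "\<bar>LINT \<theta>|m. \<phi> \<theta>\<bar> \<le> measure m (space m) * supnorm r \<phi>" by simp
  qed
  have meas: "(\<lambda>s. LINT \<theta>|m. seg r 1 x s \<theta>) \<in> borel_measurable borel"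
    if m: "finite_measure m" "sets m = sets (restrict_space borel {-r..0})" and x: "adm x" for m x
  proof -
    interpret finite_measure m by fact
    have [measurable]: "x \<in> borel_measurable borel" using x by (simp add: adm_def)
    have "(\<lambda>\<theta>. \<theta>) \<in> measurable (restrict_space borel {-r..0}) borel"
      by (intro measurable_restrict_space1) simp
    then have [measurable]: "(\<lambda>\<theta>. \<theta>) \<in> measurable m borel" by (simp add: measurable_cong_sets[OF m(2) refl])
    have 1: "(\<lambda>z. fst z + snd z) \<in> borel_measurable (borel \<Otimes>\<^sub>M m)"
      by (intro borel_measurable_add measurable_fst measurable_compose[OF measurable_snd \<open>(\<lambda>\<theta>. \<theta>) \<in> measurable m borel\<close>])
    have 2: "(\<lambda>z. x (fst z + snd z)) \<in> borel_measurable (borel \<Otimes>\<^sub>M m)"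
      by (rule measurable_compose[OF 1]) simp
    have "(\<lambda>(s, \<theta>). x (s + \<theta>)) \<in> borel_measurable (borel \<Otimes>\<^sub>M m)" using 2 by (simp add: case_prod_beta)
    then have "(\<lambda>s. LINT \<theta>|m. x (s + \<theta>)) \<in> borel_measurable borel"
      by (rule borel_measurable_lebesgue_integral)
    moreover have "space m = {-r..0}" using sets_eq_imp_space_eq[OF m(2)] by (simp add: space_restrict_space)
    then have "(LINT \<theta>|m. x (s + \<theta>)) = (LINT \<theta>|m. seg r 1 x s \<theta>)" for s
      by (intro Bochner_Integration.integral_cong) (auto simp: seg_1 on_seg_def)
    ultimately show ?thesis by simp
  qed
  \<comment> \<open>The summand 1 keeps the constant strictly positive even if both measures
    vanish.\<close>
  let ?B = "measure \<mu> (space \<mu>) + measure \<nu> (space \<nu>) + 1"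
  have "delay r Lh ?B"
  proof
    show "?B > 0" using measure_nonneg[of \<mu> "space \<mu>"] measure_nonneg[of \<nu> "space \<nu>"] by linarith
    fix \<phi> \<psi> assume c: "\<phi> \<in> Chat_space r" "\<psi> \<in> Chat_space r"
    show "Lh (\<lambda>\<theta>. \<phi> \<theta> + \<psi> \<theta>) = Lh \<phi> + Lh \<psi>"
      using int(1)[OF fin(1) sets(1)] int(1)[OF fin(2) sets(2)] c by (simp add: Lh Chat_add)
  next
    fix \<phi> k assume c: "\<phi> \<in> Chat_space r"
    show "Lh (\<lambda>\<theta>. k * \<phi> \<theta>) = k * Lh \<phi>"
      using c by (simp add: Lh Chat_scale right_diff_distrib)
    have "0 \<le> supnorm r \<phi>" using supnorm_nonneg[OF Chat_bounded[OF c]] r by simp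
    then show "\<bar>Lh \<phi>\<bar> \<le> ?B * supnorm r \<phi>"
      using int(2)[OF fin(1) sets(1) c] int(2)[OF fin(2) sets(2) c] unfolding Lh[OF c] by (simp add: algebra_simps)
  next
    fix x assume x: "adm x"
    show "(\<lambda>s. Lh (seg r 1 x s)) \<in> borel_measurable borel"
      using meas[OF fin(1) sets(1) x] meas[OF fin(2) sets(2) x] by (simp add: Lh adm_seg[OF x])
  qed fact
  then show "\<exists>B. delay r Lh B" ..
qed

section \<open>Segments of continuous paths\<close>

lemma seg_rescale: "\<epsilon> \<noteq> 0 \<Longrightarrow> seg r \<epsilon> f t = seg r 1 (\<lambda>\<tau>. f (\<epsilon>\<^sup>2 * \<tau>)) (t / \<epsilon>\<^sup>2)"
  by (simp add: seg_def distrib_left)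

lemma seg_arg:
  fixes \<epsilon> :: real
  assumes "r > 0" "t \<in> {0..T}" "\<theta> \<in> {-r..0}"
  shows "t + \<epsilon>\<^sup>2 * \<theta> \<in> {-(\<epsilon>\<^sup>2 * r)..T}"
proof -
  have "\<epsilon>\<^sup>2 * (-r) \<le> \<epsilon>\<^sup>2 * \<theta>" using assms by (intro mult_left_mono) auto
  moreover have "\<epsilon>\<^sup>2 * \<theta> \<le> 0" using assms by (simp add: mult_nonneg_nonpos)
  ultimately show ?thesis using assms by auto
qed

lemma seg_C_space:
  assumes "r > 0" "continuous_on {-(\<epsilon>\<^sup>2 * r)..T} f" "t \<in> {0..T}"
  shows "seg r \<epsilon> f t \<in> C_space r"
  unfolding seg_def
  by (intro C_spaceI continuous_on_compose2[OF assms(2)] continuous_intros) (use seg_arg[OF assms(1,3)] in auto)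

lemma seg_uniform:
  assumes r: "r > 0" and f: "continuous_on {-(\<epsilon>\<^sup>2 * r)..T} f" and e: "e > 0"
  obtains d where "d > 0" "\<And>s t. s \<in> {0..T} \<Longrightarrow> t \<in> {0..T} \<Longrightarrow> \<bar>s - t\<bar> < d \<Longrightarrow>
    supnorm r (\<lambda>\<theta>. seg r \<epsilon> f s \<theta> - seg r \<epsilon> f t \<theta>) \<le> e"
proof -
  have "uniformly_continuous_on {-(\<epsilon>\<^sup>2 * r)..T} f" by (rule compact_uniformly_continuous[OF f]) simp
  then obtain d where d: "d > 0" "\<And>s t. s \<in> {-(\<epsilon>\<^sup>2 * r)..T} \<Longrightarrow> t \<in> {-(\<epsilon>\<^sup>2 * r)..T} \<Longrightarrow> dist s t < d \<Longrightarrow> dist (f s) (f t) < e"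
    using e unfolding uniformly_continuous_on_def by metis
  show thesis
  proof (rule that[OF d(1)])
    fix s t assume st: "s \<in> {0..T}" "t \<in> {0..T}" "\<bar>s - t\<bar> < d"
    show "supnorm r (\<lambda>\<theta>. seg r \<epsilon> f s \<theta> - seg r \<epsilon> f t \<theta>) \<le> e"
    proof (rule supnorm_le)
      fix \<theta> assume \<theta>: "\<theta> \<in> {-r..0}"
      have "dist (f (s + \<epsilon>\<^sup>2 * \<theta>)) (f (t + \<epsilon>\<^sup>2 * \<theta>)) < e"
        using st by (intro d(2) seg_arg[OF r _ \<theta>]) (auto simp: dist_real_def)
      then show "\<bar>seg r \<epsilon> f s \<theta> - seg r \<epsilon> f t \<theta>\<bar> \<le> e" using \<theta> by (simp add: seg_def on_seg_def dist_real_def)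
    qed (use r in simp)
  qed
qed

lemma functional_path_continuous:
  assumes r: "r > 0" and f: "continuous_on {-(\<epsilon>\<^sup>2 * r)..T} f"
    and \<Phi>: "\<And>\<phi> \<psi>. \<phi> \<in> C_space r \<Longrightarrow> \<psi> \<in> C_space r \<Longrightarrow> \<bar>\<Phi> \<phi> - \<Phi> \<psi>\<bar> \<le> c * supnorm r (\<lambda>\<theta>. \<phi> \<theta> - \<psi> \<theta>)"
  shows "continuous_on {0..T} (\<lambda>t. \<Phi> (seg r \<epsilon> f t))"
  unfolding continuous_on_iff
proof (intro ballI allI impI)
  fix t e :: real assume t: "t \<in> {0..T}" and e: "e > 0"
  \<comment> \<open>\<open>c\<close> carries no sign condition here;
    \<open>\<bar>c\<bar> + 1\<close> is a positive majorant and the factor 2 yields a strict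
    inequality.\<close>
  define e' where "e' = e / (2 * (\<bar>c\<bar> + 1))"
  have e': "e' > 0" using e by (simp add: e'_def)
  obtain d where d: "d > 0" "\<And>s t. s \<in> {0..T} \<Longrightarrow> t \<in> {0..T} \<Longrightarrow> \<bar>s - t\<bar> < d \<Longrightarrow>
    supnorm r (\<lambda>\<theta>. seg r \<epsilon> f s \<theta> - seg r \<epsilon> f t \<theta>) \<le> e'" using seg_uniform[OF r f e'] by blast
  show "\<exists>d>0. \<forall>s\<in>{0..T}. dist s t < d \<longrightarrow> dist (\<Phi> (seg r \<epsilon> f s)) (\<Phi> (seg r \<epsilon> f t)) < e"
  proof (intro exI[of _ d] conjI d(1) ballI impI)
    fix s assume s: "s \<in> {0..T}" "dist s t < d"
    note C = seg_C_space[OF r f s(1)] seg_C_space[OF r f t]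
    let ?n = "supnorm r (\<lambda>\<theta>. seg r \<epsilon> f s \<theta> - seg r \<epsilon> f t \<theta>)"
    have n0: "0 \<le> ?n"
      by (rule supnorm_nonneg[OF Chat_bounded[OF Chat_diff]]) (use C C_subset_Chat r in auto)
    have "\<bar>\<Phi> (seg r \<epsilon> f s) - \<Phi> (seg r \<epsilon> f t)\<bar> \<le> c * ?n" by (rule \<Phi>[OF C])
    also have "\<dots> \<le> (\<bar>c\<bar> + 1) * ?n" using n0 by (intro mult_right_mono) auto
    also have "\<dots> \<le> (\<bar>c\<bar> + 1) * e'" using d(2)[OF s(1) t] s by (intro mult_left_mono) (auto simp: dist_real_def)
    also have "\<dots> = e / 2" by (simp add: e'_def field_simps)
    also have "\<dots> < e" using e by simp
    finally show "dist (\<Phi> (seg r \<epsilon> f s)) (\<Phi> (seg r \<epsilon> f t)) < e" by (simp add: dist_real_def)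
  qed
qed

lemma C_diff: "\<phi> \<in> C_space r \<Longrightarrow> \<psi> \<in> C_space r \<Longrightarrow> (\<lambda>\<theta>. \<phi> \<theta> - \<psi> \<theta>) \<in> C_space r"
  unfolding C_space_def by (auto intro: continuous_intros)

lemma bounded_linear_C_lipschitz:
  assumes L: "bounded_linear_C r L"
  obtains c where "c \<ge> 0" "\<And>\<phi>. r > 0 \<Longrightarrow> \<phi> \<in> C_space r \<Longrightarrow> \<bar>L \<phi>\<bar> \<le> c * supnorm r \<phi>"
    "\<And>\<phi> \<psi>. r > 0 \<Longrightarrow> \<phi> \<in> C_space r \<Longrightarrow> \<psi> \<in> C_space r \<Longrightarrow> \<bar>L \<phi> - L \<psi>\<bar> \<le> c * supnorm r (\<lambda>\<theta>. \<phi> \<theta> - \<psi> \<theta>)"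
proof -
  obtain b where b: "\<And>\<phi>. \<phi> \<in> C_space r \<Longrightarrow> \<bar>L \<phi>\<bar> \<le> b * supnorm r \<phi>"
    using L unfolding bounded_linear_C_def by blast
  have c: "\<bar>L \<phi>\<bar> \<le> \<bar>b\<bar> * supnorm r \<phi>" if "r > 0" "\<phi> \<in> C_space r" for \<phi>
  proof -
    have "\<phi> \<in> Chat_space r" using that C_subset_Chat by auto
    from supnorm_nonneg[OF Chat_bounded[OF this]] have "0 \<le> supnorm r \<phi>" using that by simp
    then have "b * supnorm r \<phi> \<le> \<bar>b\<bar> * supnorm r \<phi>" by (intro mult_right_mono) auto
    then show ?thesis using b[OF that(2)] by linarith
  qed
  have d: "L \<phi> - L \<psi> = L (\<lambda>\<theta>. \<phi> \<theta> - \<psi> \<theta>)" if C: "\<phi> \<in> C_space r" "\<psi> \<in> C_space r" for \<phi> \<psi>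
  proof -
    have "\<forall>\<phi>\<in>C_space r. \<forall>\<psi>\<in>C_space r. L (\<lambda>\<theta>. \<phi> \<theta> + \<psi> \<theta>) = L \<phi> + L \<psi>"
      using L by (simp add: bounded_linear_C_def)
    from bspec[OF bspec[OF this C_diff[OF C]] C(2)] show ?thesis by simp
  qed
  show thesis by (rule that[of "\<bar>b\<bar>"]) (use c d C_diff in auto)
qed

lemma integral_path_continuous:
  fixes g :: "real \<Rightarrow> real"
  assumes g: "continuous_on {0..T} g"
  shows "continuous_on {0..T} (\<lambda>t. LBINT s:{0..t}. g s)"
    and "\<And>a b. 0 \<le> a \<Longrightarrow> a \<le> b \<Longrightarrow> b \<le> T \<Longrightarrow> (\<And>s. s \<in> {0..T} \<Longrightarrow> \<bar>g s\<bar> \<le> c) \<Longrightarrow>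
      \<bar>(LBINT s:{0..b}. g s) - (LBINT s:{0..a}. g s)\<bar> \<le> c * (b - a)"
proof -
  have i: "set_integrable lborel {a..b} g" if "0 \<le> a" "b \<le> T" for a b
    using that by (intro borel_integrable_atLeastAtMost' continuous_on_subset[OF g]) auto
  have e: "(LBINT s:{a..b}. g s) = integral {a..b} g" if "0 \<le> a" "b \<le> T" for a b
    by (rule set_borel_integral_eq_integral(2)[OF i[OF that]])
  have "continuous_on {0..T} (\<lambda>t. integral {0..t} g)"
    by (intro indefinite_integral_continuous_1 integrable_continuous_interval g)
  then show "continuous_on {0..T} (\<lambda>t. LBINT s:{0..t}. g s)"
    by (rule continuous_on_eq) (simp add: e)
  fix a b assume ab: "0 \<le> a" "a \<le> b" "b \<le> T" and c: "\<And>s. s \<in> {0..T} \<Longrightarrow> \<bar>g s\<bar> \<le> c"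
  have "integral {0..a} g + integral {a..b} g = integral {0..b} g"
    using ab by (intro Henstock_Kurzweil_Integration.integral_combine integrable_continuous_interval continuous_on_subset[OF g]) auto
  then have "(LBINT s:{0..b}. g s) - (LBINT s:{0..a}. g s) = integral {a..b} g" using ab by (simp add: e)
  also have "\<bar>\<dots>\<bar> \<le> c * (b - a)"
    using integral_bound[of a b g c] ab c continuous_on_subset[OF g, of "{a..b}"] by auto
  finally show "\<bar>(LBINT s:{0..b}. g s) - (LBINT s:{0..a}. g s)\<bar> \<le> c * (b - a)" .
qed

section \<open>The stable part of the stochastic delay equation\<close>

context delay_proj begin

text \<open>Packaged as a predicate so that one constant can be fixed before
  \<open>\<epsilon>\<close> varies and then handed to the estimates for each
  \<open>\<epsilon>\<close>.\<close>

definition forcing_const :: "real \<Rightarrow> bool" where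
  "forcing_const C \<longleftrightarrow> C \<ge> 0 \<and> (\<forall>A f H N \<theta>. A > 0 \<longrightarrow> N > 0 \<longrightarrow> \<theta> \<in> {-r..0} \<longrightarrow> H \<ge> 0 \<longrightarrow>
      (\<forall>s t. 0 \<le> s \<longrightarrow> s \<le> t \<longrightarrow> t \<le> A \<longrightarrow> \<bar>f t - f s\<bar> \<le> H * (t - s) powr (1/4)) \<longrightarrow>
      \<bar>\<Sum>i<N. (f (real (Suc i) * (A / real N)) - f (real i * (A / real N)))
            * dde_semigroup r Lh (A - real i * (A / real N)) \<psi> \<theta>\<bar> \<le> C * H)"

lemma forcing_const_nonneg: "forcing_const C \<Longrightarrow> C \<ge> 0"
  by (simp only: forcing_const_def)

lemma forcing_constD:
  assumes "forcing_const C" "A > 0" "N > 0" "\<theta> \<in> {-r..0}" "H \<ge> 0"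
    "\<And>s t. 0 \<le> s \<Longrightarrow> s \<le> t \<Longrightarrow> t \<le> A \<Longrightarrow> \<bar>f t - f s\<bar> \<le> H * (t - s) powr (1/4)"
  shows "\<bar>\<Sum>i<N. (f (real (Suc i) * (A / real N)) - f (real i * (A / real N)))
            * dde_semigroup r Lh (A - real i * (A / real N)) \<psi> \<theta>\<bar> \<le> C * H"
  using assms unfolding forcing_const_def by blast

lemma forcing_const_exists: "\<exists>C. forcing_const C"
proof (rule hoelder_forcing_bound)
  fix C :: real
  assume C: "C \<ge> 0" and b: "\<And>A f H N \<theta>. A > 0 \<Longrightarrow> N > 0 \<Longrightarrow> \<theta> \<in> {-r..0} \<Longrightarrow> H \<ge> 0 \<Longrightarrow>
      (\<And>s t. 0 \<le> s \<Longrightarrow> s \<le> t \<Longrightarrow> t \<le> A \<Longrightarrow> \<bar>f t - f s\<bar> \<le> H * (t - s) powr (1/4)) \<Longrightarrow>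
      \<bar>\<Sum>i<N. (f (real (Suc i) * (A / real N)) - f (real i * (A / real N)))
            * dde_semigroup r Lh (A - real i * (A / real N)) \<psi> \<theta>\<bar> \<le> C * H"
  show ?thesis
    unfolding forcing_const_def
  proof (intro exI[of _ C] conjI allI impI C)
    fix A H \<theta> :: real and f :: "real \<Rightarrow> real" and N :: nat
    assume "A > 0" "N > 0" "\<theta> \<in> {-r..0}" "H \<ge> 0"
      and f: "\<forall>s t. 0 \<le> s \<longrightarrow> s \<le> t \<longrightarrow> t \<le> A \<longrightarrow> \<bar>f t - f s\<bar> \<le> H * (t - s) powr (1/4)"
    then show "\<bar>\<Sum>i<N. (f (real (Suc i) * (A / real N)) - f (real i * (A / real N)))
            * dde_semigroup r Lh (A - real i * (A / real N)) \<psi> \<theta>\<bar> \<le> C * H"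
      by (intro b) simp_all
  qed
qed

text \<open>As the integration variable increases to \<open>u\<close>, the kernel argument decreases
  to its limit. So what counts is right continuity of \<open>kern\<close>, which holds even at its
  jump, because the value at 0 belongs to the right branch.\<close>

lemma kern_left_continuous:
  assumes e: "\<epsilon> > 0" and u: "u \<le> s" and \<theta>: "\<theta> \<in> {-r..0}"
  shows "((\<lambda>v. dde_semigroup r Lh ((s - v) / \<epsilon>\<^sup>2) \<psi> \<theta>) \<longlongrightarrow> dde_semigroup r Lh ((s - u) / \<epsilon>\<^sup>2) \<psi> \<theta>) (at_left u)"
proof -
  obtain C1 where C1: "C1 \<ge> 0"
    "\<And>s t. -r \<le> s \<Longrightarrow> s \<le> t \<Longrightarrow> 0 \<le> s \<or> t < 0 \<Longrightarrow> \<bar>kern t - kern s\<bar> \<le> C1 * exp (- \<kappa> * s) * (t - s)"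
    by (rule kern_increment) blast
  define t where "t v = (s - v) / \<epsilon>\<^sup>2 + \<theta>" for v
  have e2: "\<epsilon>\<^sup>2 > 0" using e by simp
  have tu: "t u \<ge> -r"
  proof -
    have "(s - u) / \<epsilon>\<^sup>2 \<ge> 0" using u e2 by simp
    then show ?thesis using \<theta> unfolding t_def by simp
  qed
  have tv: "t v - t u = (u - v) / \<epsilon>\<^sup>2" for v by (simp add: t_def diff_divide_distrib)
  have c: "(t \<longlongrightarrow> t u) (at_left u)" unfolding t_def by (intro tendsto_intros) (use e in auto)
  have "((\<lambda>v. C1 * exp (- \<kappa> * t u) * ((u - v) / \<epsilon>\<^sup>2)) \<longlongrightarrow> C1 * exp (- \<kappa> * t u) * ((u - u) / \<epsilon>\<^sup>2)) (at_left u)"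
    by (intro tendsto_intros) (use e in auto)
  then have z: "((\<lambda>v. C1 * exp (- \<kappa> * t u) * ((u - v) / \<epsilon>\<^sup>2)) \<longlongrightarrow> 0) (at_left u)" by simp
  have lt: "\<forall>\<^sub>F v in at_left u. v < u" by (simp add: eventually_at_filter)
  have "\<forall>\<^sub>F v in at_left u. 0 \<le> t u \<or> t v < 0"
  proof (cases "0 \<le> t u")
    case False
    then show ?thesis using order_tendstoD(2)[OF c, of 0] by (auto elim: eventually_mono)
  qed simp
  with lt have "\<forall>\<^sub>F v in at_left u. norm (kern (t v) - kern (t u)) \<le> C1 * exp (- \<kappa> * t u) * ((u - v) / \<epsilon>\<^sup>2)"
  proof eventually_elim
    case (elim v)
    have "0 \<le> (u - v) / \<epsilon>\<^sup>2" using elim e2 by simp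
    then have "t u \<le> t v" using tv[of v] by linarith
    then show ?case using C1(2)[OF tu, of "t v"] elim by (simp add: tv)
  qed
  then have "((\<lambda>v. kern (t v) - kern (t u)) \<longlongrightarrow> 0) (at_left u)" by (rule Lim_null_comparison[OF _ z])
  then have "((\<lambda>v. kern (t v)) \<longlongrightarrow> kern (t u)) (at_left u)" by (rule LIM_zero_cancel)
  then show ?thesis using \<theta> by (simp add: semigroup_kern t_def)
qed

lemma P_continuous: "\<phi> \<in> P_space r \<omega>c \<Longrightarrow> continuous_on {-r..0} \<phi>"
  by (elim P_E) (auto simp: on_seg_def intro: continuous_on_eq[OF trig_cont])

lemma proj_compl_continuous: "\<phi> \<in> C_space r \<Longrightarrow> continuous_on {-r..0} (proj_compl p \<phi>)"
proof -
  assume \<phi>: "\<phi> \<in> C_space r"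
  then have "\<phi> \<in> Chat_space r" using C_subset_Chat by blast
  then have "continuous_on {-r..0} (p \<phi>)" by (intro P_continuous proj_P)
  with \<phi> show ?thesis unfolding proj_compl_def by (intro continuous_on_diff) (simp_all add: C_space_def)
qed

text \<open>For a continuous history the two branches meet at 0 without a jump.\<close>

lemma sol_continuous:
  assumes \<phi>: "\<phi> \<in> Chat_space r" "continuous_on {-r..0} \<phi>"
  shows "continuous_on {-r..} (sol \<phi>)"
proof -
  have "continuous_on ({-r..0} \<union> {0..}) (sol \<phi>)"
  proof (rule continuous_on_closed_Un)
    show "continuous_on {-r..0} (sol \<phi>)"
      using \<phi>(2) by (rule continuous_on_eq) (simp add: sol_init[OF \<phi>(1)])
  qed (auto intro: sol_cont[OF \<phi>(1)])
  moreover have "{-r..0} \<union> {0..} = {-r..}" using r_pos by auto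
  ultimately show ?thesis by simp
qed

end

lemma continuous_on_prod_uniform:
  fixes q :: "real \<Rightarrow> real \<Rightarrow> real"
  assumes q: "\<And>s. s \<in> S \<Longrightarrow> continuous_on B (q s)"
    and u: "\<And>s e. s \<in> S \<Longrightarrow> e > 0 \<Longrightarrow> \<exists>d>0. \<forall>s'\<in>S. \<bar>s' - s\<bar> < d \<longrightarrow> (\<forall>\<theta>\<in>B. \<bar>q s' \<theta> - q s \<theta>\<bar> \<le> e)"
  shows "continuous_on (S \<times> B) (\<lambda>(s, \<theta>). q s \<theta>)"
  unfolding continuous_on_iff
proof (intro ballI allI impI)
  fix z :: "real \<times> real" and e :: real assume z: "z \<in> S \<times> B" and e: "e > 0"
  obtain s \<theta> where z': "z = (s, \<theta>)" "s \<in> S" "\<theta> \<in> B" using z by auto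
  obtain d1 where d1: "d1 > 0" "\<And>s' \<theta>. s' \<in> S \<Longrightarrow> \<bar>s' - s\<bar> < d1 \<Longrightarrow> \<theta> \<in> B \<Longrightarrow> \<bar>q s' \<theta> - q s \<theta>\<bar> \<le> e/3"
    using u[OF z'(2), of "e/3"] e by auto
  obtain d2 where d2: "d2 > 0" "\<And>\<theta>'. \<theta>' \<in> B \<Longrightarrow> dist \<theta>' \<theta> < d2 \<Longrightarrow> dist (q s \<theta>') (q s \<theta>) < e/3"
    using q[OF z'(2)] z'(3) e unfolding continuous_on_iff by (metis divide_pos_pos zero_less_numeral)
  show "\<exists>d>0. \<forall>z'\<in>S \<times> B. dist z' z < d \<longrightarrow> dist (case z' of (s, \<theta>) \<Rightarrow> q s \<theta>) (case z of (s, \<theta>) \<Rightarrow> q s \<theta>) < e"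
  proof (intro exI[of _ "min d1 d2"] conjI ballI impI)
    fix y assume y: "y \<in> S \<times> B" "dist y z < min d1 d2"
    obtain s' \<theta>' where y': "y = (s', \<theta>')" "s' \<in> S" "\<theta>' \<in> B" using y by auto
    have "dist s' s < d1" "dist \<theta>' \<theta> < d2"
      using y(2) dist_fst_le[of y z] dist_snd_le[of y z] by (auto simp: y' z')
    then have "\<bar>q s' \<theta>' - q s \<theta>'\<bar> \<le> e/3" "dist (q s \<theta>') (q s \<theta>) < e/3"
      using d1(2)[OF y'(2), of \<theta>'] d2(2)[OF y'(3)] y'(3) by (auto simp: dist_real_def)
    then show "dist (case y of (s, \<theta>) \<Rightarrow> q s \<theta>) (case z of (s, \<theta>) \<Rightarrow> q s \<theta>) < e"
      using e unfolding y'(1) z'(1) prod.case dist_real_def by linarith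
  qed (use d1 d2 in auto)
qed

text \<open>A single fixed \<open>\<epsilon>\<close>. Constants that must be uniform in
  \<open>\<epsilon>\<close> are obtained outside this locale or enter its lemmas as
  hypotheses.\<close>

locale sdde = W: wiener M F W + D: delay_proj r Lh B \<omega>c p K \<kappa>
  for M :: "'a measure" and F W r Lh B \<omega>c p K \<kappa> +
  fixes T K_G \<epsilon> :: real and L0 G L1 :: "(real \<Rightarrow> real) \<Rightarrow> real" and \<xi> :: "real \<Rightarrow> real"
    and X :: "real \<Rightarrow> 'a \<Rightarrow> real" and V :: "real \<Rightarrow> real \<Rightarrow> 'a \<Rightarrow> real"
  assumes T_pos: "T > 0" and \<epsilon>_pos: "\<epsilon> > 0"
    and L0_eq: "\<And>\<phi>. \<phi> \<in> C_space r \<Longrightarrow> Lh \<phi> = L0 \<phi>"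
    and L0_lin: "bounded_linear_C r L0" and L1_lin: "bounded_linear_C r L1"
    and G_lip: "\<And>\<phi> \<psi>. \<phi> \<in> C_space r \<Longrightarrow> \<psi> \<in> C_space r \<Longrightarrow>
           \<bar>G \<phi> - G \<psi>\<bar> \<le> K_G * supnorm r (\<lambda>\<theta>. \<phi> \<theta> - \<psi> \<theta>)"
    and G_zero: "G (\<lambda>_. 0) = 0"
    and X_sol: "sdde_solution M F W r T L0 G L1 \<xi> \<epsilon> X"
    and V_ver: "stoch_conv_version M F W r T Lh p \<epsilon> (\<lambda>u \<omega>. L1 (seg r \<epsilon> (\<lambda>v. X v \<omega>) u)) V"
begin

abbreviation Xs :: "'a \<Rightarrow> real \<Rightarrow> real \<Rightarrow> real" where
  "Xs \<omega> \<equiv> seg r \<epsilon> (\<lambda>v. X v \<omega>)"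

definition h :: "real \<Rightarrow> 'a \<Rightarrow> real" where "h u \<omega> = L1 (Xs \<omega> u)"

text \<open>The residual of the equation is taken as the stochastic integral. Among all almost
  surely equal versions this selects one with continuous paths for which the integral equation holds
  on every path, so the deterministic theory applies without exceptional sets.\<close>

definition Z :: "real \<Rightarrow> 'a \<Rightarrow> real" where
  "Z t \<omega> = X t \<omega> - X 0 \<omega> - (LBINT s:{0..t}. L0 (Xs \<omega> s) / \<epsilon>\<^sup>2) - (LBINT s:{0..t}. G (Xs \<omega> s))"

definition IG :: "real \<Rightarrow> 'a \<Rightarrow> real" where
  "IG t \<omega> = (LBINT s:{0..t}. G (Xs \<omega> s))"

lemma e2: "\<epsilon>\<^sup>2 > 0" using \<epsilon>_pos by simp

lemma unscale: "\<epsilon>\<^sup>2 * (y / \<epsilon>\<^sup>2) = y" using \<epsilon>_pos by simp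

lemma X_cont: "\<omega> \<in> space M \<Longrightarrow> continuous_on {-(\<epsilon>\<^sup>2 * r)..T} (\<lambda>t. X t \<omega>)"
  using X_sol by (simp add: sdde_solution_def)

lemma Z_ito: "t \<in> {0..T} \<Longrightarrow> ito_integral M F W h t (Z t)"
  using X_sol unfolding sdde_solution_def h_def[abs_def] Z_def[abs_def] by blast

lemma Xs_C: "\<omega> \<in> space M \<Longrightarrow> t \<in> {0..T} \<Longrightarrow> Xs \<omega> t \<in> C_space r"
  by (rule seg_C_space[OF D.r_pos X_cont])

lemma G_cont: "\<omega> \<in> space M \<Longrightarrow> continuous_on {0..T} (\<lambda>t. G (Xs \<omega> t))"
  by (rule functional_path_continuous[OF D.r_pos X_cont G_lip])

lemma L0_cont: "\<omega> \<in> space M \<Longrightarrow> continuous_on {0..T} (\<lambda>t. L0 (Xs \<omega> t))"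
proof -
  assume w: "\<omega> \<in> space M"
  obtain c where "\<And>\<phi> \<psi>. \<phi> \<in> C_space r \<Longrightarrow> \<psi> \<in> C_space r \<Longrightarrow> \<bar>L0 \<phi> - L0 \<psi>\<bar> \<le> c * supnorm r (\<lambda>\<theta>. \<phi> \<theta> - \<psi> \<theta>)"
    using bounded_linear_C_lipschitz[OF L0_lin] D.r_pos by metis
  then show ?thesis by (rule functional_path_continuous[OF D.r_pos X_cont[OF w]])
qed

lemma h_cont: "\<omega> \<in> space M \<Longrightarrow> continuous_on {0..T} (\<lambda>t. h t \<omega>)"
proof -
  assume w: "\<omega> \<in> space M"
  obtain c where "\<And>\<phi> \<psi>. \<phi> \<in> C_space r \<Longrightarrow> \<psi> \<in> C_space r \<Longrightarrow> \<bar>L1 \<phi> - L1 \<psi>\<bar> \<le> c * supnorm r (\<lambda>\<theta>. \<phi> \<theta> - \<psi> \<theta>)"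
    using bounded_linear_C_lipschitz[OF L1_lin] D.r_pos by metis
  then show ?thesis unfolding h_def by (rule functional_path_continuous[OF D.r_pos X_cont[OF w]])
qed

lemma sub_cont: "\<omega> \<in> space M \<Longrightarrow> continuous_on {0..T} (\<lambda>t. X t \<omega>)"
proof (rule continuous_on_subset[OF X_cont])
  have "0 \<le> \<epsilon>\<^sup>2 * r" using D.r_pos by simp
  then show "{0..T} \<subseteq> {- (\<epsilon>\<^sup>2 * r)..T}" by auto
qed

lemma Z_cont: "\<omega> \<in> space M \<Longrightarrow> continuous_on {0..T} (\<lambda>t. Z t \<omega>)"
  unfolding Z_def
  by (intro continuous_intros sub_cont integral_path_continuous(1) G_cont L0_cont) (use \<epsilon>_pos in auto)

lemma IG_cont: "\<omega> \<in> space M \<Longrightarrow> continuous_on {0..T} (\<lambda>t. IG t \<omega>)"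
  unfolding IG_def by (intro integral_path_continuous(1) G_cont)

text \<open>Comparing the constant functions 1 and 0 in the Lipschitz condition forces the
  sign.\<close>

lemma KG_nonneg: "K_G \<ge> 0"
proof -
  have one: "on_seg r (\<lambda>_. 1) \<in> C_space r" by (intro C_spaceI continuous_intros)
  have zero: "(\<lambda>_. 0) \<in> C_space r" by (simp add: C_space_def)
  let ?n = "supnorm r (\<lambda>\<theta>. on_seg r (\<lambda>_. 1) \<theta> - 0)"
  have "\<bar>on_seg r (\<lambda>_. 1) 0\<bar> \<le> supnorm r (on_seg r (\<lambda>_. 1))"
    using one C_subset_Chat D.r_pos by (intro Chat_supnorm) auto
  then have n: "?n \<ge> 1" using D.r_pos by (simp add: on_seg_def)
  have "0 \<le> K_G * ?n" using G_lip[OF one zero] by (rule order_trans[OF abs_ge_zero])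
  then show ?thesis using n by (simp add: zero_le_mult_iff)
qed

lemma supnorm_Xs:
  assumes w: "\<omega> \<in> space M" and t: "t \<in> {0..T}" and N: "\<And>v. v \<in> {-(\<epsilon>\<^sup>2 * r)..T} \<Longrightarrow> \<bar>X v \<omega>\<bar> \<le> N"
  shows "supnorm r (Xs \<omega> t) \<le> N"
  using D.r_pos by (intro supnorm_le) (auto simp: seg_def on_seg_def intro!: N seg_arg[OF D.r_pos t])

lemma G_bound:
  assumes w: "\<omega> \<in> space M" and t: "t \<in> {0..T}" and N: "\<And>v. v \<in> {-(\<epsilon>\<^sup>2 * r)..T} \<Longrightarrow> \<bar>X v \<omega>\<bar> \<le> N"
  shows "\<bar>G (Xs \<omega> t)\<bar> \<le> K_G * N"
proof -
  have "\<bar>G (Xs \<omega> t) - G (\<lambda>_. 0)\<bar> \<le> K_G * supnorm r (\<lambda>\<theta>. Xs \<omega> t \<theta> - 0)"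
    by (rule G_lip[OF Xs_C[OF w t]]) (simp add: C_space_def)
  also have "\<dots> \<le> K_G * N" using supnorm_Xs[OF w t N] KG_nonneg by (intro mult_left_mono) auto
  finally show ?thesis by (simp add: G_zero)
qed

section \<open>The forced part as a limit of Riemann sums\<close>

definition Yf :: "'a \<Rightarrow> real \<Rightarrow> real \<Rightarrow> real" where
  "Yf \<omega> s = forced_y_path r Lh p \<epsilon> (\<lambda>v. X v \<omega>) s"

lemma Yf_alt: "Yf \<omega> s \<theta> = proj_compl p (Xs \<omega> s) \<theta> - dde_semigroup r Lh (s / \<epsilon>\<^sup>2) (proj_compl p (Xs \<omega> 0)) \<theta>"
  by (simp add: Yf_def forced_y_path_def y_path_def free_y_path_def)

definition ker :: "real \<Rightarrow> real \<Rightarrow> real \<Rightarrow> real" where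
  "ker s \<theta> u = dde_semigroup r Lh ((s - u) / \<epsilon>\<^sup>2) D.\<psi> \<theta>"

lemma riemann_rescale:
  assumes s: "s > 0"
  shows "(\<Sum>i<N. (f (real (Suc i) * (s / \<epsilon>\<^sup>2 / real N)) - f (real i * (s / \<epsilon>\<^sup>2 / real N)))
            * dde_semigroup r Lh (s / \<epsilon>\<^sup>2 - real i * (s / \<epsilon>\<^sup>2 / real N)) D.\<psi> \<theta>)
    = (\<Sum>i<N. ker s \<theta> (real i * (s / real N)) * (f (real (Suc i) * (s / real N) / \<epsilon>\<^sup>2) - f (real i * (s / real N) / \<epsilon>\<^sup>2)))"
proof (rule sum.cong)
  fix i assume "i \<in> {..<N}"
  have "real j * (s / \<epsilon>\<^sup>2 / real N) = real j * (s / real N) / \<epsilon>\<^sup>2" for j by simp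
  moreover have "s / \<epsilon>\<^sup>2 - real i * (s / \<epsilon>\<^sup>2 / real N) = (s - real i * (s / real N)) / \<epsilon>\<^sup>2"
    by (simp add: diff_divide_distrib)
  ultimately show "(f (real (Suc i) * (s / \<epsilon>\<^sup>2 / real N)) - f (real i * (s / \<epsilon>\<^sup>2 / real N)))
            * dde_semigroup r Lh (s / \<epsilon>\<^sup>2 - real i * (s / \<epsilon>\<^sup>2 / real N)) D.\<psi> \<theta>
    = ker s \<theta> (real i * (s / real N)) * (f (real (Suc i) * (s / real N) / \<epsilon>\<^sup>2) - f (real i * (s / real N) / \<epsilon>\<^sup>2))"
    by (simp only: ker_def mult.commute)
qed simp

text \<open>Valid for every \<open>\<omega>\<close>, because \<open>Z\<close> is the residual of the
  equation. The time \<open>s = 0\<close> is excluded, as the rescaled horizon must be positive. The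
  sums are kept apart because they are estimated in different ways.\<close>

lemma forced_limit:
  assumes w: "\<omega> \<in> space M" and s: "s \<in> {0<..T}" and \<theta>: "\<theta> \<in> {-r..0}"
  shows "(\<lambda>N. (\<Sum>i<N. ker s \<theta> (real i * (s / real N)) * (IG (real (Suc i) * (s / real N)) \<omega> - IG (real i * (s / real N)) \<omega>))
     + (\<Sum>i<N. ker s \<theta> (real i * (s / real N)) * (Z (real (Suc i) * (s / real N)) \<omega> - Z (real i * (s / real N)) \<omega>)))
     \<longlonglongrightarrow> Yf \<omega> s \<theta>"
proof -
  define x where "x \<tau> = X (\<epsilon>\<^sup>2 * \<tau>) \<omega>" for \<tau>
  define A where "A = s / \<epsilon>\<^sup>2"
  have A: "A > 0" using s e2 by (simp add: A_def)
  have sA: "\<epsilon>\<^sup>2 * A = s" using \<epsilon>_pos by (simp add: A_def)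
  define f where "f \<tau> = IG (\<epsilon>\<^sup>2 * \<tau>) \<omega> + Z (\<epsilon>\<^sup>2 * \<tau>) \<omega>" for \<tau>
  have sub: "\<epsilon>\<^sup>2 * t \<in> {0..T}" if "t \<in> {0..A}" for t
  proof -
    have "\<epsilon>\<^sup>2 * t \<le> \<epsilon>\<^sup>2 * A" using that by (intro mult_left_mono) auto
    then show ?thesis using that s sA by auto
  qed
  have sub': "\<epsilon>\<^sup>2 * t \<in> {-(\<epsilon>\<^sup>2 * r)..T}" if "t \<in> {-r..A}" for t
  proof -
    have "\<epsilon>\<^sup>2 * t \<le> \<epsilon>\<^sup>2 * A" by (rule mult_left_mono) (use that in auto)
    moreover have "\<epsilon>\<^sup>2 * (-r) \<le> \<epsilon>\<^sup>2 * t" by (rule mult_left_mono) (use that in auto)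
    ultimately show ?thesis using s sA by auto
  qed
  have xc: "continuous_on {-r..A} x"
    unfolding x_def by (rule continuous_on_compose2[OF X_cont[OF w]]) (use sub' in \<open>auto intro!: continuous_intros\<close>)
  have fc: "continuous_on {0..A} f"
    unfolding f_def
    by (intro continuous_on_add continuous_on_compose2[OF IG_cont[OF w]] continuous_on_compose2[OF Z_cont[OF w]])
       (use sub in \<open>auto intro!: continuous_intros\<close>)
  have i00: "(LBINT s:{0..0}. g s) = 0" for g :: "real \<Rightarrow> real"
  proof -
    have "set_integrable lborel {0..0} g" unfolding set_integrable_def by (rule borel_integrable_atLeastAtMost'[unfolded set_integrable_def]) auto
    from set_borel_integral_eq_integral(2)[OF this] show ?thesis by simp
  qed
  have f0: "f 0 = 0" by (simp add: f_def IG_def Z_def i00[simplified])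
  have sx: "Xs \<omega> t = seg r 1 x (t / \<epsilon>\<^sup>2)" for t unfolding x_def using \<epsilon>_pos by (intro seg_rescale) simp
  have eq: "x t = x 0 + (LBINT u:{0..t}. Lh (seg r 1 x u)) + f t" if t: "t \<in> {0..A}" for t
  proof -
    have "(LBINT u:{0..\<epsilon>\<^sup>2 * t}. L0 (Xs \<omega> u) / \<epsilon>\<^sup>2) = (LBINT u:{0..\<epsilon>\<^sup>2 * t}. Lh (Xs \<omega> u) / \<epsilon>\<^sup>2)"
      by (intro set_lebesgue_integral_cong) (use sub[OF t] in \<open>auto simp: L0_eq Xs_C w\<close>)
    also have "\<dots> = (LBINT u:{0..t}. Lh (seg r 1 x u))"
      unfolding set_lebesgue_integral_def
    proof (subst lborel_integral_real_affine[where c="\<epsilon>\<^sup>2" and t=0])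
      show "\<epsilon>\<^sup>2 \<noteq> 0" using e2 by simp
      have "indicator {0..\<epsilon>\<^sup>2 * t} (0 + \<epsilon>\<^sup>2 * u) *\<^sub>R (Lh (Xs \<omega> (0 + \<epsilon>\<^sup>2 * u)) / \<epsilon>\<^sup>2) = (1 / \<epsilon>\<^sup>2) *\<^sub>R (indicator {0..t} u *\<^sub>R Lh (seg r 1 x u))" for u
        using e2 by (simp add: sx indicator_def zero_le_mult_iff)
      then show "\<bar>\<epsilon>\<^sup>2\<bar> *\<^sub>R (LBINT u. indicator {0..\<epsilon>\<^sup>2 * t} (0 + \<epsilon>\<^sup>2 * u) *\<^sub>R (Lh (Xs \<omega> (0 + \<epsilon>\<^sup>2 * u)) / \<epsilon>\<^sup>2)) = (LBINT u. indicator {0..t} u *\<^sub>R Lh (seg r 1 x u))"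
        using e2 by (simp only: integral_scaleR_right) simp
    qed
    finally have "(LBINT u:{0..\<epsilon>\<^sup>2 * t}. L0 (Xs \<omega> u) / \<epsilon>\<^sup>2) = (LBINT u:{0..t}. Lh (seg r 1 x u))" .
    then show ?thesis by (simp add: f_def x_def Z_def IG_def)
  qed
  have lim: "(\<lambda>N. \<Sum>i<N. (f (real (Suc i) * (A / real N)) - f (real i * (A / real N)))
            * dde_semigroup r Lh (A - real i * (A / real N)) D.\<psi> \<theta>)
     \<longlonglongrightarrow> proj_compl p (seg r 1 x A) \<theta> - dde_semigroup r Lh A (proj_compl p (seg r 1 x 0)) \<theta>"
    by (rule D.voc[OF A xc fc f0 eq \<theta>])
  have fe: "f (y / \<epsilon>\<^sup>2) = IG y \<omega> + Z y \<omega>" for y using \<epsilon>_pos by (simp add: f_def)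
  have s0: "0 < s" using s by simp
  have "(\<Sum>i<N. (f (real (Suc i) * (A / real N)) - f (real i * (A / real N)))
            * dde_semigroup r Lh (A - real i * (A / real N)) D.\<psi> \<theta>)
    = (\<Sum>i<N. ker s \<theta> (real i * (s / real N)) * (IG (real (Suc i) * (s / real N)) \<omega> - IG (real i * (s / real N)) \<omega>))
     + (\<Sum>i<N. ker s \<theta> (real i * (s / real N)) * (Z (real (Suc i) * (s / real N)) \<omega> - Z (real i * (s / real N)) \<omega>))" for N
    unfolding A_def riemann_rescale[OF s0, where f=f and N=N and \<theta>=\<theta>] fe sum.distrib[symmetric]
    by (intro sum.cong refl) (simp add: algebra_simps)
  moreover have "Yf \<omega> s \<theta> = proj_compl p (seg r 1 x A) \<theta> - dde_semigroup r Lh A (proj_compl p (seg r 1 x 0)) \<theta>"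
    by (simp add: Yf_alt sx A_def)
  ultimately show ?thesis using lim by (simp only:)
qed

text \<open>In rescaled time the drift integral has Lipschitz constant
  \<open>\<epsilon>\<^sup>2 * (K_G * N)\<close>; this is where the power of
  \<open>\<epsilon>\<close> in the first term originates.\<close>

lemma IG_sum_bound:
  assumes w: "\<omega> \<in> space M" and s: "s \<in> {0<..T}" and N: "\<And>v. v \<in> {-(\<epsilon>\<^sup>2 * r)..T} \<Longrightarrow> \<bar>X v \<omega>\<bar> \<le> N"
  shows "\<bar>\<Sum>i<n. ker s \<theta> (real i * (s / real n)) * (IG (real (Suc i) * (s / real n)) \<omega> - IG (real i * (s / real n)) \<omega>)\<bar>
    \<le> \<epsilon>\<^sup>2 * (K_G * (K * supnorm r D.\<psi>) / \<kappa>) * N"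
proof -
  have N0: "N \<ge> 0"
  proof -
    have "T \<in> {-(\<epsilon>\<^sup>2 * r)..T}" using T_pos D.r_pos by (auto intro: order_trans[of _ 0])
    from N[OF this] show ?thesis by linarith
  qed
  define c where "c = \<epsilon>\<^sup>2 * (K_G * N)"
  have c0: "c \<ge> 0" using KG_nonneg N0 by (simp add: c_def)
  show ?thesis
  proof (cases "n = 0")
    case False
    have A: "s / \<epsilon>\<^sup>2 > 0" using s e2 by simp
    have "\<bar>\<Sum>i<n. (IG (\<epsilon>\<^sup>2 * (real (Suc i) * (s / \<epsilon>\<^sup>2 / real n))) \<omega> - IG (\<epsilon>\<^sup>2 * (real i * (s / \<epsilon>\<^sup>2 / real n))) \<omega>)
            * dde_semigroup r Lh (s / \<epsilon>\<^sup>2 - real i * (s / \<epsilon>\<^sup>2 / real n)) D.\<psi> \<theta>\<bar> \<le> c * (K * supnorm r D.\<psi>) / \<kappa>"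
    proof (rule D.lipschitz_forcing_bound[OF A _ c0])
      fix a b assume ab: "0 \<le> a" "a \<le> b" "b \<le> s / \<epsilon>\<^sup>2"
      have "\<epsilon>\<^sup>2 * b \<le> T" using ab s e2 by (auto simp: le_divide_eq mult.commute)
      moreover have "\<epsilon>\<^sup>2 * a \<le> \<epsilon>\<^sup>2 * b" using ab by (intro mult_left_mono) auto
      ultimately have "\<bar>IG (\<epsilon>\<^sup>2 * b) \<omega> - IG (\<epsilon>\<^sup>2 * a) \<omega>\<bar> \<le> K_G * N * (\<epsilon>\<^sup>2 * b - \<epsilon>\<^sup>2 * a)"
        unfolding IG_def using ab
        by (intro integral_path_continuous(2)[OF G_cont[OF w]] G_bound[OF w _ N]) auto
      then show "\<bar>IG (\<epsilon>\<^sup>2 * b) \<omega> - IG (\<epsilon>\<^sup>2 * a) \<omega>\<bar> \<le> c * (b - a)" by (simp add: c_def algebra_simps)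
    qed (use False in simp)
    moreover have s0: "0 < s" using s by simp
    moreover have "c * (K * supnorm r D.\<psi>) / \<kappa> = \<epsilon>\<^sup>2 * (K_G * (K * supnorm r D.\<psi>) / \<kappa>) * N"
      by (simp add: c_def)
    ultimately show ?thesis
      unfolding riemann_rescale[OF s0, where f="\<lambda>y. IG (\<epsilon>\<^sup>2 * y) \<omega>" and N=n and \<theta>=\<theta>] unscale by (simp only:)
  qed (use N0 KG_nonneg D.K_pos D.supnorm_\<psi> D.\<kappa>_pos in simp)
qed

text \<open>Rescaling time multiplies a 1/4-Hoelder constant by
  \<open>(\<epsilon>\<^sup>2) powr (1/4)\<close>, while \<open>C\<close> does not depend on the
  rescaled horizon.\<close>

lemma Z_sum_bound:
  assumes s: "s \<in> {0<..T}" and \<theta>: "\<theta> \<in> {-r..0}" and C: "D.forcing_const C" and H: "H \<ge> 0"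
    and Z: "\<And>a b. 0 \<le> a \<Longrightarrow> a \<le> b \<Longrightarrow> b \<le> T \<Longrightarrow> \<bar>Z b \<omega> - Z a \<omega>\<bar> \<le> H * (b - a) powr (1/4)"
  shows "\<bar>\<Sum>i<n. ker s \<theta> (real i * (s / real n)) * (Z (real (Suc i) * (s / real n)) \<omega> - Z (real i * (s / real n)) \<omega>)\<bar>
    \<le> C * (H * (\<epsilon>\<^sup>2) powr (1/4))"
proof (cases "n = 0")
  case False
  define q where "q = (\<epsilon>\<^sup>2) powr (1/4)"
  have q0: "q \<ge> 0" unfolding q_def by (rule powr_ge_zero)
  have A: "s / \<epsilon>\<^sup>2 > 0" and s0: "0 < s" using s e2 by auto
  have "\<bar>\<Sum>i<n. (Z (\<epsilon>\<^sup>2 * (real (Suc i) * (s / \<epsilon>\<^sup>2 / real n))) \<omega> - Z (\<epsilon>\<^sup>2 * (real i * (s / \<epsilon>\<^sup>2 / real n))) \<omega>)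
            * dde_semigroup r Lh (s / \<epsilon>\<^sup>2 - real i * (s / \<epsilon>\<^sup>2 / real n)) D.\<psi> \<theta>\<bar> \<le> C * (H * q)"
  proof (rule D.forcing_constD[OF C A _ \<theta>, where f="\<lambda>y. Z (\<epsilon>\<^sup>2 * y) \<omega>"])
    show "0 < n" using False by simp
    show "0 \<le> H * q" using H q0 by simp
    fix a b assume ab: "0 \<le> a" "a \<le> b" "b \<le> s / \<epsilon>\<^sup>2"
    have "\<epsilon>\<^sup>2 * b \<le> T" using ab s e2 by (auto simp: le_divide_eq mult.commute)
    moreover have "\<epsilon>\<^sup>2 * a \<le> \<epsilon>\<^sup>2 * b" using ab by (intro mult_left_mono) auto
    ultimately have "\<bar>Z (\<epsilon>\<^sup>2 * b) \<omega> - Z (\<epsilon>\<^sup>2 * a) \<omega>\<bar> \<le> H * (\<epsilon>\<^sup>2 * b - \<epsilon>\<^sup>2 * a) powr (1/4)"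
      using ab by (intro Z) auto
    also have "\<epsilon>\<^sup>2 * b - \<epsilon>\<^sup>2 * a = \<epsilon>\<^sup>2 * (b - a)" by (simp add: algebra_simps)
    also have "(\<epsilon>\<^sup>2 * (b - a)) powr (1/4) = q * (b - a) powr (1/4)"
      unfolding q_def by (rule powr_mult)
    finally show "\<bar>Z (\<epsilon>\<^sup>2 * b) \<omega> - Z (\<epsilon>\<^sup>2 * a) \<omega>\<bar> \<le> H * q * (b - a) powr (1/4)"
      by (simp only: mult.assoc)
  qed
  then show ?thesis
    unfolding riemann_rescale[OF s0, where f="\<lambda>y. Z (\<epsilon>\<^sup>2 * y) \<omega>" and N=n and \<theta>=\<theta>] unscale q_def .
qed (use D.forcing_const_nonneg[OF C] H in simp)

end

lemma power_add_le:
  fixes a b :: real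
  assumes "a \<ge> 0" "b \<ge> 0" "n \<ge> 1"
  shows "(a + b) ^ n \<le> 2 ^ (n - 1) * (a ^ n + b ^ n)"
  using assms(3)
proof (induction n rule: dec_induct)
  case (step n)
  \<comment> \<open>The powers are ordered in the same way as the bases. Expanding this product
    bounds the mixed terms by the pure ones and gives the factor 2 of the inductive step.\<close>
  have c: "0 \<le> (a ^ n - b ^ n) * (a - b)"
  proof (cases "a \<le> b")
    case True then show ?thesis using power_mono[OF True assms(1), of n] by (simp add: mult_nonpos_nonpos)
  next
    case False then show ?thesis using power_mono[of b a n] assms by (intro mult_nonneg_nonneg) auto
  qed
  have "(a + b) ^ Suc n \<le> (2 ^ (n - 1) * (a ^ n + b ^ n)) * (a + b)"
    using step assms by (simp add: mult.commute mult_left_mono)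
  also have "\<dots> = 2 ^ (n - 1) * ((a ^ n + b ^ n) * (a + b))" by simp
  also have "\<dots> \<le> 2 ^ (n - 1) * (2 * (a ^ Suc n + b ^ Suc n))"
    using c by (intro mult_left_mono) (auto simp: algebra_simps)
  also have "\<dots> = 2 ^ (Suc n - 1) * (a ^ Suc n + b ^ Suc n)" using step by (cases n) auto
  finally show ?case .
qed simp

text \<open>Suprema over uncountable parameter sets become countable, hence measurable,
  ones.\<close>

lemma le_SUP_dense:
  fixes f :: "'b::topological_space \<Rightarrow> real"
  assumes f: "continuous_on (closure D) f" "z \<in> closure D"
  shows "ennreal (f z) \<le> (SUP z\<in>D. ennreal (f z))"
proof (cases "(SUP z\<in>D. ennreal (f z)) = \<top>")
  case False
  then obtain u where u: "u \<ge> 0" "(SUP z\<in>D. ennreal (f z)) = ennreal u"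
    by (cases "SUP z\<in>D. ennreal (f z)") auto
  have "f z \<le> u"
  proof (rule continuous_le_on_closure[OF f])
    fix y assume "y \<in> D"
    then have "ennreal (f y) \<le> ennreal u" unfolding u(2)[symmetric] by (rule SUP_upper)
    then show "f y \<le> u" using u(1) by simp
  qed
  then show ?thesis unfolding u(2) by (rule ennreal_leI)
qed (simp only: top_greatest)

section \<open>Measurable majorants and almost sure bounds\<close>

context sdde begin

lemma param_dense:
  obtains D :: "(real \<times> real) set" where "countable D" "D \<subseteq> {0<..T} \<times> {-r..0}" "closure D = {0..T} \<times> {-r..0}"
proof -
  obtain D :: "(real \<times> real) set" where D: "countable D" "D \<subseteq> {0<..T} \<times> {-r..0}" "{0<..T} \<times> {-r..0} \<subseteq> closure D"
    by (rule separable)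
  have "closure ({0<..T} \<times> {-r..0}) = {0..T} \<times> {-r..0}"
    using T_pos by (simp add: closure_Times)
  then have "closure D = {0..T} \<times> {-r..0}"
    using closure_mono[OF D(2)] closure_minimal[OF D(3) closed_closure] by auto
  with D that show thesis by blast
qed

lemma X_meas: "v \<in> {-(\<epsilon>\<^sup>2 * r)..T} \<Longrightarrow> X v \<in> borel_measurable M"
proof (cases "v \<ge> 0")
  case True
  assume "v \<in> {-(\<epsilon>\<^sup>2 * r)..T}"
  then have "X v \<in> borel_measurable (F v)" using X_sol True by (simp add: sdde_solution_def)
  then show ?thesis by (rule W.meas_F_M)
next
  case False
  assume "v \<in> {-(\<epsilon>\<^sup>2 * r)..T}"
  then have "X v \<omega> = \<xi> (v / \<epsilon>\<^sup>2)" if "\<omega> \<in> space M" for \<omega>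
    using X_sol False that by (simp add: sdde_solution_def)
  then show ?thesis by (simp cong: measurable_cong)
qed

text \<open>A measurable stand-in for the supremum of the segment norms, taken over countably many
  times. Being measurable, it can be handled under the integral, and its moments are bounded by
  those in the hypothesis.\<close>

lemma sup_process:
  obtains N where "N \<in> borel_measurable M" "\<And>\<omega>. 0 \<le> N \<omega>"
    "\<And>\<omega> v. \<omega> \<in> space M \<Longrightarrow> v \<in> {-(\<epsilon>\<^sup>2 * r)..T} \<Longrightarrow> \<bar>X v \<omega>\<bar> \<le> N \<omega>"
    "\<And>\<omega> n. \<omega> \<in> space M \<Longrightarrow> ennreal (N \<omega> ^ n) \<le> (SUP t\<in>{0..T}. ennreal (supnorm r (Xs \<omega> t) ^ n))"
proof -
  let ?I = "{-(\<epsilon>\<^sup>2 * r)..T}"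
  have ne: "?I \<noteq> {}" using T_pos D.r_pos by (auto intro: order_trans[of _ 0])
  obtain D where D: "countable D" "D \<subseteq> ?I" "?I \<subseteq> closure D" by (rule separable)
  have cD: "closure D = ?I" using D(3) closure_minimal[OF D(2)] by auto
  define Nh where "Nh \<omega> = (SUP v\<in>D. ennreal \<bar>X v \<omega>\<bar>)" for \<omega>
  define N where "N \<omega> = enn2real (Nh \<omega>)" for \<omega>
  have Nh: "Nh \<in> borel_measurable M"
    unfolding Nh_def using D X_meas by (intro borel_measurable_SUP) auto
  show thesis
  proof (rule that)
    show "N \<in> borel_measurable M" unfolding N_def using Nh by simp
    show "0 \<le> N \<omega>" for \<omega> by (simp add: N_def)
    fix \<omega> assume w: "\<omega> \<in> space M"
    have c: "continuous_on ?I (\<lambda>v. \<bar>X v \<omega>\<bar>)" by (intro continuous_intros X_cont w)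
    obtain v0 where v0: "v0 \<in> ?I" "\<And>v. v \<in> ?I \<Longrightarrow> \<bar>X v \<omega>\<bar> \<le> \<bar>X v0 \<omega>\<bar>"
      using continuous_attains_sup[OF compact_Icc ne c] by blast
    have le: "Nh \<omega> \<le> ennreal \<bar>X v0 \<omega>\<bar>" unfolding Nh_def using D v0 by (intro SUP_least ennreal_leI) auto
    then have Nfin: "Nh \<omega> = ennreal (N \<omega>)" unfolding N_def by (metis ennreal_enn2real ennreal_less_top le_less_trans)
    show "\<bar>X v \<omega>\<bar> \<le> N \<omega>" if "v \<in> ?I" for v
    proof -
      have "ennreal \<bar>X v \<omega>\<bar> \<le> Nh \<omega>" unfolding Nh_def by (rule le_SUP_dense) (use c cD that in auto)
      then show ?thesis unfolding Nfin by (simp add: N_def)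
    qed
    fix n
    have N0: "N \<omega> \<le> \<bar>X v0 \<omega>\<bar>" using le unfolding Nfin by simp
    \<comment> \<open>A maximum at a nonnegative time is the head of the segment there; a maximum in
      the initial interval is seen by the segment at time 0.\<close>
    obtain t where t: "t \<in> {0..T}" "\<bar>X v0 \<omega>\<bar> \<le> supnorm r (Xs \<omega> t)"
    proof (cases "v0 \<ge> 0")
      case True
      then have t: "v0 \<in> {0..T}" using v0 by auto
      have "\<bar>Xs \<omega> v0 0\<bar> \<le> supnorm r (Xs \<omega> v0)"
        using Xs_C[OF w t] C_subset_Chat D.r_pos by (intro Chat_supnorm) auto
      then show ?thesis using that[OF t] D.r_pos by (simp add: seg_def on_seg_def)
    next
      case False
      have t: "0 \<in> {0..T}" using T_pos by simp
      have "\<bar>Xs \<omega> 0 (v0 / \<epsilon>\<^sup>2)\<bar> \<le> supnorm r (Xs \<omega> 0)"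
        using Xs_C[OF w t] C_subset_Chat D.r_pos by (intro Chat_supnorm) auto
      moreover have "v0 / \<epsilon>\<^sup>2 \<in> {-r..0}" using v0(1) False e2 by (simp add: field_simps)
      ultimately show ?thesis using that[OF t] unscale[of v0] by (simp add: seg_def on_seg_def)
    qed
    have "ennreal (N \<omega> ^ n) \<le> ennreal (supnorm r (Xs \<omega> t) ^ n)"
      using N0 t by (intro ennreal_leI power_mono) (auto simp: N_def)
    also have "\<dots> \<le> (SUP t\<in>{0..T}. ennreal (supnorm r (Xs \<omega> t) ^ n))" using t by (intro SUP_upper)
    finally show "ennreal (N \<omega> ^ n) \<le> (SUP t\<in>{0..T}. ennreal (supnorm r (Xs \<omega> t) ^ n))" .
  qed
qed

lemma V_ito: "s \<in> {0..T} \<Longrightarrow> \<theta> \<in> {-r..0} \<Longrightarrow> ito_integral M F W (\<lambda>u \<omega>. ker s \<theta> u * h u \<omega>) s (V s \<theta>)"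
  using V_ver unfolding stoch_conv_version_def ito_process_integral_def ker_def h_def D.\<psi>_def by blast

lemma V_meas: "s \<in> {0..T} \<Longrightarrow> \<theta> \<in> {-r..0} \<Longrightarrow> V s \<theta> \<in> borel_measurable M"
  by (rule W.ito_measurable[OF V_ito])

lemma V_cont: "\<omega> \<in> space M \<Longrightarrow> continuous_on ({0..T} \<times> {-r..0}) (\<lambda>z. V (fst z) (snd z) \<omega>)"
  using V_ver by (simp add: stoch_conv_version_def case_prod_beta)

text \<open>The segments are continuous functions, so the jump of the kernel does not appear here:
  boundedness of the projection turns uniform continuity of the path into uniform convergence of the
  projected segments, and the free part starts from a continuous function.\<close>

lemma Yf_cont:
  assumes w: "\<omega> \<in> space M"
  shows "continuous_on ({0..T} \<times> {-r..0}) (\<lambda>z. Yf \<omega> (fst z) (snd z))"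
proof -
  obtain C where C: "C \<ge> 0" "\<And>\<phi>. \<phi> \<in> Chat_space r \<Longrightarrow> supnorm r (proj_compl p \<phi>) \<le> C * supnorm r \<phi>"
    using D.proj_bounded by blast
  have XC: "Xs \<omega> t \<in> Chat_space r" if "t \<in> {0..T}" for t using Xs_C[OF w that] C_subset_Chat by blast
  have "continuous_on ({0..T} \<times> {-r..0}) (\<lambda>(s, \<theta>). proj_compl p (Xs \<omega> s) \<theta>)"
  proof (rule continuous_on_prod_uniform)
    show "continuous_on {-r..0} (proj_compl p (Xs \<omega> s))" if "s \<in> {0..T}" for s
      by (rule D.proj_compl_continuous[OF Xs_C[OF w that]])
    fix s e :: real assume s: "s \<in> {0..T}" and e: "e > 0"
    then have "e / (C + 1) > 0" using C(1) by simp
    then obtain d where d: "d > 0" "\<And>s t. s \<in> {0..T} \<Longrightarrow> t \<in> {0..T} \<Longrightarrow> \<bar>s - t\<bar> < d \<Longrightarrow>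
      supnorm r (\<lambda>\<theta>. Xs \<omega> s \<theta> - Xs \<omega> t \<theta>) \<le> e / (C + 1)"
      using seg_uniform[OF D.r_pos X_cont[OF w]] by blast
    have "\<bar>proj_compl p (Xs \<omega> s') \<theta> - proj_compl p (Xs \<omega> s) \<theta>\<bar> \<le> e" if s': "s' \<in> {0..T}" "\<bar>s' - s\<bar> < d" for s' \<theta>
    proof -
      let ?d = "\<lambda>\<theta>. Xs \<omega> s' \<theta> - Xs \<omega> s \<theta>"
      have dC: "?d \<in> Chat_space r" by (intro Chat_diff XC s s')
      have "\<bar>proj_compl p ?d \<theta>\<bar> \<le> supnorm r (proj_compl p ?d)"
        using D.r_pos by (intro Chat_supnorm D.Q_Chat D.proj_Q dC) simp
      also have "\<dots> \<le> C * supnorm r ?d" by (rule C(2)[OF dC])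
      also have "\<dots> \<le> C * (e / (C + 1))" by (intro mult_left_mono d(2) s s' C(1))
      also have "\<dots> \<le> e" using C(1) e by (simp add: field_simps)
      finally show ?thesis by (simp add: D.proj_diff[OF XC[OF s'(1)] XC[OF s]])
    qed
    then show "\<exists>d>0. \<forall>s'\<in>{0..T}. \<bar>s' - s\<bar> < d \<longrightarrow> (\<forall>\<theta>\<in>{-r..0}. \<bar>proj_compl p (Xs \<omega> s') \<theta> - proj_compl p (Xs \<omega> s) \<theta>\<bar> \<le> e)"
      using d(1) by blast
  qed
  then have 1: "continuous_on ({0..T} \<times> {-r..0}) (\<lambda>z. proj_compl p (Xs \<omega> (fst z)) (snd z))" by (simp add: case_prod_beta)
  define y where "y = proj_compl p (Xs \<omega> 0)"
  have T0: "0 \<in> {0..T}" using T_pos by simp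
  have yC: "y \<in> Chat_space r" unfolding y_def by (intro D.Q_Chat D.proj_Q XC T0)
  have yc: "continuous_on {-r..0} y" unfolding y_def by (rule D.proj_compl_continuous[OF Xs_C[OF w T0]])
  have "continuous_on ({0..T} \<times> {-r..0}) (\<lambda>z. D.sol y (fst z / \<epsilon>\<^sup>2 + snd z))"
  proof (rule continuous_on_compose2[OF D.sol_continuous[OF yC yc]])
    show "continuous_on ({0..T} \<times> {-r..0}) (\<lambda>z. fst z / \<epsilon>\<^sup>2 + snd z)"
      using \<epsilon>_pos by (intro continuous_intros) auto
    show "(\<lambda>z. fst z / \<epsilon>\<^sup>2 + snd z) ` ({0..T} \<times> {-r..0}) \<subseteq> {-r..}"
      using e2 by (auto intro: add_increasing)
  qed
  then have 2: "continuous_on ({0..T} \<times> {-r..0}) (\<lambda>z. dde_semigroup r Lh (fst z / \<epsilon>\<^sup>2) y (snd z))"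
    by (rule continuous_on_eq) (auto simp: D.dde_semigroup_sol seg_1 on_seg_def)
  show ?thesis unfolding Yf_alt y_def[symmetric] by (intro continuous_on_diff 1 2)
qed

text \<open>Along one subsequence the sums against \<open>Z\<close> converge almost surely to
  \<open>V\<close>, so the sums against \<open>IG\<close> must converge to the difference; both
  bounds pass to the limit. The quantifier over \<open>H\<close> stands inside \<open>AE\<close>,
  because the Hoelder constant to be inserted depends on the path.\<close>

lemma pointwise_AE:
  assumes s: "s \<in> {0<..T}" and \<theta>: "\<theta> \<in> {-r..0}" and C: "D.forcing_const C"
    and N: "\<And>\<omega> v. \<omega> \<in> space M \<Longrightarrow> v \<in> {-(\<epsilon>\<^sup>2 * r)..T} \<Longrightarrow> \<bar>X v \<omega>\<bar> \<le> N \<omega>"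
  shows "AE \<omega> in M. \<bar>Yf \<omega> s \<theta> - V s \<theta> \<omega>\<bar> \<le> \<epsilon>\<^sup>2 * (K_G * (K * supnorm r D.\<psi>) / \<kappa>) * N \<omega> \<and>
    (\<forall>H\<ge>0. (\<forall>a b. 0 \<le> a \<longrightarrow> a \<le> b \<longrightarrow> b \<le> T \<longrightarrow> \<bar>Z b \<omega> - Z a \<omega>\<bar> \<le> H * (b - a) powr (1/4)) \<longrightarrow>
      \<bar>V s \<theta> \<omega>\<bar> \<le> C * (H * (\<epsilon>\<^sup>2) powr (1/4)))"
proof -
  define SZ where "SZ n \<omega> = (\<Sum>i<n. ker s \<theta> (real i * (s / real n)) * (Z (real (Suc i) * (s / real n)) \<omega> - Z (real i * (s / real n)) \<omega>))" for n \<omega>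
  define SG where "SG n \<omega> = (\<Sum>i<n. ker s \<theta> (real i * (s / real n)) * (IG (real (Suc i) * (s / real n)) \<omega> - IG (real i * (s / real n)) \<omega>))" for n \<omega>
  have s0: "s > 0" and sT: "s \<in> {0..T}" using s by auto
  obtain c1 where c1: "c1 \<ge> 0" "\<And>\<phi>. r > 0 \<Longrightarrow> \<phi> \<in> C_space r \<Longrightarrow> \<bar>L1 \<phi>\<bar> \<le> c1 * supnorm r \<phi>"
    using bounded_linear_C_lipschitz[OF L1_lin] by metis
  have cp: "W.cprob SZ (V s \<theta>)"
    unfolding SZ_def[abs_def]
  proof (rule W.riemann_ito[OF s0 V_ito[OF sT \<theta>]])
    show "ito_integral M F W h t (Z t)" if "t \<in> {0..s}" for t using that s by (intro Z_ito) auto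
    show "\<bar>h u \<omega>\<bar> \<le> c1 * N \<omega>" if "\<omega> \<in> space M" "u \<in> {0..s}" for \<omega> u
    proof -
      have u: "u \<in> {0..T}" using that s by auto
      have "\<bar>h u \<omega>\<bar> \<le> c1 * supnorm r (Xs \<omega> u)" unfolding h_def by (rule c1(2)[OF D.r_pos Xs_C[OF that(1) u]])
      also have "\<dots> \<le> c1 * N \<omega>" by (intro mult_left_mono supnorm_Xs[OF that(1) u] N that c1)
      finally show ?thesis .
    qed
    show "\<bar>ker s \<theta> u\<bar> \<le> K * supnorm r D.\<psi>" if "u \<in> {0..s}" for u
    proof -
      have t: "(s - u) / \<epsilon>\<^sup>2 \<ge> 0" using that e2 by simp
      have "\<bar>ker s \<theta> u\<bar> \<le> K * supnorm r D.\<psi> * exp (- \<kappa> * ((s - u) / \<epsilon>\<^sup>2))"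
        unfolding ker_def by (rule D.semigroup_\<psi>_bound[OF t])
      also have "\<dots> \<le> K * supnorm r D.\<psi> * 1"
        using mult_nonneg_nonneg[OF less_imp_le[OF D.\<kappa>_pos] t] D.K_pos D.supnorm_\<psi> by (intro mult_left_mono) auto
      finally show ?thesis by simp
    qed
    show "(ker s \<theta> \<longlongrightarrow> ker s \<theta> u) (at_left u)" if "u \<in> {0<..s}" for u
      unfolding ker_def[abs_def] by (rule D.kern_left_continuous[OF \<epsilon>_pos _ \<theta>]) (use that in auto)
  qed
  have grid: "real i * (s / real n) \<in> {0..T}" if "i \<le> n" "n > 0" for i n
  proof -
    have "real i * (s / real n) \<le> real n * (s / real n)" using that s0 by (intro mult_right_mono) auto
    then show ?thesis using that s by auto
  qed
  have SZm: "SZ n \<in> borel_measurable M" for n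
    unfolding SZ_def[abs_def]
  proof (intro borel_measurable_sum borel_measurable_times borel_measurable_diff borel_measurable_const)
    fix i assume "i \<in> {..<n}"
    then show "Z (real (Suc i) * (s / real n)) \<in> borel_measurable M" "Z (real i * (s / real n)) \<in> borel_measurable M"
      by (intro W.ito_measurable[OF Z_ito[OF grid]]; simp)+
  qed
  \<comment> \<open>Along a subsequence the stochastic sums converge on almost every path, which
    allows them to be subtracted from the pathwise limit.\<close>
  obtain rr :: "nat \<Rightarrow> nat" where rr: "strict_mono rr" and ae: "AE \<omega> in M. (\<lambda>k. SZ (rr k) \<omega>) \<longlonglongrightarrow> V s \<theta> \<omega>"
    using W.cprob_subseq[OF cp SZm V_meas[OF sT \<theta>]] by blast
  show ?thesis
    using ae
  proof (rule AE_mp, intro AE_I2 impI)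
    fix \<omega> assume w: "\<omega> \<in> space M" and l: "(\<lambda>k. SZ (rr k) \<omega>) \<longlonglongrightarrow> V s \<theta> \<omega>"
    have "(\<lambda>n. SG n \<omega> + SZ n \<omega>) \<longlonglongrightarrow> Yf \<omega> s \<theta>"
      unfolding SG_def SZ_def by (rule forced_limit[OF w s \<theta>])
    then have "(\<lambda>k. SG (rr k) \<omega> + SZ (rr k) \<omega>) \<longlonglongrightarrow> Yf \<omega> s \<theta>"
      using LIMSEQ_subseq_LIMSEQ[OF _ rr] by (force simp: comp_def)
    from tendsto_diff[OF this l] have lG: "(\<lambda>k. SG (rr k) \<omega>) \<longlonglongrightarrow> Yf \<omega> s \<theta> - V s \<theta> \<omega>" by simp
    have "\<bar>Yf \<omega> s \<theta> - V s \<theta> \<omega>\<bar> \<le> \<epsilon>\<^sup>2 * (K_G * (K * supnorm r D.\<psi>) / \<kappa>) * N \<omega>"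
    proof (rule LIMSEQ_le_const2[OF tendsto_rabs[OF lG]], intro exI[of _ 0] allI impI)
      fix k
      show "\<bar>SG (rr k) \<omega>\<bar> \<le> \<epsilon>\<^sup>2 * (K_G * (K * supnorm r D.\<psi>) / \<kappa>) * N \<omega>"
        unfolding SG_def by (rule IG_sum_bound[OF w s N[OF w]])
    qed
    moreover have "\<bar>V s \<theta> \<omega>\<bar> \<le> C * (H * (\<epsilon>\<^sup>2) powr (1/4))"
      if H: "H \<ge> 0" "\<forall>a b. 0 \<le> a \<longrightarrow> a \<le> b \<longrightarrow> b \<le> T \<longrightarrow> \<bar>Z b \<omega> - Z a \<omega>\<bar> \<le> H * (b - a) powr (1/4)" for H
    proof (rule LIMSEQ_le_const2[OF tendsto_rabs[OF l]], intro exI[of _ 0] allI impI)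
      fix k
      show "\<bar>SZ (rr k) \<omega>\<bar> \<le> C * (H * (\<epsilon>\<^sup>2) powr (1/4))"
        unfolding SZ_def by (rule Z_sum_bound[OF s \<theta> C H(1)]) (use H(2) in blast)
    qed
    ultimately show "\<bar>Yf \<omega> s \<theta> - V s \<theta> \<omega>\<bar> \<le> \<epsilon>\<^sup>2 * (K_G * (K * supnorm r D.\<psi>) / \<kappa>) * N \<omega> \<and>
    (\<forall>H\<ge>0. (\<forall>a b. 0 \<le> a \<longrightarrow> a \<le> b \<longrightarrow> b \<le> T \<longrightarrow> \<bar>Z b \<omega> - Z a \<omega>\<bar> \<le> H * (b - a) powr (1/4)) \<longrightarrow>
      \<bar>V s \<theta> \<omega>\<bar> \<le> C * (H * (\<epsilon>\<^sup>2) powr (1/4)))" by blast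
  qed
qed

text \<open>Countably many exceptional sets are united over the dense parameter set; joint
  continuity of \<open>Yf\<close> and \<open>V\<close> extends both bounds to all
  parameters.\<close>

lemma uniform_AE:
  assumes C: "D.forcing_const C"
    and N: "\<And>\<omega> v. \<omega> \<in> space M \<Longrightarrow> v \<in> {-(\<epsilon>\<^sup>2 * r)..T} \<Longrightarrow> \<bar>X v \<omega>\<bar> \<le> N \<omega>"
  shows "AE \<omega> in M. \<forall>s\<in>{0..T}. \<forall>\<theta>\<in>{-r..0}. \<bar>Yf \<omega> s \<theta> - V s \<theta> \<omega>\<bar> \<le> \<epsilon>\<^sup>2 * (K_G * (K * supnorm r D.\<psi>) / \<kappa>) * N \<omega>"
    and "AE \<omega> in M. \<forall>H\<ge>0. (\<forall>a b. 0 \<le> a \<longrightarrow> a \<le> b \<longrightarrow> b \<le> T \<longrightarrow> \<bar>Z b \<omega> - Z a \<omega>\<bar> \<le> H * (b - a) powr (1/4)) \<longrightarrow>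
      (\<forall>s\<in>{0..T}. \<forall>\<theta>\<in>{-r..0}. \<bar>V s \<theta> \<omega>\<bar> \<le> C * (H * (\<epsilon>\<^sup>2) powr (1/4)))"
proof -
  obtain D :: "(real \<times> real) set" where D: "countable D" "D \<subseteq> {0<..T} \<times> {-r..0}" "closure D = {0..T} \<times> {-r..0}"
    by (rule param_dense)
  have ae: "AE \<omega> in M. \<forall>z\<in>D. \<bar>Yf \<omega> (fst z) (snd z) - V (fst z) (snd z) \<omega>\<bar> \<le> \<epsilon>\<^sup>2 * (K_G * (K * supnorm r D.\<psi>) / \<kappa>) * N \<omega> \<and>
    (\<forall>H\<ge>0. (\<forall>a b. 0 \<le> a \<longrightarrow> a \<le> b \<longrightarrow> b \<le> T \<longrightarrow> \<bar>Z b \<omega> - Z a \<omega>\<bar> \<le> H * (b - a) powr (1/4)) \<longrightarrow>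
      \<bar>V (fst z) (snd z) \<omega>\<bar> \<le> C * (H * (\<epsilon>\<^sup>2) powr (1/4)))"
    by (subst AE_ball_countable[OF D(1)], intro ballI pointwise_AE[OF _ _ C N]) (use D(2) in auto)
  show "AE \<omega> in M. \<forall>s\<in>{0..T}. \<forall>\<theta>\<in>{-r..0}. \<bar>Yf \<omega> s \<theta> - V s \<theta> \<omega>\<bar> \<le> \<epsilon>\<^sup>2 * (K_G * (K * supnorm r D.\<psi>) / \<kappa>) * N \<omega>"
    using ae
  proof (rule AE_mp, intro AE_I2 impI ballI)
    fix \<omega> s \<theta>
    assume w: "\<omega> \<in> space M" and b: "\<forall>z\<in>D. \<bar>Yf \<omega> (fst z) (snd z) - V (fst z) (snd z) \<omega>\<bar> \<le> \<epsilon>\<^sup>2 * (K_G * (K * supnorm r D.\<psi>) / \<kappa>) * N \<omega> \<and>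
    (\<forall>H\<ge>0. (\<forall>a b. 0 \<le> a \<longrightarrow> a \<le> b \<longrightarrow> b \<le> T \<longrightarrow> \<bar>Z b \<omega> - Z a \<omega>\<bar> \<le> H * (b - a) powr (1/4)) \<longrightarrow>
      \<bar>V (fst z) (snd z) \<omega>\<bar> \<le> C * (H * (\<epsilon>\<^sup>2) powr (1/4)))" and st: "s \<in> {0..T}" "\<theta> \<in> {-r..0}"
    have "continuous_on (closure D) (\<lambda>z. \<bar>Yf \<omega> (fst z) (snd z) - V (fst z) (snd z) \<omega>\<bar>)"
      unfolding D(3) by (intro continuous_on_rabs continuous_on_diff Yf_cont V_cont w)
    from continuous_le_on_closure[OF this, of "(s, \<theta>)"] b st
    show "\<bar>Yf \<omega> s \<theta> - V s \<theta> \<omega>\<bar> \<le> \<epsilon>\<^sup>2 * (K_G * (K * supnorm r D.\<psi>) / \<kappa>) * N \<omega>"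
      unfolding D(3) by simp
  qed
  show "AE \<omega> in M. \<forall>H\<ge>0. (\<forall>a b. 0 \<le> a \<longrightarrow> a \<le> b \<longrightarrow> b \<le> T \<longrightarrow> \<bar>Z b \<omega> - Z a \<omega>\<bar> \<le> H * (b - a) powr (1/4)) \<longrightarrow>
      (\<forall>s\<in>{0..T}. \<forall>\<theta>\<in>{-r..0}. \<bar>V s \<theta> \<omega>\<bar> \<le> C * (H * (\<epsilon>\<^sup>2) powr (1/4)))"
    using ae
  proof (rule AE_mp, intro AE_I2 impI ballI allI)
    fix \<omega> H s \<theta>
    assume w: "\<omega> \<in> space M" and b: "\<forall>z\<in>D. \<bar>Yf \<omega> (fst z) (snd z) - V (fst z) (snd z) \<omega>\<bar> \<le> \<epsilon>\<^sup>2 * (K_G * (K * supnorm r D.\<psi>) / \<kappa>) * N \<omega> \<and>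
    (\<forall>H\<ge>0. (\<forall>a b. 0 \<le> a \<longrightarrow> a \<le> b \<longrightarrow> b \<le> T \<longrightarrow> \<bar>Z b \<omega> - Z a \<omega>\<bar> \<le> H * (b - a) powr (1/4)) \<longrightarrow>
      \<bar>V (fst z) (snd z) \<omega>\<bar> \<le> C * (H * (\<epsilon>\<^sup>2) powr (1/4)))"
      and H: "0 \<le> H" "\<forall>a b. 0 \<le> a \<longrightarrow> a \<le> b \<longrightarrow> b \<le> T \<longrightarrow> \<bar>Z b \<omega> - Z a \<omega>\<bar> \<le> H * (b - a) powr (1/4)"
      and st: "s \<in> {0..T}" "\<theta> \<in> {-r..0}"
    have cV: "continuous_on (closure D) (\<lambda>z. \<bar>V (fst z) (snd z) \<omega>\<bar>)"
      unfolding D(3) by (intro continuous_on_rabs V_cont w)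
    have bV: "\<bar>V (fst z) (snd z) \<omega>\<bar> \<le> C * (H * (\<epsilon>\<^sup>2) powr (1/4))" if "z \<in> D" for z
      using b that H by blast
    have "\<bar>V (fst (s, \<theta>)) (snd (s, \<theta>)) \<omega>\<bar> \<le> C * (H * (\<epsilon>\<^sup>2) powr (1/4))"
      by (rule continuous_le_on_closure[OF cV _ bV]) (use st in \<open>simp_all add: D(3)\<close>)
    then show "\<bar>V s \<theta> \<omega>\<bar> \<le> C * (H * (\<epsilon>\<^sup>2) powr (1/4))" by (simp only: fst_conv snd_conv)
  qed
qed

lemma Upsilon_bounds:
  assumes w: "\<omega> \<in> space M" and s: "s \<in> {0..T}"
  shows "\<And>\<theta>. \<theta> \<in> {-r..0} \<Longrightarrow> \<bar>V s \<theta> \<omega>\<bar> \<le> Upsilon r V s \<omega>"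
    and "\<exists>\<theta>\<in>{-r..0}. Upsilon r V s \<omega> = \<bar>V s \<theta> \<omega>\<bar>"
proof -
  have "continuous_on {-r..0} (\<lambda>\<theta>. V (fst (s, \<theta>)) (snd (s, \<theta>)) \<omega>)"
    by (rule continuous_on_compose2[OF V_cont[OF w]]) (use s in \<open>auto intro!: continuous_intros\<close>)
  then have c: "continuous_on {-r..0} (\<lambda>\<theta>. \<bar>V s \<theta> \<omega>\<bar>)" by (intro continuous_on_rabs) simp
  obtain \<theta>0 where t0: "\<theta>0 \<in> {-r..0}" "\<And>\<theta>. \<theta> \<in> {-r..0} \<Longrightarrow> \<bar>V s \<theta> \<omega>\<bar> \<le> \<bar>V s \<theta>0 \<omega>\<bar>"
    using continuous_attains_sup[OF compact_Icc _ c] D.r_pos by auto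
  then have bdd: "bdd_above ((\<lambda>\<theta>. \<bar>V s \<theta> \<omega>\<bar>) ` {-r..0})" by (intro bdd_aboveI2)
  show u: "\<bar>V s \<theta> \<omega>\<bar> \<le> Upsilon r V s \<omega>" if "\<theta> \<in> {-r..0}" for \<theta>
    unfolding Upsilon_def by (rule cSUP_upper[OF that bdd])
  have "Upsilon r V s \<omega> \<le> \<bar>V s \<theta>0 \<omega>\<bar>"
    unfolding Upsilon_def using t0 by (intro cSUP_least) auto
  with u[OF t0(1)] t0(1) show "\<exists>\<theta>\<in>{-r..0}. Upsilon r V s \<omega> = \<bar>V s \<theta> \<omega>\<bar>" by (intro bexI[of _ \<theta>0]) auto
qed

text \<open>Needed because the integral of a sum is split below. Joint continuity reduces both
  suprema, over \<open>s\<close> and over \<open>\<theta>\<close>, to the countable dense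
  set.\<close>

lemma sup_Upsilon_measurable:
  "(\<lambda>\<omega>. SUP s\<in>{0..T}. ennreal (Upsilon r V s \<omega> ^ n)) \<in> borel_measurable M"
proof -
  obtain D :: "(real \<times> real) set" where D: "countable D" "D \<subseteq> {0<..T} \<times> {-r..0}" "closure D = {0..T} \<times> {-r..0}"
    by (rule param_dense)
  have "(\<lambda>\<omega>. SUP z\<in>D. ennreal (\<bar>V (fst z) (snd z) \<omega>\<bar> ^ n)) \<in> borel_measurable M"
  proof (rule borel_measurable_SUP[OF D(1)])
    fix z assume "z \<in> D"
    then have "V (fst z) (snd z) \<in> borel_measurable M" using D(2) by (intro V_meas) auto
    then show "(\<lambda>\<omega>. ennreal (\<bar>V (fst z) (snd z) \<omega>\<bar> ^ n)) \<in> borel_measurable M" by measurable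
  qed
  moreover have "(SUP s\<in>{0..T}. ennreal (Upsilon r V s \<omega> ^ n)) = (SUP z\<in>D. ennreal (\<bar>V (fst z) (snd z) \<omega>\<bar> ^ n))"
    if w: "\<omega> \<in> space M" for \<omega>
  proof (rule antisym)
    show "(SUP s\<in>{0..T}. ennreal (Upsilon r V s \<omega> ^ n)) \<le> (SUP z\<in>D. ennreal (\<bar>V (fst z) (snd z) \<omega>\<bar> ^ n))"
    proof (rule SUP_least)
      fix s assume s: "s \<in> {0..T}"
      obtain \<theta> where \<theta>: "\<theta> \<in> {-r..0}" "Upsilon r V s \<omega> = \<bar>V s \<theta> \<omega>\<bar>" using Upsilon_bounds(2)[OF w s] by blast
      have "continuous_on (closure D) (\<lambda>z. \<bar>V (fst z) (snd z) \<omega>\<bar> ^ n)"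
        unfolding D(3) by (intro continuous_on_power continuous_on_rabs V_cont w)
      from le_SUP_dense[OF this, of "(s, \<theta>)"]
      show "ennreal (Upsilon r V s \<omega> ^ n) \<le> (SUP z\<in>D. ennreal (\<bar>V (fst z) (snd z) \<omega>\<bar> ^ n))"
        using s \<theta> by (simp add: D(3))
    qed
    show "(SUP z\<in>D. ennreal (\<bar>V (fst z) (snd z) \<omega>\<bar> ^ n)) \<le> (SUP s\<in>{0..T}. ennreal (Upsilon r V s \<omega> ^ n))"
    proof (rule SUP_least)
      fix z assume "z \<in> D"
      then have z: "fst z \<in> {0..T}" "snd z \<in> {-r..0}" using D(2) by auto
      have "ennreal (\<bar>V (fst z) (snd z) \<omega>\<bar> ^ n) \<le> ennreal (Upsilon r V (fst z) \<omega> ^ n)"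
        using Upsilon_bounds(1)[OF w z(1) z(2)] by (intro ennreal_leI power_mono) auto
      also have "\<dots> \<le> (SUP s\<in>{0..T}. ennreal (Upsilon r V s \<omega> ^ n))" using z(1) by (rule SUP_upper)
      finally show "ennreal (\<bar>V (fst z) (snd z) \<omega>\<bar> ^ n) \<le> (SUP s\<in>{0..T}. ennreal (Upsilon r V s \<omega> ^ n))" .
    qed
  qed
  ultimately show ?thesis by (simp cong: measurable_cong)
qed

text \<open>Bound pathwise first and integrate afterwards. On the left only monotonicity of the
  integral is used; on the right the measurable majorants \<open>N\<close> and \<open>SU\<close>
  make it additive.\<close>

lemma forced_moment_bound:
  assumes n: "n \<ge> 1"
  shows "sup_moment M T n (\<lambda>s \<omega>. supnorm r (forced_y_path r Lh p \<epsilon> (\<lambda>v. X v \<omega>) s))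
    \<le> ennreal (2 ^ (n - 1) * (\<epsilon>\<^sup>2 * (K_G * (K * supnorm r D.\<psi>) / \<kappa>)) ^ n) * sup_moment M T n (\<lambda>t \<omega>. supnorm r (Xs \<omega> t))
      + 2 ^ (n - 1) * sup_moment M T n (Upsilon r V)"
proof -
  obtain C where C: "D.forcing_const C" using D.forcing_const_exists by blast
  obtain N where Nm: "N \<in> borel_measurable M" and N0: "\<And>\<omega>. 0 \<le> N \<omega>"
    and N: "\<And>\<omega> v. \<omega> \<in> space M \<Longrightarrow> v \<in> {-(\<epsilon>\<^sup>2 * r)..T} \<Longrightarrow> \<bar>X v \<omega>\<bar> \<le> N \<omega>"
    and Ns: "\<And>\<omega> n. \<omega> \<in> space M \<Longrightarrow> ennreal (N \<omega> ^ n) \<le> (SUP t\<in>{0..T}. ennreal (supnorm r (Xs \<omega> t) ^ n))"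
    using sup_process by blast
  define c where "c = \<epsilon>\<^sup>2 * (K_G * (K * supnorm r D.\<psi>) / \<kappa>)"
  have c0: "c \<ge> 0" unfolding c_def using KG_nonneg D.K_pos D.supnorm_\<psi> D.\<kappa>_pos
    by (intro mult_nonneg_nonneg divide_nonneg_nonneg) auto
  define SU where "SU \<omega> = (SUP s\<in>{0..T}. ennreal (Upsilon r V s \<omega> ^ n))" for \<omega>
  have SUm: "SU \<in> borel_measurable M" unfolding SU_def by (rule sup_Upsilon_measurable)
  have "AE \<omega> in M. \<forall>s\<in>{0..T}. \<forall>\<theta>\<in>{-r..0}. \<bar>Yf \<omega> s \<theta> - V s \<theta> \<omega>\<bar> \<le> \<epsilon>\<^sup>2 * (K_G * (K * supnorm r D.\<psi>) / \<kappa>) * N \<omega>"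
    by (rule uniform_AE(1)[OF C]) (rule N)
  then have "AE \<omega> in M. (SUP s\<in>{0..T}. ennreal (supnorm r (forced_y_path r Lh p \<epsilon> (\<lambda>v. X v \<omega>) s) ^ n))
    \<le> ennreal (2 ^ (n - 1) * c ^ n) * ennreal (N \<omega> ^ n) + 2 ^ (n - 1) * SU \<omega>"
  proof (rule AE_mp, intro AE_I2 impI)
    fix \<omega> assume w: "\<omega> \<in> space M"
      and b: "\<forall>s\<in>{0..T}. \<forall>\<theta>\<in>{-r..0}. \<bar>Yf \<omega> s \<theta> - V s \<theta> \<omega>\<bar> \<le> \<epsilon>\<^sup>2 * (K_G * (K * supnorm r D.\<psi>) / \<kappa>) * N \<omega>"
    show "(SUP s\<in>{0..T}. ennreal (supnorm r (forced_y_path r Lh p \<epsilon> (\<lambda>v. X v \<omega>) s) ^ n))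
      \<le> ennreal (2 ^ (n - 1) * c ^ n) * ennreal (N \<omega> ^ n) + 2 ^ (n - 1) * SU \<omega>"
    proof (rule SUP_least)
      fix s assume s: "s \<in> {0..T}"
      obtain \<theta>0 where "\<theta>0 \<in> {-r..0}" "Upsilon r V s \<omega> = \<bar>V s \<theta>0 \<omega>\<bar>" using Upsilon_bounds(2)[OF w s] by blast
      then have U0: "0 \<le> Upsilon r V s \<omega>" by simp
      have Yb: "\<bar>Yf \<omega> s \<theta>\<bar> \<le> c * N \<omega> + Upsilon r V s \<omega>" if "\<theta> \<in> {-r..0}" for \<theta>
        using b[rule_format, OF s that] Upsilon_bounds(1)[OF w s that] unfolding c_def by linarith
      have "bounded (Yf \<omega> s ` {-r..0})"
        unfolding bounded_iff using Yb by (intro exI[of _ "c * N \<omega> + Upsilon r V s \<omega>"]) auto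
      then have nn: "0 \<le> supnorm r (Yf \<omega> s)" using D.r_pos by (intro supnorm_nonneg) auto
      have "supnorm r (Yf \<omega> s) \<le> c * N \<omega> + Upsilon r V s \<omega>" using Yb D.r_pos by (intro supnorm_le) auto
      then have "supnorm r (Yf \<omega> s) ^ n \<le> (c * N \<omega> + Upsilon r V s \<omega>) ^ n" using nn by (intro power_mono)
      also have "\<dots> \<le> 2 ^ (n - 1) * ((c * N \<omega>) ^ n + Upsilon r V s \<omega> ^ n)"
        using c0 N0 U0 n by (intro power_add_le) auto
      also have "\<dots> = 2 ^ (n - 1) * c ^ n * N \<omega> ^ n + 2 ^ (n - 1) * Upsilon r V s \<omega> ^ n"
        by (simp add: power_mult_distrib algebra_simps)
      finally have "ennreal (supnorm r (Yf \<omega> s) ^ n) \<le> ennreal (2 ^ (n - 1) * c ^ n * N \<omega> ^ n + 2 ^ (n - 1) * Upsilon r V s \<omega> ^ n)"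
        by (rule ennreal_leI)
      also have "\<dots> = ennreal (2 ^ (n - 1) * c ^ n) * ennreal (N \<omega> ^ n) + ennreal (2 ^ (n - 1)) * ennreal (Upsilon r V s \<omega> ^ n)"
        using c0 N0[of \<omega>] U0 by (simp add: ennreal_plus ennreal_mult)
      also have "\<dots> \<le> ennreal (2 ^ (n - 1) * c ^ n) * ennreal (N \<omega> ^ n) + ennreal (2 ^ (n - 1)) * SU \<omega>"
        unfolding SU_def using s by (intro add_left_mono mult_left_mono SUP_upper) auto
      also have "ennreal (2 ^ (n - 1)) = 2 ^ (n - 1)" by (simp add: ennreal_power[symmetric])
      finally show "ennreal (supnorm r (forced_y_path r Lh p \<epsilon> (\<lambda>v. X v \<omega>) s) ^ n)
        \<le> ennreal (2 ^ (n - 1) * c ^ n) * ennreal (N \<omega> ^ n) + 2 ^ (n - 1) * SU \<omega>"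
        by (simp add: Yf_def)
    qed
  qed
  then have "sup_moment M T n (\<lambda>s \<omega>. supnorm r (forced_y_path r Lh p \<epsilon> (\<lambda>v. X v \<omega>) s))
    \<le> (\<integral>\<^sup>+\<omega>. ennreal (2 ^ (n - 1) * c ^ n) * ennreal (N \<omega> ^ n) + 2 ^ (n - 1) * SU \<omega> \<partial>M)"
    unfolding sup_moment_def by (rule nn_integral_mono_AE)
  also have "\<dots> = ennreal (2 ^ (n - 1) * c ^ n) * (\<integral>\<^sup>+\<omega>. ennreal (N \<omega> ^ n) \<partial>M) + 2 ^ (n - 1) * (\<integral>\<^sup>+\<omega>. SU \<omega> \<partial>M)"
    using Nm SUm by (simp add: nn_integral_add nn_integral_cmult)
  \<comment> \<open>Only now is the measurable stand-in \<open>N\<close> exchanged for the supremum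
    of the segment norms.\<close>
  also have "\<dots> \<le> ennreal (2 ^ (n - 1) * c ^ n) * sup_moment M T n (\<lambda>t \<omega>. supnorm r (Xs \<omega> t)) + 2 ^ (n - 1) * sup_moment M T n (Upsilon r V)"
    unfolding sup_moment_def SU_def by (intro add_right_mono mult_left_mono nn_integral_mono Ns) auto
  finally show ?thesis by (simp add: c_def)
qed

text \<open>\<open>C\<close>, \<open>c1\<close> and \<open>CI\<close> are hypotheses rather than
  obtained inside, so that the factor \<open>(\<epsilon>\<^sup>2 / T) powr (real n / 4)\<close> is
  visibly the only dependence on \<open>\<epsilon>\<close> for a given moment bound
  \<open>A\<close>.\<close>

lemma Upsilon_moment_bound:
  assumes n: "n \<ge> 1" and C: "D.forcing_const C"
    and c1: "c1 \<ge> 0" "\<And>\<phi>. \<phi> \<in> C_space r \<Longrightarrow> \<bar>L1 \<phi>\<bar> \<le> c1 * supnorm r \<phi>"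
    and CI: "CI \<ge> 0" "\<And>h Z Y A. (\<And>t. t \<in> {0..T} \<Longrightarrow> ito_integral M F W h t (Z t)) \<Longrightarrow>
      (\<And>\<omega>. \<omega> \<in> space M \<Longrightarrow> continuous_on {0..T} (\<lambda>u. h u \<omega>)) \<Longrightarrow>
      (\<And>\<omega>. \<omega> \<in> space M \<Longrightarrow> continuous_on {0..T} (\<lambda>t. Z t \<omega>)) \<Longrightarrow>
      (\<And>\<omega> u. \<omega> \<in> space M \<Longrightarrow> u \<in> {0..T} \<Longrightarrow> \<bar>h u \<omega>\<bar> \<le> Y \<omega>) \<Longrightarrow>
      (\<integral>\<^sup>+\<omega>. ennreal (Y \<omega> ^ n) \<partial>M) \<le> ennreal A \<Longrightarrow> A \<ge> 0 \<Longrightarrow>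
      \<exists>H\<in>borel_measurable M. (\<integral>\<^sup>+\<omega>. H \<omega> \<partial>M) \<le> ennreal (CI * A) \<and>
        (AE \<omega> in M. \<forall>s t. 0 \<le> s \<longrightarrow> s < t \<longrightarrow> t \<le> T \<longrightarrow>
          ennreal (\<bar>Z t \<omega> - Z s \<omega>\<bar> ^ n / ((t - s) / T) powr (real n / 4)) \<le> H \<omega>)"
    and A: "sup_moment M T n (\<lambda>t \<omega>. supnorm r (Xs \<omega> t)) \<le> ennreal A" "A \<ge> 0"
  shows "sup_moment M T n (Upsilon r V) \<le> ennreal (C ^ n * (\<epsilon>\<^sup>2 / T) powr (real n / 4) * (CI * (c1 ^ n * A)))"
proof -
  obtain N where Nm: "N \<in> borel_measurable M" and N0: "\<And>\<omega>. 0 \<le> N \<omega>"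
    and N: "\<And>\<omega> v. \<omega> \<in> space M \<Longrightarrow> v \<in> {-(\<epsilon>\<^sup>2 * r)..T} \<Longrightarrow> \<bar>X v \<omega>\<bar> \<le> N \<omega>"
    and Ns: "\<And>\<omega> n. \<omega> \<in> space M \<Longrightarrow> ennreal (N \<omega> ^ n) \<le> (SUP t\<in>{0..T}. ennreal (supnorm r (Xs \<omega> t) ^ n))"
    using sup_process by blast
  have C0: "C \<ge> 0" by (rule D.forcing_const_nonneg[OF C])
  have NA: "(\<integral>\<^sup>+\<omega>. ennreal (N \<omega> ^ n) \<partial>M) \<le> ennreal A"
    by (rule order_trans[OF _ A(1)], unfold sup_moment_def, intro nn_integral_mono Ns)
  have "(\<integral>\<^sup>+\<omega>. ennreal ((c1 * N \<omega>) ^ n) \<partial>M) = ennreal (c1 ^ n) * (\<integral>\<^sup>+\<omega>. ennreal (N \<omega> ^ n) \<partial>M)"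
    using Nm N0 c1(1) by (simp add: power_mult_distrib ennreal_mult nn_integral_cmult)
  also have "\<dots> \<le> ennreal (c1 ^ n) * ennreal A" by (intro mult_left_mono NA) simp
  also have "\<dots> = ennreal (c1 ^ n * A)" using c1(1) A(2) by (simp add: ennreal_mult)
  finally have YA: "(\<integral>\<^sup>+\<omega>. ennreal ((c1 * N \<omega>) ^ n) \<partial>M) \<le> ennreal (c1 ^ n * A)" .
  have hY: "\<bar>h u \<omega>\<bar> \<le> c1 * N \<omega>" if w: "\<omega> \<in> space M" and u: "u \<in> {0..T}" for u \<omega>
  proof -
    have "\<bar>h u \<omega>\<bar> \<le> c1 * supnorm r (Xs \<omega> u)" unfolding h_def by (rule c1(2)[OF Xs_C[OF w u]])
    also have "\<dots> \<le> c1 * N \<omega>" by (intro mult_left_mono supnorm_Xs[OF w u] N w c1)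
    finally show ?thesis .
  qed
  have "\<exists>H\<in>borel_measurable M. (\<integral>\<^sup>+\<omega>. H \<omega> \<partial>M) \<le> ennreal (CI * (c1 ^ n * A)) \<and>
        (AE \<omega> in M. \<forall>s t. 0 \<le> s \<longrightarrow> s < t \<longrightarrow> t \<le> T \<longrightarrow>
          ennreal (\<bar>Z t \<omega> - Z s \<omega>\<bar> ^ n / ((t - s) / T) powr (real n / 4)) \<le> H \<omega>)"
    by (rule CI(2)[OF Z_ito h_cont Z_cont hY YA]) (use c1 A in auto)
  then obtain H where Hm: "H \<in> borel_measurable M" and HI: "(\<integral>\<^sup>+\<omega>. H \<omega> \<partial>M) \<le> ennreal (CI * (c1 ^ n * A))"
    and H: "AE \<omega> in M. \<forall>s t. 0 \<le> s \<longrightarrow> s < t \<longrightarrow> t \<le> T \<longrightarrow>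
          ennreal (\<bar>Z t \<omega> - Z s \<omega>\<bar> ^ n / ((t - s) / T) powr (real n / 4)) \<le> H \<omega>"
    by blast
  have "(\<integral>\<^sup>+\<omega>. H \<omega> \<partial>M) \<noteq> \<infinity>" using HI by (auto simp: top_unique)
  \<comment> \<open>The random Hoelder constant may be infinite on a null set only, so almost surely
    a real root of it can be taken.\<close>
  then have Hfin: "AE \<omega> in M. H \<omega> \<noteq> \<infinity>" by (rule nn_integral_noteq_infinite[OF Hm])
  have VH: "AE \<omega> in M. \<forall>H\<ge>0. (\<forall>a b. 0 \<le> a \<longrightarrow> a \<le> b \<longrightarrow> b \<le> T \<longrightarrow> \<bar>Z b \<omega> - Z a \<omega>\<bar> \<le> H * (b - a) powr (1/4)) \<longrightarrow>
      (\<forall>s\<in>{0..T}. \<forall>\<theta>\<in>{-r..0}. \<bar>V s \<theta> \<omega>\<bar> \<le> C * (H * (\<epsilon>\<^sup>2) powr (1/4)))"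
    by (rule uniform_AE(2)[OF C]) (rule N)
  have pw: "(x powr (1/4)) ^ n = x powr (real n / 4)" for x :: real
    using n by (cases "x = 0") (auto simp: powr_power)
  have "AE \<omega> in M. (SUP s\<in>{0..T}. ennreal (Upsilon r V s \<omega> ^ n)) \<le> ennreal (C ^ n * (\<epsilon>\<^sup>2 / T) powr (real n / 4)) * H \<omega>"
    using H Hfin VH AE_space
  proof (eventually_elim, goal_cases)
    case (1 \<omega>)
    have wS: "\<omega> \<in> space M" by (rule 1(4))
    obtain hh where hh: "hh \<ge> 0" "H \<omega> = ennreal hh" using 1(2) by (cases "H \<omega>") auto
    \<comment> \<open>The \<open>n\<close>-th root turns the bound on \<open>n\<close>-th powers
      into a Hoelder constant; the factor with \<open>T\<close> undoes the normalisation of the time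
      increment.\<close>
    define H0 where "H0 = root n hh * (1 / T) powr (1/4)"
    have r0: "root n hh \<ge> 0" by (rule real_root_pos_pos_le[OF hh(1)])
    have rn: "root n hh ^ n = hh" using hh n by simp
    have H00: "H0 \<ge> 0" unfolding H0_def using r0 by simp
    have hold: "\<bar>Z b \<omega> - Z a \<omega>\<bar> \<le> H0 * (b - a) powr (1/4)" if ab: "0 \<le> a" "a \<le> b" "b \<le> T" for a b
    proof (cases "a = b")
      case False
      then have p: "((b - a) / T) powr (real n / 4) > 0" using ab T_pos by simp
      have "ennreal (\<bar>Z b \<omega> - Z a \<omega>\<bar> ^ n / ((b - a) / T) powr (real n / 4)) \<le> ennreal hh"
        using 1(1) ab False hh(2) by auto
      then have "\<bar>Z b \<omega> - Z a \<omega>\<bar> ^ n \<le> hh * ((b - a) / T) powr (real n / 4)"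
        using p hh(1) by (simp add: ennreal_le_iff divide_le_eq)
      also have "\<dots> = (root n hh * ((b - a) / T) powr (1/4)) ^ n"
        by (simp only: power_mult_distrib rn pw)
      finally have "\<bar>Z b \<omega> - Z a \<omega>\<bar> \<le> root n hh * ((b - a) / T) powr (1/4)"
        using n r0 by (subst (asm) power_mono_iff) auto
      also have "\<dots> = H0 * (b - a) powr (1/4)"
        unfolding H0_def using powr_mult[of "1/T" "b - a" "1/4"] by simp
      finally show ?thesis .
    qed simp
    show ?case
    proof (rule SUP_least)
      fix s assume s: "s \<in> {0..T}"
      obtain \<theta> where \<theta>: "\<theta> \<in> {-r..0}" "Upsilon r V s \<omega> = \<bar>V s \<theta> \<omega>\<bar>" using Upsilon_bounds(2)[OF wS s] by blast
      have "\<bar>V s \<theta> \<omega>\<bar> \<le> C * (H0 * (\<epsilon>\<^sup>2) powr (1/4))" using 1(3) H00 hold s \<theta>(1) by blast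
      also have "\<dots> = C * (root n hh * (\<epsilon>\<^sup>2 / T) powr (1/4))"
        unfolding H0_def using powr_mult[of "1/T" "\<epsilon>\<^sup>2" "1/4"] by simp
      finally have "Upsilon r V s \<omega> ^ n \<le> (C * (root n hh * (\<epsilon>\<^sup>2 / T) powr (1/4))) ^ n"
        unfolding \<theta>(2) by (rule power_mono) simp
      also have "\<dots> = C ^ n * (\<epsilon>\<^sup>2 / T) powr (real n / 4) * hh"
        by (simp only: power_mult_distrib rn pw mult_ac)
      finally have "ennreal (Upsilon r V s \<omega> ^ n) \<le> ennreal (C ^ n * (\<epsilon>\<^sup>2 / T) powr (real n / 4) * hh)" by (rule ennreal_leI)
      also have "\<dots> = ennreal (C ^ n * (\<epsilon>\<^sup>2 / T) powr (real n / 4)) * H \<omega>"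
        unfolding hh(2) using C0 hh(1) by (simp add: ennreal_mult)
      finally show "ennreal (Upsilon r V s \<omega> ^ n) \<le> ennreal (C ^ n * (\<epsilon>\<^sup>2 / T) powr (real n / 4)) * H \<omega>" .
    qed
  qed
  then have "sup_moment M T n (Upsilon r V) \<le> (\<integral>\<^sup>+\<omega>. ennreal (C ^ n * (\<epsilon>\<^sup>2 / T) powr (real n / 4)) * H \<omega> \<partial>M)"
    unfolding sup_moment_def by (rule nn_integral_mono_AE)
  also have "\<dots> = ennreal (C ^ n * (\<epsilon>\<^sup>2 / T) powr (real n / 4)) * (\<integral>\<^sup>+\<omega>. H \<omega> \<partial>M)"
    using Hm by (rule nn_integral_cmult)
  also have "\<dots> \<le> ennreal (C ^ n * (\<epsilon>\<^sup>2 / T) powr (real n / 4)) * ennreal (CI * (c1 ^ n * A))"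
    by (intro mult_left_mono HI) simp
  also have "\<dots> = ennreal (C ^ n * (\<epsilon>\<^sup>2 / T) powr (real n / 4) * (CI * (c1 ^ n * A)))"
    using C0 CI(1) c1(1) A(2) by (simp add: ennreal_mult)
  finally show ?thesis .
qed

end

text \<open>The real and imaginary parts of the characteristic equation at the critical root; these
  are the two evaluations that the rotation on P rests on.\<close>

lemma critical_root_eqs:
  assumes "critical_spectrum r L \<omega>c"
  shows "L (on_seg r (\<lambda>\<theta>. cos (\<omega>c * \<theta>))) = 0" and "L (on_seg r (\<lambda>\<theta>. sin (\<omega>c * \<theta>))) = \<omega>c"
proof -
  have "\<i> * of_real \<omega>c \<in> {z. char_fun r L z = 0 \<and> Re z = 0}"
    using assms by (simp add: critical_spectrum_def)
  then have "char_fun r L (\<i> * of_real \<omega>c) = 0" by simp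
  moreover have "Re (exp (\<i> * of_real \<omega>c * of_real \<theta>)) = cos (\<omega>c * \<theta>)" "Im (exp (\<i> * of_real \<omega>c * of_real \<theta>)) = sin (\<omega>c * \<theta>)" for \<theta>
    by (simp_all add: Re_exp Im_exp)
  ultimately show "L (on_seg r (\<lambda>\<theta>. cos (\<omega>c * \<theta>))) = 0" "L (on_seg r (\<lambda>\<theta>. sin (\<omega>c * \<theta>))) = \<omega>c"
    by (simp_all add: char_fun_def complex_eq_iff)
qed

theorem proposition2p4:
  fixes M :: "'a measure" and F :: "real \<Rightarrow> 'a measure" and W :: "real \<Rightarrow> 'a \<Rightarrow> real"
    and r T \<omega>c K \<kappa> K_G \<CC> :: real and n :: nat
    and L0 L0hat L1 G :: "(real \<Rightarrow> real) \<Rightarrow> real"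
    and pihat :: "(real \<Rightarrow> real) \<Rightarrow> real \<Rightarrow> real"
    and \<xi> :: "real \<Rightarrow> real"
    and X :: "real \<Rightarrow> real \<Rightarrow> 'a \<Rightarrow> real"
    and V :: "real \<Rightarrow> real \<Rightarrow> real \<Rightarrow> 'a \<Rightarrow> real"
  assumes "r > 0" and "T > 0"
    and "prob_space M"
    and "filtration (space M) F" and "\<And>t. sets (F t) \<subseteq> sets M"
    and "wiener_process M F W"
    and "bounded_linear_C r L0" and "bounded_linear_C r L1"
    and "\<omega>c > 0" and "critical_spectrum r L0 \<omega>c"
    and "\<And>\<phi> \<psi>. \<phi> \<in> C_space r \<Longrightarrow> \<psi> \<in> C_space r \<Longrightarrow>
           \<bar>G \<phi> - G \<psi>\<bar> \<le> K_G * supnorm r (\<lambda>\<theta>. \<phi> \<theta> - \<psi> \<theta>)"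
    and "G (\<lambda>_. 0) = 0"
    and "\<xi> \<in> C_space r"
    and "\<And>\<epsilon>. \<epsilon> > 0 \<Longrightarrow> sdde_solution M F W r T L0 G L1 \<xi> \<epsilon> (X \<epsilon>)"
    and "riesz_extension r L0 L0hat"
    and "spectral_projection r L0hat \<omega>c pihat"
    and "K > 0" and "\<kappa> > 0"
    and "\<And>\<phi> t. \<phi> \<in> Qhat_space r L0hat \<Longrightarrow> t \<ge> 0 \<Longrightarrow>
           supnorm r (dde_semigroup r L0hat t \<phi>) \<le> K * exp (- \<kappa> * t) * supnorm r \<phi>"
    and "\<And>\<epsilon>. \<epsilon> > 0 \<Longrightarrow> stoch_conv_version M F W r T L0hat pihat \<epsilon>
           (\<lambda>u \<omega>. L1 (seg r \<epsilon> (\<lambda>v. X \<epsilon> v \<omega>) u)) (V \<epsilon>)"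
    and "n \<ge> 1" and "\<CC> > 0"
    and "\<forall>\<^sub>F \<epsilon> in at_right 0.
           sup_moment M T n (\<lambda>t \<omega>. supnorm r (seg r \<epsilon> (\<lambda>v. X \<epsilon> v \<omega>) t)) < ennreal \<CC>"
  shows "let Ktilde = K * supnorm r (proj_compl pihat (indicator {0}));
             rhs = (\<lambda>\<epsilon>. ennreal (\<epsilon> ^ (2 * n) * 2 ^ (n - 1) * (K_G * Ktilde / \<kappa>) ^ n * \<CC>)
                       + 2 ^ (n - 1) * sup_moment M T n (Upsilon r (V \<epsilon>)))
         in (\<exists>\<epsilon>0>0. \<forall>\<epsilon>. 0 < \<epsilon> \<and> \<epsilon> < \<epsilon>0 \<longrightarrow>
               sup_moment M T n
                 (\<lambda>s \<omega>. supnorm r (forced_y_path r L0hat pihat \<epsilon> (\<lambda>v. X \<epsilon> v \<omega>) s)) \<le> rhs \<epsilon>)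
            \<and> (rhs \<longlongrightarrow> 0) (at_right 0)"
proof -
  note r = assms(1) and T = assms(2) and spec = assms(10) and Glip = assms(11)
    and X_sol = assms(14) and riesz = assms(15) and dec = assms(19) and Vv = assms(20) and n = assms(21) and Cp = assms(22)
  interpret W: wiener M F W
    using assms(3-6) by (simp add: wiener_def wiener_axioms_def)
  obtain B where "delay r L0hat B" using riesz_delay(1)[OF r riesz] by blast
  then interpret D0: delay r L0hat B .
  note L0_eq = riesz_delay(2)[OF r riesz]
  interpret D: delay_proj r L0hat B \<omega>c pihat K \<kappa>
  proof unfold_locales
    have "on_seg r (\<lambda>\<theta>. cos (\<omega>c * \<theta>)) \<in> C_space r" "on_seg r (\<lambda>\<theta>. sin (\<omega>c * \<theta>)) \<in> C_space r"
      by (intro C_spaceI continuous_intros)+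
    then show "L0hat (on_seg r (\<lambda>\<theta>. cos (\<omega>c * \<theta>))) = 0" "L0hat (on_seg r (\<lambda>\<theta>. sin (\<omega>c * \<theta>))) = \<omega>c"
      by (simp_all only: L0_eq critical_root_eqs[OF spec])
  qed (use assms(9,16-18) dec in auto)
  define Kt where "Kt = K * supnorm r (proj_compl pihat (indicator {0}))"
  have Kt: "K * supnorm r D.\<psi> = Kt" by (simp add: Kt_def D.\<psi>_def)
  have S: "sdde M F W r L0hat B \<omega>c pihat K \<kappa> T K_G \<epsilon> L0 G L1 \<xi> (X \<epsilon>) (V \<epsilon>)" if "\<epsilon> > 0" for \<epsilon>
    by unfold_locales (use T that L0_eq assms(7,8,12) Glip X_sol[OF that] Vv[OF that] in auto)
  \<comment> \<open>The sign of \<open>K_G\<close> does not involve \<open>\<epsilon>\<close>, so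
    any positive value gives access to the locale.\<close>
  have KG: "K_G \<ge> 0" using sdde.KG_nonneg[OF S[of 1]] by simp
  have Kt0: "Kt \<ge> 0" unfolding Kt[symmetric] using D.K_pos D.supnorm_\<psi> by simp
  define d where "d = K_G * Kt / \<kappa>"
  have d0: "d \<ge> 0" unfolding d_def using KG Kt0 D.\<kappa>_pos by simp
  define S0 where "S0 \<epsilon> = sup_moment M T n (\<lambda>t \<omega>. supnorm r (seg r \<epsilon> (\<lambda>v. X \<epsilon> v \<omega>) t))" for \<epsilon>
  define R where "R \<epsilon> = ennreal (\<epsilon> ^ (2 * n) * 2 ^ (n - 1) * d ^ n * \<CC>) + 2 ^ (n - 1) * sup_moment M T n (Upsilon r (V \<epsilon>))" for \<epsilon>
  obtain \<epsilon>0 where e0: "\<epsilon>0 > 0" and small: "\<And>\<epsilon>. 0 < \<epsilon> \<Longrightarrow> \<epsilon> < \<epsilon>0 \<Longrightarrow> S0 \<epsilon> \<le> ennreal \<CC>"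
    using assms(23) unfolding eventually_at_right_field S0_def by (metis less_imp_le)
  have bound: "sup_moment M T n (\<lambda>s \<omega>. supnorm r (forced_y_path r L0hat pihat \<epsilon> (\<lambda>v. X \<epsilon> v \<omega>) s)) \<le> R \<epsilon>"
    if e: "0 < \<epsilon>" "\<epsilon> < \<epsilon>0" for \<epsilon>
  proof -
    have "sup_moment M T n (\<lambda>s \<omega>. supnorm r (forced_y_path r L0hat pihat \<epsilon> (\<lambda>v. X \<epsilon> v \<omega>) s))
      \<le> ennreal (2 ^ (n - 1) * (\<epsilon>\<^sup>2 * d) ^ n) * S0 \<epsilon> + 2 ^ (n - 1) * sup_moment M T n (Upsilon r (V \<epsilon>))"
      using sdde.forced_moment_bound[OF S[OF e(1)] n] unfolding Kt d_def S0_def .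
    also have "\<dots> \<le> ennreal (2 ^ (n - 1) * (\<epsilon>\<^sup>2 * d) ^ n) * ennreal \<CC> + 2 ^ (n - 1) * sup_moment M T n (Upsilon r (V \<epsilon>))"
      by (intro add_right_mono mult_left_mono small e) simp
    also have "ennreal (2 ^ (n - 1) * (\<epsilon>\<^sup>2 * d) ^ n) * ennreal \<CC> = ennreal (\<epsilon> ^ (2 * n) * 2 ^ (n - 1) * d ^ n * \<CC>)"
      using d0 Cp e by (subst ennreal_mult[symmetric]) (simp_all add: power_mult_distrib mult_ac flip: power_mult)
    finally show ?thesis by (simp add: R_def)
  qed
  \<comment> \<open>This constant and the two that follow are fixed before
    \<open>\<epsilon>\<close>; uniformity is what allows the limit.\<close>
  obtain C where C: "D.forcing_const C" using D.forcing_const_exists by blast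
  obtain c1 where c1: "c1 \<ge> 0" "\<And>\<phi>. \<phi> \<in> C_space r \<Longrightarrow> \<bar>L1 \<phi>\<bar> \<le> c1 * supnorm r \<phi>"
    using bounded_linear_C_lipschitz[OF assms(8)] r by metis
  obtain CI where CI: "CI \<ge> 0" "\<And>h Z Y A. (\<And>t. t \<in> {0..T} \<Longrightarrow> ito_integral M F W h t (Z t)) \<Longrightarrow>
      (\<And>\<omega>. \<omega> \<in> space M \<Longrightarrow> continuous_on {0..T} (\<lambda>u. h u \<omega>)) \<Longrightarrow>
      (\<And>\<omega>. \<omega> \<in> space M \<Longrightarrow> continuous_on {0..T} (\<lambda>t. Z t \<omega>)) \<Longrightarrow>
      (\<And>\<omega> u. \<omega> \<in> space M \<Longrightarrow> u \<in> {0..T} \<Longrightarrow> \<bar>h u \<omega>\<bar> \<le> Y \<omega>) \<Longrightarrow>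
      (\<integral>\<^sup>+\<omega>. ennreal (Y \<omega> ^ n) \<partial>M) \<le> ennreal A \<Longrightarrow> A \<ge> 0 \<Longrightarrow>
      \<exists>H\<in>borel_measurable M. (\<integral>\<^sup>+\<omega>. H \<omega> \<partial>M) \<le> ennreal (CI * A) \<and>
        (AE \<omega> in M. \<forall>s t. 0 \<le> s \<longrightarrow> s < t \<longrightarrow> t \<le> T \<longrightarrow>
          ennreal (\<bar>Z t \<omega> - Z s \<omega>\<bar> ^ n / ((t - s) / T) powr (real n / 4)) \<le> H \<omega>)"
    by (rule W.ito_hoelder_moment[OF T n]) blast
  define E where "E = CI * (c1 ^ n * \<CC>)"
  \<comment> \<open>An explicit real majorant of the right-hand side: its first term is of order
    \<open>\<epsilon> ^ (2 * n)\<close>, its second of order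
    \<open>\<epsilon> powr (real n / 2)\<close>.\<close>
  define g where "g \<epsilon> = \<epsilon> ^ (2 * n) * 2 ^ (n - 1) * d ^ n * \<CC> + 2 ^ (n - 1) * (C ^ n * (\<epsilon>\<^sup>2 / T) powr (real n / 4) * E)" for \<epsilon>
  have Rg: "R \<epsilon> \<le> ennreal (g \<epsilon>)" if e: "0 < \<epsilon>" "\<epsilon> < \<epsilon>0" for \<epsilon>
  proof -
    have u0: "C ^ n * (\<epsilon>\<^sup>2 / T) powr (real n / 4) * E \<ge> 0"
      unfolding E_def using D.forcing_const_nonneg[OF C] CI(1) c1(1) Cp by simp
    have "sup_moment M T n (Upsilon r (V \<epsilon>)) \<le> ennreal (C ^ n * (\<epsilon>\<^sup>2 / T) powr (real n / 4) * E)"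
      unfolding E_def
      by (rule sdde.Upsilon_moment_bound[OF S[OF e(1)] n C c1 CI small[OF e, unfolded S0_def]]) (use Cp in auto)
    then have "R \<epsilon> \<le> ennreal (\<epsilon> ^ (2 * n) * 2 ^ (n - 1) * d ^ n * \<CC>) + 2 ^ (n - 1) * ennreal (C ^ n * (\<epsilon>\<^sup>2 / T) powr (real n / 4) * E)"
      unfolding R_def by (intro add_left_mono mult_left_mono) auto
    also have "2 ^ (n - 1) = ennreal (2 ^ (n - 1))" by (simp add: ennreal_power[symmetric])
    also have "ennreal (\<epsilon> ^ (2 * n) * 2 ^ (n - 1) * d ^ n * \<CC>) + ennreal (2 ^ (n - 1)) * ennreal (C ^ n * (\<epsilon>\<^sup>2 / T) powr (real n / 4) * E) = ennreal (g \<epsilon>)"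
      unfolding g_def using u0 e d0 Cp by (simp add: ennreal_mult[symmetric] ennreal_plus[symmetric] del: ennreal_plus)
    finally show ?thesis .
  qed
  have "(g \<longlongrightarrow> 0 ^ (2 * n) * 2 ^ (n - 1) * d ^ n * \<CC> + 2 ^ (n - 1) * (C ^ n * 0 * E)) (at_right 0)"
    unfolding g_def[abs_def]
  proof (intro tendsto_add tendsto_mult tendsto_power tendsto_const tendsto_ident_at)
    have "((\<lambda>\<epsilon>::real. \<epsilon>\<^sup>2 / T) \<longlongrightarrow> 0\<^sup>2 / T) (at_right 0)" using T by (intro tendsto_intros) auto
    then have "((\<lambda>\<epsilon>::real. \<epsilon>\<^sup>2 / T) \<longlongrightarrow> 0) (at_right 0)" by simp
    then show "((\<lambda>\<epsilon>::real. (\<epsilon>\<^sup>2 / T) powr (real n / 4)) \<longlongrightarrow> 0) (at_right 0)"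
      by (rule tendsto_zero_powrI[OF _ tendsto_const]) (use n T in auto)
  qed
  then have "(g \<longlongrightarrow> 0) (at_right 0)" using n by (simp add: power_0_left)
  then have "((\<lambda>\<epsilon>. ennreal (g \<epsilon>)) \<longlongrightarrow> ennreal 0) (at_right 0)" by (rule tendsto_ennrealI)
  then have g: "((\<lambda>\<epsilon>. ennreal (g \<epsilon>)) \<longlongrightarrow> 0) (at_right 0)" by simp
  have "(R \<longlongrightarrow> 0) (at_right 0)"
  proof (rule tendsto_sandwich[OF _ _ tendsto_const g])
    show "\<forall>\<^sub>F \<epsilon> in at_right 0. R \<epsilon> \<le> ennreal (g \<epsilon>)"
      unfolding eventually_at_right_field using e0 Rg by blast
  qed simp
  with bound e0 show ?thesis
    unfolding Let_def R_def d_def Kt_def by blast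
qed

end
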